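(* For each $y\in\mathbb{R}$ let $g^y$ and $X=X^y$ be the random variable and the process constructed in the context, and let $\Gamma^y:=\int_0^\infty\mathbf{1}_{\{X^y_s<0\}}\,\mathrm{d}s$. (a) As $y\to\infty$, the conditional distribution $\mathbb{P}\left(\frac{g^y}{y^2}\in\cdot\,\middle|\, g^y>0\right)$ converges weakly to the inverse chi-squared distribution with Lebesgue density $$\mathbb{R}\to[0,\infty),\quad s\mapsto \mathbf{1}_{\{s>0\}}\frac{1}{\sqrt{2\pi s^3}}e^{-\frac{1}{2s}}.$$ In particular, $g^y$ conditional on $\{g^y>0\}$ diverges in distribution to $\infty$ as $y\to\infty$, i.e. $\mathbb{P}(g^y>K\mid g^y>0)\to1$ for every $K>0$. (b) As $y\to-\infty$, the random variable $y^2(1-\Gamma^y)$ converges weakly to an exponential distribution with parameter (rate) $\frac12$, while $y^2(1-g^y)$ converges weakly to a random variable $g'$ with distribution function $$\mathbb{P}(g'\le u)=\begin{cases}\displaystyle\int_0^\infty\frac{2z}{\sqrt{2\pi(2z-u)}}e^{-z}\,\mathrm{d}z, & u\le 0,\\[3mm] 1-\frac12 e^{-\frac u2}, & u\ge 0.\end{cases}$$ In particular, $\Gamma^y$ and $g^y$ both converge in distribution to $1$ as $y\to-\infty$.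
   Context: For $t>0$ and $u\ge 0$ let $q^y(t,u):=\mathbb{P}\left(\int_0^t \mathbf{1}_{\{b'_s<0\}}\,\mathrm{d}s\le u\right)$, where $(b'_s)_{s\in[0,t]}$ is a Brownian bridge of length $t$ with $b'_0=y$ and $b'_t=0$. Construction of $g^y$ and $X=X^y$ for fixed $y\in\mathbb{R}$: 1. Let $g=g^y$ be a non-negative random variable whose distribution function is, for $x\ge 0$, $$\mathbb{P}(g\le x)=\begin{cases}\mathbf{1}_{\{x\le 1\}}\frac{\sqrt{x}}{2}+\mathbf{1}_{\{x>1\}}\left(1-\frac{1}{2\sqrt{x}}\right), & y=0,\\[2mm] \dfrac{\int_0^x q^y(t,1)\frac{1}{\sqrt t}e^{-\frac{y^2}{2t}}\,\mathrm{d}t}{2\int_0^1\frac{1}{\sqrt t}e^{-\frac{y^2}{2t}}\,\mathrm{d}t}, & y<0,\\[4mm] \dfrac{2\sqrt{2\pi}\,y+\int_0^x q^y(t,1)\frac{1}{\sqrt t}e^{-\frac{y^2}{2t}}\,\mathrm{d}t}{2\sqrt{2\pi}\,y+4}, & y>0.\end{cases}$$ 2. Let $b=(b_t)_{t\in[0,1]}$ be a process whose conditional law given $\{g=x\}$, for $x\ge 0$, is that of a standard Brownian bridge on $[0,1]$ (from $0$ to $0$) conditioned on the event $\int_0^x\mathbf{1}_{\{\sqrt{x}\,b_{s/x}+y-\frac{s}{x}y<0\}}\,\mathrm{d}s\le 1$ (for $x=0$ this condition is vacuous). 3. Let $Z=(Z_t)_{t\ge0}$ be a three-dimensional Bessel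 process starting in $0$, independent of $(g,b)$. 4. For $y>0$, let $Y=(Y_t)_{t\ge0}$ be a three-dimensional Bessel process starting in $y$, independent of $(g,b,Z)$. 5. Define, for $t\ge0$, $$X_t:=\mathbf{1}_{\{g>0,\,t<g\}}\left(\sqrt{g}\,b_{t/g}+y-\tfrac{t}{g}y\right)+\mathbf{1}_{\{g>0,\,t\ge g\}}Z_{t-g}+\mathbf{1}_{\{g=0,\,y>0\}}Y_t.$$ *)

theory Defs
  imports "HOL-Probability.Probability"
begin

section \<open>Processes and their laws\<close>

definition continuous_process ::
  "'w measure \<Rightarrow> real set \<Rightarrow> (real \<Rightarrow> 'w \<Rightarrow> 'b::topological_space) \<Rightarrow> bool" where
  "continuous_process M T X \<longleftrightarrow>
     (\<forall>t\<in>T. X t \<in> borel_measurable M) \<and> (\<forall>\<omega>\<in>space M. continuous_on T (\<lambda>t. X t \<omega>))"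

abbreviation path_space :: "real set \<Rightarrow> (real \<Rightarrow> real) measure" where
  "path_space T \<equiv> PiM T (\<lambda>_. borel)"

definition sample_path :: "real set \<Rightarrow> (real \<Rightarrow> 'w \<Rightarrow> real) \<Rightarrow> 'w \<Rightarrow> real \<Rightarrow> real" where
  "sample_path T X \<omega> = (\<lambda>t\<in>T. X t \<omega>)"

definition law :: "'w measure \<Rightarrow> real set \<Rightarrow> (real \<Rightarrow> 'w \<Rightarrow> real) \<Rightarrow> (real \<Rightarrow> real) measure" where
  "law M T X = distr M (path_space T) (sample_path T X)"

text \<open>The library's \<open>indep_var\<close> needs both variables to have values in the same type.\<close>

definition indep_elements ::
  "'w measure \<Rightarrow> 'a measure \<Rightarrow> ('w \<Rightarrow> 'a) \<Rightarrow> 'b measure \<Rightarrow> ('w \<Rightarrow> 'b) \<Rightarrow> bool" where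
  "indep_elements M S U T V \<longleftrightarrow>
     U \<in> measurable M S \<and> V \<in> measurable M T \<and>
     prob_space.indep_set M (sets (vimage_algebra (space M) U S)) (sets (vimage_algebra (space M) V T))"

definition brownian_motion :: "'w measure \<Rightarrow> real \<Rightarrow> (real \<Rightarrow> 'w \<Rightarrow> real) \<Rightarrow> bool" where
  "brownian_motion M x W \<longleftrightarrow>
     prob_space M \<and> continuous_process M {0..} W \<and> (\<forall>\<omega>\<in>space M. W 0 \<omega> = x) \<and>
     (\<forall>\<tau> :: nat \<Rightarrow> real. 0 \<le> \<tau> 0 \<longrightarrow> strict_mono \<tau> \<longrightarrow>
        prob_space.indep_vars M (\<lambda>_. borel) (\<lambda>i \<omega>. W (\<tau> (Suc i)) \<omega> - W (\<tau> i) \<omega>) UNIV) \<and>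
     (\<forall>s t. 0 \<le> s \<longrightarrow> s < t \<longrightarrow>
        distributed M lborel (\<lambda>\<omega>. W t \<omega> - W s \<omega>) (normal_density 0 (sqrt (t - s))))"

definition brownian_motion_vec ::
  "'w measure \<Rightarrow> real ^ 'n \<Rightarrow> (real \<Rightarrow> 'w \<Rightarrow> real ^ 'n) \<Rightarrow> bool" where
  "brownian_motion_vec M x W \<longleftrightarrow>
     (\<forall>i. brownian_motion M (x $ i) (\<lambda>t \<omega>. W t \<omega> $ i)) \<and>
     prob_space.indep_vars M (\<lambda>_. path_space {0..}) (\<lambda>i. sample_path {0..} (\<lambda>t \<omega>. W t \<omega> $ i)) UNIV"

text \<open>
  Brownian bridges and Bessel processes are characterised by having continuous paths and the right
  law, so that the underlying probability space is arbitrary.  The auxiliary Brownian motion lives on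
  its own space; the type of that space is a canonical one and is large enough for Wiener measure.
\<close>

text \<open>Brownian bridge of length \<open>t\<close> from \<open>y\<close> to \<open>z\<close>.\<close>

definition brownian_bridge ::
  "'w measure \<Rightarrow> real \<Rightarrow> real \<Rightarrow> real \<Rightarrow> (real \<Rightarrow> 'w \<Rightarrow> real) \<Rightarrow> bool" where
  "brownian_bridge M t y z b \<longleftrightarrow>
     prob_space M \<and> continuous_process M {0..t} b \<and>
     (\<exists>(N :: (real \<Rightarrow> real) measure) W. brownian_motion N 0 W \<and>
        law M {0..t} b = law N {0..t} (\<lambda>s \<omega>. (W s \<omega> - s / t * W t \<omega>) + y + s / t * (z - y)))"

text \<open>Three-dimensional Bessel process started in \<open>r\<close>: the modulus of a Brownian motion in
  three-space.  By rotation invariance the starting point \<open>x\<close> on the sphere is immaterial.\<close>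

definition bessel3 :: "'w measure \<Rightarrow> real \<Rightarrow> (real \<Rightarrow> 'w \<Rightarrow> real) \<Rightarrow> bool" where
  "bessel3 M r Z \<longleftrightarrow>
     prob_space M \<and> continuous_process M {0..} Z \<and>
     (\<exists>(N :: (real \<Rightarrow> real ^ 3) measure) (x :: real ^ 3) W. norm x = r \<and> brownian_motion_vec N x W \<and>
        law M {0..} Z = law N {0..} (\<lambda>t \<omega>. norm (W t \<omega>)))"


section \<open>The random time and the process\<close>

definition neg_time :: "real set \<Rightarrow> (real \<Rightarrow> real) \<Rightarrow> real" where
  "neg_time T f = (LINT s:T|lborel. indicator {..<0} (f s))"

definition neg_time_cdf :: "'w measure \<Rightarrow> (real \<Rightarrow> 'w \<Rightarrow> real) \<Rightarrow> real \<Rightarrow> real \<Rightarrow> real" where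
  "neg_time_cdf N b t u = \<P>(\<omega> in N. neg_time {0..t} (\<lambda>s. b s \<omega>) \<le> u)"

text \<open>The distribution function of \<open>g\<close> on \<open>[0,\<infinity>)\<close>, where \<open>q y t u\<close> is the probability that a
  bridge of length \<open>t\<close> from \<open>y\<close> to \<open>0\<close> spends at most time \<open>u\<close> below zero.\<close>

definition g_cdf :: "(real \<Rightarrow> real \<Rightarrow> real \<Rightarrow> real) \<Rightarrow> real \<Rightarrow> real \<Rightarrow> real" where
  "g_cdf q y x =
    (if y = 0 then (if x \<le> 1 then sqrt x / 2 else 1 - 1 / (2 * sqrt x))
     else if y < 0 then
       (LINT t:{0..x}|lborel. q y t 1 * (1 / sqrt t) * exp (- (y\<^sup>2 / (2 * t)))) /
       (2 * (LINT t:{0..1}|lborel. 1 / sqrt t * exp (- (y\<^sup>2 / (2 * t)))))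
     else
       (2 * sqrt (2 * pi) * y + (LINT t:{0..x}|lborel. q y t 1 * (1 / sqrt t) * exp (- (y\<^sup>2 / (2 * t))))) /
       (2 * sqrt (2 * pi) * y + 4))"

text \<open>The process \<open>b\<close> has, conditionally on \<open>g = x\<close>, the law of the standard bridge \<open>\<beta>\<close> conditioned
  on the scaled and tilted bridge spending at most unit time below zero: the conditional
  probabilities form a regular conditional distribution of \<open>b\<close> given \<open>g\<close>.  For \<open>x = 0\<close> the
  conditioning event is the whole space.\<close>

definition conditioned_bridge_given ::
  "'v measure \<Rightarrow> (real \<Rightarrow> 'v \<Rightarrow> real) \<Rightarrow> real \<Rightarrow> 'w measure \<Rightarrow> ('w \<Rightarrow> real) \<Rightarrow> (real \<Rightarrow> 'w \<Rightarrow> real) \<Rightarrow> bool" where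
  "conditioned_bridge_given N \<beta> y M g b \<longleftrightarrow>
     continuous_process M {0..1} b \<and>
     (\<forall>B \<in> sets borel. \<forall>A \<in> sets (path_space {0..1}).
        \<P>(\<omega> in M. g \<omega> \<in> B \<and> sample_path {0..1} b \<omega> \<in> A) =
        (LINT x:B|distr M borel g.
           \<P>(\<omega> in N. sample_path {0..1} \<beta> \<omega> \<in> A \<bar>
              neg_time {0..x} (\<lambda>s. sqrt x * \<beta> (s / x) \<omega> + y - s / x * y) \<le> 1)))"

definition X_process ::
  "real \<Rightarrow> ('w \<Rightarrow> real) \<Rightarrow> (real \<Rightarrow> 'w \<Rightarrow> real) \<Rightarrow> (real \<Rightarrow> 'w \<Rightarrow> real) \<Rightarrow> (real \<Rightarrow> 'w \<Rightarrow> real)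
    \<Rightarrow> real \<Rightarrow> 'w \<Rightarrow> real" where
  "X_process y g b Z Y t \<omega> =
     of_bool (g \<omega> > 0 \<and> t < g \<omega>) * (sqrt (g \<omega>) * b (t / g \<omega>) \<omega> + y - t / g \<omega> * y) +
     of_bool (g \<omega> > 0 \<and> t \<ge> g \<omega>) * Z (t - g \<omega>) \<omega> +
     of_bool (g \<omega> = 0 \<and> y > 0) * Y t \<omega>"


section \<open>Weak convergence along a filter\<close>

text \<open>The library's \<^const>\<open>weak_conv_m\<close> is for sequences; here the parameter is a real number.\<close>

definition weak_conv_along :: "'i filter \<Rightarrow> ('i \<Rightarrow> real measure) \<Rightarrow> real measure \<Rightarrow> bool" where
  "weak_conv_along F \<mu> \<nu> \<longleftrightarrow> (\<forall>x. isCont (cdf \<nu>) x \<longrightarrow> ((\<lambda>i. cdf (\<mu> i) x) \<longlongrightarrow> cdf \<nu> x) F)"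

lemma weak_conv_along_sequentially: "weak_conv_along sequentially \<mu> \<nu> \<longleftrightarrow> weak_conv_m \<mu> \<nu>"
  by (simp add: weak_conv_along_def weak_conv_m_def weak_conv_def)

end

theory Submission
  imports Defs "HOL-Real_Asymp.Real_Asymp"
begin

text \<open>
  By Brownian scaling, \<open>q y t u\<close> depends only on \<open>y / sqrt t\<close> and \<open>u / t\<close>: it is the distribution
  function \<open>occ_cdf\<close> of the time that a bridge from \<open>c\<close> to \<open>0\<close> of unit length spends below zero.  For \<open>c < 0\<close>
  this function is bounded from below through Gaussian walk bridges.  Cyclic shifts of the steps after
  the first passage above zero (Sparre Andersen) show that the number of later negative points is
  stochastically at most uniform, and a reflection bounds the law of the passage time.  In the limit this
  gives \<open>occ_cdf c r \<ge> r * occ_tail (- c * sqrt ((1 - r) / r))\<close>.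

  No matching upper bound has to be derived.  The distribution function of \<open>g\<close> tends to \<open>1\<close>, which
  prescribes the integral over \<open>t\<close> of \<open>q y t 1 * exp (- y\<^sup>2 / (2 * t)) / sqrt t\<close>, and the
  lower bound already exhausts it; hence equality holds for \<open>c < 0\<close>, and changing the sign of the bridge
  gives a lower bound for \<open>c > 0\<close>.  The limits of the law of \<open>g\<close> follow by a Scheffe argument, in which
  lower bounds on the densities again suffice.

  For \<open>y < 0\<close> the conditional law of \<open>b\<close> given \<open>g\<close> turns the probability of \<open>\<Gamma> \<le> v\<close> into the quotient of
  the integrals with \<open>q y t v\<close> and \<open>q y t 1\<close>.  By scaling the first one is known as well, so that \<open>\<Gamma>\<close> has
  density proportional to \<open>exp (- y\<^sup>2 / (2 * v)) / sqrt v\<close> on the unit interval.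
\<close>

section \<open>Gaussian tails and occupation masses\<close>

text \<open>A walk bridge does not meet zero but jumps over it, and the chord from there to the end
  point lifts the later path. Every discrete comparison is therefore an inequality; all of them are
  arranged to point the same way, and the passage from walks to paths is one-sided too, so that the
  time which a path spends at zero never has to be shown negligible. \<open>occ_tail\<close> comes
  from the following computation. By reflection a bridge from \<open>c < 0\<close> reaches zero
  before \<tau> with probability \<open>2 * gauss_tail (- c * sqrt ((1 - \<tau>) / \<tau>))\<close>.
  If it first does so at \<tau>, its time below zero is \<tau> plus a uniform variable on
  [0, 1 - \<tau>], hence at most \<open>r\<close> with probability
  \<open>(r - \<tau>) / (1 - \<tau>)\<close>. Averaging this over the passage time gives
  \<open>r * occ_tail (- c * sqrt ((1 - r) / r))\<close>. The prescribed mass closes the gap for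
  \<open>y < 0\<close> by an exact identity: up to time 1 the constraint is void and the weight is
  \<open>phi y\<close>, of mass \<open>phi_mass y 1\<close>; beyond time 1 the lower bound has the
  same mass \<open>phi_mass y 1\<close>; and the normalising constant is
  \<open>2 * phi_mass y 1\<close>.\<close>

lemma nn_integral_FTC_einterval:
  fixes f F :: "real \<Rightarrow> real" and a b :: ereal
  assumes ab: "a < b"
    and F: "\<And>x. a < ereal x \<Longrightarrow> ereal x < b \<Longrightarrow> (F has_real_derivative f x) (at x)"
    and f: "\<And>x. a < ereal x \<Longrightarrow> ereal x < b \<Longrightarrow> isCont f x"
    and nonneg: "\<And>x. a < ereal x \<Longrightarrow> ereal x < b \<Longrightarrow> 0 \<le> f x"
    and A: "((F \<circ> real_of_ereal) \<longlongrightarrow> A) (at_right a)"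
    and B: "((F \<circ> real_of_ereal) \<longlongrightarrow> B) (at_left b)"
  shows "(\<integral>\<^sup>+x\<in>einterval a b. ennreal (f x) \<partial>lborel) = ennreal (B - A)"
proof -
  have ae: "AE x in lborel. a < ereal x \<longrightarrow> ereal x < b \<longrightarrow> 0 \<le> f x"
    using nonneg by auto
  note ftc = interval_integral_FTC_nonneg[OF ab F f ae A B]
  have int: "integrable lborel (\<lambda>x. indicator (einterval a b) x * f x)"
    using ftc(1) by (simp add: set_integrable_def)
  have "(\<integral>\<^sup>+x\<in>einterval a b. ennreal (f x) \<partial>lborel)
      = (\<integral>\<^sup>+x. ennreal (indicator (einterval a b) x * f x) \<partial>lborel)"
    by (intro nn_integral_cong) (simp add: indicator_def)
  also have "\<dots> = ennreal (\<integral>x. indicator (einterval a b) x * f x \<partial>lborel)"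
    by (intro nn_integral_eq_integral[OF int]) (auto simp: indicator_def einterval_def nonneg)
  also have "(\<integral>x. indicator (einterval a b) x * f x \<partial>lborel) = B - A"
    using ftc(2) ab by (simp add: interval_lebesgue_integral_def set_lebesgue_integral_def less_imp_le)
  finally show ?thesis .
qed

lemma nn_integral_FTC_Ioo:
  fixes f F :: "real \<Rightarrow> real"
  assumes ab: "a < b"
    and F: "\<And>x. a < x \<Longrightarrow> x < b \<Longrightarrow> (F has_real_derivative f x) (at x)"
    and f: "\<And>x. a < x \<Longrightarrow> x < b \<Longrightarrow> isCont f x"
    and nonneg: "\<And>x. a < x \<Longrightarrow> x < b \<Longrightarrow> 0 \<le> f x"
    and A: "(F \<longlongrightarrow> A) (at_right a)" and B: "(F \<longlongrightarrow> B) (at_left b)"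
  shows "(\<integral>\<^sup>+x\<in>{a<..<b}. ennreal (f x) \<partial>lborel) = ennreal (B - A)"
proof -
  have "einterval (ereal a) (ereal b) = {a<..<b}"
    by (auto simp: einterval_def)
  moreover have "((F \<circ> real_of_ereal) \<longlongrightarrow> A) (at_right (ereal a))" "((F \<circ> real_of_ereal) \<longlongrightarrow> B) (at_left (ereal b))"
    using A B by (simp_all add: ereal_tendsto_simps)
  ultimately show ?thesis
    using nn_integral_FTC_einterval[of "ereal a" "ereal b" F f A B] ab F f nonneg by simp
qed

lemma nn_integral_FTC_Ioi:
  fixes f F :: "real \<Rightarrow> real"
  assumes F: "\<And>x. a < x \<Longrightarrow> (F has_real_derivative f x) (at x)"
    and f: "\<And>x. a < x \<Longrightarrow> isCont f x"
    and nonneg: "\<And>x. a < x \<Longrightarrow> 0 \<le> f x"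
    and A: "(F \<longlongrightarrow> A) (at_right a)" and B: "(F \<longlongrightarrow> B) at_top"
  shows "(\<integral>\<^sup>+x\<in>{a<..}. ennreal (f x) \<partial>lborel) = ennreal (B - A)"
proof -
  have "einterval (ereal a) \<infinity> = {a<..}"
    by (auto simp: einterval_def)
  moreover have "((F \<circ> real_of_ereal) \<longlongrightarrow> A) (at_right (ereal a))" "((F \<circ> real_of_ereal) \<longlongrightarrow> B) (at_left \<infinity>)"
    using A B by (simp_all add: ereal_tendsto_simps)
  ultimately show ?thesis
    using nn_integral_FTC_einterval[of "ereal a" \<infinity> F f A B] F f nonneg by simp
qed

section \<open>The tail of the standard normal law\<close>

abbreviation std_gauss :: "real measure" where
  "std_gauss \<equiv> density lborel std_normal_density"

lemma prob_space_std_gauss: "prob_space std_gauss"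
  by (rule prob_space_normal_density) simp

definition gauss_tail :: "real \<Rightarrow> real" where
  "gauss_tail a = measure std_gauss {a<..}"

lemma gauss_tail_nonneg [simp]: "0 \<le> gauss_tail a"
  by (simp add: gauss_tail_def)

lemma continuous_std_normal_density: "continuous_on A std_normal_density"
  unfolding std_normal_density_def by (intro continuous_intros) auto

lemma gauss_tail_diff:
  assumes "a \<le> b"
  shows "gauss_tail a - gauss_tail b = integral {a..b} std_normal_density"
proof -
  interpret prob_space std_gauss by (rule prob_space_std_gauss)
  have "gauss_tail a - gauss_tail b = measure std_gauss ({a<..} - {b<..})"
    using assms unfolding gauss_tail_def by (subst finite_measure_Diff) auto
  also have "{a<..} - {b<..} = {a<..b}"
    by auto
  also have "measure std_gauss {a<..b} = measure std_gauss {a..b}"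
  proof (rule measure_eq_AE)
    have "AE x in lborel. x \<noteq> a"
      by (rule AE_lborel_singleton)
    then show "AE x in std_gauss. (x \<in> {a<..b}) = (x \<in> {a..b})"
      by (subst AE_density) (auto elim!: eventually_mono)
  qed auto
  also have "\<dots> = (\<integral>x. indicator {a..b} x * std_normal_density x \<partial>lborel)"
    unfolding measure_def
    by (subst emeasure_density)
      (auto simp: integral_eq_nn_integral intro!: arg_cong[where f=enn2real] nn_integral_cong split: split_indicator)
  also have "\<dots> = (LINT x:{a..b}|lborel. std_normal_density x)"
    by (simp add: set_lebesgue_integral_def)
  also have "\<dots> = integral {a..b} std_normal_density"
    by (rule set_borel_integral_eq_integral(2)) (rule borel_integrable_atLeastAtMost', rule continuous_std_normal_density)
  finally show ?thesis .
qed

lemma gauss_tail_deriv [derivative_intros]: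
  "(gauss_tail has_real_derivative - std_normal_density x) (at x)"
proof -
  have "((\<lambda>u. integral {x-1..u} std_normal_density) has_real_derivative std_normal_density x) (at x within {x-1..x+1})"
    by (rule integral_has_real_derivative[OF continuous_std_normal_density]) auto
  then have "((\<lambda>u. integral {x-1..u} std_normal_density) has_real_derivative std_normal_density x) (at x)"
    by (subst (asm) at_within_interior) auto
  then have "((\<lambda>u. gauss_tail (x-1) - integral {x-1..u} std_normal_density) has_real_derivative - std_normal_density x) (at x)"
    by (auto intro!: derivative_eq_intros)
  then show ?thesis
  proof (rule has_field_derivative_transform_within_open[of _ _ _ "{x-1<..}"])
    fix u :: real assume "u \<in> {x-1<..}"
    then show "gauss_tail (x-1) - integral {x-1..u} std_normal_density = gauss_tail u"
      using gauss_tail_diff[of "x-1" u] by simp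
  qed auto
qed

lemma gauss_tail_deriv' [derivative_intros]:
  "(g has_real_derivative g') (at x within S) \<Longrightarrow>
    ((\<lambda>x. gauss_tail (g x)) has_real_derivative - std_normal_density (g x) * g') (at x within S)"
  by (rule DERIV_chain2[OF gauss_tail_deriv])

lemma isCont_gauss_tail: "isCont gauss_tail x"
  using gauss_tail_deriv by (rule DERIV_isCont)

lemma continuous_on_gauss_tail [continuous_intros]:
  "continuous_on A f \<Longrightarrow> continuous_on A (\<lambda>x. gauss_tail (f x))"
  by (rule continuous_on_compose2[of UNIV gauss_tail])
    (auto intro!: continuous_at_imp_continuous_on isCont_gauss_tail)

lemma tendsto_gauss_tail [tendsto_intros]:
  "(f \<longlongrightarrow> a) F \<Longrightarrow> ((\<lambda>x. gauss_tail (f x)) \<longlongrightarrow> gauss_tail a) F"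
  by (rule isCont_tendsto_compose[OF isCont_gauss_tail])

lemma borel_measurable_gauss_tail [measurable]: "gauss_tail \<in> borel_measurable borel"
  by (intro borel_measurable_continuous_onI continuous_intros)

lemma gauss_tail_cdf: "gauss_tail x = 1 - cdf std_gauss x"
proof -
  interpret prob_space std_gauss by (rule prob_space_std_gauss)
  have "{x<..} = space std_gauss - {..x}" by auto
  then show ?thesis
    unfolding gauss_tail_def cdf_def2 by (subst prob_compl[symmetric]) auto
qed

lemma gauss_tail_at_top: "(gauss_tail \<longlongrightarrow> 0) at_top"
proof -
  interpret prob_space std_gauss by (rule prob_space_std_gauss)
  interpret real_distribution std_gauss by standard auto
  have "((\<lambda>x. 1 - cdf std_gauss x) \<longlongrightarrow> 1 - 1) at_top"
    by (intro tendsto_intros cdf_lim_at_top_prob)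
  then show ?thesis by (simp add: gauss_tail_cdf[abs_def])
qed

lemma std_gauss_uminus: "distr std_gauss borel uminus = std_gauss"
proof (rule measure_eqI)
  fix A :: "real set" assume A: "A \<in> sets (distr std_gauss borel uminus)"
  then have [measurable]: "A \<in> sets borel" by simp
  have [measurable]: "uminus -` A \<in> sets borel"
    using measurable_sets[of uminus "borel :: real measure" borel A] by simp
  have "emeasure (distr std_gauss borel uminus) A = (\<integral>\<^sup>+x. ennreal (std_normal_density x) * indicator (uminus -` A) x \<partial>lborel)"
    by (simp add: emeasure_distr emeasure_density)
  also have "\<dots> = (\<integral>\<^sup>+x. ennreal (std_normal_density (0 + (-1) * x)) * indicator (uminus -` A) (0 + (-1) * x) \<partial>lborel)"
    by (subst nn_integral_real_affine[where c="-1" and t=0]) auto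
  also have "\<dots> = (\<integral>\<^sup>+x. ennreal (std_normal_density x) * indicator A x \<partial>lborel)"
    by (intro nn_integral_cong) (auto simp: std_normal_density_def indicator_def)
  finally show "emeasure (distr std_gauss borel uminus) A = emeasure std_gauss A"
    by (simp add: emeasure_density)
qed simp

lemma gauss_tail_0: "gauss_tail 0 = 1 / 2"
proof -
  interpret prob_space std_gauss by (rule prob_space_std_gauss)
  have "measure std_gauss {0<..} = measure (distr std_gauss borel uminus) {0<..}"
    by (simp only: std_gauss_uminus)
  also have "\<dots> = measure std_gauss {..<0}"
    by (subst measure_distr) (auto simp: vimage_def intro!: arg_cong[where f="measure std_gauss"])
  finally have 1: "measure std_gauss {..<0} = gauss_tail 0"
    by (simp add: gauss_tail_def)
  have "emeasure lborel {0::real} = 0" by simp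
  then have "emeasure std_gauss {0::real} = 0"
    by (subst emeasure_density) (auto simp: nn_integral_indicator_singleton)
  then have 0: "measure std_gauss {0::real} = 0" by (simp add: measure_def)
  have "measure std_gauss ({..<0} \<union> {0} \<union> {0<..}) = measure std_gauss {..<0} + measure std_gauss {0} + measure std_gauss {0<..}"
  proof -
    have "measure std_gauss ({..<0} \<union> {0} \<union> {0<..}) = measure std_gauss ({..<0} \<union> {0}) + measure std_gauss {0<..}"
      by (rule finite_measure_Union) auto
    also have "measure std_gauss ({..<0} \<union> {0}) = measure std_gauss {..<0} + measure std_gauss {0}"
      by (rule finite_measure_Union) auto
    finally show ?thesis .
  qed
  moreover have "{..<0} \<union> {0} \<union> {0<..} = space std_gauss" by auto
  ultimately show ?thesis
    using prob_space 0 1 by (simp add: gauss_tail_def)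
qed

lemma std_normal_density_deriv [derivative_intros]:
  "(g has_real_derivative g') (at x within S) \<Longrightarrow>
    ((\<lambda>x. std_normal_density (g x)) has_real_derivative - g x * std_normal_density (g x) * g') (at x within S)"
proof -
  assume g: "(g has_real_derivative g') (at x within S)"
  have "((\<lambda>x. C * exp (- ((g x)\<^sup>2) / 2)) has_real_derivative - g x * (C * exp (- ((g x)\<^sup>2) / 2)) * g') (at x within S)" for C
    using g by (auto intro!: derivative_eq_intros simp: power2_eq_square field_simps)
  then show ?thesis unfolding std_normal_density_def .
qed

lemma tendsto_std_normal_density [tendsto_intros]:
  "(f \<longlongrightarrow> a) F \<Longrightarrow> ((\<lambda>x. std_normal_density (f x)) \<longlongrightarrow> std_normal_density a) F"
  unfolding std_normal_density_def by (auto intro!: tendsto_intros)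

lemma std_normal_density_at_top: "(std_normal_density \<longlongrightarrow> 0) at_top"
  unfolding std_normal_density_def by real_asymp

text \<open>For a standard normal \<open>G\<close> this is twice the mean of the square of the
  positive part of \<open>G - a\<close>, in closed form; the factor 2 makes the value at 0 equal to
  1. The function arises from averaging over the first passage time in
  \<open>occ_tail_first_passage_integral\<close>.\<close>

definition occ_tail :: "real \<Rightarrow> real" where
  "occ_tail a = 2 * (1 + a\<^sup>2) * gauss_tail a - 2 * a * std_normal_density a"

lemma tendsto_occ_tail [tendsto_intros]:
  "(f \<longlongrightarrow> a) F \<Longrightarrow> ((\<lambda>x. occ_tail (f x)) \<longlongrightarrow> occ_tail a) F"
  unfolding occ_tail_def by (auto intro!: tendsto_intros)

lemma borel_measurable_occ_tail [measurable]: "occ_tail \<in> borel_measurable borel"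
  unfolding occ_tail_def by measurable

lemma occ_tail_0 [simp]: "occ_tail 0 = 1"
  by (simp add: occ_tail_def gauss_tail_0)

lemma occ_tail_deriv:
  "(occ_tail has_real_derivative 4 * a * gauss_tail a - 4 * std_normal_density a) (at a)"
  unfolding occ_tail_def
  by (auto intro!: derivative_eq_intros simp: algebra_simps power2_eq_square)

text \<open>The substitution \<open>w = sqrt (2 * z + x)\<close> turns \<open>exp (- z)\<close> into
  \<open>exp (x / 2)\<close> times a Gaussian factor and leaves the integrand
  \<open>2 * (1 - x / w\<^sup>2) * std_normal_density w\<close>, whose antiderivative is the
  function \<open>B\<close>. With \<open>occ_tail\<close> written as an integral over
  \<open>z\<close>, the integrals in \<open>occ_phi_mass\<close> and \<open>occ_tail_g_tail\<close>
  reduce by Fubini to integrals of powers.\<close>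

lemma occ_tail_integral_repr:
  assumes "x > 0"
  shows "(\<integral>\<^sup>+z\<in>{0<..}. ennreal (4 * z * exp (- z) / (sqrt (2 * pi) * sqrt ((2 * z + x) ^ 3))) \<partial>lborel)
    = ennreal (exp (x / 2) * occ_tail (sqrt x))" (is "?I = _")
proof -
  define B where "B = (\<lambda>z. 2 * exp (x / 2) * (x * std_normal_density (sqrt (2 * z + x)) / sqrt (2 * z + x) - (1 + x) * gauss_tail (sqrt (2 * z + x))))"
  have "?I = ennreal (0 - B 0)"
  proof (rule nn_integral_FTC_Ioi)
    fix z :: real assume z: "0 < z"
    define w where "w = sqrt (2 * z + x)"
    have w: "w > 0" "w\<^sup>2 = 2 * z + x" using z assms by (auto simp: w_def)
    have e: "exp (- z) = exp (x / 2) * exp (- (w\<^sup>2) / 2)"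
      unfolding w(2) exp_add[symmetric] by (simp add: field_simps)
    have w3: "sqrt ((2 * z + x) ^ 3) = w ^ 3"
      by (simp add: w_def real_sqrt_power)
    have z': "z = (w\<^sup>2 - x) / 2" using w by simp
    have d: "((\<lambda>z. sqrt (2 * z + x)) has_real_derivative 1 / w) (at z)"
      using z assms unfolding w_def by (auto intro!: derivative_eq_intros simp: field_simps)
    have "(B has_real_derivative 2 * exp (x / 2) * (((x * (- w * std_normal_density w * (1 / w))) * w - x * std_normal_density w * (1 / w)) / (w * w)
       - (1 + x) * (- std_normal_density w * (1 / w)))) (at z)"
      unfolding B_def w_def[symmetric]
      by (rule derivative_eq_intros d refl | (use w in \<open>simp add: w_def; fail\<close>))+ (use w in \<open>simp add: w_def algebra_simps\<close>)
    also have "2 * exp (x / 2) * (((x * (- w * std_normal_density w * (1 / w))) * w - x * std_normal_density w * (1 / w)) / (w * w)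
       - (1 + x) * (- std_normal_density w * (1 / w))) = 4 * z * exp (- z) / (sqrt (2 * pi) * sqrt ((2 * z + x) ^ 3))"
    proof -
      have "4 * z * exp (- z) / (sqrt (2 * pi) * sqrt ((2 * z + x) ^ 3))
          = 2 * (w\<^sup>2 - x) * (exp (x / 2) * exp (- (w\<^sup>2) / 2)) / (sqrt (2 * pi) * w ^ 3)"
      proof -
        have "4 * z = 2 * (w\<^sup>2 - x)" using z' by simp
        then show ?thesis unfolding e w3 by presburger
      qed
      then show ?thesis
        unfolding std_normal_density_def using w(1)
        by (simp add: field_simps power2_eq_square power3_eq_cube)
    qed
    finally show "(B has_real_derivative 4 * z * exp (- z) / (sqrt (2 * pi) * sqrt ((2 * z + x) ^ 3))) (at z)" .
    show "isCont (\<lambda>z. 4 * z * exp (- z) / (sqrt (2 * pi) * sqrt ((2 * z + x) ^ 3))) z"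
      using z assms by (intro continuous_intros) auto
    show "0 \<le> 4 * z * exp (- z) / (sqrt (2 * pi) * sqrt ((2 * z + x) ^ 3))"
      using z assms by auto
  next
    have "isCont B 0"
      unfolding B_def using assms
      by (intro continuous_intros isCont_o2[OF _ isCont_gauss_tail] isCont_o2[OF _ continuous_on_interior[OF continuous_std_normal_density[of UNIV]]]) auto
    then show "(B \<longlongrightarrow> B 0) (at_right 0)"
      by (simp add: isCont_def filterlim_at_split)
    have w: "filterlim (\<lambda>z. sqrt (2 * z + x)) at_top at_top"
      by real_asymp
    have "((\<lambda>w. 2 * exp (x / 2) * (x * std_normal_density w * (1 / w) - (1 + x) * gauss_tail w)) \<longlongrightarrow>
       2 * exp (x / 2) * (x * 0 * 0 - (1 + x) * 0)) at_top"
      by (intro tendsto_mult tendsto_diff tendsto_const gauss_tail_at_top std_normal_density_at_top) real_asymp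
    from filterlim_compose[OF this w] show "(B \<longlongrightarrow> 0) at_top"
      unfolding B_def by simp
  qed
  also have "0 - B 0 = exp (x / 2) * occ_tail (sqrt x)"
    using assms by (simp add: B_def occ_tail_def field_simps)
  finally show ?thesis .
qed

text \<open>In the quotient rule the density terms cancel and only \<open>- 4 * gauss_tail w\<close>
  survives of \<open>w\<close> times the derivative minus twice the function. This ratio is the
  antiderivative behind the first passage integral; as it decreases to 0 at infinity, it also shows
  that \<open>occ_tail\<close> is nonnegative.\<close>

lemma occ_tail_ratio_deriv:
  assumes "w > 0"
  shows "((\<lambda>w. occ_tail w / w\<^sup>2) has_real_derivative - 4 * gauss_tail w / w ^ 3) (at w)"
proof -
  have "((\<lambda>w. occ_tail w / w\<^sup>2) has_real_derivative
     ((4 * w * gauss_tail w - 4 * std_normal_density w) * w\<^sup>2 - occ_tail w * (2 * w)) / (w\<^sup>2 * w\<^sup>2)) (at w)"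
    using assms by (auto intro!: derivative_eq_intros DERIV_chain2[OF occ_tail_deriv])
  also have "((4 * w * gauss_tail w - 4 * std_normal_density w) * w\<^sup>2 - occ_tail w * (2 * w)) / (w\<^sup>2 * w\<^sup>2)
      = - 4 * gauss_tail w / w ^ 3"
    using assms by (simp add: occ_tail_def field_simps power2_eq_square power3_eq_cube)
  finally show ?thesis .
qed

lemma occ_tail_ratio_at_top: "((\<lambda>w. occ_tail w / w\<^sup>2) \<longlongrightarrow> 0) at_top"
proof -
  have "((\<lambda>w. 2 * (1 / w\<^sup>2 + 1) * gauss_tail w - 2 * (1 / w) * std_normal_density w) \<longlongrightarrow> 2 * (0 + 1) * 0 - 2 * 0 * 0) at_top"
    by (intro tendsto_intros gauss_tail_at_top std_normal_density_at_top) real_asymp+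
  moreover have "eventually (\<lambda>w. 2 * (1 / w\<^sup>2 + 1) * gauss_tail w - 2 * (1 / w) * std_normal_density w = occ_tail w / w\<^sup>2) at_top"
    using eventually_gt_at_top[of 0]
    by eventually_elim (simp add: occ_tail_def field_simps power2_eq_square)
  ultimately show ?thesis
    by (simp add: filterlim_cong)
qed

lemma occ_tail_nonneg:
  assumes "a \<ge> 0"
  shows "occ_tail a \<ge> 0"
proof (cases "a = 0")
  case False
  with assms have a: "a > 0" by simp
  have "occ_tail b / b\<^sup>2 \<le> occ_tail a / a\<^sup>2" if "a \<le> b" for b
    using that a
    by (intro DERIV_nonpos_imp_nonincreasing[of a b "\<lambda>w. occ_tail w / w\<^sup>2"])
      (auto intro!: exI[of _ "- 4 * gauss_tail _ / _ ^ 3"] occ_tail_ratio_deriv)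
  then have "eventually (\<lambda>b. occ_tail b / b\<^sup>2 \<le> occ_tail a / a\<^sup>2) at_top"
    by (rule eventually_mono[OF eventually_ge_at_top])
  then have "0 \<le> occ_tail a / a\<^sup>2"
    by (intro tendsto_upperbound[OF occ_tail_ratio_at_top]) auto
  then show ?thesis
    using a by (simp add: zero_le_divide_iff)
qed simp

section \<open>The Gaussian kernel as a function of time, and its mass\<close>

definition phi :: "real \<Rightarrow> real \<Rightarrow> real" where
  "phi y t = 1 / sqrt t * exp (- (y\<^sup>2 / (2 * t)))"

definition phi_mass :: "real \<Rightarrow> real \<Rightarrow> real" where
  "phi_mass y v = (LINT t:{0..v}|lborel. phi y t)"

lemma borel_measurable_phi [measurable]: "phi y \<in> borel_measurable borel"
  unfolding phi_def by measurable

lemma phi_nonneg: "0 \<le> t \<Longrightarrow> 0 \<le> phi y t"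
  by (simp add: phi_def)

lemma phi_pos: "0 < t \<Longrightarrow> 0 < phi y t"
  by (simp add: phi_def)

lemma phi_le: "0 \<le> t \<Longrightarrow> phi y t \<le> 1 / sqrt t"
  by (simp add: phi_def mult_left_le divide_right_mono)

text \<open>The value comes from \<open>1 / 0 = 0\<close> and so holds for \<open>y = 0\<close> too,
  although \<open>phi 0\<close> is unbounded near 0. Integrals can then be taken over closed
  intervals starting at 0.\<close>

lemma phi_0 [simp]: "phi y 0 = 0"
  by (simp add: phi_def)

lemma nn_integral_inverse_sqrt:
  assumes "v > 0"
  shows "(\<integral>\<^sup>+t\<in>{0<..<v}. ennreal (1 / sqrt t) \<partial>lborel) = ennreal (2 * sqrt v)"
proof -
  have "(\<integral>\<^sup>+t\<in>{0<..<v}. ennreal (1 / sqrt t) \<partial>lborel) = ennreal (2 * sqrt v - 2 * sqrt 0)"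
    using assms
  proof (intro nn_integral_FTC_Ioo[where F="\<lambda>t. 2 * sqrt t"])
    show "((\<lambda>t. 2 * sqrt t) has_real_derivative 1 / sqrt t) (at t)" if "0 < t" "t < v" for t
      using that by (auto intro!: derivative_eq_intros simp: field_simps)
    show "((\<lambda>t. 2 * sqrt t) \<longlongrightarrow> 2 * sqrt 0) (at_right 0)"
      by (intro tendsto_intros)
  qed (use assms in \<open>auto intro!: continuous_intros tendsto_intros\<close>)
  then show ?thesis by simp
qed

lemma phi_integrable:
  assumes "0 \<le> v"
  shows "set_integrable lborel {0..v} (phi y)"
proof (cases "v = 0")
  case True
  have "(\<lambda>x. indicator {0..v} x *\<^sub>R phi y x) = (\<lambda>_. 0)"
    using True by (auto simp: fun_eq_iff indicator_def)
  then show ?thesis by (simp add: set_integrable_def)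
next
  case False
  with assms have v: "v > 0" by simp
  show ?thesis unfolding set_integrable_def
  proof (rule integrableI_nonneg)
    have "(\<integral>\<^sup>+x. ennreal (indicator {0..v} x *\<^sub>R phi y x) \<partial>lborel) \<le> (\<integral>\<^sup>+t\<in>{0<..<v}. ennreal (1 / sqrt t) \<partial>lborel)"
    proof (rule nn_integral_mono_AE)
      show "AE x in lborel. ennreal (indicator {0..v} x *\<^sub>R phi y x) \<le> ennreal (1 / sqrt x) * indicator {0<..<v} x"
        using AE_lborel_singleton[of v] AE_lborel_singleton[of 0]
        by eventually_elim (auto simp: indicator_def intro!: ennreal_leI phi_le)
    qed
    also have "\<dots> < \<infinity>" using nn_integral_inverse_sqrt[OF v] by simp
    finally show "(\<integral>\<^sup>+x. ennreal (indicator {0..v} x *\<^sub>R phi y x) \<partial>lborel) < \<infinity>" .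
  qed (auto simp: phi_nonneg indicator_def)
qed

lemma ennreal_phi_mass:
  assumes "0 \<le> v"
  shows "ennreal (phi_mass y v) = (\<integral>\<^sup>+t\<in>{0..v}. ennreal (phi y t) \<partial>lborel)"
  unfolding phi_mass_def set_lebesgue_integral_def
  by (subst nn_integral_eq_integral[symmetric])
    (use phi_integrable[OF assms, of y] in \<open>auto simp: set_integrable_def phi_nonneg indicator_def intro!: nn_integral_cong\<close>)

lemma phi_mass_nonneg: "0 \<le> phi_mass y v"
  unfolding phi_mass_def set_lebesgue_integral_def
  by (rule integral_nonneg_AE) (auto simp: indicator_def phi_nonneg)

lemma ennreal_phi_mass_1:
  "ennreal (phi_mass y 1) = (\<integral>\<^sup>+t\<in>{0<..<1}. ennreal (phi y t) \<partial>lborel)"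
  unfolding ennreal_phi_mass[of 1, simplified]
  by (rule nn_integral_cong_AE)
    (use AE_lborel_singleton[of 1] AE_lborel_singleton[of 0] in \<open>eventually_elim, auto simp: indicator_def\<close>)

lemma phi_mass_pos:
  assumes "v > 0"
  shows "0 < phi_mass y v"
proof (rule ccontr)
  assume "\<not> 0 < phi_mass y v"
  then have "(\<integral>\<^sup>+t\<in>{0..v}. ennreal (phi y t) \<partial>lborel) = 0"
    using ennreal_phi_mass[of v y] assms by (simp add: ennreal_neg)
  then have "AE t in lborel. ennreal (phi y t) * indicator {0..v} t = 0"
    by (subst (asm) nn_integral_0_iff_AE) auto
  then have "AE t in lborel. t \<notin> {0<..<v}"
    by eventually_elim (auto simp: indicator_def dest: phi_pos[of _ y] split: if_splits)
  moreover have "{x. \<not> x \<notin> {0<..<v}} = {0<..<v}" by auto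
  ultimately have "emeasure lborel {0<..<v} = 0"
    by (subst (asm) AE_iff_measurable[OF _ refl]) auto
  then show False using assms by simp
qed

lemma phi_scale:
  assumes "v > 0"
  shows "phi y (v * t) = phi (y / sqrt v) t / sqrt v"
  using assms by (simp add: phi_def real_sqrt_mult power_divide mult.commute)

lemma phi_mass_scale:
  assumes "v > 0"
  shows "phi_mass y v = sqrt v * phi_mass (y / sqrt v) 1"
proof -
  have "phi_mass y v = (LINT t|lborel. indicator {0..v} t * phi y t)"
    by (simp add: phi_mass_def set_lebesgue_integral_def)
  also have "\<dots> = \<bar>v\<bar> * (LINT t|lborel. indicator {0..v} (0 + v * t) * phi y (0 + v * t))"
    using assms by (subst lborel_integral_real_affine[where c=v and t=0]) auto
  also have "(LINT t|lborel. indicator {0..v} (0 + v * t) * phi y (0 + v * t)) = (LINT t|lborel. (indicator {0..1} t * phi (y / sqrt v) t) / sqrt v)"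
    using assms by (intro Bochner_Integration.integral_cong) (auto simp: phi_scale indicator_def zero_le_mult_iff mult_le_cancel_left1)
  also have "\<dots> = phi_mass (y / sqrt v) 1 / sqrt v"
    by (simp add: phi_mass_def set_lebesgue_integral_def)
  finally have "phi_mass y v = v / sqrt v * phi_mass (y / sqrt v) 1"
    using assms by simp
  then show ?thesis using assms by (simp add: real_div_sqrt)
qed

lemma nn_integral_sqrt_exp:
  assumes "t > 0"
  shows "(\<integral>\<^sup>+z\<in>{0<..}. ennreal (sqrt z * exp (- (z / t))) \<partial>lborel) = ennreal (sqrt pi / 2 * sqrt t ^ 3)"
proof -
  have "(\<integral>\<^sup>+z\<in>{0<..}. ennreal (sqrt z * exp (- (z / t))) \<partial>lborel)
      = ennreal t * (\<integral>\<^sup>+z. ennreal (sqrt (0 + t * z) * exp (- ((0 + t * z) / t))) * indicator {0<..} (0 + t * z) \<partial>lborel)"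
    using assms by (subst nn_integral_real_affine[where c=t and t=0]) auto
  also have "(\<integral>\<^sup>+z. ennreal (sqrt (0 + t * z) * exp (- ((0 + t * z) / t))) * indicator {0<..} (0 + t * z) \<partial>lborel)
      = (\<integral>\<^sup>+z. ennreal (sqrt t) * ennreal (indicator {0..} z * z powr (3/2 - 1) / exp z) \<partial>lborel)"
    using assms
    by (intro nn_integral_cong)
      (auto simp: indicator_def zero_less_mult_iff ennreal_mult[symmetric] real_sqrt_mult powr_half_sqrt exp_minus field_simps)
  also have "\<dots> = ennreal (sqrt t) * ennreal (Gamma (3/2))"
    using Gamma_conv_nn_integral_real[of "3/2"] by (subst nn_integral_cmult) auto
  also have "Gamma (3/2 :: real) = sqrt pi / 2"
  proof -
    have "(1/2 :: real) \<notin> \<int>\<^sub>\<le>\<^sub>0" using nonpos_Ints_nonpos[of "1/2 :: real"] by auto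
    then show ?thesis using Gamma_plus1[of "1/2 :: real"] Gamma_one_half_real by simp
  qed
  finally show ?thesis
    using assms by (simp add: ennreal_mult[symmetric] power3_eq_cube mult_ac)
qed

text \<open>With \<open>1 / t - 1\<close> as the variable this is the integral of an exponential
  over the half-line. The variable \<open>t\<close> is kept because the kernel
  \<open>phi y t\<close> has to appear in \<open>phi_mass_repr\<close>.\<close>

lemma inverse_eq_nn_integral:
  assumes "b > 0"
  shows "(\<integral>\<^sup>+t\<in>{0<..<1}. ennreal (exp (- b * (1 / t - 1)) / t\<^sup>2) \<partial>lborel) = ennreal (1 / b)"
proof -
  have "(\<integral>\<^sup>+t\<in>{0<..<1}. ennreal (exp (- b * (1 / t - 1)) / t\<^sup>2) \<partial>lborel) = ennreal (1 / b - 0)"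
  proof (rule nn_integral_FTC_Ioo)
    show "((\<lambda>t. exp (- b * (1 / t - 1)) / b) has_real_derivative exp (- b * (1 / t - 1)) / t\<^sup>2) (at t)"
      if "0 < t" "t < 1" for t
      using that assms by (auto intro!: derivative_eq_intros simp: power2_eq_square)
    show "isCont (\<lambda>t. exp (- b * (1 / t - 1)) / t\<^sup>2) t" if "0 < t" "t < 1" for t
      using that by (auto intro!: continuous_intros)
    show "((\<lambda>t. exp (- b * (1 / t - 1)) / b) \<longlongrightarrow> 0) (at_right 0)"
      using assms by real_asymp
    have "((\<lambda>t. exp (- b * (1 / t - 1)) / b) \<longlongrightarrow> exp (- b * (1 / 1 - 1)) / b) (at 1)"
      using assms by (intro tendsto_intros) auto
    then show "((\<lambda>t. exp (- b * (1 / t - 1)) / b) \<longlongrightarrow> 1 / b) (at_left 1)"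
      by (simp add: filterlim_at_split)
  qed auto
  then show ?thesis by simp
qed

text \<open>The reciprocal is replaced by an integral over \<open>t\<close> and the order of
  integration exchanged. The inner integral over \<open>z\<close> is a Gamma integral of order 3/2,
  proportional to \<open>sqrt t ^ 3\<close>; with the factor \<open>1 / t\<^sup>2\<close> and the
  exponential it makes up \<open>phi y t\<close>.\<close>

lemma phi_mass_repr:
  assumes "y \<noteq> 0"
  shows "(\<integral>\<^sup>+z\<in>{0<..}. ennreal (sqrt z * exp (- z) / (z + y\<^sup>2 / 2)) \<partial>lborel)
    = ennreal (sqrt pi / 2 * exp (y\<^sup>2 / 2) * phi_mass y 1)"
proof -
  define k where "k = y\<^sup>2 / 2"
  have k: "k > 0" using assms by (simp add: k_def)
  have "(\<integral>\<^sup>+z\<in>{0<..}. ennreal (sqrt z * exp (- z) / (z + k)) \<partial>lborel)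
     = (\<integral>\<^sup>+z. ennreal (sqrt z * exp (- z)) * indicator {0<..} z * (\<integral>\<^sup>+t\<in>{0<..<1}. ennreal (exp (- (z + k) * (1 / t - 1)) / t\<^sup>2) \<partial>lborel) \<partial>lborel)"
  proof (intro nn_integral_cong)
    fix z :: real
    show "ennreal (sqrt z * exp (- z) / (z + k)) * indicator {0<..} z = ennreal (sqrt z * exp (- z)) * indicator {0<..} z * (\<integral>\<^sup>+t\<in>{0<..<1}. ennreal (exp (- (z + k) * (1 / t - 1)) / t\<^sup>2) \<partial>lborel)"
    proof (cases "z > 0")
      case True
      then show ?thesis
        using inverse_eq_nn_integral[of "z + k"] k by (simp add: ennreal_mult[symmetric])
    qed simp
  qed
  also have "\<dots> = (\<integral>\<^sup>+z. (\<integral>\<^sup>+t. ennreal (sqrt z * exp (- z)) * indicator {0<..} z * (ennreal (exp (- (z + k) * (1 / t - 1)) / t\<^sup>2) * indicator {0<..<1} t) \<partial>lborel) \<partial>lborel)"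
    by (intro nn_integral_cong nn_integral_cmult[symmetric]) auto
  also have "\<dots> = (\<integral>\<^sup>+t. (\<integral>\<^sup>+z. ennreal (sqrt z * exp (- z)) * indicator {0<..} z * (ennreal (exp (- (z + k) * (1 / t - 1)) / t\<^sup>2) * indicator {0<..<1} t) \<partial>lborel) \<partial>lborel)"
    by (rule lborel_pair.Fubini') measurable
  also have "\<dots> = (\<integral>\<^sup>+t. ennreal (sqrt pi / 2 * exp k) * (ennreal (phi y t) * indicator {0<..<1} t) \<partial>lborel)"
  proof (intro nn_integral_cong)
    fix t :: real
    show "(\<integral>\<^sup>+z. ennreal (sqrt z * exp (- z)) * indicator {0<..} z * (ennreal (exp (- (z + k) * (1 / t - 1)) / t\<^sup>2) * indicator {0<..<1} t) \<partial>lborel)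
      = ennreal (sqrt pi / 2 * exp k) * (ennreal (phi y t) * indicator {0<..<1} t)"
    proof (cases "t \<in> {0<..<1}")
      case True
      then have t: "t > 0" by simp
      have "(\<integral>\<^sup>+z. ennreal (sqrt z * exp (- z)) * indicator {0<..} z * (ennreal (exp (- (z + k) * (1 / t - 1)) / t\<^sup>2) * indicator {0<..<1} t) \<partial>lborel)
         = (\<integral>\<^sup>+z. ennreal (exp k * exp (- (k / t)) / t\<^sup>2) * (ennreal (sqrt z * exp (- (z / t))) * indicator {0<..} z) \<partial>lborel)"
      proof (intro nn_integral_cong)
        fix z :: real
        have "exp (- z) * exp (- (z + k) * (1 / t - 1)) = exp k * exp (- (k / t)) * exp (- (z / t))"
          using t by (simp add: exp_add[symmetric] field_simps)
        then have "sqrt z * exp (- z) * (exp (- (z + k) * (1 / t - 1)) / t\<^sup>2) = exp k * exp (- (k / t)) / t\<^sup>2 * (sqrt z * exp (- (z / t)))"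
          by (simp add: field_simps)
        then show "ennreal (sqrt z * exp (- z)) * indicator {0<..} z * (ennreal (exp (- (z + k) * (1 / t - 1)) / t\<^sup>2) * indicator {0<..<1} t)
          = ennreal (exp k * exp (- (k / t)) / t\<^sup>2) * (ennreal (sqrt z * exp (- (z / t))) * indicator {0<..} z)"
          using True by (auto simp: indicator_def ennreal_mult[symmetric])
      qed
      also have "\<dots> = ennreal (exp k * exp (- (k / t)) / t\<^sup>2) * ennreal (sqrt pi / 2 * sqrt t ^ 3)"
        by (subst nn_integral_cmult) (auto simp: nn_integral_sqrt_exp[OF t])
      also have "\<dots> = ennreal (sqrt pi / 2 * exp k) * ennreal (phi y t)"
      proof -
        define w where "w = sqrt t"
        have w: "w > 0" "t\<^sup>2 = w ^ 4"
          using t by (simp_all add: w_def power4_eq_xxxx power2_eq_square)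
        have "exp k * exp (- (k / t)) / t\<^sup>2 * (sqrt pi / 2 * w ^ 3) = sqrt pi / 2 * exp k * (1 / w * exp (- (k / t)))"
          unfolding w(2) using w(1) by (simp add: power4_eq_xxxx power3_eq_cube mult_ac)
        then have "exp k * exp (- (k / t)) / t\<^sup>2 * (sqrt pi / 2 * sqrt t ^ 3) = sqrt pi / 2 * exp k * phi y t"
          by (simp add: phi_def k_def w_def)
        then show ?thesis
          using t by (simp add: ennreal_mult[symmetric] phi_nonneg)
      qed
      finally show ?thesis using True by simp
    qed simp
  qed
  also have "\<dots> = ennreal (sqrt pi / 2 * exp k) * ennreal (phi_mass y 1)"
    by (subst nn_integral_cmult) (auto simp: ennreal_phi_mass_1)
  finally show ?thesis
    by (simp add: k_def ennreal_mult[symmetric] phi_mass_nonneg)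
qed

text \<open>In \<open>phi_mass_repr\<close>, multiplied by \<open>y\<^sup>2 / 2\<close>, the factor
  \<open>y\<^sup>2 / 2 / (z + y\<^sup>2 / 2)\<close> is at most 1 and tends to 1, so dominated
  convergence yields the Gamma value \<open>sqrt pi / 2\<close>. The limit is taken at infinity and
  moved to minus infinity because \<open>phi\<close> is even in \<open>y\<close>.\<close>

lemma phi_mass_asymp:
  "((\<lambda>y. y\<^sup>2 * exp (y\<^sup>2 / 2) * phi_mass y 1) \<longlongrightarrow> 2) at_bot"
proof -
  have lim: "((\<lambda>h. (\<integral>z. indicator {0<..} z * (sqrt z * exp (- z) * (h\<^sup>2 / 2 / (z + h\<^sup>2 / 2))) \<partial>lborel)) \<longlongrightarrow>
     (\<integral>z. indicator {0<..} z * (sqrt z * exp (- z)) \<partial>lborel)) at_top"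
  proof (rule integral_dominated_convergence_at_top[where w="\<lambda>z. indicator {0<..} z * (sqrt z * exp (- z))"])
    show "integrable lborel (\<lambda>z::real. indicator {0<..} z * (sqrt z * exp (- z)))"
    proof (rule integrableI_nonneg)
      have "(\<integral>\<^sup>+z. ennreal (indicator {0<..} z * (sqrt z * exp (- z))) \<partial>lborel) = (\<integral>\<^sup>+z\<in>{0<..}. ennreal (sqrt z * exp (- (z / 1))) \<partial>lborel)"
        by (intro nn_integral_cong) (auto simp: indicator_def)
      then show "(\<integral>\<^sup>+z. ennreal (indicator {0<..} z * (sqrt z * exp (- z))) \<partial>lborel) < \<infinity>"
        using nn_integral_sqrt_exp[of 1] by simp
    qed (auto simp: indicator_def)
    show "AE z in lborel. ((\<lambda>h. indicator {0<..} z * (sqrt z * exp (- z) * (h\<^sup>2 / 2 / (z + h\<^sup>2 / 2)))) \<longlongrightarrow> indicator {0<..} z * (sqrt z * exp (- z))) at_top"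
    proof (rule AE_I2)
      fix z :: real
      have "((\<lambda>h. h\<^sup>2 / 2 / (z + h\<^sup>2 / 2)) \<longlongrightarrow> 1) at_top" by real_asymp
      from tendsto_mult[OF tendsto_const[of "indicator {0<..} z * (sqrt z * exp (- z))"] this]
      show "((\<lambda>h. indicator {0<..} z * (sqrt z * exp (- z) * (h\<^sup>2 / 2 / (z + h\<^sup>2 / 2)))) \<longlongrightarrow> indicator {0<..} z * (sqrt z * exp (- z))) at_top"
        by (simp add: mult_ac)
    qed
    show "\<forall>\<^sub>F h in at_top. AE z in lborel. norm (indicator {0<..} z * (sqrt z * exp (- z) * (h\<^sup>2 / 2 / (z + h\<^sup>2 / 2)))) \<le> indicator {0<..} z * (sqrt z * exp (- z))"
    proof (intro always_eventually allI AE_I2)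
      fix h z :: real
      show "norm (indicator {0<..} z * (sqrt z * exp (- z) * (h\<^sup>2 / 2 / (z + h\<^sup>2 / 2)))) \<le> indicator {0<..} z * (sqrt z * exp (- z))"
      proof (cases "z > 0")
        case True
        then have "0 \<le> h\<^sup>2 / 2 / (z + h\<^sup>2 / 2)" "h\<^sup>2 / 2 / (z + h\<^sup>2 / 2) \<le> 1"
          by (auto simp: divide_le_eq_1 add_pos_nonneg intro!: divide_nonneg_nonneg)
        from mult_left_le[OF this(2), of "sqrt z * exp (- z)"] this(1) True show ?thesis
          by (simp add: abs_mult del: times_divide_eq_right times_divide_eq_left divide_divide_eq_left)
      qed simp
    qed
  qed auto
  have val: "(\<integral>z. indicator {0<..} z * (sqrt z * exp (- z)) \<partial>lborel) = sqrt pi / 2"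
  proof (rule integral_eq_nn_integral[THEN trans])
    have "(\<integral>\<^sup>+z. ennreal (indicator {0<..} z * (sqrt z * exp (- z))) \<partial>lborel) = (\<integral>\<^sup>+z\<in>{0<..}. ennreal (sqrt z * exp (- (z / 1))) \<partial>lborel)"
      by (intro nn_integral_cong) (auto simp: indicator_def)
    then show "enn2real (\<integral>\<^sup>+z. ennreal (indicator {0<..} z * (sqrt z * exp (- z))) \<partial>lborel) = sqrt pi / 2"
      using nn_integral_sqrt_exp[of 1] by simp
  qed (auto simp: indicator_def)
  have eq: "(\<integral>z. indicator {0<..} z * (sqrt z * exp (- z) * (h\<^sup>2 / 2 / (z + h\<^sup>2 / 2))) \<partial>lborel) = h\<^sup>2 / 2 * (sqrt pi / 2 * exp (h\<^sup>2 / 2) * phi_mass h 1)"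
    if "h \<noteq> 0" for h
  proof (rule integral_eq_nn_integral[THEN trans])
    have "(\<integral>\<^sup>+z. ennreal (indicator {0<..} z * (sqrt z * exp (- z) * (h\<^sup>2 / 2 / (z + h\<^sup>2 / 2)))) \<partial>lborel)
       = (\<integral>\<^sup>+z. ennreal (h\<^sup>2 / 2) * (ennreal (sqrt z * exp (- z) / (z + h\<^sup>2 / 2)) * indicator {0<..} z) \<partial>lborel)"
      by (intro nn_integral_cong) (auto simp: indicator_def ennreal_mult[symmetric] mult_ac)
    also have "\<dots> = ennreal (h\<^sup>2 / 2) * ennreal (sqrt pi / 2 * exp (h\<^sup>2 / 2) * phi_mass h 1)"
      by (subst nn_integral_cmult) (auto simp: phi_mass_repr[OF that])
    finally show "enn2real (\<integral>\<^sup>+z. ennreal (indicator {0<..} z * (sqrt z * exp (- z) * (h\<^sup>2 / 2 / (z + h\<^sup>2 / 2)))) \<partial>lborel) = h\<^sup>2 / 2 * (sqrt pi / 2 * exp (h\<^sup>2 / 2) * phi_mass h 1)"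
      by (simp add: ennreal_mult[symmetric] phi_mass_nonneg)
  qed (auto simp: indicator_def)
  have "((\<lambda>h. h\<^sup>2 / 2 * (sqrt pi / 2 * exp (h\<^sup>2 / 2) * phi_mass h 1)) \<longlongrightarrow> sqrt pi / 2) at_top"
    by (rule Lim_transform_eventually[OF lim[unfolded val]], rule eventually_mono[OF eventually_gt_at_top[of 0]], rule eq) simp
  from tendsto_mult[OF tendsto_const[of "4 / sqrt pi"] this]
  have "((\<lambda>h. h\<^sup>2 * exp (h\<^sup>2 / 2) * phi_mass h 1) \<longlongrightarrow> 2) at_top"
    by (simp add: field_simps)
  then show ?thesis
    by (simp add: filterlim_at_bot_mirror phi_mass_def phi_def)
qed

text \<open>The left side is the mass that the lower bound \<open>occ_lower\<close> assigns to times
  beyond 1; that it equals the mass of \<open>phi y\<close> up to time 1 is what makes the lower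
  bound sharp. In \<open>occ_tail_integral_repr\<close> with
  \<open>x = y\<^sup>2 * (1 - 1 / t)\<close> the quantity \<open>t * (2 * z + x)\<close> is affine
  in \<open>t\<close>, so after Fubini the integral over \<open>t\<close> is elementary, and the
  integral over \<open>z\<close> that remains is that of \<open>phi_mass_repr\<close>.\<close>

lemma occ_phi_mass:
  assumes "y \<noteq> 0"
  shows "(\<integral>\<^sup>+t\<in>{1<..}. ennreal (1 / t * occ_tail (sqrt (y\<^sup>2 * (1 - 1 / t))) * phi y t) \<partial>lborel) = ennreal (phi_mass y 1)"
proof -
  define k where "k = y\<^sup>2"
  have k: "k > 0" using assms by (simp add: k_def)
  define f where "f = (\<lambda>t z::real. exp (- (k / 2)) * 4 * z * exp (- z) / (sqrt (2 * pi) * sqrt (((2 * z + k) * t - k) ^ 3)))"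
  have "(\<integral>\<^sup>+t\<in>{1<..}. ennreal (1 / t * occ_tail (sqrt (k * (1 - 1 / t))) * phi y t) \<partial>lborel)
    = (\<integral>\<^sup>+t. (\<integral>\<^sup>+z. ennreal (f t z) * indicator {0<..} z * indicator {1<..} t \<partial>lborel) \<partial>lborel)"
  proof (intro nn_integral_cong)
    fix t :: real
    show "ennreal (1 / t * occ_tail (sqrt (k * (1 - 1 / t))) * phi y t) * indicator {1<..} t
      = (\<integral>\<^sup>+z. ennreal (f t z) * indicator {0<..} z * indicator {1<..} t \<partial>lborel)"
    proof (cases "t > 1")
      case True
      define x where "x = k * (1 - 1 / t)"
      have x: "x > 0" using True k by (simp add: x_def)
      define C where "C = exp (- (k / 2)) / (sqrt t ^ 3)"
      have C: "C \<ge> 0" using True by (simp add: C_def)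
      have "(\<integral>\<^sup>+z. ennreal (f t z) * indicator {0<..} z \<partial>lborel) = (\<integral>\<^sup>+z. ennreal C * (ennreal (4 * z * exp (- z) / (sqrt (2 * pi) * sqrt ((2 * z + x) ^ 3))) * indicator {0<..} z) \<partial>lborel)"
      proof (intro nn_integral_cong)
        fix z :: real
        have "(2 * z + k) * t - k = t * (2 * z + x)"
          using True by (simp add: x_def algebra_simps)
        then have "f t z = C * (4 * z * exp (- z) / (sqrt (2 * pi) * sqrt ((2 * z + x) ^ 3)))"
          by (simp add: f_def C_def power_mult_distrib real_sqrt_mult real_sqrt_power mult_ac)
        then show "ennreal (f t z) * indicator {0<..} z = ennreal C * (ennreal (4 * z * exp (- z) / (sqrt (2 * pi) * sqrt ((2 * z + x) ^ 3))) * indicator {0<..} z)"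
          using C x by (auto simp: ennreal_mult'[symmetric] indicator_def)
      qed
      also have "\<dots> = ennreal C * ennreal (exp (x / 2) * occ_tail (sqrt x))"
        by (subst nn_integral_cmult) (auto simp: occ_tail_integral_repr[OF x])
      also have "\<dots> = ennreal (C * (exp (x / 2) * occ_tail (sqrt x)))"
        using C by (simp add: ennreal_mult')
      also have "C * (exp (x / 2) * occ_tail (sqrt x)) = 1 / t * occ_tail (sqrt x) * phi y t"
      proof -
        have "exp (- (k / 2)) * exp (x / 2) = exp (- (k / (2 * t)))"
          using True by (simp add: x_def exp_add[symmetric] field_simps)
        moreover have "sqrt t ^ 3 = t * sqrt t" using True by (simp add: power3_eq_cube)
        ultimately show ?thesis by (simp add: C_def phi_def k_def field_simps)
      qed
      finally show ?thesis using True by (simp add: x_def)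
    qed simp
  qed
  also have "\<dots> = (\<integral>\<^sup>+z. (\<integral>\<^sup>+t. ennreal (f t z) * indicator {0<..} z * indicator {1<..} t \<partial>lborel) \<partial>lborel)"
    unfolding f_def by (rule lborel_pair.Fubini') measurable
  also have "\<dots> = (\<integral>\<^sup>+z. ennreal (exp (- (k / 2)) * (2 / sqrt pi)) * (ennreal (sqrt z * exp (- z) / (z + k / 2)) * indicator {0<..} z) \<partial>lborel)"
  proof (intro nn_integral_cong)
    fix z :: real
    show "(\<integral>\<^sup>+t. ennreal (f t z) * indicator {0<..} z * indicator {1<..} t \<partial>lborel)
        = ennreal (exp (- (k / 2)) * (2 / sqrt pi)) * (ennreal (sqrt z * exp (- z) / (z + k / 2)) * indicator {0<..} z)"
    proof (cases "z > 0")
      case z: True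
      define C where "C = exp (- (k / 2)) * 4 * z * exp (- z) / sqrt (2 * pi)"
      have C: "C \<ge> 0" using z by (simp add: C_def)
      define c where "c = 2 * z + k"
      have c: "c > 0" "c > k" using z k by (auto simp: c_def)
      have pos: "c * t - k > 0" if "t \<ge> 1" for t
        using that c by (smt (verit) mult_left_le mult_le_cancel_left1)
      have "(\<integral>\<^sup>+t\<in>{1<..}. ennreal (1 / sqrt ((c * t - k) ^ 3)) \<partial>lborel) = ennreal (0 - - 2 / (c * sqrt (c * 1 - k)))"
      proof (rule nn_integral_FTC_Ioi)
        fix t :: real assume t: "1 < t"
        define w where "w = sqrt (c * t - k)"
        have w: "w > 0" using pos[of t] t by (simp add: w_def)
        have d: "((\<lambda>t. sqrt (c * t - k)) has_real_derivative c / (2 * w)) (at t)"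
          using pos[of t] t unfolding w_def by (auto intro!: derivative_eq_intros simp: field_simps)
        have "((\<lambda>t. - 2 / (c * sqrt (c * t - k))) has_real_derivative (2 * (c * (c / (2 * w)))) / (c * w * (c * w))) (at t)"
          unfolding w_def[symmetric]
          by (rule derivative_eq_intros d refl | (use w c in \<open>simp add: w_def; fail\<close>))+ (use w c in \<open>simp add: w_def field_simps\<close>)
        also have "(2 * (c * (c / (2 * w)))) / (c * w * (c * w)) = 1 / sqrt ((c * t - k) ^ 3)"
        proof -
          have "sqrt ((c * t - k) ^ 3) = w ^ 3" by (simp add: w_def real_sqrt_power)
          then show ?thesis using w c by (simp add: power3_eq_cube)
        qed
        finally show "((\<lambda>t. - 2 / (c * sqrt (c * t - k))) has_real_derivative 1 / sqrt ((c * t - k) ^ 3)) (at t)" .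
        show "isCont (\<lambda>t. 1 / sqrt ((c * t - k) ^ 3)) t"
          using pos[of t] t by (intro continuous_intros) auto
        show "0 \<le> 1 / sqrt ((c * t - k) ^ 3)" using pos[of t] t by simp
      next
        have "((\<lambda>t. - 2 / (c * sqrt (c * t - k))) \<longlongrightarrow> - 2 / (c * sqrt (c * 1 - k))) (at 1)"
          using pos[of 1] c by (intro tendsto_intros) auto
        then show "((\<lambda>t. - 2 / (c * sqrt (c * t - k))) \<longlongrightarrow> - 2 / (c * sqrt (c * 1 - k))) (at_right 1)"
          by (simp add: filterlim_at_split)
        show "((\<lambda>t. - 2 / (c * sqrt (c * t - k))) \<longlongrightarrow> 0) at_top"
          using c by real_asymp
      qed
      then have i: "(\<integral>\<^sup>+t\<in>{1<..}. ennreal (1 / sqrt ((c * t - k) ^ 3)) \<partial>lborel) = ennreal (2 / (c * sqrt (2 * z)))"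
        by (simp add: c_def)
      have "(\<integral>\<^sup>+t. ennreal (f t z) * indicator {0<..} z * indicator {1<..} t \<partial>lborel) = (\<integral>\<^sup>+t. ennreal C * (ennreal (1 / sqrt ((c * t - k) ^ 3)) * indicator {1<..} t) \<partial>lborel)"
        using z C by (intro nn_integral_cong) (auto simp: f_def C_def c_def ennreal_mult'[symmetric] indicator_def)
      also have "\<dots> = ennreal C * ennreal (2 / (c * sqrt (2 * z)))"
        by (subst nn_integral_cmult) (auto simp: i)
      also have "\<dots> = ennreal (C * (2 / (c * sqrt (2 * z))))"
        using C c by (subst ennreal_mult') auto
      also have "C * (2 / (c * sqrt (2 * z))) = exp (- (k / 2)) * (2 / sqrt pi) * (sqrt z * exp (- z) / (z + k / 2))"
      proof -
        define a d where "a = sqrt z" and "d = z + k / 2"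
        have a: "a > 0" "z = a * a" and d: "d > 0" "c = 2 * d"
          using z k by (auto simp: a_def d_def c_def)
        have "E * 4 * (a * a) * e / (sqrt 2 * sqrt pi) * (2 / (2 * d * (sqrt 2 * a))) = E * (2 / sqrt pi) * (a * e / d)" for E e
          using a(1) d(1) by (simp add: field_simps)
        from this[of "exp (- (k / 2))" "exp (- z)"] show ?thesis
          unfolding C_def d(2) real_sqrt_mult a_def[symmetric] d_def[symmetric] by (simp add: a(2)[symmetric])
      qed
      finally show ?thesis using z by (simp add: ennreal_mult'[symmetric])
    qed simp
  qed
  also have "\<dots> = ennreal (exp (- (k / 2)) * (2 / sqrt pi)) * ennreal (sqrt pi / 2 * exp (k / 2) * phi_mass y 1)"
    using phi_mass_repr[OF assms] by (subst nn_integral_cmult) (auto simp: k_def)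
  also have "\<dots> = ennreal (phi_mass y 1)"
    by (simp add: ennreal_mult'[symmetric] exp_minus field_simps)
  finally show ?thesis by (simp add: k_def)
qed

text \<open>The value at \<open>- s\<close> of the distribution function that the theorem states for
  the limit of \<open>y\<^sup>2 * (1 - g)\<close>.\<close>

definition g_tail :: "real \<Rightarrow> real" where
  "g_tail s = (LINT z:{0<..}|lborel. 2 * z / sqrt (2 * pi * (2 * z + s)) * exp (- z))"

lemma g_tail_integrable:
  assumes "s \<ge> 0"
  shows "set_integrable lborel {0<..} (\<lambda>z. 2 * z / sqrt (2 * pi * (2 * z + s)) * exp (- z))"
    and "ennreal (g_tail s) = (\<integral>\<^sup>+z\<in>{0<..}. ennreal (2 * z / sqrt (2 * pi * (2 * z + s)) * exp (- z)) \<partial>lborel)"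
proof -
  have "integrable lborel (\<lambda>z. indicator {0<..} z * (2 * z / sqrt (2 * pi * (2 * z + s)) * exp (- z)))"
  proof (rule integrableI_nonneg)
    have "(\<integral>\<^sup>+z. ennreal (indicator {0<..} z * (2 * z / sqrt (2 * pi * (2 * z + s)) * exp (- z))) \<partial>lborel) \<le> (\<integral>\<^sup>+z\<in>{0<..}. ennreal (sqrt z * exp (- (z / 1))) \<partial>lborel)"
    proof (intro nn_integral_mono)
      fix z :: real
      have "2 * z / sqrt (2 * pi * (2 * z + s)) * exp (- z) \<le> sqrt z * exp (- z)" if "z > 0"
      proof (rule mult_right_mono)
        have "2 * z / sqrt (2 * pi * (2 * z + s)) \<le> 2 * z / sqrt (4 * z)"
        proof (intro divide_left_mono)
          have "2 * z * 1 \<le> (2 * z + s) * pi"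
            using that assms pi_gt3 by (intro mult_mono) auto
          then show "sqrt (4 * z) \<le> sqrt (2 * pi * (2 * z + s))"
            by (simp add: algebra_simps)
        qed (use that assms in \<open>auto intro!: mult_pos_pos add_pos_nonneg\<close>)
        also have "\<dots> = sqrt z" using that by (simp add: real_sqrt_mult real_div_sqrt)
        finally show "2 * z / sqrt (2 * pi * (2 * z + s)) \<le> sqrt z" .
      qed simp
      then show "ennreal (indicator {0<..} z * (2 * z / sqrt (2 * pi * (2 * z + s)) * exp (- z))) \<le> ennreal (sqrt z * exp (- (z / 1))) * indicator {0<..} z"
        by (auto simp: indicator_def intro!: ennreal_leI mult_right_mono)
    qed
    also have "\<dots> < \<infinity>" using nn_integral_sqrt_exp[of 1] by simp
    finally show "(\<integral>\<^sup>+z. ennreal (indicator {0<..} z * (2 * z / sqrt (2 * pi * (2 * z + s)) * exp (- z))) \<partial>lborel) < \<infinity>" .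
  qed (use assms in \<open>auto simp: indicator_def\<close>)
  then show i: "set_integrable lborel {0<..} (\<lambda>z. 2 * z / sqrt (2 * pi * (2 * z + s)) * exp (- z))"
    by (simp add: set_integrable_def)
  show "ennreal (g_tail s) = (\<integral>\<^sup>+z\<in>{0<..}. ennreal (2 * z / sqrt (2 * pi * (2 * z + s)) * exp (- z)) \<partial>lborel)"
    unfolding g_tail_def set_lebesgue_integral_def
    by (subst nn_integral_eq_integral[symmetric])
      (use i assms in \<open>auto simp: set_integrable_def indicator_def intro!: nn_integral_cong\<close>)
qed

lemma g_tail_nonneg: "0 \<le> s \<Longrightarrow> 0 \<le> g_tail s"
  unfolding g_tail_def set_lebesgue_integral_def
  by (rule integral_nonneg_AE) (auto simp: indicator_def)

lemma g_tail_0: "g_tail 0 = 1 / 2"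
proof -
  have "ennreal (g_tail 0) = (\<integral>\<^sup>+z. ennreal (1 / sqrt pi) * (ennreal (sqrt z * exp (- (z / 1))) * indicator {0<..} z) \<partial>lborel)"
    unfolding g_tail_integrable(2)[OF order_refl]
    by (intro nn_integral_cong) (auto simp: indicator_def ennreal_mult'[symmetric] real_sqrt_mult real_div_sqrt field_simps)
  also have "\<dots> = ennreal (1 / sqrt pi) * ennreal (sqrt pi / 2)"
    using nn_integral_sqrt_exp[of 1] by (subst nn_integral_cmult) auto
  also have "\<dots> = ennreal (1 / 2)"
    by (simp add: ennreal_mult'[symmetric])
  finally show ?thesis by (subst (asm) ennreal_inj) (auto simp: g_tail_nonneg)
qed

text \<open>The integrand is the limit of the rescaled density of \<open>g\<close> beyond 1, found
  in \<open>g_tail_limit\<close>; here its tail is matched with the integral of the theorem. After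
  \<open>occ_tail_integral_repr\<close> and Fubini, the power \<open>- 3 / 2\<close> of
  \<open>2 * z + x\<close> is integrated over \<open>x > s\<close>, which leaves
  \<open>2 / sqrt (2 * z + s)\<close>.\<close>

lemma occ_tail_g_tail:
  assumes "s \<ge> 0"
  shows "(\<integral>\<^sup>+x\<in>{s<..}. ennreal (exp (x / 2) * occ_tail (sqrt x) / 4) \<partial>lborel) = ennreal (g_tail s)"
proof -
  have "(\<integral>\<^sup>+x\<in>{s<..}. ennreal (exp (x / 2) * occ_tail (sqrt x) / 4) \<partial>lborel)
     = (\<integral>\<^sup>+x. (\<integral>\<^sup>+z. ennreal (z * exp (- z) / (sqrt (2 * pi) * sqrt ((2 * z + x) ^ 3))) * indicator {0<..} z * indicator {s<..} x \<partial>lborel) \<partial>lborel)"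
  proof (intro nn_integral_cong)
    fix x :: real
    show "ennreal (exp (x / 2) * occ_tail (sqrt x) / 4) * indicator {s<..} x = (\<integral>\<^sup>+z. ennreal (z * exp (- z) / (sqrt (2 * pi) * sqrt ((2 * z + x) ^ 3))) * indicator {0<..} z * indicator {s<..} x \<partial>lborel)"
    proof (cases "x > s")
      case True
      then have x: "x > 0" using assms by simp
      have "(\<integral>\<^sup>+z. ennreal (z * exp (- z) / (sqrt (2 * pi) * sqrt ((2 * z + x) ^ 3))) * indicator {0<..} z \<partial>lborel)
         = (\<integral>\<^sup>+z. ennreal (1/4) * (ennreal (4 * z * exp (- z) / (sqrt (2 * pi) * sqrt ((2 * z + x) ^ 3))) * indicator {0<..} z) \<partial>lborel)"
        by (intro nn_integral_cong) (auto simp: ennreal_mult'[symmetric] indicator_def)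
      also have "\<dots> = ennreal (1/4) * ennreal (exp (x / 2) * occ_tail (sqrt x))"
        by (subst nn_integral_cmult) (auto simp: occ_tail_integral_repr[OF x])
      finally show ?thesis using True by (simp add: ennreal_mult'[symmetric])
    qed simp
  qed
  also have "\<dots> = (\<integral>\<^sup>+z. (\<integral>\<^sup>+x. ennreal (z * exp (- z) / (sqrt (2 * pi) * sqrt ((2 * z + x) ^ 3))) * indicator {0<..} z * indicator {s<..} x \<partial>lborel) \<partial>lborel)"
    by (rule lborel_pair.Fubini') measurable
  also have "\<dots> = (\<integral>\<^sup>+z\<in>{0<..}. ennreal (2 * z / sqrt (2 * pi * (2 * z + s)) * exp (- z)) \<partial>lborel)"
  proof (intro nn_integral_cong)
    fix z :: real
    show "(\<integral>\<^sup>+x. ennreal (z * exp (- z) / (sqrt (2 * pi) * sqrt ((2 * z + x) ^ 3))) * indicator {0<..} z * indicator {s<..} x \<partial>lborel)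
      = ennreal (2 * z / sqrt (2 * pi * (2 * z + s)) * exp (- z)) * indicator {0<..} z"
    proof (cases "z > 0")
      case z: True
      have "(\<integral>\<^sup>+x\<in>{s<..}. ennreal (1 / sqrt ((2 * z + x) ^ 3)) \<partial>lborel) = ennreal (0 - - 2 / sqrt (2 * z + s))"
      proof (rule nn_integral_FTC_Ioi)
        fix x :: real assume x: "s < x"
        define w where "w = sqrt (2 * z + x)"
        have w: "w > 0" using x z assms by (simp add: w_def)
        have d: "((\<lambda>x. sqrt (2 * z + x)) has_real_derivative 1 / (2 * w)) (at x)"
          using x z assms unfolding w_def by (auto intro!: derivative_eq_intros simp: field_simps)
        have "((\<lambda>x. - 2 / sqrt (2 * z + x)) has_real_derivative (2 * (1 / (2 * w))) / (w * w)) (at x)"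
          unfolding w_def[symmetric]
          by (rule derivative_eq_intros d refl | (use w in \<open>simp add: w_def; fail\<close>))+ (use w in \<open>simp add: w_def field_simps\<close>)
        also have "(2 * (1 / (2 * w))) / (w * w) = 1 / sqrt ((2 * z + x) ^ 3)"
        proof -
          have "sqrt ((2 * z + x) ^ 3) = w ^ 3" by (simp add: w_def real_sqrt_power)
          then show ?thesis using w by (simp add: power3_eq_cube)
        qed
        finally show "((\<lambda>x. - 2 / sqrt (2 * z + x)) has_real_derivative 1 / sqrt ((2 * z + x) ^ 3)) (at x)" .
        show "isCont (\<lambda>x. 1 / sqrt ((2 * z + x) ^ 3)) x"
          using x z assms by (intro continuous_intros) auto
        show "0 \<le> 1 / sqrt ((2 * z + x) ^ 3)" using x z assms by simp
      next
        have "((\<lambda>x. - 2 / sqrt (2 * z + x)) \<longlongrightarrow> - 2 / sqrt (2 * z + s)) (at s)"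
          using z assms by (intro tendsto_intros) auto
        then show "((\<lambda>x. - 2 / sqrt (2 * z + x)) \<longlongrightarrow> - 2 / sqrt (2 * z + s)) (at_right s)"
          by (simp add: filterlim_at_split)
        show "((\<lambda>x. - 2 / sqrt (2 * z + x)) \<longlongrightarrow> 0) at_top"
          by real_asymp
      qed
      then have i: "(\<integral>\<^sup>+x\<in>{s<..}. ennreal (1 / sqrt ((2 * z + x) ^ 3)) \<partial>lborel) = ennreal (2 / sqrt (2 * z + s))"
        by simp
      have "(\<integral>\<^sup>+x. ennreal (z * exp (- z) / (sqrt (2 * pi) * sqrt ((2 * z + x) ^ 3))) * indicator {0<..} z * indicator {s<..} x \<partial>lborel)
        = (\<integral>\<^sup>+x. ennreal (z * exp (- z) / sqrt (2 * pi)) * (ennreal (1 / sqrt ((2 * z + x) ^ 3)) * indicator {s<..} x) \<partial>lborel)"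
        using z by (intro nn_integral_cong) (auto simp: ennreal_mult'[symmetric] indicator_def)
      also have "\<dots> = ennreal (z * exp (- z) / sqrt (2 * pi)) * ennreal (2 / sqrt (2 * z + s))"
        by (subst nn_integral_cmult) (auto simp: i)
      also have "\<dots> = ennreal (2 * z / sqrt (2 * pi * (2 * z + s)) * exp (- z))"
        using z by (subst ennreal_mult'[symmetric])
          (auto simp: real_sqrt_mult intro!: arg_cong[where f=ennreal])
      finally show ?thesis using z by simp
    qed simp
  qed
  finally show ?thesis by (simp add: g_tail_integrable(2)[OF assms])
qed

section \<open>Cyclic shifts of Gaussian walk bridges\<close>

definition gauss_seq :: "(nat \<Rightarrow> real) measure" where
  "gauss_seq = PiM UNIV (\<lambda>_. std_gauss)"

lemma sets_gauss_seq [measurable_cong, simp]: "sets gauss_seq = sets (PiM UNIV (\<lambda>_. borel))"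
  unfolding gauss_seq_def by (intro sets_PiM_cong) auto

lemma space_gauss_seq [simp]: "space gauss_seq = UNIV"
  by (simp add: gauss_seq_def space_PiM)

lemma prob_space_gauss_seq: "prob_space gauss_seq"
  unfolding gauss_seq_def by (intro prob_space_PiM prob_space_std_gauss)

interpretation gauss_seq: prob_space gauss_seq
  by (rule prob_space_gauss_seq)

lemma measurable_gauss_seq_coord [measurable]: "(\<lambda>x. x i) \<in> borel_measurable gauss_seq"
  by (simp add: measurable_cong_sets[OF sets_gauss_seq refl] measurable_component_singleton)

lemma distr_gauss_seq_coord: "distr gauss_seq borel (\<lambda>x. x i) = std_gauss"
proof -
  have "distr gauss_seq borel (\<lambda>x. x i) = distr gauss_seq std_gauss (\<lambda>x. x i)"
    by (rule distr_cong) auto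
  then show ?thesis
    unfolding gauss_seq_def using distr_PiM_component[of UNIV "\<lambda>_. std_gauss" i] prob_space_std_gauss by simp
qed

lemma indep_vars_gauss_seq: "gauss_seq.indep_vars (\<lambda>_. borel) (\<lambda>i x. x i) I"
proof (rule gauss_seq.indep_vars_subset)
  have "distr gauss_seq (\<Pi>\<^sub>M i\<in>UNIV. borel) (\<lambda>x. \<lambda>i\<in>UNIV. x i) = distr gauss_seq gauss_seq (\<lambda>x. x)"
    by (rule distr_cong) (auto simp: restrict_def)
  also have "\<dots> = (\<Pi>\<^sub>M i\<in>UNIV. distr gauss_seq borel (\<lambda>x. x i))"
    unfolding distr_gauss_seq_coord by (simp add: gauss_seq_def)
  finally show "gauss_seq.indep_vars (\<lambda>_. borel) (\<lambda>i x. x i) UNIV"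
    by (subst gauss_seq.indep_vars_iff_distr_eq_PiM) auto
qed simp

lemma gauss_seq_reindex:
  assumes "inj f"
  shows "distr gauss_seq gauss_seq (\<lambda>x n. x (f n)) = gauss_seq"
  using distr_PiM_reindex[of UNIV "\<lambda>_. std_gauss" f UNIV] assms prob_space_std_gauss
  by (simp add: gauss_seq_def restrict_def)

lemma measurable_reindex: "(\<lambda>x n. x (f n)) \<in> measurable gauss_seq gauss_seq"
  by (subst measurable_cong_sets[OF refl sets_gauss_seq]) (rule measurable_PiM_single', auto)

definition loop :: "nat \<Rightarrow> (nat \<Rightarrow> real) \<Rightarrow> nat \<Rightarrow> real" where
  "loop n u i = (\<Sum>l<i. u l) - real i / real n * (\<Sum>l<n. u l)"

text \<open>For independent standard normal steps this has the law of a Brownian bridge of unit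
  length from \<open>c\<close> to 0 at the times \<open>j / m\<close>.\<close>

definition walk_bridge :: "nat \<Rightarrow> real \<Rightarrow> (nat \<Rightarrow> real) \<Rightarrow> nat \<Rightarrow> real" where
  "walk_bridge m c x j = c * (1 - real j / real m) + loop m x j / sqrt (real m)"

definition neg_count :: "nat \<Rightarrow> real \<Rightarrow> (nat \<Rightarrow> real) \<Rightarrow> nat" where
  "neg_count m c x = card {j. j < m \<and> walk_bridge m c x j < 0}"

definition hits_at :: "nat \<Rightarrow> real \<Rightarrow> nat \<Rightarrow> (nat \<Rightarrow> real) set" where
  "hits_at m c k = {x. (\<forall>j<k. walk_bridge m c x j < 0) \<and> 0 \<le> walk_bridge m c x k}"

lemma loop_0 [simp]: "loop n u 0 = 0"
  by (simp add: loop_def)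

lemma loop_n [simp]: "n > 0 \<Longrightarrow> loop n u n = 0"
  by (simp add: loop_def)

lemma walk_bridge_0 [simp]: "walk_bridge m c x 0 = c"
  by (simp add: walk_bridge_def)

lemma measurable_loop [measurable]: "(\<lambda>x. loop n x j) \<in> borel_measurable gauss_seq"
  unfolding loop_def by measurable

lemma measurable_walk_bridge [measurable]: "(\<lambda>x. walk_bridge m c x j) \<in> borel_measurable gauss_seq"
  unfolding walk_bridge_def by measurable

lemma sets_hits_at [measurable]: "hits_at m c k \<in> sets gauss_seq"
proof -
  have "{x\<in>space gauss_seq. (\<forall>j<k. walk_bridge m c x j < 0) \<and> 0 \<le> walk_bridge m c x k} \<in> sets gauss_seq"
    by measurable
  then show ?thesis by (simp add: hits_at_def)
qed

lemma card_measurable_aux: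
  fixes m :: nat
  assumes "\<And>j. j < m \<Longrightarrow> Measurable.pred M (P j)"
  shows "(\<lambda>x. card {j. j < m \<and> P j x}) \<in> measurable M (count_space UNIV)"
proof -
  have "(\<lambda>x. card {j. j < m \<and> P j x}) = (\<lambda>x. \<Sum>j<m. if P j x then 1 else 0)"
  proof
    fix x
    have "{j. j < m \<and> P j x} = {..<m} \<inter> {j. P j x}" by auto
    then have "card {j. j < m \<and> P j x} = (\<Sum>j\<in>{..<m} \<inter> {j. P j x}. 1)" by simp
    also have "\<dots> = (\<Sum>j<m. if j \<in> {j. P j x} then 1 else 0)"
      by (rule sum.inter_restrict) simp
    finally show "card {j. j < m \<and> P j x} = (\<Sum>j<m. if P j x then 1 else 0)" by simp
  qed
  moreover have "(\<lambda>x. \<Sum>j<m. if P j x then 1 else 0 :: nat) \<in> measurable M (count_space UNIV)"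
    using assms by (induction m) auto
  ultimately show ?thesis by simp
qed

lemma measurable_neg_count [measurable]: "neg_count m c \<in> measurable gauss_seq (count_space UNIV)"
  unfolding neg_count_def[abs_def] by (rule card_measurable_aux) measurable

lemma hits_at_disjoint: "disjoint_family (hits_at m c)"
  unfolding disjoint_family_on_def hits_at_def
  by (auto, metis linorder_neqE_nat not_le)

lemma ex_hits_at:
  assumes "0 \<le> walk_bridge m c x j"
  shows "\<exists>k\<le>j. x \<in> hits_at m c k"
proof -
  define k where "k = (LEAST k. 0 \<le> walk_bridge m c x k)"
  have "0 \<le> walk_bridge m c x k" unfolding k_def by (rule LeastI[of "\<lambda>k. 0 \<le> walk_bridge m c x k", OF assms])
  moreover have "walk_bridge m c x i < 0" if "i < k" for i
    using not_less_Least[of i "\<lambda>k. 0 \<le> walk_bridge m c x k"] that unfolding k_def by auto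
  moreover have "k \<le> j" unfolding k_def by (rule Least_le) (rule assms)
  ultimately show ?thesis by (auto simp: hits_at_def)
qed

section \<open>Cyclic shifts of a closed path and ranks of its points\<close>

lemma mod_shift_inverse:
  fixes a n x :: nat
  assumes "a < n" "x < n"
  shows "((x + a) mod n + (n - a)) mod n = x" "((x + (n - a)) mod n + a) mod n = x"
proof -
  have "((x + a) mod n + (n - a)) mod n = (x + a + (n - a)) mod n"
    "((x + (n - a)) mod n + a) mod n = (x + (n - a) + a) mod n"
    by (rule mod_add_left_eq)+
  then show "((x + a) mod n + (n - a)) mod n = x" "((x + (n - a)) mod n + a) mod n = x"
    using assms by simp_all
qed

text \<open>A loop closes up, so it can be read as a periodic path. Rotating the steps keeps their
  sum and hence the slope of the chord, and it only shows the same path from its point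
  \<open>a\<close>.\<close>

lemma loop_cyclic_shift:
  assumes "a < n" "i \<le> n"
  shows "loop n (\<lambda>l. u ((l + a) mod n)) i = loop n u ((i + a) mod n) - loop n u a"
  using assms(2)
proof (induction i)
  case 0
  then show ?case using assms by simp
next
  case (Suc i)
  have n: "n > 0" using assms by simp
  have "bij_betw (\<lambda>l. (l + a) mod n) {..<n} {..<n}"
  proof (rule bij_betwI[where g="\<lambda>l. (l + (n - a)) mod n"])
    show "((x + a) mod n + (n - a)) mod n = x" if "x \<in> {..<n}" for x
      using that assms(1) mod_shift_inverse by simp
    show "((x + (n - a)) mod n + a) mod n = x" if "x \<in> {..<n}" for x
      using that assms(1) mod_shift_inverse by simp
  qed (use n in auto)
  then have s: "(\<Sum>l<n. u ((l + a) mod n)) = (\<Sum>l<n. u l)"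
    by (rule sum.reindex_bij_betw)
  have step: "loop n v (Suc k) = loop n v k + v k - (\<Sum>l<n. v l) / n" for v k
    by (simp add: loop_def add_divide_distrib algebra_simps)
  \<comment> \<open>When the index wraps around, the two sides evaluate the loop at 0 and at
    \<open>n\<close>, and both values are 0.\<close>
  have "loop n u ((Suc i + a) mod n) = loop n u (Suc ((i + a) mod n))"
    using n by (simp add: mod_Suc)
  then show ?case using Suc by (simp add: step s)
qed

text \<open>Among the points of rank above \<open>l\<close> take one of smallest value. All points
  strictly below it have rank at most \<open>l\<close>, and there are more than \<open>l\<close> of
  them. The comparison in the rank is strict, so ties only lower ranks and do no harm.\<close>

lemma card_rank_le:
  fixes v :: "nat \<Rightarrow> real"
  assumes "l < n"
  shows "Suc l \<le> card {a. a < n \<and> card {j. j < n \<and> v j < v a} \<le> l}"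
proof (cases "{a. a < n \<and> card {j. j < n \<and> v j < v a} \<le> l} = {..<n}")
  case True
  then show ?thesis using assms by simp
next
  case False
  define B where "B = {a. a < n \<and> \<not> card {j. j < n \<and> v j < v a} \<le> l}"
  have B: "finite B" "B \<noteq> {}" using False by (auto simp: B_def)
  obtain a where a: "a \<in> B" "\<And>b. b \<in> B \<Longrightarrow> v a \<le> v b"
    using ex_min_if_finite[of "v ` B"] B by (metis (mono_tags, lifting) arg_min_if_finite(1) arg_min_least)
  have "{j. j < n \<and> v j < v a} \<subseteq> {a. a < n \<and> card {j. j < n \<and> v j < v a} \<le> l}"
    using a(2) by (auto simp: B_def) (meson not_le)
  then have "card {j. j < n \<and> v j < v a} \<le> card {a. a < n \<and> card {j. j < n \<and> v j < v a} \<le> l}"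
    by (intro card_mono) auto
  then show ?thesis using a(1) by (simp add: B_def)
qed

definition block_shift :: "nat \<Rightarrow> nat \<Rightarrow> nat \<Rightarrow> nat \<Rightarrow> nat" where
  "block_shift k n a l = (if k \<le> l \<and> l < k + n then k + (l - k + a) mod n else l)"

lemma inj_block_shift:
  assumes "a < n"
  shows "inj (block_shift k n a)"
proof (rule inj_on_inverseI[where g="block_shift k n (n - a)"])
  fix l
  show "block_shift k n (n - a) (block_shift k n a l) = l"
  proof (cases "k \<le> l \<and> l < k + n")
    case True
    have "((l - k + a) mod n + (n - a)) mod n = l - k"
      using True assms by (intro mod_shift_inverse) auto
    then show ?thesis using True assms by (simp add: block_shift_def)
  qed (auto simp: block_shift_def)
qed

lemma sum_block_shift:
  assumes "a < n"
  shows "(\<Sum>l<k + n. x (block_shift k n a l)) = (\<Sum>l<k + n. x l)"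
proof (rule sum.reindex_bij_betw)
  have "inj_on (block_shift k n a) {..<k + n}"
    using inj_block_shift[OF assms] by (rule inj_on_subset) simp
  moreover have "block_shift k n a ` {..<k + n} \<subseteq> {..<k + n}"
    using assms by (auto simp: block_shift_def)
  ultimately show "bij_betw (block_shift k n a) {..<k + n} {..<k + n}"
    by (simp add: bij_betw_def endo_inj_surj)
qed

lemma walk_bridge_block_shift:
  assumes "a < n" "j \<le> k"
  shows "walk_bridge (k + n) c (\<lambda>l. x (block_shift k n a l)) j = walk_bridge (k + n) c x j"
proof -
  have "(\<Sum>l<j. x (block_shift k n a l)) = (\<Sum>l<j. x l)"
    using assms by (intro sum.cong) (auto simp: block_shift_def)
  then show ?thesis
    unfolding walk_bridge_def loop_def sum_block_shift[OF assms(1)] by (simp only:)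
qed

text \<open>From time \<open>k\<close> on, the bridge is the chord from its current height to 0 plus
  a loop that is formed by the later steps alone.\<close>

lemma walk_bridge_split:
  assumes "n > 0" "i \<le> n"
  shows "walk_bridge (k + n) c x (k + i)
    = (1 - real i / real n) * walk_bridge (k + n) c x k + loop n (\<lambda>l. x (k + l)) i / sqrt (real (k + n))"
proof -
  have split: "(\<Sum>l<k + j. x l) = (\<Sum>l<k. x l) + (\<Sum>l<j. x (k + l))" for j
    by (induction j) simp_all
  define A B C q where "A = (\<Sum>l<k. x l)" and "B = (\<Sum>l<n. x (k + l))" and "C = (\<Sum>l<i. x (k + l))"
    and "q = sqrt (real (k + n))"
  have q: "q \<noteq> 0" using assms by (simp add: q_def)
  have kn: "real k + real n \<noteq> 0" "real n \<noteq> 0" using assms by auto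
  have "c * (1 - (real k + real i) / (real k + real n)) + (A + C - (real k + real i) / (real k + real n) * (A + B)) / q
     = (1 - real i / real n) * (c * (1 - real k / (real k + real n)) + (A - real k / (real k + real n) * (A + B)) / q)
      + (C - real i / real n * B) / q"
    using q kn by (simp add: divide_simps) (simp add: algebra_simps)
  then show ?thesis
    unfolding walk_bridge_def loop_def split A_def B_def C_def q_def by simp
qed

text \<open>After the passage the chord is nonnegative, so the bridge can be negative only where the
  loop of the later steps is. The \<open>k\<close> earlier points are all counted.\<close>

lemma neg_count_le_on_hits_at:
  assumes "n > 0" "x \<in> hits_at (k + n) c k"
  shows "neg_count (k + n) c x \<le> k + card {i. i < n \<and> loop n (\<lambda>l. x (k + l)) i < 0}"
proof -
  have "{j. j < k + n \<and> walk_bridge (k + n) c x j < 0} \<subseteq> {..<k} \<union> (\<lambda>i. k + i) ` {i. i < n \<and> loop n (\<lambda>l. x (k + l)) i < 0}"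
  proof
    fix j assume "j \<in> {j. j < k + n \<and> walk_bridge (k + n) c x j < 0}"
    then have j: "j < k + n" "walk_bridge (k + n) c x j < 0" by auto
    show "j \<in> {..<k} \<union> (\<lambda>i. k + i) ` {i. i < n \<and> loop n (\<lambda>l. x (k + l)) i < 0}"
    proof (cases "j < k")
      case False
      define i where "i = j - k"
      have i: "j = k + i" "i < n" using False j by (auto simp: i_def)
      have "0 \<le> (1 - real i / real n) * walk_bridge (k + n) c x k"
        using assms i by (intro mult_nonneg_nonneg) (auto simp: hits_at_def)
      then have "loop n (\<lambda>l. x (k + l)) i / sqrt (real (k + n)) < 0"
        using j(2) walk_bridge_split[of n i k c x] i assms by simp
      then have "loop n (\<lambda>l. x (k + l)) i < 0"
        using assms by (simp add: divide_less_0_iff)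
      then show ?thesis using i by auto
    qed simp
  qed
  then have "neg_count (k + n) c x \<le> card ({..<k} \<union> (\<lambda>i. k + i) ` {i. i < n \<and> loop n (\<lambda>l. x (k + l)) i < 0})"
    unfolding neg_count_def by (intro card_mono) auto
  also have "\<dots> \<le> card {..<k} + card ((\<lambda>i. k + i) ` {i. i < n \<and> loop n (\<lambda>l. x (k + l)) i < 0})"
    by (rule card_Un_le)
  also have "card ((\<lambda>i. k + i) ` {i. i < n \<and> loop n (\<lambda>l. x (k + l)) i < 0}) = card {i. i < n \<and> loop n (\<lambda>l. x (k + l)) i < 0}"
    by (intro card_image) simp
  finally show ?thesis by simp
qed

text \<open>A cyclic shift of the steps after time \<open>k\<close> preserves the law, the path up to time \<open>k\<close> and the end
  point, and it turns the number of negative points of the loop into the rank of a point of the loop.\<close>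

lemma prob_hits_at_neg_count_le:
  assumes "l < n"
  shows "(real l + 1) / real n * measure gauss_seq (hits_at (k + n) c k)
    \<le> measure gauss_seq {x \<in> hits_at (k + n) c k. neg_count (k + n) c x \<le> k + l}"
proof -
  define E where "E = hits_at (k + n) c k"
  define L where "L = (\<lambda>x. card {i. i < n \<and> loop n (\<lambda>l. x (k + l)) i < 0})"
  have n: "n > 0" using assms by simp
  have [measurable]: "(\<lambda>x. loop n (\<lambda>l. x (k + l)) i) \<in> borel_measurable gauss_seq" for i
    unfolding loop_def by measurable
  have [measurable]: "L \<in> measurable gauss_seq (count_space UNIV)"
    unfolding L_def by (rule card_measurable_aux) measurable
  have [measurable]: "E \<in> sets gauss_seq" unfolding E_def by measurable
  have int: "integrable gauss_seq (\<lambda>x. indicator A x :: real)" if "A \<in> sets gauss_seq" for A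
    using that by (intro integrable_real_indicator) (auto simp: less_top[symmetric])
  define F where "F = (\<lambda>a. {x \<in> space gauss_seq. x \<in> E \<and> card {j. j < n \<and> loop n (\<lambda>l. x (k + l)) j < loop n (\<lambda>l. x (k + l)) a} \<le> l})"
  have F_meas [measurable]: "F a \<in> sets gauss_seq" for a
    unfolding F_def
    by (intro sets.sets_Collect_conj measurable_sets_Collect[OF card_measurable_aux]) measurable
  \<comment> \<open>Rotating the block by \<open>a\<close> shows the loop from its point
    \<open>a\<close>, so the rank of that point is the number of negative points of the rotated
    loop. The rotation preserves the law and the event \<open>E\<close>, hence the probability does
    not depend on \<open>a\<close>.\<close>
  have F: "measure gauss_seq (F a) = measure gauss_seq {x\<in>E. L x \<le> l}" if a: "a < n" for a
  proof -
    let ?f = "\<lambda>(x :: nat \<Rightarrow> real) i. x (block_shift k n a i)"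
    have "L (?f x) = card {j. j < n \<and> loop n (\<lambda>l. x (k + l)) j < loop n (\<lambda>l. x (k + l)) a}" for x
    proof -
      have u: "(\<lambda>l. ?f x (k + l)) i = (\<lambda>l. x (k + (l + a) mod n)) i" if "i < n" for i
        using that by (simp add: block_shift_def)
      have "loop n (\<lambda>l. ?f x (k + l)) i = loop n (\<lambda>l. x (k + (l + a) mod n)) i" if "i < n" for i
      proof -
        have "(\<Sum>l<i. ?f x (k + l)) = (\<Sum>l<i. x (k + (l + a) mod n))"
          using that by (intro sum.cong refl u) simp
        moreover have "(\<Sum>l<n. ?f x (k + l)) = (\<Sum>l<n. x (k + (l + a) mod n))"
          by (intro sum.cong refl u) simp
        ultimately show ?thesis by (simp add: loop_def)
      qed
      then have lp: "loop n (\<lambda>l. ?f x (k + l)) i = loop n (\<lambda>l. x (k + l)) ((i + a) mod n) - loop n (\<lambda>l. x (k + l)) a" if "i < n" for i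
        using that a loop_cyclic_shift[of a n i "\<lambda>l. x (k + l)"] by simp
      have "bij_betw (\<lambda>i. (i + a) mod n) {i. i < n \<and> loop n (\<lambda>l. ?f x (k + l)) i < 0} {j. j < n \<and> loop n (\<lambda>l. x (k + l)) j < loop n (\<lambda>l. x (k + l)) a}"
      proof (rule bij_betwI[where g="\<lambda>i. (i + (n - a)) mod n"])
        show "(\<lambda>i. (i + a) mod n) \<in> {i. i < n \<and> loop n (\<lambda>l. ?f x (k + l)) i < 0} \<rightarrow> {j. j < n \<and> loop n (\<lambda>l. x (k + l)) j < loop n (\<lambda>l. x (k + l)) a}"
          using lp n by auto
        have inv: "((y + (n - a)) mod n + a) mod n = y" if "y < n" for y
          using that a mod_shift_inverse(2) by simp
        show "(\<lambda>i. (i + (n - a)) mod n) \<in> {j. j < n \<and> loop n (\<lambda>l. x (k + l)) j < loop n (\<lambda>l. x (k + l)) a} \<rightarrow> {i. i < n \<and> loop n (\<lambda>l. ?f x (k + l)) i < 0}"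
          using lp n inv by auto
        show "((y + (n - a)) mod n + a) mod n = y" if "y \<in> {j. j < n \<and> loop n (\<lambda>l. x (k + l)) j < loop n (\<lambda>l. x (k + l)) a}" for y
          using that inv by auto
        show "((y + a) mod n + (n - a)) mod n = y" if "y \<in> {i. i < n \<and> loop n (\<lambda>l. ?f x (k + l)) i < 0}" for y
          using that a mod_shift_inverse(1)[OF a, of y] by auto
      qed
      then show ?thesis unfolding L_def by (rule bij_betw_same_card)
    qed
    moreover have "?f x \<in> E \<longleftrightarrow> x \<in> E" for x
      unfolding E_def hits_at_def using walk_bridge_block_shift[OF a, of _ k c x] by auto
    ultimately have "F a = ?f -` {x\<in>E. L x \<le> l} \<inter> space gauss_seq"
      by (auto simp: F_def)
    moreover have "{x\<in>space gauss_seq. x \<in> E \<and> L x \<le> l} \<in> sets gauss_seq" by measurable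
    ultimately have "measure gauss_seq (F a) = measure (distr gauss_seq gauss_seq ?f) {x\<in>E. L x \<le> l}"
      by (subst measure_distr) (auto intro: measurable_reindex)
    then show ?thesis by (simp add: gauss_seq_reindex inj_block_shift[OF a])
  qed
  \<comment> \<open>Double counting: on \<open>E\<close> at least \<open>l + 1\<close> of the
    \<open>n\<close> indicators are 1 by \<open>card_rank_le\<close>, while the \<open>n\<close>
    events are equally likely.\<close>
  have "(real l + 1) * measure gauss_seq E = (\<integral>x. (real l + 1) * indicator E x \<partial>gauss_seq)"
    by simp
  also have "\<dots> \<le> (\<integral>x. (\<Sum>a<n. indicator (F a) x) \<partial>gauss_seq)"
  proof (rule integral_mono)
    fix x
    show "(real l + 1) * indicator E x \<le> (\<Sum>a<n. indicator (F a) x :: real)"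
    proof (cases "x \<in> E")
      case True
      have "(\<Sum>a<n. indicator (F a) x :: real) = real (card {a. a < n \<and> card {j. j < n \<and> loop n (\<lambda>l. x (k + l)) j < loop n (\<lambda>l. x (k + l)) a} \<le> l})"
        using True by (simp add: indicator_def F_def sum.If_cases Int_def of_bool_def)
      then show ?thesis
        using True card_rank_le[OF assms, of "loop n (\<lambda>l. x (k + l))"] by simp
    qed (simp add: sum_nonneg)
  qed (use int[OF \<open>E \<in> sets gauss_seq\<close>] int[OF F_meas] in \<open>auto intro!: Bochner_Integration.integrable_sum\<close>)
  also have "\<dots> = (\<Sum>a<n. measure gauss_seq (F a))"
    using int[OF F_meas] by (subst Bochner_Integration.integral_sum) auto
  also have "\<dots> = real n * measure gauss_seq {x\<in>E. L x \<le> l}"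
    by (simp add: F)
  finally have "(real l + 1) / real n * measure gauss_seq E \<le> measure gauss_seq {x\<in>E. L x \<le> l}"
    using n by (simp add: field_simps)
  also have "\<dots> \<le> measure gauss_seq {x\<in>E. neg_count (k + n) c x \<le> k + l}"
  proof (rule gauss_seq.finite_measure_mono)
    show "{x\<in>E. L x \<le> l} \<subseteq> {x\<in>E. neg_count (k + n) c x \<le> k + l}"
      using neg_count_le_on_hits_at[OF n, of _ k c] by (force simp: E_def L_def)
  qed measurable
  finally show ?thesis by (simp add: E_def)
qed

text \<open>The bound for a single passage time is summed over the disjoint events, with
  \<open>m - k\<close> points from the passage on and \<open>K - k\<close> negative ones allowed
  among them. The \<open>+ 1\<close> is that of a uniform law on \<open>0, ..., m - k - 1\<close>,
  where 0 is a possible value.\<close>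

lemma prob_neg_count_le:
  assumes "K < m"
  shows "(\<Sum>k\<le>K. measure gauss_seq (hits_at m c k) * ((real K - real k + 1) / (real m - real k)))
    \<le> measure gauss_seq {x. neg_count m c x \<le> K}"
proof -
  have "(\<Sum>k\<le>K. measure gauss_seq (hits_at m c k) * ((real K - real k + 1) / (real m - real k)))
     \<le> (\<Sum>k\<le>K. measure gauss_seq {x \<in> hits_at m c k. neg_count m c x \<le> K})"
  proof (rule sum_mono)
    fix k assume "k \<in> {..K}"
    then show "measure gauss_seq (hits_at m c k) * ((real K - real k + 1) / (real m - real k))
       \<le> measure gauss_seq {x \<in> hits_at m c k. neg_count m c x \<le> K}"
      using prob_hits_at_neg_count_le[of "K - k" "m - k" k c] assms by (simp add: of_nat_diff mult.commute)
  qed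
  also have "\<dots> = measure gauss_seq (\<Union>k\<le>K. {x \<in> hits_at m c k. neg_count m c x \<le> K})"
  proof (rule gauss_seq.finite_measure_finite_Union[symmetric])
    show "disjoint_family_on (\<lambda>k. {x \<in> hits_at m c k. neg_count m c x \<le> K}) {..K}"
      using hits_at_disjoint[of m c] unfolding disjoint_family_on_def by blast
    have "{x \<in> hits_at m c k. neg_count m c x \<le> K} \<in> sets gauss_seq" for k
      by measurable
    then show "(\<lambda>k. {x \<in> hits_at m c k. neg_count m c x \<le> K}) ` {..K} \<subseteq> sets gauss_seq" by auto
  qed simp
  also have "\<dots> \<le> measure gauss_seq {x. neg_count m c x \<le> K}"
  proof (rule gauss_seq.finite_measure_mono)
    have "{x\<in>space gauss_seq. neg_count m c x \<le> K} \<in> sets gauss_seq" by measurable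
    then show "{x. neg_count m c x \<le> K} \<in> sets gauss_seq" by simp
  qed auto
  finally show ?thesis .
qed

section \<open>Reflection and first passage\<close>

abbreviation centered_gauss :: "real \<Rightarrow> real measure" where
  "centered_gauss v \<equiv> density lborel (normal_density 0 (sqrt v))"

text \<open>The coordinates are the first summand and the sum \<open>s\<close>, with
  \<open>s\<close> as the outer variable: the flip keeps the sum, so it can be dealt with in the
  inner integral alone.\<close>

lemma emeasure_centered_gauss_pair:
  assumes a: "a > 0" and b: "b > 0" and [measurable]: "C \<in> sets (borel \<Otimes>\<^sub>M borel)"
  shows "emeasure (centered_gauss a \<Otimes>\<^sub>M centered_gauss b) C
    = (\<integral>\<^sup>+s. \<integral>\<^sup>+x. ennreal (normal_density 0 (sqrt a) x * normal_density 0 (sqrt b) (s - x)) * indicator C (x, s - x) \<partial>lborel \<partial>lborel)"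
proof -
  interpret b: prob_space "centered_gauss b" using b by (intro prob_space_normal_density) simp
  have [measurable]: "C \<in> sets (lborel \<Otimes>\<^sub>M lborel)" by simp
  have "emeasure (centered_gauss a \<Otimes>\<^sub>M centered_gauss b) C
    = (\<integral>\<^sup>+x. \<integral>\<^sup>+z. indicator C (x, z) \<partial>centered_gauss b \<partial>centered_gauss a)"
    by (rule b.emeasure_pair_measure) simp
  also have "\<dots> = (\<integral>\<^sup>+x. ennreal (normal_density 0 (sqrt a) x) * (\<integral>\<^sup>+z. ennreal (normal_density 0 (sqrt b) z) * indicator C (x, z) \<partial>lborel) \<partial>lborel)"
    by (simp add: nn_integral_density)
  also have "\<dots> = (\<integral>\<^sup>+x. ennreal (normal_density 0 (sqrt a) x) * (\<integral>\<^sup>+s. ennreal (normal_density 0 (sqrt b) (- x + 1 * s)) * indicator C (x, - x + 1 * s) \<partial>lborel) \<partial>lborel)"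
  proof (intro nn_integral_cong)
    fix x :: real
    have "(\<integral>\<^sup>+z. ennreal (normal_density 0 (sqrt b) z) * indicator C (x, z) \<partial>lborel)
      = \<bar>1::real\<bar> * (\<integral>\<^sup>+s. ennreal (normal_density 0 (sqrt b) (- x + 1 * s)) * indicator C (x, - x + 1 * s) \<partial>lborel)"
      by (rule nn_integral_real_affine) auto
    then show "ennreal (normal_density 0 (sqrt a) x) * (\<integral>\<^sup>+z. ennreal (normal_density 0 (sqrt b) z) * indicator C (x, z) \<partial>lborel)
      = ennreal (normal_density 0 (sqrt a) x) * (\<integral>\<^sup>+s. ennreal (normal_density 0 (sqrt b) (- x + 1 * s)) * indicator C (x, - x + 1 * s) \<partial>lborel)"
      by simp
  qed
  also have "\<dots> = (\<integral>\<^sup>+x. \<integral>\<^sup>+s. ennreal (normal_density 0 (sqrt a) x * normal_density 0 (sqrt b) (s - x)) * indicator C (x, s - x) \<partial>lborel \<partial>lborel)"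
    by (intro nn_integral_cong) (subst nn_integral_cmult[symmetric], auto simp: ennreal_mult' mult.assoc)
  also have "\<dots> = (\<integral>\<^sup>+s. \<integral>\<^sup>+x. ennreal (normal_density 0 (sqrt a) x * normal_density 0 (sqrt b) (s - x)) * indicator C (x, s - x) \<partial>lborel \<partial>lborel)"
    by (rule lborel_pair.Fubini') measurable
  finally show ?thesis .
qed

text \<open>Given the sum of two independent centred Gaussian variables with variances
  \<open>a\<close> and \<open>b\<close>, the first has conditional mean \<open>a / (a + b)\<close>
  times the sum. With this \<rho> the map reflects the first summand about its conditional mean and
  keeps the sum. For a walk bridge it reflects one point about the chord.\<close>

definition bridge_flip :: "real \<Rightarrow> real \<times> real \<Rightarrow> real \<times> real" where
  "bridge_flip \<rho> = (\<lambda>(x, z). (2 * \<rho> * (x + z) - x, x + z - (2 * \<rho> * (x + z) - x)))"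

lemma measurable_bridge_flip [measurable]: "bridge_flip \<rho> \<in> borel \<Otimes>\<^sub>M borel \<rightarrow>\<^sub>M borel \<Otimes>\<^sub>M borel"
  unfolding bridge_flip_def by measurable

text \<open>For a fixed sum the flip is an affine map of slope -1, and the product of the two
  densities is invariant because its quadratic exponent is symmetric about the conditional
  mean.\<close>

lemma emeasure_bridge_flip:
  assumes a: "a > 0" and b: "b > 0" and C[measurable]: "C \<in> sets (borel \<Otimes>\<^sub>M borel)"
  shows "emeasure (centered_gauss a \<Otimes>\<^sub>M centered_gauss b) (bridge_flip (a / (a + b)) -` C)
    = emeasure (centered_gauss a \<Otimes>\<^sub>M centered_gauss b) C"
proof -
  define \<rho> where "\<rho> = a / (a + b)"
  have "bridge_flip \<rho> -` C \<inter> space (borel \<Otimes>\<^sub>M borel) \<in> sets (borel \<Otimes>\<^sub>M borel)"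
    by (rule measurable_sets) measurable
  then have C': "bridge_flip \<rho> -` C \<in> sets (borel \<Otimes>\<^sub>M borel)"
    by (simp add: space_pair_measure)
  have "(\<integral>\<^sup>+x. ennreal (normal_density 0 (sqrt a) x * normal_density 0 (sqrt b) (s - x)) * indicator (bridge_flip \<rho> -` C) (x, s - x) \<partial>lborel)
     = (\<integral>\<^sup>+x. ennreal (normal_density 0 (sqrt a) x * normal_density 0 (sqrt b) (s - x)) * indicator C (x, s - x) \<partial>lborel)" for s
  proof -
    have "(\<integral>\<^sup>+x. ennreal (normal_density 0 (sqrt a) x * normal_density 0 (sqrt b) (s - x)) * indicator C (x, s - x) \<partial>lborel)
      = \<bar>-1::real\<bar> * (\<integral>\<^sup>+x. ennreal (normal_density 0 (sqrt a) (2 * \<rho> * s + (-1) * x) * normal_density 0 (sqrt b) (s - (2 * \<rho> * s + (-1) * x))) * indicator C (2 * \<rho> * s + (-1) * x, s - (2 * \<rho> * s + (-1) * x)) \<partial>lborel)"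
      by (rule nn_integral_real_affine) auto
    also have "\<dots> = (\<integral>\<^sup>+x. ennreal (normal_density 0 (sqrt a) x * normal_density 0 (sqrt b) (s - x)) * indicator (bridge_flip \<rho> -` C) (x, s - x) \<partial>lborel)"
    proof -
      have "normal_density 0 (sqrt a) (2 * \<rho> * s - x) * normal_density 0 (sqrt b) (s - (2 * \<rho> * s - x))
          = normal_density 0 (sqrt a) x * normal_density 0 (sqrt b) (s - x)" for x
      proof -
        have "(2 * \<rho> * s - x)\<^sup>2 / (2 * a) + (s - (2 * \<rho> * s - x))\<^sup>2 / (2 * b) = x\<^sup>2 / (2 * a) + (s - x)\<^sup>2 / (2 * b)"
        proof -
          have ab: "a + b \<noteq> 0" "a \<noteq> 0" "b \<noteq> 0" using a b by auto
          have rs: "\<rho> * (a + b) = a" using ab by (simp add: \<rho>_def)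
          \<comment> \<open>The two quadratic forms differ by a multiple of
            \<open>\<rho> * (a + b) - a\<close>, which vanishes for the chosen \<rho>.\<close>
          have "b * (2 * \<rho> * s - x)\<^sup>2 + a * (s - (2 * \<rho> * s - x))\<^sup>2 = b * x\<^sup>2 + a * (s - x)\<^sup>2 + (\<rho> * (a + b) - a) * (4 * \<rho> * s\<^sup>2 - 4 * s * x)"
            by (simp add: power2_eq_square algebra_simps)
          then have "b * (2 * \<rho> * s - x)\<^sup>2 + a * (s - (2 * \<rho> * s - x))\<^sup>2 = b * x\<^sup>2 + a * (s - x)\<^sup>2"
            using rs by simp
          then show ?thesis using ab by (simp add: field_simps)
        qed
        then have "exp (- ((2 * \<rho> * s - x)\<^sup>2 / (2 * a))) * exp (- ((s - (2 * \<rho> * s - x))\<^sup>2 / (2 * b))) = exp (- (x\<^sup>2 / (2 * a))) * exp (- ((s - x)\<^sup>2 / (2 * b)))"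
          by (simp add: exp_add[symmetric])
        moreover have "normal_density 0 (sqrt a) u * normal_density 0 (sqrt b) v
            = 1 / sqrt (2 * pi * a) * (1 / sqrt (2 * pi * b)) * (exp (- (u\<^sup>2 / (2 * a))) * exp (- (v\<^sup>2 / (2 * b))))" for u v
          using a b by (simp add: normal_density_def)
        ultimately show ?thesis by simp
      qed
      moreover have "indicator C (2 * \<rho> * s - x, s - (2 * \<rho> * s - x)) = (indicator (bridge_flip \<rho> -` C) (x, s - x) :: ennreal)" for x
        by (simp add: bridge_flip_def indicator_def algebra_simps)
      ultimately show ?thesis by simp
    qed
    finally show ?thesis by simp
  qed
  then show ?thesis
    unfolding \<rho>_def[symmetric] using emeasure_centered_gauss_pair[OF a b C'] emeasure_centered_gauss_pair[OF a b C] by simp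
qed

lemma distributed_gauss_seq_sum:
  assumes "finite I" "I \<noteq> {}" "\<And>i. i \<in> I \<Longrightarrow> w i \<noteq> 0"
  shows "distributed gauss_seq lborel (\<lambda>x. \<Sum>i\<in>I. w i * x i) (normal_density 0 (sqrt (\<Sum>i\<in>I. (w i)\<^sup>2)))"
proof -
  have "distributed gauss_seq lborel (\<lambda>x. \<Sum>i\<in>I. w i * x i) (normal_density (\<Sum>i\<in>I. 0) (sqrt (\<Sum>i\<in>I. \<bar>w i\<bar>\<^sup>2)))"
  proof (rule gauss_seq.sum_indep_normal)
    show "gauss_seq.indep_vars (\<lambda>_. borel) (\<lambda>i x. w i * x i) I"
      using gauss_seq.indep_vars_compose2[OF indep_vars_gauss_seq[of I], of "\<lambda>i y. w i * y" "\<lambda>_. borel"] by simp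
    fix i assume "i \<in> I"
    then have w: "w i \<noteq> 0" using assms by simp
    then show "0 < \<bar>w i\<bar>" by simp
    have "distributed gauss_seq lborel (\<lambda>x. x i) std_normal_density"
      using distr_gauss_seq_coord[of i]
      by (auto simp: distributed_def cong: distr_cong)
    then have "distributed gauss_seq lborel (\<lambda>x. 0 + w i * x i) (normal_density (0 + w i * 0) (\<bar>w i\<bar> * 1))"
      using w by (intro gauss_seq.normal_density_affine) auto
    then show "distributed gauss_seq lborel (\<lambda>x. w i * x i) (normal_density 0 \<bar>w i\<bar>)" by simp
  qed (use assms in auto)
  then show ?thesis by simp
qed

lemma distr_gauss_seq_two_blocks:
  assumes "finite A" "finite B" "A \<noteq> {}" "B \<noteq> {}" "A \<inter> B = {}"
  shows "distr gauss_seq (borel \<Otimes>\<^sub>M borel) (\<lambda>x. (\<Sum>l\<in>A. x l, \<Sum>l\<in>B. x l))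
    = centered_gauss (card A) \<Otimes>\<^sub>M centered_gauss (card B)"
proof -
  have ind: "gauss_seq.indep_var borel ((\<lambda>f. \<Sum>l\<in>A. f l) \<circ> (\<lambda>x. restrict (\<lambda>i. x i) A)) borel ((\<lambda>f. \<Sum>l\<in>B. f l) \<circ> (\<lambda>x. restrict (\<lambda>i. x i) B))"
    using assms by (intro gauss_seq.indep_var_compose[OF gauss_seq.indep_var_restrict[OF indep_vars_gauss_seq[of UNIV]]]) auto
  have d: "distr gauss_seq borel ((\<lambda>f. \<Sum>l\<in>D. f l) \<circ> (\<lambda>x. restrict (\<lambda>i. x i) D)) = centered_gauss (card D)"
    if "finite D" "D \<noteq> {}" for D
  proof -
    have "distributed gauss_seq lborel (\<lambda>x. \<Sum>i\<in>D. 1 * x i) (normal_density 0 (sqrt (\<Sum>i\<in>D. 1\<^sup>2)))"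
      using that by (intro distributed_gauss_seq_sum) auto
    from distributed_distr_eq_density[OF this]
    have "distr gauss_seq lborel (\<lambda>x. \<Sum>l\<in>D. x l) = centered_gauss (card D)" by simp
    moreover have "distr gauss_seq borel ((\<lambda>f. \<Sum>l\<in>D. f l) \<circ> (\<lambda>x. restrict (\<lambda>i. x i) D)) = distr gauss_seq lborel (\<lambda>x. \<Sum>l\<in>D. x l)"
      by (rule distr_cong) (auto intro: sum.cong)
    ultimately show ?thesis by simp
  qed
  have "distr gauss_seq (borel \<Otimes>\<^sub>M borel) (\<lambda>x. (((\<lambda>f. \<Sum>l\<in>A. f l) \<circ> (\<lambda>x. restrict (\<lambda>i. x i) A)) x, ((\<lambda>f. \<Sum>l\<in>B. f l) \<circ> (\<lambda>x. restrict (\<lambda>i. x i) B)) x))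
    = centered_gauss (card A) \<Otimes>\<^sub>M centered_gauss (card B)"
    using ind unfolding gauss_seq.indep_var_distribution_eq using d assms by simp
  moreover have "distr gauss_seq (borel \<Otimes>\<^sub>M borel) (\<lambda>x. (((\<lambda>f. \<Sum>l\<in>A. f l) \<circ> (\<lambda>x. restrict (\<lambda>i. x i) A)) x, ((\<lambda>f. \<Sum>l\<in>B. f l) \<circ> (\<lambda>x. restrict (\<lambda>i. x i) B)) x))
    = distr gauss_seq (borel \<Otimes>\<^sub>M borel) (\<lambda>x. (\<Sum>l\<in>A. x l, \<Sum>l\<in>B. x l))"
    by (rule distr_cong) (auto intro: sum.cong)
  ultimately show ?thesis by simp
qed

text \<open>The flip acts on the sums \<open>X\<close> and \<open>Z\<close> of two adjacent blocks
  and not on single steps, since \<open>C\<close> sees the steps after \<open>k\<close> only through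
  these sums. They are independent of the past, so \<open>emeasure_bridge_flip\<close> applies to
  each section of \<open>C\<close> at a fixed past.\<close>

lemma emeasure_past_bridge_flip:
  fixes k i n :: nat
  assumes i: "0 < i" "i < n"
    and C: "C \<in> sets (PiM {..<k} (\<lambda>_. borel) \<Otimes>\<^sub>M borel \<Otimes>\<^sub>M borel)"
  defines "X \<equiv> \<lambda>x. \<Sum>l\<in>{k..<k + i}. x l" and "Z \<equiv> \<lambda>x. \<Sum>l\<in>{k + i..<k + n}. x l"
  shows "emeasure gauss_seq {x. (restrict x {..<k}, bridge_flip (real i / real n) (X x, Z x)) \<in> C}
    = emeasure gauss_seq {x. (restrict x {..<k}, X x, Z x) \<in> C}"
proof -
  define P where "P = PiM {..<k} (\<lambda>_. borel :: real measure)"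
  define R where "R = PiM {k..<k + n} (\<lambda>_. borel :: real measure)"
  define \<mu>1 where "\<mu>1 = distr gauss_seq P (\<lambda>x. restrict (\<lambda>i. x i) {..<k})"
  define \<mu>2 where "\<mu>2 = distr gauss_seq R (\<lambda>x. restrict (\<lambda>i. x i) {k..<k + n})"
  define N2 where "N2 = centered_gauss (real i) \<Otimes>\<^sub>M centered_gauss (real (n - i))"
  have C' [measurable]: "C \<in> sets (P \<Otimes>\<^sub>M borel \<Otimes>\<^sub>M borel)" using C by (simp add: P_def)
  have rv1 [measurable]: "(\<lambda>x. restrict (\<lambda>i. x i) {..<k}) \<in> measurable gauss_seq P"
    unfolding P_def by (intro measurable_restrict) auto
  have rv2 [measurable]: "(\<lambda>x. restrict (\<lambda>i. x i) {k..<k + n}) \<in> measurable gauss_seq R"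
    unfolding R_def by (intro measurable_restrict) auto
  have "gauss_seq.indep_var P (\<lambda>x. restrict (\<lambda>i. x i) {..<k}) R (\<lambda>x. restrict (\<lambda>i. x i) {k..<k + n})"
    unfolding P_def R_def by (intro gauss_seq.indep_var_restrict[OF indep_vars_gauss_seq[of UNIV]]) auto
  then have joint: "distr gauss_seq (P \<Otimes>\<^sub>M R) (\<lambda>x. (restrict (\<lambda>i. x i) {..<k}, restrict (\<lambda>i. x i) {k..<k + n})) = \<mu>1 \<Otimes>\<^sub>M \<mu>2"
    unfolding gauss_seq.indep_var_distribution_eq \<mu>1_def \<mu>2_def by simp
  interpret m2: prob_space \<mu>2 unfolding \<mu>2_def by (intro gauss_seq.prob_space_distr rv2)
  have [measurable]: "X \<in> borel_measurable R" "Z \<in> borel_measurable R"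
    unfolding X_def Z_def R_def using i by (auto intro!: borel_measurable_sum measurable_component_singleton)
  have [measurable]: "X \<in> borel_measurable gauss_seq" "Z \<in> borel_measurable gauss_seq"
    unfolding X_def Z_def by measurable
  have XZ: "distr \<mu>2 (borel \<Otimes>\<^sub>M borel) (\<lambda>r. (X r, Z r)) = N2"
  proof -
    have "distr \<mu>2 (borel \<Otimes>\<^sub>M borel) (\<lambda>r. (X r, Z r)) = distr gauss_seq (borel \<Otimes>\<^sub>M borel) ((\<lambda>r. (X r, Z r)) \<circ> (\<lambda>x. restrict (\<lambda>i. x i) {k..<k + n}))"
      unfolding \<mu>2_def by (subst distr_distr) auto
    also have "\<dots> = distr gauss_seq (borel \<Otimes>\<^sub>M borel) (\<lambda>x. (\<Sum>l\<in>{k..<k + i}. x l, \<Sum>l\<in>{k + i..<k + n}. x l))"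
      using i by (intro distr_cong) (auto simp: X_def Z_def intro!: sum.cong)
    also have "\<dots> = N2"
      unfolding N2_def using i by (subst distr_gauss_seq_two_blocks) auto
    finally show ?thesis .
  qed
  \<comment> \<open>Stated for a general map \<open>f\<close>, because it is applied both to the
    flip and to the identity.\<close>
  have main: "emeasure gauss_seq {x. (restrict x {..<k}, f (X x, Z x)) \<in> C} = (\<integral>\<^sup>+p. emeasure N2 (f -` {v. (p, v) \<in> C}) \<partial>\<mu>1)"
    if f [measurable]: "f \<in> borel \<Otimes>\<^sub>M borel \<rightarrow>\<^sub>M borel \<Otimes>\<^sub>M (borel :: real measure)" for f :: "real \<times> real \<Rightarrow> real \<times> real"
  proof -
    define D where "D = {y \<in> space (P \<Otimes>\<^sub>M R). (fst y, f (X (snd y), Z (snd y))) \<in> C}"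
    have D [measurable]: "D \<in> sets (P \<Otimes>\<^sub>M R)" unfolding D_def by measurable
    have "(restrict x {..<k}, f (X x, Z x)) \<in> C \<longleftrightarrow> (restrict x {..<k}, restrict x {k..<k + n}) \<in> D" for x
    proof -
      have "X (restrict x {k..<k + n}) = X x" "Z (restrict x {k..<k + n}) = Z x"
        unfolding X_def Z_def using i by (auto intro!: sum.cong)
      then show ?thesis by (simp add: D_def space_pair_measure P_def R_def space_PiM)
    qed
    then have "{x. (restrict x {..<k}, f (X x, Z x)) \<in> C} = (\<lambda>x. (restrict (\<lambda>i. x i) {..<k}, restrict (\<lambda>i. x i) {k..<k + n})) -` D \<inter> space gauss_seq"
      by auto
    then have "emeasure gauss_seq {x. (restrict x {..<k}, f (X x, Z x)) \<in> C} = emeasure (\<mu>1 \<Otimes>\<^sub>M \<mu>2) D"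
      unfolding joint[symmetric] by (subst emeasure_distr) auto
    also have "\<dots> = (\<integral>\<^sup>+p. emeasure \<mu>2 (Pair p -` D) \<partial>\<mu>1)"
      by (rule m2.emeasure_pair_measure_alt) (simp add: \<mu>1_def \<mu>2_def)
    also have "\<dots> = (\<integral>\<^sup>+p. emeasure N2 (f -` {v. (p, v) \<in> C}) \<partial>\<mu>1)"
    proof (rule nn_integral_cong)
      fix p assume "p \<in> space \<mu>1"
      then have p: "p \<in> space P" by (simp add: \<mu>1_def)
      have "f -` {v. (p, v) \<in> C} \<inter> space (borel \<Otimes>\<^sub>M borel) \<in> sets (borel \<Otimes>\<^sub>M borel)"
        by (rule measurable_sets[OF f]) (use sets_Pair1[OF C'] in \<open>simp add: vimage_def\<close>)
      then have s: "f -` {v. (p, v) \<in> C} \<in> sets (borel \<Otimes>\<^sub>M borel)" by (simp add: space_pair_measure)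
      have "Pair p -` D = (\<lambda>r. (X r, Z r)) -` (f -` {v. (p, v) \<in> C}) \<inter> space \<mu>2"
        using p by (auto simp: D_def space_pair_measure \<mu>2_def)
      then have "emeasure \<mu>2 (Pair p -` D) = emeasure (distr \<mu>2 (borel \<Otimes>\<^sub>M borel) (\<lambda>r. (X r, Z r))) (f -` {v. (p, v) \<in> C})"
        using s by (subst emeasure_distr) (auto simp: \<mu>2_def)
      then show "emeasure \<mu>2 (Pair p -` D) = emeasure N2 (f -` {v. (p, v) \<in> C})" by (simp add: XZ)
    qed
    finally show ?thesis .
  qed
  have "emeasure N2 (bridge_flip (real i / real n) -` {v. (p, v) \<in> C}) = emeasure N2 {v. (p, v) \<in> C}" for p
    using emeasure_bridge_flip[of "real i" "real (n - i)" "{v. (p, v) \<in> C}"] i sets_Pair1[OF C', of p]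
    by (simp add: N2_def vimage_def of_nat_diff)
  then show ?thesis
    using main[of "bridge_flip (real i / real n)"] main[of "\<lambda>v. v"] by simp
qed

text \<open>On \<open>hits_at m c k\<close> the bridge is flipped after time \<open>k\<close> about the segment joining its position
  at time \<open>k\<close> to its end point.\<close>

lemma prob_hits_at_reflect:
  assumes "k < j" "j < m"
  shows "measure gauss_seq {x \<in> hits_at m c k. walk_bridge m c x j > 2 * walk_bridge m c x k}
    \<le> measure gauss_seq {x \<in> hits_at m c k. walk_bridge m c x j < 0}"
proof -
  define i n where "i = j - k" and "n = m - k"
  have i: "0 < i" "i < n" and j: "j = k + i" and m: "m = k + n"
    using assms by (auto simp: i_def n_def)
  define X :: "(nat \<Rightarrow> real) \<Rightarrow> real" where "X = (\<lambda>x. \<Sum>l\<in>{k..<k + i}. x l)"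
  define Z :: "(nat \<Rightarrow> real) \<Rightarrow> real" where "Z = (\<lambda>x. \<Sum>l\<in>{k + i..<k + n}. x l)"
  \<comment> \<open>\<open>wb\<close> and \<open>wj\<close> express the bridge up to time
    \<open>k\<close> and at time \<open>j\<close> through the past steps and the two block sums. The
    later steps enter \<open>wb\<close> only through their total, which the flip keeps; hence the
    flip does not change the event of first passage at \<open>k\<close>.\<close>
  define wb where "wb = (\<lambda>(p :: nat \<Rightarrow> real) s l. c * (1 - real l / real m) + ((\<Sum>q<l. p q) - real l / real m * ((\<Sum>q<k. p q) + s)) / sqrt (real m))"
  define wj where "wj = (\<lambda>(p :: nat \<Rightarrow> real) x z. (1 - real i / real n) * wb p (x + z) k + (x - real i / real n * (x + z)) / sqrt (real m))"
  define P where "P = PiM {..<k} (\<lambda>_. borel :: real measure)"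
  have coord: "(\<lambda>y. fst y q) \<in> borel_measurable (P \<Otimes>\<^sub>M (borel :: real measure) \<Otimes>\<^sub>M (borel :: real measure))" if "q < k" for q
  proof -
    have "(\<lambda>p. p q) \<in> borel_measurable P"
      unfolding P_def using that by (intro measurable_component_singleton) simp
    from measurable_compose[OF measurable_fst this] show ?thesis .
  qed
  have sum_coord: "(\<lambda>y. \<Sum>q<l. fst y q) \<in> borel_measurable (P \<Otimes>\<^sub>M (borel :: real measure) \<Otimes>\<^sub>M (borel :: real measure))" if "l \<le> k" for l
    using that by (intro borel_measurable_sum coord) auto
  have wbm: "(\<lambda>y. wb (fst y) (fst (snd y) + snd (snd y)) l) \<in> borel_measurable (P \<Otimes>\<^sub>M borel \<Otimes>\<^sub>M borel)" if "l \<le> k" for l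
    unfolding wb_def using sum_coord[OF that] sum_coord[OF order_refl] by measurable
  define C where "C = {y \<in> space (P \<Otimes>\<^sub>M borel \<Otimes>\<^sub>M borel). (\<forall>l\<in>{..<k}. wb (fst y) (fst (snd y) + snd (snd y)) l < 0) \<and> 0 \<le> wb (fst y) (fst (snd y) + snd (snd y)) k \<and> wj (fst y) (fst (snd y)) (snd (snd y)) < 0}"
  have "C \<in> sets (P \<Otimes>\<^sub>M borel \<Otimes>\<^sub>M borel)"
  proof -
    have [measurable]: "(\<lambda>y. wj (fst y) (fst (snd y)) (snd (snd y))) \<in> borel_measurable (P \<Otimes>\<^sub>M borel \<Otimes>\<^sub>M borel)"
      unfolding wj_def using wbm[OF order_refl] by measurable
    have "{y \<in> space (P \<Otimes>\<^sub>M borel \<Otimes>\<^sub>M borel). wb (fst y) (fst (snd y) + snd (snd y)) l < 0} \<in> sets (P \<Otimes>\<^sub>M borel \<Otimes>\<^sub>M borel)" if "l < k" for l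
      using wbm[OF less_imp_le[OF that]] by measurable
    moreover have "{y \<in> space (P \<Otimes>\<^sub>M borel \<Otimes>\<^sub>M borel). 0 \<le> wb (fst y) (fst (snd y) + snd (snd y)) k} \<in> sets (P \<Otimes>\<^sub>M borel \<Otimes>\<^sub>M borel)"
      using wbm[OF order_refl] by measurable
    moreover have "{y \<in> space (P \<Otimes>\<^sub>M borel \<Otimes>\<^sub>M borel). wj (fst y) (fst (snd y)) (snd (snd y)) < 0} \<in> sets (P \<Otimes>\<^sub>M borel \<Otimes>\<^sub>M borel)"
      by measurable
    ultimately show ?thesis
      unfolding C_def by (intro sets.sets_Collect_conj sets.sets_Collect_finite_All) auto
  qed
  then have C: "C \<in> sets (PiM {..<k} (\<lambda>_. borel) \<Otimes>\<^sub>M borel \<Otimes>\<^sub>M borel)" by (simp add: P_def)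
  have tot: "(\<Sum>l<m. x l) = (\<Sum>l<k. x l) + (X x + Z x)" for x :: "nat \<Rightarrow> real"
  proof -
    have "sum x {k..<k + i} + sum x {k + i..<k + n} = sum x {k..<k + n}" "sum x {0..<k} + sum x {k..<k + n} = sum x {0..<k + n}"
      using i by (intro sum.atLeastLessThan_concat; simp)+
    then show ?thesis unfolding X_def Z_def m lessThan_atLeast0 by simp
  qed
  have wb: "walk_bridge m c x l = wb (restrict x {..<k}) (X x + Z x) l" if "l \<le> k" for x l
  proof -
    have "(\<Sum>q<l. restrict x {..<k} q) = (\<Sum>q<l. x q)" using that by (intro sum.cong) auto
    then show ?thesis unfolding walk_bridge_def loop_def wb_def tot by simp
  qed
  have X': "(\<Sum>l<i. x (k + l)) = X x" for x :: "nat \<Rightarrow> real"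
    unfolding X_def by (rule sum.reindex_bij_witness[of _ "\<lambda>l. l - k" "\<lambda>l. k + l"]) auto
  have XZ': "(\<Sum>l<n. x (k + l)) = X x + Z x" for x :: "nat \<Rightarrow> real"
  proof -
    have "(\<Sum>l<n. x (k + l)) = (\<Sum>l\<in>{k..<k + n}. x l)"
      by (rule sum.reindex_bij_witness[of _ "\<lambda>l. l - k" "\<lambda>l. k + l"]) auto
    also have "\<dots> = sum x {k..<k + i} + sum x {k + i..<k + n}"
      using i by (intro sum.atLeastLessThan_concat[symmetric]) simp_all
    finally show ?thesis unfolding X_def Z_def .
  qed
  have wj: "walk_bridge m c x j = wj (restrict x {..<k}) (X x) (Z x)" for x
    using walk_bridge_split[of n i k c x] i wb[of k x]
    by (simp add: wj_def j m loop_def X' XZ')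
  have 1: "{x \<in> hits_at m c k. walk_bridge m c x j < 0} = {x. (restrict x {..<k}, X x, Z x) \<in> C}"
    by (auto simp: hits_at_def C_def wb wj space_pair_measure P_def space_PiM)
  \<comment> \<open>The height at \<open>j\<close> is reflected about the chord, whose height there
    is \<open>1 - i / n\<close> times the height at \<open>k\<close>.\<close>
  have flip: "wj p (fst (bridge_flip (real i / real n) (x, z))) (snd (bridge_flip (real i / real n) (x, z))) = 2 * (1 - real i / real n) * wb p (x + z) k - wj p x z" for p x z
    by (simp add: wj_def bridge_flip_def add_divide_distrib diff_divide_distrib algebra_simps)
  have 2: "{x \<in> hits_at m c k. 2 * (1 - real i / real n) * walk_bridge m c x k - walk_bridge m c x j < 0}
     = {x. (restrict x {..<k}, bridge_flip (real i / real n) (X x, Z x)) \<in> C}"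
  proof -
    have "fst (bridge_flip \<rho> v) + snd (bridge_flip \<rho> v) = fst v + snd v" for \<rho> v
      by (simp add: bridge_flip_def split_beta)
    then show ?thesis
      using flip by (auto simp: hits_at_def C_def wb wj space_pair_measure P_def space_PiM)
  qed
  \<comment> \<open>The height at \<open>k\<close> is nonnegative, so the chord is nowhere above it.
    A value at \<open>j\<close> above twice that height is therefore reflected below zero.\<close>
  have "measure gauss_seq {x \<in> hits_at m c k. walk_bridge m c x j > 2 * walk_bridge m c x k}
     \<le> measure gauss_seq {x \<in> hits_at m c k. 2 * (1 - real i / real n) * walk_bridge m c x k - walk_bridge m c x j < 0}"
  proof (rule gauss_seq.finite_measure_mono)
    show "{x \<in> hits_at m c k. walk_bridge m c x j > 2 * walk_bridge m c x k} \<subseteq> {x \<in> hits_at m c k. 2 * (1 - real i / real n) * walk_bridge m c x k - walk_bridge m c x j < 0}"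
    proof safe
      fix x assume x: "x \<in> hits_at m c k" "walk_bridge m c x j > 2 * walk_bridge m c x k"
      have "(1 - real i / real n) * walk_bridge m c x k \<le> 1 * walk_bridge m c x k"
        using x(1) i by (intro mult_right_mono) (auto simp: hits_at_def)
      then show "2 * (1 - real i / real n) * walk_bridge m c x k - walk_bridge m c x j < 0" using x(2) unfolding mult.assoc by linarith
    qed
    have "{x \<in> space gauss_seq. x \<in> hits_at m c k \<and> 2 * (1 - real i / real n) * walk_bridge m c x k - walk_bridge m c x j < 0} \<in> sets gauss_seq"
      by measurable
    then show "{x \<in> hits_at m c k. 2 * (1 - real i / real n) * walk_bridge m c x k - walk_bridge m c x j < 0} \<in> sets gauss_seq" by simp
  qed
  also have "\<dots> = measure gauss_seq {x \<in> hits_at m c k. walk_bridge m c x j < 0}"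
    unfolding 1 2 measure_def X_def Z_def using emeasure_past_bridge_flip[OF i C] by simp
  finally show ?thesis .
qed

section \<open>Marginals and large steps of the walk bridge\<close>

lemma real_le_iff_nat_floor: "0 \<le> x \<Longrightarrow> real k \<le> x \<longleftrightarrow> k \<le> nat \<lfloor>x\<rfloor>"
  by (simp add: le_nat_iff le_floor_iff)

text \<open>The bridge at time \<open>j\<close> is its mean \<open>c * (1 - r)\<close> plus a linear
  combination of the steps, with weights \<open>(1 - r) / sqrt m\<close> before \<open>j\<close> and
  \<open>- r / sqrt m\<close> from \<open>j\<close> on; their squares add up to
  \<open>r * (1 - r)\<close>.\<close>

lemma prob_walk_bridge_gt:
  assumes j: "0 < j" "j < m" and r: "r = real j / real m"
  shows "measure gauss_seq {x. walk_bridge m c x j > w} = gauss_tail ((w - c * (1 - r)) / sqrt (r * (1 - r)))"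
proof -
  have r01: "0 < r" "r < 1" using j by (auto simp: r)
  define v where "v = (\<lambda>l. ((if l < j then 1 else 0) - r) / sqrt (real m))"
  define Y where "Y = (\<lambda>x :: nat \<Rightarrow> real. \<Sum>l<m. v l * x l)"
  define \<sigma> where "\<sigma> = sqrt (r * (1 - r))"
  have \<sigma>: "\<sigma> > 0" using r01 by (simp add: \<sigma>_def)
  have [measurable]: "Y \<in> borel_measurable gauss_seq" unfolding Y_def by measurable
  have Y: "walk_bridge m c x j = c * (1 - r) + Y x" for x
  proof -
    have "Y x = (\<Sum>l<m. (if l < j then x l else 0) / sqrt (real m) - r / sqrt (real m) * x l)"
      unfolding Y_def v_def by (intro sum.cong) (auto simp: field_simps)
    also have "\<dots> = (\<Sum>l<m. if l < j then x l else 0) / sqrt (real m) - r / sqrt (real m) * (\<Sum>l<m. x l)"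
      by (simp add: sum_subtractf sum_divide_distrib sum_distrib_left)
    also have "(\<Sum>l<m. if l < j then x l else 0) = (\<Sum>l<j. x l)"
      using j by (intro sum.mono_neutral_cong_right) auto
    finally show ?thesis by (simp add: walk_bridge_def loop_def r diff_divide_distrib)
  qed
  have "(\<Sum>l<m. (v l)\<^sup>2) = (\<Sum>l<j. (1 - r)\<^sup>2 / real m) + (\<Sum>l\<in>{j..<m}. r\<^sup>2 / real m)"
  proof -
    have "(\<Sum>l<m. (v l)\<^sup>2) = (\<Sum>l\<in>{0..<j}. (v l)\<^sup>2) + (\<Sum>l\<in>{j..<m}. (v l)\<^sup>2)"
      unfolding lessThan_atLeast0 using j by (intro sum.atLeastLessThan_concat[symmetric]) auto
    moreover have "(\<Sum>l\<in>{0..<j}. (v l)\<^sup>2) = (\<Sum>l<j. (1 - r)\<^sup>2 / real m)"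
      unfolding lessThan_atLeast0 by (intro sum.cong) (auto simp: v_def power_divide)
    moreover have "(\<Sum>l\<in>{j..<m}. (v l)\<^sup>2) = (\<Sum>l\<in>{j..<m}. r\<^sup>2 / real m)"
      by (intro sum.cong) (auto simp: v_def power_divide)
    ultimately show ?thesis by simp
  qed
  also have "\<dots> = r * (1 - r)\<^sup>2 + (1 - r) * r\<^sup>2"
    using j by (simp add: r of_nat_diff field_simps)
  also have "\<dots> = r * (1 - r)" by (simp add: power2_eq_square algebra_simps)
  finally have s: "sqrt (\<Sum>l<m. (v l)\<^sup>2) = \<sigma>" by (simp add: \<sigma>_def)
  have "distributed gauss_seq lborel Y (normal_density 0 (sqrt (\<Sum>l<m. (v l)\<^sup>2)))"
    unfolding Y_def using j r01 by (intro distributed_gauss_seq_sum) (auto simp: v_def)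
  then have "distributed gauss_seq lborel (\<lambda>x. (Y x - 0) / \<sigma>) std_normal_density"
    unfolding s using gauss_seq.normal_standard_normal_convert[OF \<sigma>] by blast
  from distributed_distr_eq_density[OF this]
  have d: "distr gauss_seq lborel (\<lambda>x. Y x / \<sigma>) = std_gauss" by simp
  have "{x. walk_bridge m c x j > w} = (\<lambda>x. Y x / \<sigma>) -` {(w - c * (1 - r)) / \<sigma><..} \<inter> space gauss_seq"
    using \<sigma> by (auto simp: Y divide_less_cancel)
  also have "measure gauss_seq \<dots> = measure (distr gauss_seq lborel (\<lambda>x. Y x / \<sigma>)) {(w - c * (1 - r)) / \<sigma><..}"
    by (subst measure_distr) auto
  finally show ?thesis unfolding d by (simp add: gauss_tail_def \<sigma>_def)
qed

text \<open>Markov's inequality for the fourth moment, which is 3. The bound is summed over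
  \<open>m\<close> steps with \<open>r\<close> of order \<open>sqrt m\<close>; the second moment
  would leave an error of order 1, the fourth leaves one of order \<open>1 / m\<close>.\<close>

lemma prob_coord_large:
  assumes "r > 0"
  shows "measure gauss_seq {x. \<bar>x i\<bar> > r} \<le> 3 / r ^ 4"
proof -
  have m4: "has_bochner_integral lborel (\<lambda>x. std_normal_density x * x ^ (2 * 2)) (fact (2 * 2) / (2 ^ 2 * fact 2))"
    by (rule std_normal_moment_even)
  have "{x. \<bar>x i\<bar> > r} = (\<lambda>x. x i) -` {y. \<bar>y\<bar> > r} \<inter> space gauss_seq" by auto
  also have "measure gauss_seq \<dots> = measure (distr gauss_seq borel (\<lambda>x. x i)) {y. \<bar>y\<bar> > r}"
    by (subst measure_distr) auto
  also have "\<dots> = measure std_gauss {y. \<bar>y\<bar> > r}" by (simp add: distr_gauss_seq_coord)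
  also have "\<dots> = (\<integral>y. std_normal_density y * indicator {y. \<bar>y\<bar> > r} y \<partial>lborel)"
  proof -
    have "measure std_gauss {y. \<bar>y\<bar> > r} = (\<integral>y. indicator {y. \<bar>y\<bar> > r} y \<partial>std_gauss)"
      by simp
    also have "\<dots> = (\<integral>y. std_normal_density y * indicator {y. \<bar>y\<bar> > r} y \<partial>lborel)"
      by (subst integral_real_density) auto
    finally show ?thesis .
  qed
  also have "\<dots> \<le> (\<integral>y. std_normal_density y * y ^ (2 * 2) / r ^ 4 \<partial>lborel)"
  proof (rule integral_mono)
    show "integrable lborel (\<lambda>y. std_normal_density y * indicator {y. \<bar>y\<bar> > r} y)"
      by (intro integrable_real_mult_indicator) auto
    show "integrable lborel (\<lambda>y. std_normal_density y * y ^ (2 * 2) / r ^ 4)"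
      using m4 by (intro integrable_divide) (auto simp: has_bochner_integral_iff)
    fix y :: real
    show "std_normal_density y * indicator {y. \<bar>y\<bar> > r} y \<le> std_normal_density y * y ^ (2 * 2) / r ^ 4"
    proof (cases "\<bar>y\<bar> > r")
      case True
      then have "r ^ 4 \<le> \<bar>y\<bar> ^ 4" using assms by (intro power_mono) auto
      then have "1 \<le> y ^ 4 / r ^ 4" using assms by (simp add: power_even_abs)
      from mult_left_mono[OF this, of "std_normal_density y"] True show ?thesis by simp
    qed (use assms in simp)
  qed
  also have "\<dots> = 3 / r ^ 4"
    using m4 by (simp add: has_bochner_integral_iff fact_numeral)
  finally show ?thesis .
qed

text \<open>If every step is at most \<open>\<delta> * sqrt m / 4\<close> in absolute value, an
  increment of the bridge is at most \<delta>: the drift contributes at most half of it, the step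
  and the average of the steps a quarter each. The constant is 768 = 3 * 256, with the 3 from the
  fourth moment and 256 the fourth power of 4.\<close>

lemma prob_large_step:
  assumes \<delta>: "\<delta> > 0" and m: "0 < m" "2 * \<bar>c\<bar> \<le> \<delta> * real m"
  shows "measure gauss_seq {x. \<exists>k<m. walk_bridge m c x (Suc k) - walk_bridge m c x k > \<delta>} \<le> 768 / (\<delta> ^ 4 * real m)"
proof -
  define r where "r = \<delta> * sqrt (real m) / 4"
  have r: "r > 0" using \<delta> m by (simp add: r_def)
  have sub: "{x. \<exists>k<m. walk_bridge m c x (Suc k) - walk_bridge m c x k > \<delta>} \<subseteq> (\<Union>i<m. {x. \<bar>x i\<bar> > r})"
  proof
    fix x assume "x \<in> {x. \<exists>k<m. walk_bridge m c x (Suc k) - walk_bridge m c x k > \<delta>}"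
    then obtain k where k: "k < m" "walk_bridge m c x (Suc k) - walk_bridge m c x k > \<delta>" by auto
    show "x \<in> (\<Union>i<m. {x. \<bar>x i\<bar> > r})"
    proof (rule ccontr)
      assume "x \<notin> (\<Union>i<m. {x. \<bar>x i\<bar> > r})"
      then have small: "\<bar>x i\<bar> \<le> r" if "i < m" for i using that by (auto simp: not_less)
      have "\<bar>\<Sum>l<m. x l\<bar> \<le> (\<Sum>l<m. \<bar>x l\<bar>)" by (rule sum_abs)
      also have "\<dots> \<le> (\<Sum>l<m. r)" using small by (intro sum_mono) auto
      finally have "\<bar>\<Sum>l<m. x l\<bar> / real m \<le> r" using m by (simp add: field_simps)
      moreover have "- (\<Sum>l<m. x l) / real m \<le> \<bar>\<Sum>l<m. x l\<bar> / real m"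
        by (intro divide_right_mono) auto
      ultimately have S: "- ((\<Sum>l<m. x l) / real m) \<le> r" by linarith
      have "walk_bridge m c x (Suc k) - walk_bridge m c x k = - c / real m + (x k - (\<Sum>l<m. x l) / real m) / sqrt (real m)"
      proof -
        have "loop m x (Suc k) - loop m x k = x k - (\<Sum>l<m. x l) / real m"
          by (simp add: loop_def add_divide_distrib ring_distribs)
        moreover have "c * (1 - real (Suc k) / real m) - c * (1 - real k / real m) = - c / real m"
          by (simp add: add_divide_distrib ring_distribs)
        ultimately show ?thesis
        proof -
          have "walk_bridge m c x (Suc k) - walk_bridge m c x k = (c * (1 - real (Suc k) / real m) - c * (1 - real k / real m))
              + (loop m x (Suc k) - loop m x k) / sqrt (real m)"
            unfolding walk_bridge_def diff_divide_distrib by simp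
          then show ?thesis
            unfolding \<open>loop m x (Suc k) - loop m x k = _\<close> \<open>c * (1 - real (Suc k) / real m) - c * (1 - real k / real m) = _\<close> .
        qed
      qed
      also have "\<dots> \<le> \<delta> / 2 + (r + r) / sqrt (real m)"
      proof (intro add_mono divide_right_mono)
        show "- c / real m \<le> \<delta> / 2" using m by (simp add: field_simps)
        show "x k - (\<Sum>l<m. x l) / real m \<le> r + r" using small[OF k(1)] S by linarith
      qed simp
      also have "\<dots> = \<delta>" using m by (simp add: r_def field_simps)
      finally show False using k(2) by simp
    qed
  qed
  have large: "{x. \<bar>x i\<bar> > r} \<in> sets gauss_seq" for i
  proof -
    have "{x\<in>space gauss_seq. \<bar>x i\<bar> > r} \<in> sets gauss_seq" by measurable
    then show ?thesis by simp
  qed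
  have "measure gauss_seq {x. \<exists>k<m. walk_bridge m c x (Suc k) - walk_bridge m c x k > \<delta>} \<le> measure gauss_seq (\<Union>i<m. {x. \<bar>x i\<bar> > r})"
    by (intro gauss_seq.finite_measure_mono sub sets.finite_UN large) auto
  also have "\<dots> \<le> (\<Sum>i<m. measure gauss_seq {x. \<bar>x i\<bar> > r})"
    using large by (intro gauss_seq.finite_measure_subadditive_finite) auto
  also have "\<dots> \<le> (\<Sum>i<m. 3 / r ^ 4)"
    by (intro sum_mono prob_coord_large r)
  also have "\<dots> = 768 / (\<delta> ^ 4 * real m)"
  proof -
    have "sqrt (real m) ^ 4 = (real m)\<^sup>2" by (simp add: power4_eq_xxxx power2_eq_square)
    then have r4: "r ^ 4 = \<delta> ^ 4 * (real m)\<^sup>2 / 256" by (simp add: r_def power_mult_distrib power_divide)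
    show ?thesis unfolding r4 using m \<delta> by (simp add: power2_eq_square)
  qed
  finally show ?thesis .
qed

text \<open>A reflection principle with overshoot. Paths that have passed zero by time
  \<open>j\<close> are split by their sign at \<open>j\<close>. The nonnegative ones include all
  paths above \<open>2 * \<delta>\<close>. The negative ones are at least as likely as those above
  twice their height at the passage, by \<open>prob_hits_at_reflect\<close>; without large steps
  that height is at most \<delta>, so being above \<open>2 * \<delta>\<close> suffices
  again.\<close>

lemma sum_prob_hits_at_ge:
  assumes c: "c < 0" and j: "j < m" and \<delta>: "\<delta> \<ge> 0"
  shows "2 * measure gauss_seq {x. walk_bridge m c x j > 2 * \<delta>}
      - measure gauss_seq {x. \<exists>k<m. walk_bridge m c x (Suc k) - walk_bridge m c x k > \<delta>}
    \<le> (\<Sum>k\<le>j. measure gauss_seq (hits_at m c k))"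
proof -
  let ?P = "measure gauss_seq"
  define Ov where "Ov = {x. \<exists>k<m. walk_bridge m c x (Suc k) - walk_bridge m c x k > \<delta>}"
  define W where "W = {x. walk_bridge m c x j > 2 * \<delta>}"
  have "{x \<in> space gauss_seq. walk_bridge m c x j > 2 * \<delta>} \<in> sets gauss_seq" by measurable
  then have [measurable]: "W \<in> sets gauss_seq" by (simp add: W_def)
  have "{x \<in> space gauss_seq. walk_bridge m c x (Suc k) - walk_bridge m c x k > \<delta>} \<in> sets gauss_seq" for k by measurable
  then have "(\<Union>k<m. {x \<in> space gauss_seq. walk_bridge m c x (Suc k) - walk_bridge m c x k > \<delta>}) \<in> sets gauss_seq"
    by (intro sets.finite_UN) auto
  also have "(\<Union>k<m. {x \<in> space gauss_seq. walk_bridge m c x (Suc k) - walk_bridge m c x k > \<delta>}) = Ov"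
    by (auto simp: Ov_def)
  finally have [measurable]: "Ov \<in> sets gauss_seq" .
  define A where "A = (\<lambda>k. {x. x \<in> hits_at m c k \<and> walk_bridge m c x j < 0})"
  define B where "B = (\<lambda>k. {x. x \<in> hits_at m c k \<and> \<not> walk_bridge m c x j < 0})"
  define C where "C = (\<lambda>k. {x. x \<in> hits_at m c k \<and> walk_bridge m c x j > 2 * walk_bridge m c x k})"
  have "{x \<in> space gauss_seq. x \<in> hits_at m c k \<and> walk_bridge m c x j < 0} \<in> sets gauss_seq"
    "{x \<in> space gauss_seq. x \<in> hits_at m c k \<and> \<not> walk_bridge m c x j < 0} \<in> sets gauss_seq"
    "{x \<in> space gauss_seq. x \<in> hits_at m c k \<and> walk_bridge m c x j > 2 * walk_bridge m c x k} \<in> sets gauss_seq" for k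
    by measurable
  then have ABC [measurable]: "A k \<in> sets gauss_seq" "B k \<in> sets gauss_seq" "C k \<in> sets gauss_seq" for k
    by (simp_all add: A_def B_def C_def)
  have ABC': "A ` I \<subseteq> sets gauss_seq" "B ` I \<subseteq> sets gauss_seq" "C ` I \<subseteq> sets gauss_seq" for I
    using ABC by blast+
  have AB: "?P (hits_at m c k) = ?P (A k) + ?P (B k)" for k
  proof -
    have "hits_at m c k = A k \<union> B k" "A k \<inter> B k = {}" by (auto simp: A_def B_def)
    then show ?thesis using gauss_seq.finite_measure_Union[OF ABC(1) ABC(2), of k k] by simp
  qed
  have "?P W \<le> ?P (\<Union>k\<le>j. B k)"
  proof (intro gauss_seq.finite_measure_mono)
    show "W \<subseteq> (\<Union>k\<le>j. B k)"
    proof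
      fix x assume x: "x \<in> W"
      then obtain k where "k \<le> j" "x \<in> hits_at m c k"
        using ex_hits_at[of m c x j] \<delta> by (auto simp: W_def)
      with x \<delta> show "x \<in> (\<Union>k\<le>j. B k)" by (auto simp: W_def B_def)
    qed
  qed (intro sets.finite_UN ABC, simp)
  also have "\<dots> \<le> (\<Sum>k\<le>j. ?P (B k))"
    by (intro gauss_seq.finite_measure_subadditive_finite ABC') simp
  finally have 1: "?P W \<le> (\<Sum>k\<le>j. ?P (B k))" .
  have "?P W \<le> ?P (Ov \<union> (\<Union>k<j. C k))"
  proof (intro gauss_seq.finite_measure_mono)
    show "W \<subseteq> Ov \<union> (\<Union>k<j. C k)"
    proof
      fix x assume x: "x \<in> W"
      then obtain k where k: "k \<le> j" "x \<in> hits_at m c k"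
        using ex_hits_at[of m c x j] \<delta> by (auto simp: W_def)
      show "x \<in> Ov \<union> (\<Union>k<j. C k)"
      proof (cases "x \<in> Ov")
        case False
        \<comment> \<open>The start is negative, so the passage happens in a step from below zero,
          and its height is at most the size of that step.\<close>
        have "k \<noteq> 0"
        proof
          assume "k = 0"
          then show False using k(2) c by (simp add: hits_at_def)
        qed
        then obtain k' where k': "k = Suc k'" by (cases k) auto
        have "walk_bridge m c x k' < 0" using k(2) k' by (auto simp: hits_at_def)
        moreover have "walk_bridge m c x (Suc k') - walk_bridge m c x k' \<le> \<delta>"
        proof -
          have "k' < m" using k k' j by simp
          with False show ?thesis unfolding Ov_def mem_Collect_eq by (meson not_less)
        qed
        ultimately have wk: "walk_bridge m c x k \<le> \<delta>" using k' by simp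
        have wj: "walk_bridge m c x j > 2 * \<delta>" using x by (simp add: W_def)
        then have "k \<noteq> j" using wk \<delta> by auto
        then show ?thesis using k wk wj by (auto simp: C_def intro!: bexI[of _ k])
      qed simp
    qed
  qed (intro sets.Un sets.finite_UN ABC \<open>Ov \<in> sets gauss_seq\<close>, simp)
  also have "\<dots> \<le> ?P Ov + ?P (\<Union>k<j. C k)"
    by (intro measure_Un_le sets.finite_UN ABC \<open>Ov \<in> sets gauss_seq\<close>) simp
  also have "?P (\<Union>k<j. C k) \<le> (\<Sum>k<j. ?P (C k))"
    by (intro gauss_seq.finite_measure_subadditive_finite ABC') simp
  also have "(\<Sum>k<j. ?P (C k)) \<le> (\<Sum>k<j. ?P (A k))"
    unfolding A_def C_def using prob_hits_at_reflect[of _ j m c] j by (intro sum_mono) auto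
  also have "\<dots> \<le> (\<Sum>k\<le>j. ?P (A k))"
    by (intro sum_mono2) auto
  finally have 2: "?P W \<le> ?P Ov + (\<Sum>k\<le>j. ?P (A k))" by simp
  have "(\<Sum>k\<le>j. ?P (hits_at m c k)) = (\<Sum>k\<le>j. ?P (A k)) + (\<Sum>k\<le>j. ?P (B k))"
    by (simp add: AB sum.distrib)
  then show ?thesis using 1 2 by (simp add: Ov_def[symmetric] W_def[symmetric])
qed

section \<open>The limit of the first passage law and of the number of negative points\<close>

definition hit_cdf :: "nat \<Rightarrow> real \<Rightarrow> real \<Rightarrow> real" where
  "hit_cdf m c \<tau> = (\<Sum>k\<in>{k. real k \<le> \<tau> * real m}. measure gauss_seq (hits_at m c k))"

text \<open>For fixed \<delta> the error from large steps vanishes as \<open>m\<close> grows; then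
  \<delta> tends to 0. The bound is twice the probability that a bridge from \<open>c\<close> is
  positive at time \<tau>, as the reflection principle predicts. It is phrased as a liminf in
  \<open>ennreal\<close> for use in Fatou's lemma.\<close>

lemma liminf_hit_cdf:
  assumes c: "c < 0" and \<tau>: "0 < \<tau>" "\<tau> < 1"
  shows "ennreal (2 * gauss_tail (- c * sqrt ((1 - \<tau>) / \<tau>))) \<le> liminf (\<lambda>m. ennreal (hit_cdf m c \<tau>))"
proof -
  define j where "j = (\<lambda>m. nat \<lfloor>\<tau> * real m\<rfloor>)"
  define \<rho> where "\<rho> = (\<lambda>m. real (j m) / real m)"
  have "(\<lambda>m. real_of_int \<lfloor>\<tau> * real m\<rfloor> / real m) \<longlonglongrightarrow> \<tau>"
    using \<tau> by real_asymp
  moreover have "real_of_int \<lfloor>\<tau> * real m\<rfloor> / real m = \<rho> m" for m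
    using \<tau> by (simp add: \<rho>_def j_def)
  ultimately have \<rho>: "\<rho> \<longlonglongrightarrow> \<tau>" by simp
  have ev: "\<forall>\<^sub>F m in sequentially. 0 < j m \<and> j m < m"
  proof -
    have "\<forall>\<^sub>F m in sequentially. 0 < \<rho> m \<and> \<rho> m < 1"
      using order_tendstoD[OF \<rho>] \<tau> by (auto intro: eventually_conj)
    then show ?thesis
      by eventually_elim (auto simp: \<rho>_def zero_less_divide_iff divide_less_eq_1 split: if_splits)
  qed
  have cdf: "hit_cdf m c \<tau> = (\<Sum>k\<le>j m. measure gauss_seq (hits_at m c k))" for m
  proof -
    have "{k. real k \<le> \<tau> * real m} = {..j m}"
      using \<tau> unfolding j_def by (auto simp: real_le_iff_nat_floor)
    then show ?thesis by (simp add: hit_cdf_def)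
  qed
  have main: "ennreal (2 * gauss_tail ((2 * \<delta> - c * (1 - \<tau>)) / sqrt (\<tau> * (1 - \<tau>)))) \<le> liminf (\<lambda>m. ennreal (hit_cdf m c \<tau>))"
    if \<delta>: "\<delta> > 0" for \<delta>
  proof -
    define h where "h = (\<lambda>m. 2 * gauss_tail ((2 * \<delta> - c * (1 - \<rho> m)) / sqrt (\<rho> m * (1 - \<rho> m))) - 768 / (\<delta> ^ 4 * real m))"
    have "(\<lambda>m. 768 / (\<delta> ^ 4 * real m)) \<longlonglongrightarrow> 0" using \<delta> by real_asymp
    then have "h \<longlonglongrightarrow> 2 * gauss_tail ((2 * \<delta> - c * (1 - \<tau>)) / sqrt (\<tau> * (1 - \<tau>))) - 0"
      unfolding h_def using \<tau> by (intro tendsto_intros \<rho>) auto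
    then have "liminf (\<lambda>m. ennreal (h m)) = ennreal (2 * gauss_tail ((2 * \<delta> - c * (1 - \<tau>)) / sqrt (\<tau> * (1 - \<tau>))))"
      by (intro lim_imp_Liminf tendsto_ennrealI) auto
    moreover have "\<forall>\<^sub>F m in sequentially. ennreal (h m) \<le> ennreal (hit_cdf m c \<tau>)"
    proof -
      have "\<forall>\<^sub>F m in sequentially. 2 * \<bar>c\<bar> \<le> \<delta> * real m"
        using \<delta> by real_asymp
      with ev show ?thesis
      proof eventually_elim
        case (elim m)
        have "measure gauss_seq {x. walk_bridge m c x (j m) > 2 * \<delta>} = gauss_tail ((2 * \<delta> - c * (1 - \<rho> m)) / sqrt (\<rho> m * (1 - \<rho> m)))"
          using elim by (intro prob_walk_bridge_gt) (auto simp: \<rho>_def)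
        moreover have "measure gauss_seq {x. \<exists>k<m. walk_bridge m c x (Suc k) - walk_bridge m c x k > \<delta>} \<le> 768 / (\<delta> ^ 4 * real m)"
          using elim \<delta> by (intro prob_large_step) auto
        ultimately have "h m \<le> (\<Sum>k\<le>j m. measure gauss_seq (hits_at m c k))"
          using sum_prob_hits_at_ge[OF c, of "j m" m \<delta>] elim \<delta> by (simp add: h_def)
        then show ?case by (simp add: cdf ennreal_leI)
      qed
    qed
    ultimately show ?thesis using Liminf_mono by metis
  qed
  have "((\<lambda>\<delta>. ennreal (2 * gauss_tail ((2 * \<delta> - c * (1 - \<tau>)) / sqrt (\<tau> * (1 - \<tau>))))) \<longlongrightarrow> ennreal (2 * gauss_tail ((2 * 0 - c * (1 - \<tau>)) / sqrt (\<tau> * (1 - \<tau>))))) (at_right 0)"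
    using \<tau> by (intro tendsto_ennrealI tendsto_intros) auto
  then have "ennreal (2 * gauss_tail ((2 * 0 - c * (1 - \<tau>)) / sqrt (\<tau> * (1 - \<tau>)))) \<le> liminf (\<lambda>m. ennreal (hit_cdf m c \<tau>))"
    by (rule tendsto_upperbound) (use main in \<open>auto simp: eventually_at_filter\<close>)
  moreover have "(2 * 0 - c * (1 - \<tau>)) / sqrt (\<tau> * (1 - \<tau>)) = - c * sqrt ((1 - \<tau>) / \<tau>)"
  proof -
    have "(1 - \<tau>) / sqrt (\<tau> * (1 - \<tau>)) = sqrt ((1 - \<tau>) / \<tau>)"
    proof -
      define a b where "a = sqrt (1 - \<tau>)" and "b = sqrt \<tau>"
      have ab: "1 - \<tau> = a * a" "a > 0" "b > 0" using \<tau> by (auto simp: a_def b_def)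
      have "sqrt (\<tau> * (1 - \<tau>)) = b * a" "sqrt ((1 - \<tau>) / \<tau>) = a / b"
        by (simp_all add: a_def b_def real_sqrt_mult real_sqrt_divide)
      then show ?thesis using ab by simp
    qed
    then have "- c * ((1 - \<tau>) / sqrt (\<tau> * (1 - \<tau>))) = - c * sqrt ((1 - \<tau>) / \<tau>)" by (simp only:)
    then show ?thesis by simp
  qed
  ultimately show ?thesis by simp
qed

text \<open>The weight is minus the derivative of \<open>(r - \<tau>) / (1 - \<tau>)\<close>, the
  probability that a uniform variable on [0, 1 - \<tau>] is at most \<open>r - \<tau>\<close>. The
  left side is thus, after integration by parts, the average of this probability over a passage time
  with the distribution function of \<open>liminf_hit_cdf\<close>. The antiderivative comes from
  \<open>occ_tail_ratio_deriv\<close> at \<open>w \<tau>\<close>, whose square is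
  \<open>\<kappa>\<^sup>2 * (1 - \<tau>) / \<tau>\<close>.\<close>

lemma occ_tail_first_passage_integral:
  assumes \<kappa>: "\<kappa> > 0" and r: "0 < r" "r < 1"
  shows "(\<integral>\<^sup>+\<tau>\<in>{0<..<r}. ennreal (2 * gauss_tail (\<kappa> * sqrt ((1 - \<tau>) / \<tau>)) * ((1 - r) / (1 - \<tau>)\<^sup>2)) \<partial>lborel)
    = ennreal (r * occ_tail (\<kappa> * sqrt ((1 - r) / r)))"
proof -
  define w where "w = (\<lambda>\<tau>. \<kappa> * sqrt ((1 - \<tau>) / \<tau>))"
  define R where "R = (\<lambda>w. occ_tail w / w\<^sup>2)"
  define F where "F = (\<lambda>\<tau>. (1 - r) * \<kappa>\<^sup>2 * R (w \<tau>))"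
  have "(\<integral>\<^sup>+\<tau>\<in>{0<..<r}. ennreal (2 * gauss_tail (w \<tau>) * ((1 - r) / (1 - \<tau>)\<^sup>2)) \<partial>lborel) = ennreal (F r - 0)"
  proof (rule nn_integral_FTC_Ioo)
    fix \<tau> assume t: "0 < \<tau>" "\<tau> < r"
    have t1: "\<tau> < 1" using t r by simp
    define s where "s = sqrt ((1 - \<tau>) / \<tau>)"
    have s: "s > 0" "s\<^sup>2 = (1 - \<tau>) / \<tau>" using t t1 by (auto simp: s_def)
    have wp: "w \<tau> > 0" using \<kappa> s(1) by (simp add: w_def s_def)
    have d1: "((\<lambda>\<tau>. (1 - \<tau>) / \<tau>) has_real_derivative - 1 / \<tau>\<^sup>2) (at \<tau>)"
      using t by (auto intro!: derivative_eq_intros simp: field_simps power2_eq_square)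
    have dw: "(w has_real_derivative \<kappa> * (- 1 / \<tau>\<^sup>2 * (inverse s / 2))) (at \<tau>)"
    proof -
      have "((\<lambda>\<tau>. sqrt ((1 - \<tau>) / \<tau>)) has_real_derivative inverse s / 2 * (- 1 / \<tau>\<^sup>2)) (at \<tau>)"
        unfolding s_def using t t1 by (intro DERIV_chain2[OF DERIV_real_sqrt d1]) simp
      from DERIV_cmult[OF this, of \<kappa>] show ?thesis
        unfolding w_def by (simp only: mult.commute mult.left_commute)
    qed
    from dw have "((\<lambda>\<tau>. R (w \<tau>)) has_real_derivative - 4 * gauss_tail (w \<tau>) / w \<tau> ^ 3 * (\<kappa> * (- 1 / \<tau>\<^sup>2 * (inverse s / 2)))) (at \<tau>)"
      unfolding R_def by (rule DERIV_chain2[where f="\<lambda>w. occ_tail w / w\<^sup>2" and g=w and x=\<tau>, OF occ_tail_ratio_deriv[OF wp]])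
    then have "(F has_real_derivative (1 - r) * \<kappa>\<^sup>2 * (- 4 * gauss_tail (w \<tau>) / w \<tau> ^ 3 * (\<kappa> * (- 1 / \<tau>\<^sup>2 * (inverse s / 2))))) (at \<tau>)"
      unfolding F_def by (rule DERIV_cmult)
    also have "(1 - r) * \<kappa>\<^sup>2 * (- 4 * gauss_tail (w \<tau>) / w \<tau> ^ 3 * (\<kappa> * (- 1 / \<tau>\<^sup>2 * (inverse s / 2)))) = 2 * gauss_tail (w \<tau>) * ((1 - r) / (1 - \<tau>)\<^sup>2)"
    proof -
      have t2: "1 - \<tau> = s\<^sup>2 * \<tau>" using s t by simp
      have wt: "w \<tau> ^ 3 = \<kappa> ^ 3 * s ^ 3" by (simp add: w_def s_def power_mult_distrib)
      show ?thesis
        unfolding wt t2 using s(1) t \<kappa> by (simp add: field_simps power2_eq_square power3_eq_cube)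
    qed
    finally show "(F has_real_derivative 2 * gauss_tail (w \<tau>) * ((1 - r) / (1 - \<tau>)\<^sup>2)) (at \<tau>)" .
    show "isCont (\<lambda>\<tau>. 2 * gauss_tail (w \<tau>) * ((1 - r) / (1 - \<tau>)\<^sup>2)) \<tau>"
    proof -
      have "isCont (\<lambda>\<tau>. gauss_tail (w \<tau>)) \<tau>"
        using DERIV_isCont[OF dw] isCont_gauss_tail by (rule isCont_o2)
      moreover have "isCont (\<lambda>\<tau>. (1 - r) / (1 - \<tau>)\<^sup>2) \<tau>"
        using t1 by (intro continuous_intros) auto
      ultimately show ?thesis by (intro isCont_mult continuous_const)
    qed
    show "0 \<le> 2 * gauss_tail (w \<tau>) * ((1 - r) / (1 - \<tau>)\<^sup>2)" using r by simp
  next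
    have "filterlim w at_top (at_right 0)" unfolding w_def using \<kappa> by real_asymp
    from filterlim_compose[OF occ_tail_ratio_at_top this]
    have "((\<lambda>\<tau>. (1 - r) * \<kappa>\<^sup>2 * R (w \<tau>)) \<longlongrightarrow> (1 - r) * \<kappa>\<^sup>2 * 0) (at_right 0)"
      unfolding R_def by (intro tendsto_mult tendsto_const)
    then show "(F \<longlongrightarrow> 0) (at_right 0)" by (simp add: F_def)
    have "(F \<longlongrightarrow> F r) (at r)"
      unfolding F_def R_def w_def using \<kappa> r by (intro tendsto_intros) auto
    then show "(F \<longlongrightarrow> F r) (at_left r)" by (simp add: filterlim_at_split)
  qed (use r in auto)
  also have "F r - 0 = r * occ_tail (w r)"
    using \<kappa> r by (simp add: F_def R_def w_def power_mult_distrib field_simps)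
  finally show ?thesis by (simp add: w_def)
qed

text \<open>Summation by parts: the weight of the passage time \<open>k\<close> in
  \<open>prob_neg_count_le\<close> is at least \<open>(r - k / m) / (1 - k / m)\<close>, the
  integral of \<open>v\<close> from \<open>k / m\<close> to \<open>r\<close>. Exchanging sum and
  integral turns the sum over \<open>k\<close> into an integral of \<open>hit_cdf\<close> against
  \<open>v\<close>, to which Fatou's lemma and \<open>liminf_hit_cdf\<close> apply.\<close>

lemma liminf_prob_neg_count_le:
  assumes c: "c < 0" and r: "0 < r" "r < 1"
  shows "ennreal (r * occ_tail (- c * sqrt ((1 - r) / r)))
    \<le> liminf (\<lambda>m. ennreal (measure gauss_seq {x. real (neg_count m c x) \<le> r * real m}))"
proof -
  define v where "v = (\<lambda>\<tau>. (1 - r) / (1 - \<tau>)\<^sup>2)"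
  have v: "v \<tau> \<ge> 0" for \<tau> using r by (simp add: v_def)
  have [measurable]: "v \<in> borel_measurable borel" unfolding v_def by measurable
  have fin: "finite {k. real k \<le> \<tau> * real m}" for \<tau> m
    by (rule finite_subset[of _ "{..nat \<lfloor>\<tau> * real m\<rfloor>}"]) (auto simp: le_nat_floor)
  have cdf_eq: "hit_cdf m c \<tau> = (\<Sum>k\<in>{k. real k \<le> r * real m}. measure gauss_seq (hits_at m c k) * indicator {real k / real m..} \<tau>)"
    if "m > 0" "\<tau> < r" for m \<tau>
  proof -
    have "k \<in> {k. real k \<le> \<tau> * real m} \<longleftrightarrow> real k \<le> r * real m \<and> real k / real m \<le> \<tau>" for k
    proof -
      have "\<tau> * real m \<le> r * real m" using that by (intro mult_right_mono) auto
      moreover have "real k / real m \<le> \<tau> \<longleftrightarrow> real k \<le> \<tau> * real m"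
        using that by (simp add: pos_divide_le_eq)
      ultimately show ?thesis unfolding mem_Collect_eq by linarith
    qed
    then have eq: "{k. real k \<le> \<tau> * real m} = {k\<in>{k. real k \<le> r * real m}. real k / real m \<le> \<tau>}" by auto
    have "hit_cdf m c \<tau> = (\<Sum>k\<in>{k\<in>{k. real k \<le> r * real m}. real k / real m \<le> \<tau>}. measure gauss_seq (hits_at m c k))"
      unfolding hit_cdf_def eq ..
    also have "\<dots> = (\<Sum>k\<in>{k. real k \<le> r * real m}. if real k / real m \<le> \<tau> then measure gauss_seq (hits_at m c k) else 0)"
      by (rule sum.inter_filter) (rule fin)
    also have "\<dots> = (\<Sum>k\<in>{k. real k \<le> r * real m}. measure gauss_seq (hits_at m c k) * indicator {real k / real m..} \<tau>)"
      by (intro sum.cong) (auto simp: indicator_def)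
    finally show ?thesis .
  qed
  have w: "(\<integral>\<^sup>+\<tau>\<in>{x..<r}. ennreal (v \<tau>) \<partial>lborel) = ennreal ((r - x) / (1 - x))" if "x \<le> r" for x
  proof (cases "x = r")
    case False
    with that have x: "x < r" by simp
    have "(\<integral>\<^sup>+\<tau>\<in>{x..<r}. ennreal (v \<tau>) \<partial>lborel) = (\<integral>\<^sup>+\<tau>\<in>{x<..<r}. ennreal (v \<tau>) \<partial>lborel)"
      by (rule nn_integral_cong_AE) (use AE_lborel_singleton[of x] in \<open>eventually_elim, auto simp: indicator_def\<close>)
    also have "\<dots> = ennreal ((1 - r) / (1 - r) - (1 - r) / (1 - x))"
    proof (rule nn_integral_FTC_Ioo)
      fix \<tau> assume "x < \<tau>" "\<tau> < r"
      then show "((\<lambda>\<tau>. (1 - r) / (1 - \<tau>)) has_real_derivative v \<tau>) (at \<tau>)"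
        unfolding v_def using r by (auto intro!: derivative_eq_intros simp: power2_eq_square)
      show "isCont v \<tau>" unfolding v_def using \<open>\<tau> < r\<close> r by (intro continuous_intros) auto
    next
      have "((\<lambda>\<tau>. (1 - r) / (1 - \<tau>)) \<longlongrightarrow> (1 - r) / (1 - r)) (at r)" "((\<lambda>\<tau>. (1 - r) / (1 - \<tau>)) \<longlongrightarrow> (1 - r) / (1 - x)) (at x)"
        using r x by (intro tendsto_intros; simp)+
      then show "((\<lambda>\<tau>. (1 - r) / (1 - \<tau>)) \<longlongrightarrow> (1 - r) / (1 - r)) (at_left r)" "((\<lambda>\<tau>. (1 - r) / (1 - \<tau>)) \<longlongrightarrow> (1 - r) / (1 - x)) (at_right x)"
        by (simp_all add: filterlim_at_split)
    qed (use x v in auto)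
    also have "(1 - r) / (1 - r) - (1 - r) / (1 - x) = (r - x) / (1 - x)"
      using r x by (simp add: field_simps)
    finally show ?thesis .
  qed simp
  have step: "(\<integral>\<^sup>+\<tau>\<in>{0<..<r}. ennreal (hit_cdf m c \<tau> * v \<tau>) \<partial>lborel) \<le> ennreal (measure gauss_seq {x. real (neg_count m c x) \<le> r * real m})"
    if m: "m > 0" for m
  proof -
    define K where "K = nat \<lfloor>r * real m\<rfloor>"
    have K: "{k. real k \<le> r * real m} = {..K}"
      using r unfolding K_def by (auto simp: real_le_iff_nat_floor)
    have Km: "K < m"
    proof -
      have "real K \<le> r * real m" using K by auto
      also have "\<dots> < real m" using r m by simp
      finally show ?thesis by simp
    qed
    \<comment> \<open>The loss from rounding \<open>r * m\<close> down to \<open>K\<close> is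
      covered by the \<open>+ 1\<close> of the discrete uniform law.\<close>
    have rK: "r * real m < real K + 1" using r unfolding K_def by simp
    have "(\<integral>\<^sup>+\<tau>\<in>{0<..<r}. ennreal (hit_cdf m c \<tau> * v \<tau>) \<partial>lborel)
      = (\<integral>\<^sup>+\<tau>. (\<Sum>k\<le>K. ennreal (measure gauss_seq (hits_at m c k)) * (ennreal (v \<tau>) * indicator ({real k / real m..<r} \<inter> {0<..}) \<tau>)) \<partial>lborel)"
    proof (intro nn_integral_cong)
      fix \<tau> :: real
      show "ennreal (hit_cdf m c \<tau> * v \<tau>) * indicator {0<..<r} \<tau> = (\<Sum>k\<le>K. ennreal (measure gauss_seq (hits_at m c k)) * (ennreal (v \<tau>) * indicator ({real k / real m..<r} \<inter> {0<..}) \<tau>))"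
      proof (cases "\<tau> \<in> {0<..<r}")
        case True
        then have "hit_cdf m c \<tau> * v \<tau> = (\<Sum>k\<le>K. measure gauss_seq (hits_at m c k) * (v \<tau> * indicator ({real k / real m..<r} \<inter> {0<..}) \<tau>))"
        proof -
          have "hit_cdf m c \<tau> * v \<tau> = (\<Sum>k\<le>K. measure gauss_seq (hits_at m c k) * indicator {real k / real m..} \<tau> * v \<tau>)"
            using cdf_eq[OF m, of \<tau>] True unfolding K by (simp only: sum_distrib_right greaterThanLessThan_iff)
          also have "\<dots> = (\<Sum>k\<le>K. measure gauss_seq (hits_at m c k) * (v \<tau> * indicator ({real k / real m..<r} \<inter> {0<..}) \<tau>))"
            using True by (intro sum.cong) (auto simp: indicator_def)
          finally show ?thesis .
        qed
        also have "ennreal \<dots> = (\<Sum>k\<le>K. ennreal (measure gauss_seq (hits_at m c k) * (v \<tau> * indicator ({real k / real m..<r} \<inter> {0<..}) \<tau>)))"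
          by (rule sum_ennreal[symmetric]) (auto simp: v)
        also have "\<dots> = (\<Sum>k\<le>K. ennreal (measure gauss_seq (hits_at m c k)) * (ennreal (v \<tau>) * indicator ({real k / real m..<r} \<inter> {0<..}) \<tau>))"
          by (intro sum.cong) (auto simp: ennreal_mult v indicator_def)
        finally show ?thesis using True by simp
      qed (auto simp: indicator_def)
    qed
    also have "\<dots> = (\<Sum>k\<le>K. ennreal (measure gauss_seq (hits_at m c k)) * (\<integral>\<^sup>+\<tau>. ennreal (v \<tau>) * indicator ({real k / real m..<r} \<inter> {0<..}) \<tau> \<partial>lborel))"
      by (subst nn_integral_sum) (auto simp: nn_integral_cmult)
    also have "\<dots> \<le> (\<Sum>k\<le>K. ennreal (measure gauss_seq (hits_at m c k) * ((real K - real k + 1) / (real m - real k))))"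
    proof (rule sum_mono)
      fix k assume k: "k \<in> {..K}"
      then have km: "real k \<le> r * real m" "k < m" using K Km by auto
      have "(\<integral>\<^sup>+\<tau>. ennreal (v \<tau>) * indicator ({real k / real m..<r} \<inter> {0<..}) \<tau> \<partial>lborel) \<le> (\<integral>\<^sup>+\<tau>\<in>{real k / real m..<r}. ennreal (v \<tau>) \<partial>lborel)"
        by (intro nn_integral_mono) (auto simp: indicator_def)
      also have "\<dots> = ennreal ((r - real k / real m) / (1 - real k / real m))"
        using km m by (intro w) (simp add: field_simps)
      also have "(r - real k / real m) / (1 - real k / real m) = (r * real m - real k) / (real m - real k)"
        using km m by (simp add: divide_simps)
      also have "ennreal ((r * real m - real k) / (real m - real k)) \<le> ennreal ((real K - real k + 1) / (real m - real k))"
        using rK km by (intro ennreal_leI divide_right_mono) auto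
      finally show "ennreal (measure gauss_seq (hits_at m c k)) * (\<integral>\<^sup>+\<tau>. ennreal (v \<tau>) * indicator ({real k / real m..<r} \<inter> {0<..}) \<tau> \<partial>lborel)
        \<le> ennreal (measure gauss_seq (hits_at m c k) * ((real K - real k + 1) / (real m - real k)))"
        using km k by (subst ennreal_mult) (auto intro!: mult_left_mono)
    qed
    also have "\<dots> = ennreal (\<Sum>k\<le>K. measure gauss_seq (hits_at m c k) * ((real K - real k + 1) / (real m - real k)))"
      using Km by (intro sum_ennreal) auto
    also have "\<dots> \<le> ennreal (measure gauss_seq {x. neg_count m c x \<le> K})"
      by (intro ennreal_leI prob_neg_count_le Km)
    also have "{x. neg_count m c x \<le> K} = {x. real (neg_count m c x) \<le> r * real m}"
      using K by auto
    finally show ?thesis .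
  qed
  have hm: "hit_cdf m c \<in> borel_measurable borel" for m
  proof -
    have "mono (hit_cdf m c)"
    proof (unfold hit_cdf_def, intro monoI sum_mono2 fin)
      fix x y :: real assume "x \<le> y"
      then have "x * real m \<le> y * real m" by (intro mult_right_mono) auto
      then show "{k. real k \<le> x * real m} \<subseteq> {k. real k \<le> y * real m}" by auto
    qed simp
    then show ?thesis by (rule borel_measurable_mono)
  qed
  have "ennreal (r * occ_tail (- c * sqrt ((1 - r) / r))) = (\<integral>\<^sup>+\<tau>\<in>{0<..<r}. ennreal (2 * gauss_tail (- c * sqrt ((1 - \<tau>) / \<tau>)) * v \<tau>) \<partial>lborel)"
    using occ_tail_first_passage_integral[of "- c" r] c r by (simp add: v_def)
  also have "\<dots> \<le> (\<integral>\<^sup>+\<tau>. liminf (\<lambda>m. ennreal (hit_cdf m c \<tau> * v \<tau>) * indicator {0<..<r} \<tau>) \<partial>lborel)"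
  proof (intro nn_integral_mono)
    fix \<tau> :: real
    show "ennreal (2 * gauss_tail (- c * sqrt ((1 - \<tau>) / \<tau>)) * v \<tau>) * indicator {0<..<r} \<tau> \<le> liminf (\<lambda>m. ennreal (hit_cdf m c \<tau> * v \<tau>) * indicator {0<..<r} \<tau>)"
    proof (cases "\<tau> \<in> {0<..<r}")
      case True
      have "ennreal (2 * gauss_tail (- c * sqrt ((1 - \<tau>) / \<tau>)) * v \<tau>) = ennreal (v \<tau>) * ennreal (2 * gauss_tail (- c * sqrt ((1 - \<tau>) / \<tau>)))"
        using v by (simp add: ennreal_mult mult.commute)
      also have "\<dots> \<le> ennreal (v \<tau>) * liminf (\<lambda>m. ennreal (hit_cdf m c \<tau>))"
        using True r by (intro mult_left_mono liminf_hit_cdf c) auto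
      also have "\<dots> = liminf (\<lambda>m. ennreal (v \<tau>) * ennreal (hit_cdf m c \<tau>))"
        by (rule Liminf_compose_continuous_mono[of "\<lambda>x. ennreal (v \<tau>) * x", symmetric])
          (auto intro!: monoI mult_left_mono ennreal_continuous_on_cmult continuous_intros)
      also have "\<dots> = liminf (\<lambda>m. ennreal (hit_cdf m c \<tau> * v \<tau>))"
        using v by (simp add: ennreal_mult' mult.commute)
      finally show ?thesis using True by simp
    qed simp
  qed
  also have "\<dots> \<le> liminf (\<lambda>m. \<integral>\<^sup>+\<tau>\<in>{0<..<r}. ennreal (hit_cdf m c \<tau> * v \<tau>) \<partial>lborel)"
  proof (rule nn_integral_liminf)
    fix m
    have "(\<lambda>\<tau>. hit_cdf m c \<tau> * v \<tau>) \<in> borel_measurable lborel"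
      using hm[of m] by (intro borel_measurable_times) auto
    then show "(\<lambda>\<tau>. ennreal (hit_cdf m c \<tau> * v \<tau>) * indicator {0<..<r} \<tau>) \<in> borel_measurable lborel"
      by (intro borel_measurable_times_ennreal measurable_compose[OF _ measurable_ennreal]) auto
  qed
  also have "\<dots> \<le> liminf (\<lambda>m. ennreal (measure gauss_seq {x. real (neg_count m c x) \<le> r * real m}))"
    by (rule Liminf_mono) (use step in \<open>auto intro: eventually_mono[OF eventually_gt_at_top[of 0]]\<close>)
  finally show ?thesis .
qed

section \<open>Discretisation of the Brownian bridge\<close>

text \<open>The cell of \<open>j = m\<close> starts at 1; it is included so that the approximation
  is right at the end point of the unit interval.\<close>

definition step_path :: "nat \<Rightarrow> (real \<Rightarrow> real) \<Rightarrow> real \<Rightarrow> real" where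
  "step_path m f s = (\<Sum>j\<le>m. f (real j / real m) * indicator {real j / real m..<(real j + 1) / real m} s)"

lemma step_path_eq:
  assumes "m > 0" "0 \<le> s" "s \<le> 1"
  shows "step_path m f s = f (real (nat \<lfloor>s * real m\<rfloor>) / real m)"
proof -
  define i where "i = nat \<lfloor>s * real m\<rfloor>"
  have "s * real m \<le> real m" using assms by (simp add: mult_left_le_one_le)
  then have i: "i \<le> m" unfolding i_def by (simp add: nat_le_iff floor_le_iff)
  have "real j / real m \<le> s \<and> s < (real j + 1) / real m \<longleftrightarrow> j = i" for j
  proof -
    have "real j / real m \<le> s \<and> s < (real j + 1) / real m \<longleftrightarrow> real j \<le> s * real m \<and> s * real m < real j + 1"
      using assms by (simp add: pos_divide_le_eq pos_less_divide_eq)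
    also have "\<dots> \<longleftrightarrow> \<lfloor>s * real m\<rfloor> = int j" by (simp add: floor_eq_iff)
    also have "\<dots> \<longleftrightarrow> j = i" using assms by (auto simp: i_def)
    finally show ?thesis .
  qed
  then have "step_path m f s = (\<Sum>j\<le>m. if j = i then f (real j / real m) else 0)"
    unfolding step_path_def by (intro sum.cong) (auto simp: indicator_def)
  then show ?thesis using i by (simp add: i_def)
qed

lemma step_path_tendsto:
  assumes f: "continuous_on {0..1} f" and s: "s \<in> {0..1}"
  shows "(\<lambda>m. step_path m f s) \<longlonglongrightarrow> f s"
proof -
  define g where "g = (\<lambda>m. real (nat \<lfloor>s * real m\<rfloor>) / real m)"
  have "(\<lambda>m. real_of_int \<lfloor>s * real m\<rfloor> / real m) \<longlonglongrightarrow> s"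
  proof (rule tendsto_sandwich[of "\<lambda>m. s - 1 / real m" _ _ "\<lambda>_. s"])
    show "\<forall>\<^sub>F m in sequentially. s - 1 / real m \<le> real_of_int \<lfloor>s * real m\<rfloor> / real m"
      using eventually_gt_at_top[of 0]
    proof eventually_elim
      case (elim m)
      have "s * real m - 1 \<le> real_of_int \<lfloor>s * real m\<rfloor>" by linarith
      then have "(s * real m - 1) / real m \<le> real_of_int \<lfloor>s * real m\<rfloor> / real m" by (rule divide_right_mono) simp
      then show ?case using elim by (simp add: diff_divide_distrib)
    qed
    show "\<forall>\<^sub>F m in sequentially. real_of_int \<lfloor>s * real m\<rfloor> / real m \<le> s"
      using eventually_gt_at_top[of 0] by eventually_elim (simp add: pos_divide_le_eq)
    show "(\<lambda>m. s - 1 / real m) \<longlonglongrightarrow> s" by real_asymp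
  qed simp
  moreover have "real_of_int \<lfloor>s * real m\<rfloor> / real m = g m" for m using s by (simp add: g_def)
  ultimately have g: "g \<longlonglongrightarrow> s" by simp
  have g01: "g m \<in> {0..1}" for m
  proof (cases "m = 0")
    case False
    have "real_of_int \<lfloor>s * real m\<rfloor> \<le> s * real m" by simp
    also have "\<dots> \<le> real m" using s by (simp add: mult_left_le_one_le)
    finally show ?thesis using False s by (simp add: g_def)
  qed (simp add: g_def)
  have "(\<lambda>m. f (g m)) \<longlonglongrightarrow> f s"
    using f s g g01 by (auto simp: continuous_on_sequentially comp_def)
  then show ?thesis
  proof (rule Lim_transform_eventually)
    show "\<forall>\<^sub>F m in sequentially. f (g m) = step_path m f s"
      using eventually_gt_at_top[of 0] by eventually_elim (use s in \<open>simp add: step_path_eq g_def\<close>)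
  qed
qed

lemma continuous_on_unit_interval_bound:
  assumes "continuous_on {0..1::real} (k :: real \<Rightarrow> real)"
  obtains B where "\<And>s. s \<in> {0..1} \<Longrightarrow> \<bar>k s\<bar> \<le> B"
proof -
  have "compact (k ` {0..1})" by (rule compact_continuous_image[OF assms]) simp
  then obtain B where "\<forall>x\<in>k ` {0..1}. norm x \<le> B"
    using compact_imp_bounded bounded_iff by metis
  then show thesis by (intro that[of B]) auto
qed

lemma riemann_sum_tendsto:
  assumes k: "continuous_on {0..1} k"
  shows "(\<lambda>m. (\<Sum>j<m. k (real j / real m)) / real m) \<longlonglongrightarrow> (LINT s:{0..1}|lborel. k s)"
proof -
  obtain B where B: "\<And>s. s \<in> {0..1} \<Longrightarrow> \<bar>k s\<bar> \<le> B" using continuous_on_unit_interval_bound[OF k] by metis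
  \<comment> \<open>The half-open interval removes the cell that starts at 1, which leaves exactly
    the indices \<open>j < m\<close> of the Riemann sum.\<close>
  have A: "(\<lambda>m. LINT s|lborel. indicator {0..<1} s * step_path m k s) \<longlonglongrightarrow> (LINT s|lborel. indicator {0..<1} s * k s)"
  proof (rule integral_dominated_convergence[where w="\<lambda>s. B * indicator {0..1} s"])
    have "continuous_on {0..<1} k" using k by (rule continuous_on_subset) auto
    then show "(\<lambda>s. indicator {0..<1} s * k s) \<in> borel_measurable lborel"
      using borel_measurable_continuous_on_indicator[of "{0..<1}" k] by simp
    show "(\<lambda>s. indicator {0..<1} s * step_path m k s) \<in> borel_measurable lborel" for m
      unfolding step_path_def by measurable
    show "AE s in lborel. (\<lambda>m. indicator {0..<1} s * step_path m k s) \<longlonglongrightarrow> indicator {0..<1} s * k s"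
    proof (rule AE_I2)
      fix s :: real
      show "(\<lambda>m. indicator {0..<1} s * step_path m k s) \<longlonglongrightarrow> indicator {0..<1} s * k s"
        by (cases "s \<in> {0..<1}") (auto intro!: step_path_tendsto k)
    qed
    fix m
    show "AE s in lborel. norm (indicator {0..<1} s * step_path m k s) \<le> B * indicator {0..1} s"
    proof (rule AE_I2)
      fix s :: real
      show "norm (indicator {0..<1} s * step_path m k s) \<le> B * indicator {0..1} s"
      proof (cases "s \<in> {0..<1}")
        case True
        show ?thesis
        proof (cases "m = 0")
          case False
          have "real_of_int \<lfloor>s * real m\<rfloor> \<le> s * real m" by simp
          also have "\<dots> \<le> real m" using True by (simp add: mult_left_le_one_le)
          finally show ?thesis using False True B[of "real (nat \<lfloor>s * real m\<rfloor>) / real m"] by (simp add: step_path_eq)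
        qed (use True B[of 0] in \<open>simp add: step_path_def\<close>)
      next
        case False
        then show ?thesis using B[of 0] by (auto simp: indicator_def)
      qed
    qed
  qed auto
  have eq: "(LINT s|lborel. indicator {0..<1} s * step_path m k s) = (\<Sum>j<m. k (real j / real m)) / real m" if "m > 0" for m
  proof -
    have steps: "indicator {0..<1} s * step_path m k s = (\<Sum>j<m. k (real j / real m) * indicator {real j / real m..<(real j + 1) / real m} s)" for s
    proof -
      have "indicator {0..<1} s * step_path m k s = (\<Sum>j\<le>m. k (real j / real m) * (indicator {0..<1} s * indicator {real j / real m..<(real j + 1) / real m} s))"
        unfolding step_path_def sum_distrib_left by (intro sum.cong) (simp_all only: mult_ac)
      also have "\<dots> = (\<Sum>j<m. k (real j / real m) * (indicator {0..<1} s * indicator {real j / real m..<(real j + 1) / real m} s))"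
        using that by (intro sum.mono_neutral_right) (auto simp: indicator_def)
      also have "\<dots> = (\<Sum>j<m. k (real j / real m) * indicator {real j / real m..<(real j + 1) / real m} s)"
      proof (intro sum.cong refl)
        fix j assume j: "j \<in> {..<m}"
        have "0 \<le> real j / real m" by simp
        moreover have "(real j + 1) / real m \<le> 1" using j that by (simp add: field_simps)
        ultimately show "k (real j / real m) * (indicator {0..<1} s * indicator {real j / real m..<(real j + 1) / real m} s) = k (real j / real m) * indicator {real j / real m..<(real j + 1) / real m} s"
          by (auto simp: indicator_def dest: order_trans[OF \<open>0 \<le> real j / real m\<close>])
      qed
      finally show ?thesis .
    qed
    have "(LINT s|lborel. indicator {0..<1} s * step_path m k s) = (\<Sum>j<m. k (real j / real m) * measure lborel {real j / real m..<(real j + 1) / real m})"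
    proof -
      have "(LINT s|lborel. indicator {0..<1} s * step_path m k s) = (LINT s|lborel. (\<Sum>j<m. k (real j / real m) * indicator {real j / real m..<(real j + 1) / real m} s))"
        by (simp only: steps)
      also have "\<dots> = (\<Sum>j<m. (LINT s|lborel. k (real j / real m) * indicator {real j / real m..<(real j + 1) / real m} s))"
        by (rule Bochner_Integration.integral_sum) (auto intro!: integrable_mult_right integrable_real_indicator simp: emeasure_lborel_Ico divide_right_mono)
      finally show ?thesis by simp
    qed
    also have "\<dots> = (\<Sum>j<m. k (real j / real m) * (1 / real m))"
      using that by (intro sum.cong) (auto simp: divide_right_mono diff_divide_distrib[symmetric])
    also have "\<dots> = (\<Sum>j<m. k (real j / real m)) / real m"
      by (simp add: sum_divide_distrib)
    finally show ?thesis .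
  qed
  have lim: "(\<lambda>m. (\<Sum>j<m. k (real j / real m)) / real m) \<longlonglongrightarrow> (LINT s|lborel. indicator {0..<1} s * k s)"
    by (rule Lim_transform_eventually[OF A], rule eventually_mono[OF eventually_gt_at_top[of 0]], rule eq)
  have "(LINT s|lborel. indicator {0..<1} s * k s) = (LINT s|lborel. indicator {0..1} s *\<^sub>R k s)"
  proof (rule integral_cong_AE)
    show "(\<lambda>s. indicator {0..<1} s * k s) \<in> borel_measurable lborel"
    proof -
      have "continuous_on {0..<1} k" using k by (rule continuous_on_subset) auto
      then show ?thesis
        using borel_measurable_continuous_on_indicator[of "{0..<1}" k] by simp
    qed
    show "(\<lambda>s. indicator {0..1} s *\<^sub>R k s) \<in> borel_measurable lborel"
      using borel_measurable_continuous_on_indicator[of "{0..1}" k] k by simp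
    show "AE s in lborel. indicator {0..<1} s * k s = indicator {0..1} s *\<^sub>R k s"
      using AE_lborel_singleton[of 1] by eventually_elim (auto simp: indicator_def)
  qed
  with lim show ?thesis by (simp add: set_lebesgue_integral_def)
qed

text \<open>Continuous minorants that converge pointwise to the indicator of the negative half-line.
  Continuity makes their Riemann sums along a path converge, which is not assured for the indicator
  itself; as minorants they can be compared with counts of negative grid points.\<close>

definition neg_ramp :: "nat \<Rightarrow> real \<Rightarrow> real" where
  "neg_ramp n z = min 1 (max 0 (- (real n * z)))"

lemma neg_ramp_le: "neg_ramp n z \<le> indicator {..<0} z"
  by (auto simp: neg_ramp_def indicator_def zero_le_mult_iff)

lemma neg_ramp_nonneg: "0 \<le> neg_ramp n z" and neg_ramp_le_1: "neg_ramp n z \<le> 1"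
  by (auto simp: neg_ramp_def)

lemma continuous_on_neg_ramp [continuous_intros]:
  "continuous_on A f \<Longrightarrow> continuous_on A (\<lambda>x. neg_ramp n (f x))"
  unfolding neg_ramp_def by (intro continuous_intros)

lemma borel_measurable_neg_ramp [measurable]: "neg_ramp n \<in> borel_measurable borel"
  unfolding neg_ramp_def by measurable

lemma neg_ramp_tendsto: "(\<lambda>n. neg_ramp n z) \<longlonglongrightarrow> indicator {..<0} z"
proof (cases "z < 0")
  case True
  have "\<forall>\<^sub>F n in sequentially. 1 \<le> real n * (- z)"
    using True by real_asymp
  then have "\<forall>\<^sub>F n in sequentially. neg_ramp n z = 1"
    by eventually_elim (auto simp: neg_ramp_def)
  then have "(\<lambda>n. neg_ramp n z) \<longlonglongrightarrow> 1" by (rule tendsto_eventually)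
  then show ?thesis using True by simp
next
  case False
  then have "0 \<le> real n * z" for n by simp
  then have "neg_ramp n z = 0" for n by (simp add: neg_ramp_def)
  then show ?thesis using False by simp
qed

section \<open>The time that a continuous path spends below zero\<close>

lemma measurable_neg_indicator:
  fixes f :: "real \<Rightarrow> real"
  assumes "continuous_on {0..1} f"
  shows "(\<lambda>s. indicator {0..1} s * indicator {..<0} (f s) :: real) \<in> borel_measurable lborel"
proof -
  have "(\<lambda>s. indicator {0..1} s *\<^sub>R f s) \<in> borel_measurable borel"
    using assms by (intro borel_measurable_continuous_on_indicator) auto
  then have [measurable]: "(\<lambda>s. indicator {0..1} s * f s) \<in> borel_measurable borel" by simp
  have "(\<lambda>s. indicator {..<0} (indicator {0..1} s * f s) :: real) \<in> borel_measurable lborel"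
    by measurable
  moreover have "(\<lambda>s. indicator {..<0} (indicator {0..1} s * f s) :: real) = (\<lambda>s. indicator {0..1} s * indicator {..<0} (f s))"
    by (auto simp: indicator_def fun_eq_iff)
  ultimately show ?thesis by simp
qed

lemma neg_ramp_integral_tendsto:
  assumes f: "continuous_on {0..1} f"
  shows "(\<lambda>n. LINT s:{0..1}|lborel. neg_ramp n (f s)) \<longlonglongrightarrow> neg_time {0..1} f"
  unfolding neg_time_def set_lebesgue_integral_def real_scaleR_def
proof (rule integral_dominated_convergence[where w="indicator {0..1}"])
  show "(\<lambda>s. indicator {0..1} s * indicator {..<0} (f s) :: real) \<in> borel_measurable lborel"
    by (rule measurable_neg_indicator[OF f])
  show "(\<lambda>s. indicator {0..1} s * neg_ramp n (f s)) \<in> borel_measurable lborel" for n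
    using borel_measurable_continuous_on_indicator[OF _ continuous_on_neg_ramp[OF f]] by simp
  show "AE s in lborel. (\<lambda>n. indicator {0..1} s * neg_ramp n (f s)) \<longlonglongrightarrow> indicator {0..1} s * indicator {..<0} (f s)"
    by (intro AE_I2 tendsto_intros neg_ramp_tendsto)
  show "AE s in lborel. norm (indicator {0..1} s * neg_ramp n (f s)) \<le> indicator {0..1} s" for n
    using neg_ramp_nonneg neg_ramp_le_1 by (intro AE_I2) (auto simp: indicator_def)
qed auto

lemma neg_time_integrable:
  fixes f :: "real \<Rightarrow> real"
  assumes "continuous_on {0..1} f"
  shows "integrable lborel (\<lambda>s. indicator {0..1} s * indicator {..<0} (f s) :: real)"
proof (rule Bochner_Integration.integrable_bound)
  show "integrable lborel (indicator {0..1} :: real \<Rightarrow> real)" by simp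
  show "(\<lambda>s. indicator {0..1} s * indicator {..<0} (f s) :: real) \<in> borel_measurable lborel"
    by (rule measurable_neg_indicator[OF assms])
  show "AE s in lborel. norm (indicator {0..1} s * indicator {..<0} (f s) :: real) \<le> norm (indicator {0..1} s :: real)"
    by (rule AE_I2) (simp add: indicator_def)
qed

lemma neg_time_le_1:
  assumes "continuous_on {0..1} f"
  shows "neg_time {0..1} f \<le> 1"
proof -
  have "neg_time {0..1} f \<le> (LINT s::real|lborel. indicator {0..1} s :: real)"
    unfolding neg_time_def set_lebesgue_integral_def real_scaleR_def
    by (rule integral_mono[OF neg_time_integrable[OF assms]]) (simp, auto simp: indicator_def)
  then show ?thesis by simp
qed

lemma neg_time_nonneg: "0 \<le> neg_time T f"
  unfolding neg_time_def set_lebesgue_integral_def by (intro integral_nonneg_AE) auto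

lemma neg_time_antimono:
  assumes "continuous_on {0..1} f" "continuous_on {0..1} h" "\<And>s. s \<in> {0..1} \<Longrightarrow> f s \<le> h s"
  shows "neg_time {0..1} h \<le> neg_time {0..1} f"
  unfolding neg_time_def set_lebesgue_integral_def real_scaleR_def
  using neg_time_integrable[OF assms(1)] neg_time_integrable[OF assms(2)] assms(3)
  by (intro integral_mono) (fastforce simp: indicator_def)+

text \<open>Time spent exactly at zero counts for neither path; the inequality is all that
  \<open>occ_cdf_reflect\<close> requires.\<close>

lemma neg_time_add_neg_time_uminus:
  assumes f: "continuous_on {0..1} f"
  shows "neg_time {0..1} f + neg_time {0..1} (\<lambda>s. - f s) \<le> 1"
proof -
  have f': "continuous_on {0..1} (\<lambda>s. - f s)" using f by (intro continuous_intros)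
  have "neg_time {0..1} f + neg_time {0..1} (\<lambda>s. - f s)
    = (LINT s|lborel. indicator {0..1} s * indicator {..<0} (f s) + indicator {0..1} s * indicator {..<0} (- f s))"
    unfolding neg_time_def set_lebesgue_integral_def real_scaleR_def
    using neg_time_integrable[OF f] neg_time_integrable[OF f'] by simp
  also have "\<dots> \<le> (LINT s::real|lborel. indicator {0..1} s :: real)"
    by (rule integral_mono[OF Bochner_Integration.integrable_add[OF neg_time_integrable[OF f] neg_time_integrable[OF f']]])
      (simp, auto simp: indicator_def)
  finally show ?thesis by simp
qed

lemma neg_time_pos_mult: "a > 0 \<Longrightarrow> neg_time T (\<lambda>s. a * f s) = neg_time T f"
  by (simp add: neg_time_def indicator_def mult_less_0_iff)

lemma neg_time_scale:
  assumes "t > 0"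
  shows "neg_time {0..t} f = t * neg_time {0..1} (\<lambda>s. f (t * s))"
proof -
  have "neg_time {0..t} f = (LINT s|lborel. indicator {0..t} s * indicator {..<0} (f s))"
    by (simp add: neg_time_def set_lebesgue_integral_def)
  also have "\<dots> = \<bar>t\<bar> * (LINT s|lborel. indicator {0..t} (0 + t * s) * indicator {..<0} (f (0 + t * s)))"
    using assms by (subst lborel_integral_real_affine[where c=t and t=0]) auto
  also have "(\<lambda>s. indicator {0..t} (0 + t * s) * indicator {..<0} (f (0 + t * s)) :: real) = (\<lambda>s. indicator {0..1} s * indicator {..<0} (f (t * s)))"
    using assms by (auto simp: fun_eq_iff indicator_def zero_le_mult_iff mult_le_cancel_left1)
  finally show ?thesis using assms by (simp add: neg_time_def set_lebesgue_integral_def)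
qed

lemma measurable_process_grid:
  assumes "continuous_process P {0..1} X" "j \<le> m"
  shows "X (real j / real m) \<in> borel_measurable P"
  using assms unfolding continuous_process_def by (auto simp: divide_le_eq_1)

text \<open>On continuous paths this is evaluation at \<open>s\<close>; unlike evaluation it is jointly measurable in \<open>f\<close>
  and \<open>s\<close> for the product sigma-algebra on paths.\<close>

definition path_eval :: "(real \<Rightarrow> real) \<Rightarrow> real \<Rightarrow> real" where
  "path_eval f s = lim (\<lambda>m. step_path m f s)"

text \<open>The tilt is an argument of its own, so that joint measurability in the starting point
  and the path is available: the starting point \<open>y / sqrt t\<close> later varies with the
  variable of integration.\<close>

definition tilted_neg_time :: "real \<Rightarrow> (real \<Rightarrow> real) \<Rightarrow> real" where
  "tilted_neg_time c f = (LINT s:{0..1}|lborel. indicator {..<0} (path_eval f s + c * (1 - s)))"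

lemma tilted_neg_time_eq:
  assumes "continuous_on {0..1} f"
  shows "tilted_neg_time c (\<lambda>s\<in>{0..1}. f s) = neg_time {0..1} (\<lambda>s. f s + c * (1 - s))"
proof -
  have "path_eval (\<lambda>s\<in>{0..1}. f s) s = f s" if "s \<in> {0..1}" for s
  proof -
    have "continuous_on {0..1} (\<lambda>s\<in>{0..1}. f s)"
      using assms by (subst continuous_on_cong[OF refl, of _ _ f]) auto
    from step_path_tendsto[OF this that] show ?thesis
      unfolding path_eval_def using that by (auto intro: limI)
  qed
  then show ?thesis
    unfolding tilted_neg_time_def neg_time_def by (intro set_lebesgue_integral_cong) auto
qed

lemma measurable_tilted_neg_time:
  "(\<lambda>z. tilted_neg_time (fst z) (snd z)) \<in> borel_measurable (borel \<Otimes>\<^sub>M path_space {0..1})"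
proof -
  have coord: "(\<lambda>w. snd (fst w) (real j / real m)) \<in> borel_measurable ((borel \<Otimes>\<^sub>M path_space {0..1}) \<Otimes>\<^sub>M lborel)" if "j \<le> m" for j m
  proof -
    have "real j / real m \<in> {0..1}" using that by (auto simp: divide_le_eq_1)
    then have "(\<lambda>f. f (real j / real m)) \<in> borel_measurable (path_space {0..1})"
      by (rule measurable_component_singleton)
    then show ?thesis
      by (rule measurable_compose[rotated]) measurable
  qed
  have "(\<lambda>w. step_path m (snd (fst w)) (snd w)) \<in> borel_measurable ((borel \<Otimes>\<^sub>M path_space {0..1}) \<Otimes>\<^sub>M lborel)" for m
    unfolding step_path_def
    by (intro borel_measurable_sum borel_measurable_times coord) auto
  then have [measurable]: "(\<lambda>w. path_eval (snd (fst w)) (snd w)) \<in> borel_measurable ((borel \<Otimes>\<^sub>M path_space {0..1}) \<Otimes>\<^sub>M lborel)"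
    unfolding path_eval_def by (rule borel_measurable_lim_metric)
  have "(\<lambda>w. indicator {0..1} (snd w) *\<^sub>R (indicator {..<0} (path_eval (snd (fst w)) (snd w) + fst (fst w) * (1 - snd w)) :: real)) \<in> borel_measurable ((borel \<Otimes>\<^sub>M path_space {0..1}) \<Otimes>\<^sub>M lborel)"
    by measurable
  then show ?thesis
    unfolding tilted_neg_time_def set_lebesgue_integral_def
    by (intro lborel.borel_measurable_lebesgue_integral) (simp add: case_prod_beta)
qed

lemma measurable_sample_path:
  assumes "continuous_process M T X"
  shows "sample_path T X \<in> measurable M (path_space T)"
proof -
  have "(\<lambda>\<omega>. \<lambda>t\<in>T. X t \<omega>) \<in> measurable M (path_space T)"
    using assms by (intro measurable_restrict) (auto simp: continuous_process_def)
  then show ?thesis by (simp add: sample_path_def[abs_def])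
qed

lemma measurable_neg_time_tilted:
  assumes "continuous_process P {0..1} X"
  shows "(\<lambda>\<omega>. neg_time {0..1} (\<lambda>s. X s \<omega> + c * (1 - s))) \<in> borel_measurable P"
proof -
  have "(\<lambda>\<omega>. tilted_neg_time c (sample_path {0..1} X \<omega>)) \<in> borel_measurable P"
    by (rule measurable_compose[OF _ measurable_tilted_neg_time, of "\<lambda>\<omega>. (c, sample_path {0..1} X \<omega>)", simplified])
      (use measurable_sample_path[OF assms] in measurable)
  then show ?thesis
    by (subst (asm) measurable_cong[of P _ "\<lambda>\<omega>. neg_time {0..1} (\<lambda>s. X s \<omega> + c * (1 - s))"])
      (use assms in \<open>auto simp: sample_path_def continuous_process_def tilted_neg_time_eq\<close>)
qed

lemma measurable_neg_time:
  assumes "continuous_process P {0..1} X"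
  shows "(\<lambda>\<omega>. neg_time {0..1} (\<lambda>s. X s \<omega>)) \<in> borel_measurable P"
  using measurable_neg_time_tilted[OF assms, of 0] by simp

text \<open>Only continuity and the laws on the grids \<open>j / m\<close> are kept of a bridge.
  This property is stable under a change of the starting point and of the sign, and it compares
  bridges that live on unrelated probability spaces.\<close>

definition bridge_grid :: "'a measure \<Rightarrow> (real \<Rightarrow> 'a \<Rightarrow> real) \<Rightarrow> real \<Rightarrow> bool" where
  "bridge_grid P X c \<longleftrightarrow> prob_space P \<and> continuous_process P {0..1} X \<and>
    (\<forall>m>0. distr P (PiM {..m} (\<lambda>_. borel)) (\<lambda>\<omega>. \<lambda>j\<in>{..m}. X (real j / real m) \<omega>)
      = distr gauss_seq (PiM {..m} (\<lambda>_. borel)) (\<lambda>x. \<lambda>j\<in>{..m}. walk_bridge m c x j))"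

lemma measurable_process_grid_vector:
  assumes "continuous_process P {0..1} X"
  shows "(\<lambda>\<omega>. \<lambda>j\<in>{..m}. X (real j / real m) \<omega>) \<in> measurable P (PiM {..m} (\<lambda>_. borel))"
  using assms by (intro measurable_restrict measurable_process_grid) auto

lemma measurable_walk_bridge_vector:
  "(\<lambda>x. \<lambda>j\<in>{..m}. walk_bridge m c x j) \<in> measurable gauss_seq (PiM {..m} (\<lambda>_. borel))"
  by (intro measurable_restrict) auto

lemma bridge_grid_shift:
  assumes "bridge_grid P X c"
  shows "bridge_grid P (\<lambda>s \<omega>. X s \<omega> + d * (1 - s)) (c + d)"
proof -
  interpret prob_space P using assms by (simp add: bridge_grid_def)
  have X: "continuous_process P {0..1} X" using assms by (simp add: bridge_grid_def)
  have "distr P (PiM {..m} (\<lambda>_. borel)) (\<lambda>\<omega>. \<lambda>j\<in>{..m}. X (real j / real m) \<omega> + d * (1 - real j / real m))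
      = distr gauss_seq (PiM {..m} (\<lambda>_. borel)) (\<lambda>x. \<lambda>j\<in>{..m}. walk_bridge m (c + d) x j)" if m: "m > 0" for m
  proof -
    define h where "h = (\<lambda>v :: nat \<Rightarrow> real. \<lambda>j\<in>{..m}. v j + d * (1 - real j / real m))"
    have h: "h \<in> measurable (PiM {..m} (\<lambda>_. borel)) (PiM {..m} (\<lambda>_. borel))"
      unfolding h_def by (intro measurable_restrict) measurable
    have "distr P (PiM {..m} (\<lambda>_. borel)) (\<lambda>\<omega>. \<lambda>j\<in>{..m}. X (real j / real m) \<omega> + d * (1 - real j / real m))
      = distr (distr P (PiM {..m} (\<lambda>_. borel)) (\<lambda>\<omega>. \<lambda>j\<in>{..m}. X (real j / real m) \<omega>)) (PiM {..m} (\<lambda>_. borel)) h"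
      using h measurable_process_grid_vector[OF X] by (subst distr_distr) (auto simp: h_def comp_def intro!: distr_cong restrict_ext)
    also have "\<dots> = distr (distr gauss_seq (PiM {..m} (\<lambda>_. borel)) (\<lambda>x. \<lambda>j\<in>{..m}. walk_bridge m c x j)) (PiM {..m} (\<lambda>_. borel)) h"
      using assms m by (simp add: bridge_grid_def)
    also have "\<dots> = distr gauss_seq (PiM {..m} (\<lambda>_. borel)) (\<lambda>x. \<lambda>j\<in>{..m}. walk_bridge m (c + d) x j)"
      using h measurable_walk_bridge_vector
      by (subst distr_distr) (auto simp: h_def comp_def walk_bridge_def distrib_right intro!: distr_cong restrict_ext)
    finally show ?thesis .
  qed
  moreover have "continuous_process P {0..1} (\<lambda>s \<omega>. X s \<omega> + d * (1 - s))"
    using X unfolding continuous_process_def by (auto intro!: continuous_intros)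
  ultimately show ?thesis using prob_space_axioms by (simp add: bridge_grid_def)
qed

lemma gauss_seq_uminus: "distr gauss_seq gauss_seq (\<lambda>x n. - x n) = gauss_seq"
proof -
  have ind: "gauss_seq.indep_vars (\<lambda>_. borel) (\<lambda>i x. - x i) UNIV"
    using gauss_seq.indep_vars_compose2[OF indep_vars_gauss_seq[of UNIV], of "\<lambda>_. uminus" "\<lambda>_. borel"] by simp
  have d: "distr gauss_seq borel (\<lambda>x. - x i) = std_gauss" for i
  proof -
    have "distr gauss_seq borel (\<lambda>x. - x i) = distr (distr gauss_seq borel (\<lambda>x. x i)) borel uminus"
      by (subst distr_distr) (auto simp: comp_def)
    then show ?thesis by (simp add: distr_gauss_seq_coord std_gauss_uminus)
  qed
  have "distr gauss_seq gauss_seq (\<lambda>x n. - x n) = distr gauss_seq (PiM UNIV (\<lambda>_. borel)) (\<lambda>x. \<lambda>i\<in>UNIV. - x i)"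
    by (rule distr_cong) (auto simp: restrict_def)
  also have "\<dots> = PiM UNIV (\<lambda>i. distr gauss_seq borel (\<lambda>x. - x i))"
    using ind by (subst (asm) gauss_seq.indep_vars_iff_distr_eq_PiM) auto
  also have "\<dots> = gauss_seq" unfolding d by (simp only: gauss_seq_def)
  finally show ?thesis .
qed

lemma bridge_grid_uminus:
  assumes "bridge_grid P X c"
  shows "bridge_grid P (\<lambda>s \<omega>. - X s \<omega>) (- c)"
proof -
  interpret prob_space P using assms by (simp add: bridge_grid_def)
  have X: "continuous_process P {0..1} X" using assms by (simp add: bridge_grid_def)
  have "distr P (PiM {..m} (\<lambda>_. borel)) (\<lambda>\<omega>. \<lambda>j\<in>{..m}. - X (real j / real m) \<omega>)
      = distr gauss_seq (PiM {..m} (\<lambda>_. borel)) (\<lambda>x. \<lambda>j\<in>{..m}. walk_bridge m (- c) x j)" if m: "m > 0" for m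
  proof -
    define h where "h = (\<lambda>v :: nat \<Rightarrow> real. \<lambda>j\<in>{..m}. - v j)"
    have h: "h \<in> measurable (PiM {..m} (\<lambda>_. borel)) (PiM {..m} (\<lambda>_. borel))"
      unfolding h_def by (intro measurable_restrict) measurable
    have um: "(\<lambda>x n. - x n) \<in> measurable gauss_seq gauss_seq"
      by (subst measurable_cong_sets[OF refl sets_gauss_seq]) (rule measurable_PiM_single', auto)
    have wb: "walk_bridge m (- c) (\<lambda>n. - x n) j = - walk_bridge m c x j" for x j
      by (simp add: walk_bridge_def loop_def sum_negf minus_divide_left[symmetric] algebra_simps)
        (simp add: diff_divide_distrib add_divide_distrib)
    have "distr P (PiM {..m} (\<lambda>_. borel)) (\<lambda>\<omega>. \<lambda>j\<in>{..m}. - X (real j / real m) \<omega>)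
      = distr (distr P (PiM {..m} (\<lambda>_. borel)) (\<lambda>\<omega>. \<lambda>j\<in>{..m}. X (real j / real m) \<omega>)) (PiM {..m} (\<lambda>_. borel)) h"
      using h measurable_process_grid_vector[OF X] by (subst distr_distr) (auto simp: h_def comp_def intro!: distr_cong restrict_ext)
    also have "\<dots> = distr (distr gauss_seq (PiM {..m} (\<lambda>_. borel)) (\<lambda>x. \<lambda>j\<in>{..m}. walk_bridge m c x j)) (PiM {..m} (\<lambda>_. borel)) h"
      using assms m by (simp add: bridge_grid_def)
    also have "\<dots> = distr gauss_seq (PiM {..m} (\<lambda>_. borel)) (\<lambda>x. \<lambda>j\<in>{..m}. walk_bridge m (- c) (\<lambda>n. - x n) j)"
      using h measurable_walk_bridge_vector
      by (subst distr_distr) (auto simp: h_def comp_def wb intro!: distr_cong restrict_ext)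
    also have "\<dots> = distr (distr gauss_seq gauss_seq (\<lambda>x n. - x n)) (PiM {..m} (\<lambda>_. borel)) (\<lambda>x. \<lambda>j\<in>{..m}. walk_bridge m (- c) x j)"
      using um measurable_walk_bridge_vector by (subst distr_distr) (auto simp: comp_def)
    finally show ?thesis by (simp add: gauss_seq_uminus)
  qed
  moreover have "continuous_process P {0..1} (\<lambda>s \<omega>. - X s \<omega>)"
    using X unfolding continuous_process_def by (auto intro!: continuous_intros)
  ultimately show ?thesis using prob_space_axioms by (simp add: bridge_grid_def)
qed

text \<open>The increments of the Brownian motion over cells of length \<open>t / m\<close>, divided
  by the root of that length, are independent standard normal variables, and at the grid points the
  bridge built from them is their \<open>walk_bridge\<close>. Equality of laws on
  \<open>path_space\<close> carries over because a grid involves finitely many coordinates.\<close>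

lemma brownian_bridge_grid:
  assumes t: "t > 0" and b: "brownian_bridge M t y 0 b"
  shows "bridge_grid M (\<lambda>s \<omega>. b (t * s) \<omega> / sqrt t) (y / sqrt t)"
proof -
  have M: "prob_space M" and bc: "continuous_process M {0..t} b" using b by (auto simp: brownian_bridge_def)
  obtain N :: "(real \<Rightarrow> real) measure" and W where W: "brownian_motion N 0 W"
    and law: "law M {0..t} b = law N {0..t} (\<lambda>s \<omega>. (W s \<omega> - s / t * W t \<omega>) + y + s / t * (0 - y))"
    using b unfolding brownian_bridge_def by blast
  interpret N: prob_space N using W by (simp add: brownian_motion_def)
  have Wm: "W s \<in> borel_measurable N" if "s \<ge> 0" for s
    using W that by (auto simp: brownian_motion_def continuous_process_def)
  define B where "B = (\<lambda>s \<omega>. (W s \<omega> - s / t * W t \<omega>) + y + s / t * (0 - y))"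
  have Bm: "B s \<in> borel_measurable N" if "s \<ge> 0" for s
    using Wm[OF that] Wm[of t] t unfolding B_def by (auto intro!: borel_measurable_add borel_measurable_diff borel_measurable_times)
  have sp: "sample_path {0..t} B \<in> measurable N (path_space {0..t})"
  proof -
    have "(\<lambda>\<omega>. \<lambda>s\<in>{0..t}. B s \<omega>) \<in> measurable N (path_space {0..t})"
      by (intro measurable_restrict Bm) auto
    then show ?thesis by (simp add: sample_path_def[abs_def])
  qed
  have "distr M (PiM {..m} (\<lambda>_. borel)) (\<lambda>\<omega>. \<lambda>j\<in>{..m}. b (t * (real j / real m)) \<omega> / sqrt t)
      = distr gauss_seq (PiM {..m} (\<lambda>_. borel)) (\<lambda>x. \<lambda>j\<in>{..m}. walk_bridge m (y / sqrt t) x j)" if m: "m > 0" for m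
  proof -
    define \<delta> where "\<delta> = t / real m"
    have \<delta>: "\<delta> > 0" using t m by (simp add: \<delta>_def)
    define h where "h = (\<lambda>f :: real \<Rightarrow> real. \<lambda>j\<in>{..m}. f (t * (real j / real m)) / sqrt t)"
    have grid: "t * (real j / real m) \<in> {0..t}" if "j \<le> m" for j
    proof -
      have "t * (real j / real m) \<le> t * 1"
        using that t m by (intro mult_left_mono) (auto simp: divide_le_eq_1)
      then show ?thesis using t by simp
    qed
    have h: "h \<in> measurable (path_space {0..t}) (PiM {..m} (\<lambda>_. borel))"
      unfolding h_def using grid
      by (intro measurable_restrict borel_measurable_divide measurable_component_singleton) auto
    define xi where "xi = (\<lambda>i \<omega>. (W (real (Suc i) * \<delta>) \<omega> - W (real i * \<delta>) \<omega>) / sqrt \<delta>)"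
    have xim: "xi i \<in> borel_measurable N" for i
      unfolding xi_def using \<delta> by (intro borel_measurable_divide borel_measurable_diff Wm) auto
    have xid: "distr N borel (xi i) = std_gauss" for i
    proof -
      have "distributed N lborel (\<lambda>\<omega>. W (real (Suc i) * \<delta>) \<omega> - W (real i * \<delta>) \<omega>) (normal_density 0 (sqrt (real (Suc i) * \<delta> - real i * \<delta>)))"
      proof -
        have "\<forall>s t. 0 \<le> s \<longrightarrow> s < t \<longrightarrow> distributed N lborel (\<lambda>\<omega>. W t \<omega> - W s \<omega>) (normal_density 0 (sqrt (t - s)))"
          using W unfolding brownian_motion_def by blast
        then show ?thesis using \<delta> by (auto simp: mult_strict_right_mono)
      qed
      also have "real (Suc i) * \<delta> - real i * \<delta> = \<delta>" by (simp add: algebra_simps)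
      finally have "distributed N lborel (\<lambda>\<omega>. (W (real (Suc i) * \<delta>) \<omega> - W (real i * \<delta>) \<omega> - 0) / sqrt \<delta>) std_normal_density"
        using \<delta> by (subst (asm) N.normal_standard_normal_convert) auto
      from distributed_distr_eq_density[OF this] have "distr N lborel (xi i) = std_gauss"
        by (simp add: xi_def)
      moreover have "distr N borel (xi i) = distr N lborel (xi i)" by (rule distr_cong) auto
      ultimately show ?thesis by simp
    qed
    have "N.indep_vars (\<lambda>_. borel) (\<lambda>i \<omega>. W (real (Suc i) * \<delta>) \<omega> - W (real i * \<delta>) \<omega>) UNIV"
    proof -
      have "strict_mono (\<lambda>i. real i * \<delta>)" using \<delta> by (auto simp: strict_mono_def)
      then show ?thesis using W \<delta> unfolding brownian_motion_def by (auto dest!: spec[of _ "\<lambda>i. real i * \<delta>"])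
    qed
    then have "N.indep_vars (\<lambda>_. borel) xi UNIV"
      using N.indep_vars_compose2[of "\<lambda>_. borel" "\<lambda>i \<omega>. W (real (Suc i) * \<delta>) \<omega> - W (real i * \<delta>) \<omega>" UNIV "\<lambda>_ z. z / sqrt \<delta>" "\<lambda>_. borel"]
      by (simp add: xi_def[abs_def])
    then have "distr N (PiM UNIV (\<lambda>_. borel)) (\<lambda>\<omega>. \<lambda>i\<in>UNIV. xi i \<omega>) = PiM UNIV (\<lambda>i. distr N borel (xi i))"
      using xim by (subst (asm) N.indep_vars_iff_distr_eq_PiM) auto
    also have "\<dots> = gauss_seq" unfolding xid by (simp only: gauss_seq_def)
    finally have xi_law: "distr N gauss_seq (\<lambda>\<omega> i. xi i \<omega>) = gauss_seq"
      by (subst distr_cong[of N N gauss_seq "PiM UNIV (\<lambda>_. borel)" _ "\<lambda>\<omega>. \<lambda>i\<in>UNIV. xi i \<omega>"]) (auto simp: restrict_def)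
    have xi_meas: "(\<lambda>\<omega> i. xi i \<omega>) \<in> measurable N gauss_seq"
      by (subst measurable_cong_sets[OF refl sets_gauss_seq]) (rule measurable_PiM_single', auto simp: xim)
    have Wsum: "W (real j * \<delta>) \<omega> = sqrt \<delta> * (\<Sum>i<j. xi i \<omega>)" if "\<omega> \<in> space N" for j \<omega>
    proof (induction j)
      case 0
      then show ?case using W that by (simp add: brownian_motion_def)
    next
      case (Suc j)
      have "W (real (Suc j) * \<delta>) \<omega> = W (real j * \<delta>) \<omega> + sqrt \<delta> * xi j \<omega>"
        using \<delta> by (simp add: xi_def)
      then show ?case using Suc by (simp add: distrib_left)
    qed
    have wb: "B (t * (real j / real m)) \<omega> / sqrt t = walk_bridge m (y / sqrt t) (\<lambda>i. xi i \<omega>) j" if "\<omega> \<in> space N" for j \<omega>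
    proof -
      have e: "t * (real j / real m) = real j * \<delta>" "t = real m * \<delta>" using m by (auto simp: \<delta>_def)
      have q: "sqrt \<delta> / sqrt t = 1 / sqrt (real m)" using t m by (simp add: \<delta>_def real_sqrt_divide)
      have "B (t * (real j / real m)) \<omega> = sqrt \<delta> * loop m (\<lambda>i. xi i \<omega>) j + y * (1 - real j / real m)"
      proof -
        have "W t \<omega> = sqrt \<delta> * (\<Sum>i<m. xi i \<omega>)" using Wsum[OF that, of m] e(2) by simp
        then have "B (real j * \<delta>) \<omega> = sqrt \<delta> * (\<Sum>i<j. xi i \<omega>) - real j * \<delta> / t * (sqrt \<delta> * (\<Sum>i<m. xi i \<omega>)) + y + real j * \<delta> / t * (0 - y)"
          unfolding B_def Wsum[OF that] by simp
        also have "real j * \<delta> / t = real j / real m" using t by (simp add: \<delta>_def)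
        finally show ?thesis unfolding e(1) by (simp add: loop_def algebra_simps)
      qed
      then have "B (t * (real j / real m)) \<omega> / sqrt t = sqrt \<delta> / sqrt t * loop m (\<lambda>i. xi i \<omega>) j + y / sqrt t * (1 - real j / real m)"
        by (simp add: add_divide_distrib)
      then show ?thesis unfolding q by (simp add: walk_bridge_def)
    qed
    have "distr M (PiM {..m} (\<lambda>_. borel)) (\<lambda>\<omega>. \<lambda>j\<in>{..m}. b (t * (real j / real m)) \<omega> / sqrt t)
      = distr (law M {0..t} b) (PiM {..m} (\<lambda>_. borel)) h"
      unfolding law_def using h measurable_sample_path[OF bc] grid
      by (subst distr_distr) (auto simp: h_def comp_def sample_path_def intro!: distr_cong restrict_ext)
    also have "\<dots> = distr (law N {0..t} B) (PiM {..m} (\<lambda>_. borel)) h"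
      by (simp add: law B_def)
    also have "\<dots> = distr N (PiM {..m} (\<lambda>_. borel)) (\<lambda>\<omega>. \<lambda>j\<in>{..m}. B (t * (real j / real m)) \<omega> / sqrt t)"
      unfolding law_def using h sp grid
      by (subst distr_distr) (auto simp: h_def comp_def sample_path_def intro!: distr_cong restrict_ext)
    also have "\<dots> = distr N (PiM {..m} (\<lambda>_. borel)) ((\<lambda>x. \<lambda>j\<in>{..m}. walk_bridge m (y / sqrt t) x j) \<circ> (\<lambda>\<omega> i. xi i \<omega>))"
      by (intro distr_cong refl) (simp only: wb comp_def)
    also have "\<dots> = distr (distr N gauss_seq (\<lambda>\<omega> i. xi i \<omega>)) (PiM {..m} (\<lambda>_. borel)) (\<lambda>x. \<lambda>j\<in>{..m}. walk_bridge m (y / sqrt t) x j)"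
      using xi_meas measurable_walk_bridge_vector by (intro distr_distr[symmetric]) auto
    finally show ?thesis by (simp add: xi_law)
  qed
  moreover have "continuous_process M {0..1} (\<lambda>s \<omega>. b (t * s) \<omega> / sqrt t)"
    unfolding continuous_process_def
  proof (intro conjI ballI)
    fix s :: real assume s: "s \<in> {0..1}"
    then have "t * s \<in> {0..t}" using t by (auto simp: mult_left_le)
    then have "b (t * s) \<in> borel_measurable M"
      using bc by (simp add: continuous_process_def)
    from borel_measurable_divide[OF this borel_measurable_const[of "sqrt t"]]
    show "(\<lambda>\<omega>. b (t * s) \<omega> / sqrt t) \<in> borel_measurable M" .
  next
    fix \<omega> assume "\<omega> \<in> space M"
    then have "continuous_on {0..t} (\<lambda>s. b s \<omega>)" using bc by (auto simp: continuous_process_def)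
    moreover have "(*) t ` {0..1} \<subseteq> {0..t}"
    proof
      fix u assume "u \<in> (*) t ` {0..1}"
      then obtain s where "u = t * s" "s \<in> {0..1}" by (rule imageE)
      then show "u \<in> {0..t}" using t mult_left_mono[of s 1 t] by simp
    qed
    moreover have "continuous_on {0..1} ((*) t)" by (intro continuous_intros)
    ultimately have "continuous_on {0..1} (\<lambda>s. b (t * s) \<omega>)"
      using continuous_on_compose2[of "{0..t}" "\<lambda>s. b s \<omega>" "{0..1}" "(*) t"] by blast
    then show "continuous_on {0..1} (\<lambda>s. b (t * s) \<omega> / sqrt t)"
      using t by (intro continuous_on_divide continuous_on_const) auto
  qed
  ultimately show ?thesis using M by (simp add: bridge_grid_def)
qed

definition ramp_mean :: "nat \<Rightarrow> nat \<Rightarrow> (nat \<Rightarrow> real) \<Rightarrow> real" where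
  "ramp_mean n m v = (\<Sum>j<m. neg_ramp n (v j)) / real m"

lemma measurable_ramp_mean [measurable]: "ramp_mean n m \<in> borel_measurable (PiM {..m} (\<lambda>_. borel))"
proof -
  have "(\<lambda>v. v j) \<in> borel_measurable (PiM {..m} (\<lambda>_. borel :: real measure))" if "j < m" for j
    using that by (intro measurable_component_singleton) auto
  then show ?thesis
    unfolding ramp_mean_def[abs_def]
    by (intro borel_measurable_divide borel_measurable_sum measurable_compose[OF _ borel_measurable_neg_ramp]) auto
qed

lemma ramp_mean_restrict: "ramp_mean n m (\<lambda>j\<in>{..m}. v j) = ramp_mean n m v"
  unfolding ramp_mean_def by (intro arg_cong2[where f="(/)"] sum.cong) auto

text \<open>The law of the time spent below zero is determined by the values on the grids.\<close>

lemma bridge_grid_char: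
  assumes X: "bridge_grid P X c"
  shows "\<exists>L. (\<forall>n. (\<lambda>m. CLINT x|gauss_seq. iexp (\<theta> * ramp_mean n m (walk_bridge m c x))) \<longlonglongrightarrow> L n) \<and>
    L \<longlonglongrightarrow> char (distr P borel (\<lambda>\<omega>. neg_time {0..1} (\<lambda>s. X s \<omega>))) \<theta>"
proof -
  interpret prob_space P using X by (simp add: bridge_grid_def)
  have cp: "continuous_process P {0..1} X" using X by (simp add: bridge_grid_def)
  have cont: "continuous_on {0..1} (\<lambda>s. X s \<omega>)" if "\<omega> \<in> space P" for \<omega>
    using cp that by (simp add: continuous_process_def)
  define I where "I = (\<lambda>n \<omega>. LINT s:{0..1}|lborel. neg_ramp n (X s \<omega>))"
  define R where "R = (\<lambda>n m \<omega>. ramp_mean n m (\<lambda>j. X (real j / real m) \<omega>))"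
  define A where "A = (\<lambda>\<omega>. neg_time {0..1} (\<lambda>s. X s \<omega>))"
  have A [measurable]: "A \<in> borel_measurable P"
    unfolding A_def by (rule measurable_neg_time[OF cp])
  have R [measurable]: "R n m \<in> borel_measurable P" for n m
    using measurable_compose[OF measurable_process_grid_vector[OF cp] measurable_ramp_mean]
    by (simp add: R_def[abs_def] ramp_mean_restrict)
  have RI: "(\<lambda>m. R n m \<omega>) \<longlonglongrightarrow> I n \<omega>" if "\<omega> \<in> space P" for n \<omega>
    unfolding R_def I_def ramp_mean_def
    by (intro riemann_sum_tendsto continuous_on_neg_ramp cont that)
  have I [measurable]: "I n \<in> borel_measurable P" for n
    by (rule borel_measurable_LIMSEQ_real[where u="R n"]) (use RI in auto)
  have IA: "(\<lambda>n. I n \<omega>) \<longlonglongrightarrow> A \<omega>" if "\<omega> \<in> space P" for \<omega>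
    unfolding I_def A_def by (intro neg_ramp_integral_tendsto cont that)
  \<comment> \<open>Two limits are taken in turn: finer grids for a fixed ramp, then steeper ramps.
    The integrands have modulus 1, so dominated convergence applies both times.\<close>
  have lim1: "(\<lambda>m. CLINT \<omega>|P. iexp (\<theta> * R n m \<omega>)) \<longlonglongrightarrow> (CLINT \<omega>|P. iexp (\<theta> * I n \<omega>))" for n
    by (rule integral_dominated_convergence[where w="\<lambda>_. 1"]) (auto intro!: tendsto_intros RI)
  have lim2: "(\<lambda>n. CLINT \<omega>|P. iexp (\<theta> * I n \<omega>)) \<longlonglongrightarrow> (CLINT \<omega>|P. iexp (\<theta> * A \<omega>))"
    by (rule integral_dominated_convergence[where w="\<lambda>_. 1"]) (auto intro!: tendsto_intros IA)
  \<comment> \<open>For finite \<open>m\<close> only grid values enter, so the integral moves to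
    \<open>gauss_seq\<close> and no longer depends on the particular process.\<close>
  have eq: "(CLINT \<omega>|P. iexp (\<theta> * R n m \<omega>)) = (CLINT x|gauss_seq. iexp (\<theta> * ramp_mean n m (walk_bridge m c x)))" if "m > 0" for n m
  proof -
    have "(CLINT \<omega>|P. iexp (\<theta> * R n m \<omega>)) = (CLINT v|distr P (PiM {..m} (\<lambda>_. borel)) (\<lambda>\<omega>. \<lambda>j\<in>{..m}. X (real j / real m) \<omega>). iexp (\<theta> * ramp_mean n m v))"
      by (subst integral_distr) (auto simp: ramp_mean_restrict R_def intro!: measurable_process_grid_vector[OF cp])
    also have "distr P (PiM {..m} (\<lambda>_. borel)) (\<lambda>\<omega>. \<lambda>j\<in>{..m}. X (real j / real m) \<omega>) = distr gauss_seq (PiM {..m} (\<lambda>_. borel)) (\<lambda>x. \<lambda>j\<in>{..m}. walk_bridge m c x j)"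
      using X that by (simp add: bridge_grid_def)
    also have "(CLINT v|\<dots>. iexp (\<theta> * ramp_mean n m v)) = (CLINT x|gauss_seq. iexp (\<theta> * ramp_mean n m (\<lambda>j\<in>{..m}. walk_bridge m c x j)))"
      by (subst integral_distr) (auto intro!: measurable_walk_bridge_vector)
    finally show ?thesis by (simp only: ramp_mean_restrict)
  qed
  have l1: "(\<lambda>m. CLINT x|gauss_seq. iexp (\<theta> * ramp_mean n m (walk_bridge m c x))) \<longlonglongrightarrow> (CLINT \<omega>|P. iexp (\<theta> * I n \<omega>))" for n
    by (rule Lim_transform_eventually[OF lim1], rule eventually_mono[OF eventually_gt_at_top[of 0]], rule eq)
  have char_eq: "char (distr P borel A) \<theta> = (CLINT \<omega>|P. iexp (\<theta> * A \<omega>))"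
    unfolding char_def by (subst integral_distr) auto
  show ?thesis
    unfolding A_def[symmetric] char_eq
    by (intro exI[of _ "\<lambda>n. CLINT \<omega>|P. iexp (\<theta> * I n \<omega>)"] conjI allI l1 lim2)
qed

text \<open>Both characteristic functions are the same iterated limit of integrals over
  \<open>gauss_seq\<close>, so the laws agree by Levy's uniqueness theorem.\<close>

lemma bridge_grid_neg_time_eq:
  assumes X: "bridge_grid P X c" and X': "bridge_grid P' X' c"
  shows "\<P>(\<omega> in P. neg_time {0..1} (\<lambda>s. X s \<omega>) \<le> u) = \<P>(\<omega> in P'. neg_time {0..1} (\<lambda>s. X' s \<omega>) \<le> u)"
proof -
  define D where "D = distr P borel (\<lambda>\<omega>. neg_time {0..1} (\<lambda>s. X s \<omega>))"
  define D' where "D' = distr P' borel (\<lambda>\<omega>. neg_time {0..1} (\<lambda>s. X' s \<omega>))"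
  interpret P: prob_space P using X by (simp add: bridge_grid_def)
  interpret P': prob_space P' using X' by (simp add: bridge_grid_def)
  have m: "(\<lambda>\<omega>. neg_time {0..1} (\<lambda>s. X s \<omega>)) \<in> borel_measurable P" "(\<lambda>\<omega>. neg_time {0..1} (\<lambda>s. X' s \<omega>)) \<in> borel_measurable P'"
    using X X' by (auto simp: bridge_grid_def intro: measurable_neg_time)
  have "char D \<theta> = char D' \<theta>" for \<theta>
  proof -
    obtain L where L: "\<And>n. (\<lambda>m. CLINT x|gauss_seq. iexp (\<theta> * ramp_mean n m (walk_bridge m c x))) \<longlonglongrightarrow> L n" "L \<longlonglongrightarrow> char D \<theta>"
      using bridge_grid_char[OF X, of \<theta>] unfolding D_def by blast
    obtain L' where L': "\<And>n. (\<lambda>m. CLINT x|gauss_seq. iexp (\<theta> * ramp_mean n m (walk_bridge m c x))) \<longlonglongrightarrow> L' n" "L' \<longlonglongrightarrow> char D' \<theta>"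
      using bridge_grid_char[OF X', of \<theta>] unfolding D'_def by blast
    have "L = L'" using L(1) L'(1) LIMSEQ_unique by blast
    then show ?thesis using L(2) L'(2) LIMSEQ_unique by blast
  qed
  moreover have "real_distribution D" "real_distribution D'"
    unfolding D_def D'_def using m by auto
  ultimately have "D = D'" by (intro Levy_uniqueness) auto
  then have "measure D {..u} = measure D' {..u}" by simp
  then show ?thesis
    unfolding D_def D'_def using m by (simp add: measure_distr vimage_def Int_def conj_commute)
qed

text \<open>If the time below zero exceeds \<open>r\<close>, so does some ramp integral, then its
  Riemann sums on all fine grids, and then the proportion of negative grid points. The event thus
  lies in the lower limit of events whose probabilities are controlled by
  \<open>liminf_prob_neg_count_le\<close>, and Fatou's lemma for events concludes. The implication
  is used in this direction alone, so the zeros of the path do not matter.\<close>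

lemma bridge_grid_neg_time_ge:
  assumes X: "bridge_grid P X c" and c: "c < 0" and r: "0 < r" "r < 1"
  shows "r * occ_tail (- c * sqrt ((1 - r) / r)) \<le> \<P>(\<omega> in P. neg_time {0..1} (\<lambda>s. X s \<omega>) \<le> r)"
proof -
  interpret prob_space P using X by (simp add: bridge_grid_def)
  have cp: "continuous_process P {0..1} X" using X by (simp add: bridge_grid_def)
  have cont: "continuous_on {0..1} (\<lambda>s. X s \<omega>)" if "\<omega> \<in> space P" for \<omega>
    using cp that by (simp add: continuous_process_def)
  define A where "A = (\<lambda>\<omega>. neg_time {0..1} (\<lambda>s. X s \<omega>))"
  have A [measurable]: "A \<in> borel_measurable P"
    unfolding A_def by (rule measurable_neg_time[OF cp])
  define C where "C = (\<lambda>m \<omega>. real (card {j. j < m \<and> X (real j / real m) \<omega> < 0}))"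
  define F where "F = (\<lambda>m. {\<omega> \<in> space P. C m \<omega> > r * real m})"
  define p where "p = (\<lambda>m. measure gauss_seq {x. real (neg_count m c x) \<le> r * real m})"
  define K where "K = r * occ_tail (- c * sqrt ((1 - r) / r))"
  have F: "F m \<in> sets P \<and> measure P (F m) = 1 - p m" if m: "m > 0" for m
  proof -
    define G where "G = {v \<in> space (PiM {..m} (\<lambda>_. borel :: real measure)). real (card {j. j < m \<and> v j < 0}) > r * real m}"
    have cm [measurable]: "(\<lambda>v. card {j. j < m \<and> v j < 0}) \<in> measurable (PiM {..m} (\<lambda>_. borel :: real measure)) (count_space UNIV)"
    proof (rule card_measurable_aux)
      fix j assume "j < m"
      then have [measurable]: "(\<lambda>v. v j) \<in> borel_measurable (PiM {..m} (\<lambda>_. borel :: real measure))"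
        by (intro measurable_component_singleton) auto
      show "Measurable.pred (PiM {..m} (\<lambda>_. borel :: real measure)) (\<lambda>v. v j < 0)" by measurable
    qed
    have G: "G \<in> sets (PiM {..m} (\<lambda>_. borel))" unfolding G_def by measurable
    have res: "{j. j < m \<and> (\<lambda>j\<in>{..m}. w j) j < 0} = {j. j < m \<and> w j < (0::real)}" for w by auto
    have FG: "F m = (\<lambda>\<omega>. \<lambda>j\<in>{..m}. X (real j / real m) \<omega>) -` G \<inter> space P"
      unfolding F_def G_def C_def using res by (auto simp: space_PiM)
    have "measure P (F m) = measure (distr P (PiM {..m} (\<lambda>_. borel)) (\<lambda>\<omega>. \<lambda>j\<in>{..m}. X (real j / real m) \<omega>)) G"
      unfolding FG using G measurable_process_grid_vector[OF cp] by (subst measure_distr) auto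
    also have "\<dots> = measure (distr gauss_seq (PiM {..m} (\<lambda>_. borel)) (\<lambda>x. \<lambda>j\<in>{..m}. walk_bridge m c x j)) G"
      using X m by (simp add: bridge_grid_def)
    also have "\<dots> = measure gauss_seq ((\<lambda>x. \<lambda>j\<in>{..m}. walk_bridge m c x j) -` G \<inter> space gauss_seq)"
      using G measurable_walk_bridge_vector by (subst measure_distr) auto
    also have "(\<lambda>x. \<lambda>j\<in>{..m}. walk_bridge m c x j) -` G \<inter> space gauss_seq = space gauss_seq - {x. real (neg_count m c x) \<le> r * real m}"
      unfolding G_def neg_count_def using res by (auto simp: space_PiM not_le)
    also have "measure gauss_seq \<dots> = 1 - p m"
    proof -
      have "{x \<in> space gauss_seq. real (neg_count m c x) \<le> r * real m} \<in> sets gauss_seq" by measurable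
      then have "{x. real (neg_count m c x) \<le> r * real m} \<in> sets gauss_seq" by simp
      from gauss_seq.prob_compl[OF this] show ?thesis unfolding p_def .
    qed
    finally show ?thesis
      using FG G measurable_process_grid_vector[OF cp, of m] by (auto intro: measurable_sets)
  qed
  have sub: "{\<omega> \<in> space P. A \<omega> > r} \<subseteq> {\<omega> \<in> space P. \<forall>\<^sub>F m in sequentially. \<omega> \<in> F m}"
  proof safe
    fix \<omega> assume \<omega>: "\<omega> \<in> space P" "r < A \<omega>"
    have "(\<lambda>n. LINT s:{0..1}|lborel. neg_ramp n (X s \<omega>)) \<longlonglongrightarrow> A \<omega>"
      unfolding A_def by (intro neg_ramp_integral_tendsto cont \<omega>)
    from order_tendstoD(1)[OF this \<omega>(2)] obtain n where n: "r < (LINT s:{0..1}|lborel. neg_ramp n (X s \<omega>))"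
      unfolding eventually_sequentially by blast
    have "(\<lambda>m. (\<Sum>j<m. neg_ramp n (X (real j / real m) \<omega>)) / real m) \<longlonglongrightarrow> (LINT s:{0..1}|lborel. neg_ramp n (X s \<omega>))"
      by (intro riemann_sum_tendsto continuous_on_neg_ramp cont \<omega>)
    from order_tendstoD(1)[OF this n]
    show "\<forall>\<^sub>F m in sequentially. \<omega> \<in> F m"
      using eventually_gt_at_top[of 0]
    proof eventually_elim
      case (elim m)
      have "r * real m < (\<Sum>j<m. neg_ramp n (X (real j / real m) \<omega>))"
        using elim by (simp add: pos_less_divide_eq)
      also have "\<dots> \<le> (\<Sum>j<m. if j \<in> {j. X (real j / real m) \<omega> < 0} then 1 else 0)"
      proof (intro sum_mono)
        fix j show "neg_ramp n (X (real j / real m) \<omega>) \<le> (if j \<in> {j. X (real j / real m) \<omega> < 0} then 1 else 0)"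
          using neg_ramp_le[of n "X (real j / real m) \<omega>"] by (auto simp: indicator_def)
      qed
      also have "\<dots> = (\<Sum>j\<in>{..<m} \<inter> {j. X (real j / real m) \<omega> < 0}. 1)"
        by (rule sum.inter_restrict[symmetric]) simp
      also have "\<dots> = C m \<omega>"
        unfolding C_def by (simp add: lessThan_def Int_def)
      finally show ?case using \<omega> by (simp add: F_def)
    qed
  qed
  have main: "K - e \<le> measure P {\<omega> \<in> space P. A \<omega> \<le> r}" if e: "e > 0" for e
  proof (cases "K - e \<le> 0")
    case False
    have "ennreal (K - e) < ennreal K" using e False by (intro ennreal_lessI) auto
    also have "\<dots> \<le> liminf (\<lambda>m. ennreal (p m))"
      unfolding K_def p_def by (rule liminf_prob_neg_count_le[OF c r])
    finally have "\<forall>\<^sub>F m in sequentially. ennreal (K - e) < ennreal (p m)"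
      by (rule less_LiminfD)
    then have "\<forall>\<^sub>F m in sequentially. 0 < m \<and> K - e \<le> p m"
      using eventually_gt_at_top[of 0]
    proof eventually_elim
      case (elim m)
      then show ?case using False by (simp add: p_def ennreal_less_iff less_imp_le)
    qed
    then obtain M where M: "\<And>m. m \<ge> M \<Longrightarrow> 0 < m \<and> K - e \<le> p m"
      unfolding eventually_sequentially by blast
    \<comment> \<open>The sets \<open>H i\<close> increase to the lower limit of the events
      \<open>F m\<close>. Starting at \<open>M\<close> ensures that \<open>m\<close> is positive and
      that \<open>p m\<close> is already large.\<close>
    define H where "H = (\<lambda>i. \<Inter>m\<in>{max M i..}. F m)"
    have Hs: "H i \<in> sets P" for i
      unfolding H_def using M F by (intro sets.countable_INT') auto
    have "{\<omega> \<in> space P. A \<omega> > r} \<subseteq> (\<Union>i. H i)"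
    proof
      fix \<omega> assume "\<omega> \<in> {\<omega> \<in> space P. A \<omega> > r}"
      then have "\<forall>\<^sub>F m in sequentially. \<omega> \<in> F m" using sub by blast
      then obtain i where "\<And>m. m \<ge> i \<Longrightarrow> \<omega> \<in> F m" unfolding eventually_sequentially by blast
      then have "\<omega> \<in> H i" by (auto simp: H_def)
      then show "\<omega> \<in> (\<Union>i. H i)" by blast
    qed
    then have "measure P {\<omega> \<in> space P. A \<omega> > r} \<le> measure P (\<Union>i. H i)"
      using Hs by (intro finite_measure_mono) auto
    also have "\<dots> \<le> 1 - (K - e)"
    proof (rule LIMSEQ_le_const2)
      show "(\<lambda>i. measure P (H i)) \<longlonglongrightarrow> measure P (\<Union>i. H i)"
        using Hs by (intro finite_Lim_measure_incseq) (auto simp: incseq_def H_def)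
      have "measure P (H i) \<le> 1 - (K - e)" for i
      proof -
        have "measure P (H i) \<le> measure P (F (max M i))"
          using F M by (intro finite_measure_mono) (auto simp: H_def)
        also have "\<dots> = 1 - p (max M i)" using F M by simp
        also have "\<dots> \<le> 1 - (K - e)" using M[of "max M i"] by simp
        finally show ?thesis .
      qed
      then show "\<exists>N. \<forall>n\<ge>N. measure P (H n) \<le> 1 - (K - e)" by blast
    qed
    finally have "measure P {\<omega> \<in> space P. A \<omega> > r} \<le> 1 - (K - e)" .
    moreover have "{\<omega> \<in> space P. A \<omega> > r} = space P - {\<omega> \<in> space P. A \<omega> \<le> r}" by auto
    moreover have "measure P (space P - {\<omega> \<in> space P. A \<omega> \<le> r}) = 1 - measure P {\<omega> \<in> space P. A \<omega> \<le> r}"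
      by (rule prob_compl) measurable
    ultimately show ?thesis by simp
  next
    case True
    then show ?thesis by (rule order_trans[OF _ measure_nonneg])
  qed
  have "K \<le> measure P {\<omega> \<in> space P. A \<omega> \<le> r}"
  proof (rule field_le_epsilon)
    fix e :: real assume "0 < e"
    from main[OF this] show "K \<le> measure P {\<omega> \<in> space P. A \<omega> \<le> r} + e" by linarith
  qed
  then show ?thesis by (simp add: K_def A_def)
qed

section \<open>The occupation time of the bridge\<close>

definition occ_cdf :: "'a measure \<Rightarrow> (real \<Rightarrow> 'a \<Rightarrow> real) \<Rightarrow> real \<Rightarrow> real \<Rightarrow> real" where
  "occ_cdf N \<beta> c r = \<P>(\<omega> in N. neg_time {0..1} (\<lambda>s. \<beta> s \<omega> + c * (1 - s)) \<le> r)"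

locale standard_bridge =
  fixes N :: "'a measure" and \<beta> :: "real \<Rightarrow> 'a \<Rightarrow> real"
  assumes grid: "bridge_grid N \<beta> 0"
begin

sublocale prob_space N using grid by (simp add: bridge_grid_def)

lemma process: "continuous_process N {0..1} \<beta>"
  using grid by (simp add: bridge_grid_def)

lemma cont: "\<omega> \<in> space N \<Longrightarrow> continuous_on {0..1} (\<lambda>s. \<beta> s \<omega> + c * (1 - s))"
  using process by (auto simp: continuous_process_def intro!: continuous_intros)

lemma meas [measurable]: "(\<lambda>\<omega>. neg_time {0..1} (\<lambda>s. \<beta> s \<omega> + c * (1 - s))) \<in> borel_measurable N"
  by (rule measurable_neg_time_tilted[OF process])

lemma tilted_grid: "bridge_grid N (\<lambda>s \<omega>. \<beta> s \<omega> + c * (1 - s)) c"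
  using bridge_grid_shift[OF grid, of c] by simp

lemma occ_cdf_nonneg: "0 \<le> occ_cdf N \<beta> c r" and occ_cdf_le_1: "occ_cdf N \<beta> c r \<le> 1"
  by (simp_all add: occ_cdf_def)

text \<open>A higher start raises the tilted path on the whole unit interval. Monotonicity in both
  arguments turns an identity that holds almost everywhere into a bound everywhere in
  \<open>occ_cdf_le\<close>.\<close>

lemma occ_cdf_mono: "c \<le> c' \<Longrightarrow> r \<le> r' \<Longrightarrow> occ_cdf N \<beta> c r \<le> occ_cdf N \<beta> c' r'"
  unfolding occ_cdf_def
proof (rule finite_measure_mono)
  assume le: "c \<le> c'" "r \<le> r'"
  show "{\<omega> \<in> space N. neg_time {0..1} (\<lambda>s. \<beta> s \<omega> + c * (1 - s)) \<le> r} \<subseteq> {\<omega> \<in> space N. neg_time {0..1} (\<lambda>s. \<beta> s \<omega> + c' * (1 - s)) \<le> r'}"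
  proof safe
    fix \<omega> assume \<omega>: "\<omega> \<in> space N" "neg_time {0..1} (\<lambda>s. \<beta> s \<omega> + c * (1 - s)) \<le> r"
    have "neg_time {0..1} (\<lambda>s. \<beta> s \<omega> + c' * (1 - s)) \<le> neg_time {0..1} (\<lambda>s. \<beta> s \<omega> + c * (1 - s))"
      using le \<omega> by (intro neg_time_antimono cont) (auto intro!: mult_right_mono)
    then show "neg_time {0..1} (\<lambda>s. \<beta> s \<omega> + c' * (1 - s)) \<le> r'" using \<omega> le by simp
  qed
qed measurable

lemma occ_cdf_eq_1: "1 \<le> r \<Longrightarrow> occ_cdf N \<beta> c r = 1"
  unfolding occ_cdf_def
  by (rule prob_Collect_eq_1[THEN iffD2]) (auto intro!: AE_I2 order_trans[OF neg_time_le_1] cont)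

lemma occ_cdf_ge:
  assumes "c < 0" "0 < r" "r < 1"
  shows "r * occ_tail (- c * sqrt ((1 - r) / r)) \<le> occ_cdf N \<beta> c r"
  unfolding occ_cdf_def by (rule bridge_grid_neg_time_ge[OF tilted_grid assms])

text \<open>The negated bridge is a bridge from \<open>- c\<close>, and the times below zero of the
  two paths add up to at most 1. If one of them exceeds \<open>1 - r\<close>, the other is below
  \<open>r\<close>. This converts upper bounds for negative starts into lower bounds for positive
  ones.\<close>

lemma occ_cdf_reflect: "1 - occ_cdf N \<beta> (- c) (1 - r) \<le> occ_cdf N \<beta> c r"
proof -
  define A where "A = (\<lambda>\<omega>. neg_time {0..1} (\<lambda>s. \<beta> s \<omega> + c * (1 - s)))"
  define B where "B = (\<lambda>\<omega>. neg_time {0..1} (\<lambda>s. - (\<beta> s \<omega> + c * (1 - s))))"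
  have B: "bridge_grid N (\<lambda>s \<omega>. - (\<beta> s \<omega> + c * (1 - s))) (- c)"
    by (rule bridge_grid_uminus[OF tilted_grid])
  have [measurable]: "A \<in> borel_measurable N" "B \<in> borel_measurable N"
    unfolding A_def B_def using B by (auto simp: bridge_grid_def intro!: measurable_neg_time)
  have "occ_cdf N \<beta> (- c) (1 - r) = measure N {\<omega> \<in> space N. B \<omega> \<le> 1 - r}"
    unfolding occ_cdf_def B_def by (rule bridge_grid_neg_time_eq[OF tilted_grid B])
  moreover have "1 - measure N {\<omega> \<in> space N. B \<omega> \<le> 1 - r} = measure N (space N - {\<omega> \<in> space N. B \<omega> \<le> 1 - r})"
    by (rule prob_compl[symmetric]) measurable
  moreover have "\<dots> \<le> measure N {\<omega> \<in> space N. A \<omega> \<le> r}"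
  proof (rule finite_measure_mono)
    show "space N - {\<omega> \<in> space N. B \<omega> \<le> 1 - r} \<subseteq> {\<omega> \<in> space N. A \<omega> \<le> r}"
    proof safe
      fix \<omega> assume \<omega>: "\<omega> \<in> space N" "\<not> B \<omega> \<le> 1 - r"
      then show "A \<omega> \<le> r" using neg_time_add_neg_time_uminus[OF cont[OF \<omega>(1)], of c] by (simp add: A_def B_def)
    qed
  qed measurable
  ultimately show ?thesis by (simp add: occ_cdf_def A_def)
qed

text \<open>The event in question is the section at \<open>t\<close> of one set that is measurable
  in time and sample point jointly.\<close>

lemma measurable_occ_cdf:
  assumes [measurable]: "f \<in> borel_measurable borel" "g \<in> borel_measurable borel"
  shows "(\<lambda>t :: real. occ_cdf N \<beta> (f t) (g t)) \<in> borel_measurable borel"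
proof -
  define V where "V = (\<lambda>(t :: real, \<omega>). tilted_neg_time (f t) (sample_path {0..1} \<beta> \<omega>))"
  have [measurable]: "V \<in> borel_measurable (borel \<Otimes>\<^sub>M N)"
  proof -
    have "(\<lambda>z. (f (fst z), sample_path {0..1} \<beta> (snd z))) \<in> (borel :: real measure) \<Otimes>\<^sub>M N \<rightarrow>\<^sub>M borel \<Otimes>\<^sub>M path_space {0..1}"
      using measurable_sample_path[OF process] by measurable
    from measurable_compose[OF this measurable_tilted_neg_time] show ?thesis
      by (simp add: V_def case_prod_beta')
  qed
  have V: "V (t, \<omega>) = neg_time {0..1} (\<lambda>s. \<beta> s \<omega> + f t * (1 - s))" if "\<omega> \<in> space N" for t \<omega>
    using process that by (simp add: V_def sample_path_def tilted_neg_time_eq continuous_process_def)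
  define S where "S = {z \<in> space (borel \<Otimes>\<^sub>M N). V z \<le> g (fst z)}"
  have S: "S \<in> sets (borel \<Otimes>\<^sub>M N)" unfolding S_def by measurable
  have "occ_cdf N \<beta> (f t) (g t) = measure N (Pair t -` S)" for t
  proof -
    have "Pair t -` S = {\<omega> \<in> space N. neg_time {0..1} (\<lambda>s. \<beta> s \<omega> + f t * (1 - s)) \<le> g t}"
      using V by (auto simp: S_def space_pair_measure)
    then show ?thesis by (simp add: occ_cdf_def)
  qed
  moreover have "(\<lambda>t. measure N (Pair t -` S)) \<in> borel_measurable borel"
    unfolding measure_def using measurable_emeasure_Pair[OF S] by measurable
  ultimately show ?thesis by simp
qed

end

lemma standard_bridgeI:
  assumes "brownian_bridge N 1 0 0 \<beta>"
  shows "standard_bridge N \<beta>"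
proof
  have "bridge_grid N (\<lambda>s \<omega>. \<beta> (1 * s) \<omega> / sqrt 1) (0 / sqrt 1)"
    by (rule brownian_bridge_grid[OF _ assms]) simp
  then show "bridge_grid N \<beta> 0" by simp
qed

text \<open>Brownian scaling. Bridges with different lengths and starts live on unrelated spaces;
  \<open>bridge_grid_neg_time_eq\<close> replaces all of them by tilts of the one standard
  bridge.\<close>

lemma (in standard_bridge) neg_time_cdf_eq_occ_cdf:
  assumes t: "t > 0" and b: "brownian_bridge M t y 0 b"
  shows "neg_time_cdf M b t u = occ_cdf N \<beta> (y / sqrt t) (u / t)"
proof -
  have "neg_time {0..t} (\<lambda>s. b s \<omega>) = t * neg_time {0..1} (\<lambda>s. b (t * s) \<omega> / sqrt t)" for \<omega>
  proof -
    have "neg_time {0..t} (\<lambda>s. b s \<omega>) = t * neg_time {0..1} (\<lambda>s. b (t * s) \<omega>)"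
      by (rule neg_time_scale[OF t])
    also have "neg_time {0..1} (\<lambda>s. b (t * s) \<omega>) = neg_time {0..1} (\<lambda>s. 1 / sqrt t * b (t * s) \<omega>)"
      using t by (intro neg_time_pos_mult[symmetric]) simp
    finally show ?thesis by simp
  qed
  then have "neg_time_cdf M b t u = \<P>(\<omega> in M. neg_time {0..1} (\<lambda>s. b (t * s) \<omega> / sqrt t) \<le> u / t)"
    unfolding neg_time_cdf_def using t by (simp add: pos_le_divide_eq mult.commute)
  also have "\<dots> = occ_cdf N \<beta> (y / sqrt t) (u / t)"
    unfolding occ_cdf_def by (rule bridge_grid_neg_time_eq[OF brownian_bridge_grid[OF t b] tilted_grid])
  finally show ?thesis .
qed

lemma neg_time_rescaled_bridge:
  assumes x: "x > 0"
  shows "neg_time {0..x} (\<lambda>s. sqrt x * f (s / x) + y - s / x * y) = x * neg_time {0..1} (\<lambda>s. f s + y / sqrt x * (1 - s))"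
proof -
  have "neg_time {0..x} (\<lambda>s. sqrt x * f (s / x) + y - s / x * y) = x * neg_time {0..1} (\<lambda>s. sqrt x * f (x * s / x) + y - x * s / x * y)"
    by (rule neg_time_scale[OF x])
  also have "(\<lambda>s. sqrt x * f (x * s / x) + y - x * s / x * y) = (\<lambda>s. sqrt x * (f s + y / sqrt x * (1 - s)))"
    using x by (auto simp: fun_eq_iff field_simps)
  also have "neg_time {0..1} \<dots> = neg_time {0..1} (\<lambda>s. f s + y / sqrt x * (1 - s))"
    using x by (intro neg_time_pos_mult) simp
  finally show ?thesis .
qed

section \<open>Limits of the masses\<close>

text \<open>A one-sided form of Scheffe's lemma: a lower bound on the densities that converges to the limit
  density suffices, since no mass is lost.\<close>

lemma tendsto_set_integral_of_lower_bound:
  fixes f :: "nat \<Rightarrow> 'a \<Rightarrow> real"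
  assumes meas: "\<And>n. f n \<in> borel_measurable M" "g \<in> borel_measurable M" and A: "A \<in> sets M"
    and nonneg: "\<And>n x. 0 \<le> f n x" "\<And>x. 0 \<le> g x" and C: "0 \<le> C"
    and mass: "\<And>n. (\<integral>\<^sup>+x. ennreal (f n x) \<partial>M) = ennreal C" "(\<integral>\<^sup>+x. ennreal (g x) \<partial>M) = ennreal C"
    and lower: "\<And>x. x \<in> space M \<Longrightarrow> \<exists>l. l \<longlonglongrightarrow> g x \<and> (\<forall>\<^sub>F n in sequentially. l n \<le> f n x)"
  shows "(\<lambda>n. LINT x|M. indicator A x * f n x) \<longlonglongrightarrow> (LINT x|M. indicator A x * g x)"
proof -
  have int: "integrable M (f n)" "integral\<^sup>L M (f n) = C" for n
    using nn_integral_eq_integrable[of "f n" M C] meas nonneg C mass by auto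
  have intg: "integrable M g" "integral\<^sup>L M g = C"
    using nn_integral_eq_integrable[of g M C] meas nonneg C mass by auto
  \<comment> \<open>The minimum with the limit density is dominated by \<open>g\<close>, and the
    lower bound on the densities forces it to converge to \<open>g\<close>.\<close>
  define m where "m = (\<lambda>n x. min (f n x) (g x))"
  have mm [measurable]: "m n \<in> borel_measurable M" for n
    unfolding m_def using meas by measurable
  have m_lim: "(\<lambda>n. m n x) \<longlonglongrightarrow> g x" if x: "x \<in> space M" for x
  proof -
    obtain l where l: "l \<longlonglongrightarrow> g x" "\<forall>\<^sub>F n in sequentially. l n \<le> f n x" using lower[OF x] by blast
    have "(\<lambda>n. min (l n) (g x)) \<longlonglongrightarrow> min (g x) (g x)" by (intro tendsto_min l tendsto_const)
    then have "(\<lambda>n. min (l n) (g x)) \<longlonglongrightarrow> g x" by simp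
    then show ?thesis
      by (rule tendsto_sandwich[rotated 2, of _ _ _ "\<lambda>_. g x"])
        (use l(2) in \<open>auto simp: m_def elim!: eventually_mono\<close>)
  qed
  have lim: "(\<lambda>n. LINT x|M. indicator B x * m n x) \<longlonglongrightarrow> (LINT x|M. indicator B x * g x)" if B: "B \<in> sets M" for B
  proof (rule integral_dominated_convergence[where w=g])
    show "AE x in M. (\<lambda>n. indicator B x * m n x) \<longlonglongrightarrow> indicator B x * g x"
      by (intro AE_I2 tendsto_mult tendsto_const m_lim)
    show "AE x in M. norm (indicator B x * m n x) \<le> g x" for n
      using nonneg by (intro AE_I2) (auto simp: indicator_def m_def)
  qed (use B meas intg in auto)
  have indint: "integrable M (\<lambda>x. indicator B x * h x)" if "integrable M h" "B \<in> sets M" for B and h :: "'a \<Rightarrow> real"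
    using integrable_mult_indicator[OF that(2,1)] by simp
  have intm: "integrable M (m n)" for n
    by (rule Bochner_Integration.integrable_bound[OF intg(1) mm]) (use nonneg in \<open>auto simp: m_def\<close>)
  have m_le: "(LINT x|M. indicator B x * m n x) \<le> (LINT x|M. indicator B x * f n x)" if "B \<in> sets M" for B n
    using that by (intro integral_mono indint intm int) (auto simp: m_def indicator_def)
  have A': "space M - A \<in> sets M" using A by simp
  have split: "(LINT x|M. indicator A x * h x) = (LINT x|M. h x) - (LINT x|M. indicator (space M - A) x * h x)" if "integrable M h" for h :: "'a \<Rightarrow> real"
  proof -
    have "(LINT x|M. h x) = (LINT x|M. indicator A x * h x + indicator (space M - A) x * h x)"
      by (intro Bochner_Integration.integral_cong) (auto simp: indicator_def)
    also have "\<dots> = (LINT x|M. indicator A x * h x) + (LINT x|M. indicator (space M - A) x * h x)"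
      using indint[OF that A] indint[OF that A'] by (rule Bochner_Integration.integral_add)
    finally show ?thesis by simp
  qed
  show ?thesis
  proof (rule tendsto_sandwich)
    show "(\<lambda>n. LINT x|M. indicator A x * m n x) \<longlonglongrightarrow> (LINT x|M. indicator A x * g x)" by (rule lim[OF A])
    \<comment> \<open>The upper bound is the lower bound on the complement, because all densities
      have the same total mass \<open>C\<close>.\<close>
    show "(\<lambda>n. C - (LINT x|M. indicator (space M - A) x * m n x)) \<longlonglongrightarrow> (LINT x|M. indicator A x * g x)"
      unfolding split[OF intg(1)] intg(2) by (intro tendsto_intros lim[OF A'])
    show "\<forall>\<^sub>F n in sequentially. (LINT x|M. indicator A x * m n x) \<le> (LINT x|M. indicator A x * f n x)"
      using m_le[OF A] by simp
    show "\<forall>\<^sub>F n in sequentially. (LINT x|M. indicator A x * f n x) \<le> C - (LINT x|M. indicator (space M - A) x * m n x)"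
      unfolding split[OF int(1)] int(2) using m_le[OF A'] by simp
  qed
qed

text \<open>With \<open>v = 1 - u / y\<^sup>2\<close>, scaling expresses the numerator by the mass
  up to 1 at \<open>y / sqrt v\<close>, so \<open>phi_mass_asymp\<close> applies to numerator and
  denominator. The exponents differ by
  \<open>y\<^sup>2 / (2 * v) - y\<^sup>2 / 2 = u / (2 * v)\<close>, which tends to
  \<open>u / 2\<close>.\<close>

lemma phi_mass_ratio:
  assumes u: "0 \<le> u"
  shows "((\<lambda>y. phi_mass y (1 - u / y\<^sup>2) / phi_mass y 1) \<longlongrightarrow> exp (- (u / 2))) at_bot"
proof -
  define J where "J = (\<lambda>y. y\<^sup>2 * exp (y\<^sup>2 / 2) * phi_mass y 1)"
  define v where "v = (\<lambda>y. 1 - u / y\<^sup>2)"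
  have J: "(J \<longlongrightarrow> 2) at_bot" unfolding J_def by (rule phi_mass_asymp)
  have v: "(v \<longlongrightarrow> 1) at_bot" unfolding v_def by real_asymp
  have yv: "filterlim (\<lambda>y. y / sqrt (v y)) at_bot at_bot" unfolding v_def by real_asymp
  have ev: "\<forall>\<^sub>F y in at_bot. y < 0 \<and> v y > 0"
  proof -
    have "\<forall>\<^sub>F y in at_bot. 0 < v y" by (rule order_tendstoD(1)[OF v]) simp
    then show ?thesis using eventually_gt_at_bot[of "0::real"] by eventually_elim simp
  qed
  have "((\<lambda>y. sqrt (v y) * v y * (J (y / sqrt (v y)) / J y) * exp (- (u / v y / 2))) \<longlongrightarrow> sqrt 1 * 1 * (2 / 2) * exp (- (u / 1 / 2))) at_bot"
    by (intro tendsto_intros v J filterlim_compose[OF J yv]) auto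
  then have "((\<lambda>y. sqrt (v y) * v y * (J (y / sqrt (v y)) / J y) * exp (- (u / v y / 2))) \<longlongrightarrow> exp (- (u / 2))) at_bot" by simp
  then show ?thesis
  proof (rule Lim_transform_eventually)
    show "\<forall>\<^sub>F y in at_bot. sqrt (v y) * v y * (J (y / sqrt (v y)) / J y) * exp (- (u / v y / 2)) = phi_mass y (1 - u / y\<^sup>2) / phi_mass y 1"
      using ev
    proof eventually_elim
      case (elim y)
      define w where "w = v y"
      have w: "w > 0" "y \<noteq> 0" using elim by (auto simp: w_def)
      have sc: "phi_mass y w = sqrt w * phi_mass (y / sqrt w) 1" by (rule phi_mass_scale[OF w(1)])
      have J1: "J (y / sqrt w) = y\<^sup>2 / w * exp (y\<^sup>2 / w / 2) * phi_mass (y / sqrt w) 1"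
        using w by (simp add: J_def power_divide)
      have yu: "y\<^sup>2 / w / 2 = y\<^sup>2 / 2 + u / w / 2"
        using w by (simp add: w_def v_def field_simps)
      have pm: "phi_mass y 1 > 0" by (rule phi_mass_pos) simp
      have "sqrt w * w * (J (y / sqrt w) / J y) * exp (- (u / w / 2))
        = sqrt w * phi_mass (y / sqrt w) 1 / phi_mass y 1 * (exp (u / w / 2) * exp (- (u / w / 2)))"
        unfolding J1 yu exp_add using w pm by (simp add: J_def)
      also have "exp (u / w / 2) * exp (- (u / w / 2)) = 1" by (simp add: exp_minus)
      finally have calc: "sqrt w * w * (J (y / sqrt w) / J y) * exp (- (u / w / 2)) = phi_mass y w / phi_mass y 1"
        by (simp add: sc)
      have "1 - u / y\<^sup>2 = w" by (simp add: w_def v_def)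
      then show ?case using calc by (simp only: w_def[symmetric])
    qed
  qed
qed

definition inv_chi_density :: "real \<Rightarrow> real" where
  "inv_chi_density s = indicator {0<..} s * (1 / sqrt (2 * pi * s ^ 3) * exp (- (1 / (2 * s))))"

lemma inv_chi_density_nonneg: "0 \<le> inv_chi_density s"
  by (auto simp: inv_chi_density_def indicator_def)

lemma borel_measurable_inv_chi_density [measurable]: "inv_chi_density \<in> borel_measurable borel"
  unfolding inv_chi_density_def by measurable

text \<open>This is the density of the reciprocal of a squared standard normal variable, with
  distribution function \<open>2 * gauss_tail (1 / sqrt s)\<close> on the positive
  half-line.\<close>

lemma inv_chi_density_mass: "(\<integral>\<^sup>+s. ennreal (inv_chi_density s) \<partial>lborel) = ennreal 1"
proof -
  have "(\<integral>\<^sup>+s. ennreal (inv_chi_density s) \<partial>lborel) = (\<integral>\<^sup>+s\<in>{0<..}. ennreal (1 / sqrt (2 * pi * s ^ 3) * exp (- (1 / (2 * s)))) \<partial>lborel)"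
    by (intro nn_integral_cong) (auto simp: inv_chi_density_def indicator_def)
  also have "\<dots> = ennreal (1 - 0)"
  proof (rule nn_integral_FTC_Ioi[where F="\<lambda>s. 2 * gauss_tail (1 / sqrt s)"])
    fix s :: real assume s: "0 < s"
    define r where "r = sqrt s"
    have r: "r > 0" "s = r\<^sup>2" using s by (auto simp: r_def)
    have d: "((\<lambda>s. 1 / sqrt s) has_real_derivative - (1 / (2 * r)) / (r * r)) (at s)"
      using s unfolding r_def by (auto intro!: derivative_eq_intros simp: field_simps)
    have "((\<lambda>s. 2 * gauss_tail (1 / sqrt s)) has_real_derivative 2 * (- std_normal_density (1 / sqrt s) * (- (1 / (2 * r)) / (r * r)))) (at s)"
      by (intro DERIV_cmult gauss_tail_deriv' d)
    also have "2 * (- std_normal_density (1 / sqrt s) * (- (1 / (2 * r)) / (r * r))) = 1 / sqrt (2 * pi * s ^ 3) * exp (- (1 / (2 * s)))"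
    proof -
      have "sqrt (2 * pi * s ^ 3) = sqrt (2 * pi) * r ^ 3"
        by (simp add: real_sqrt_mult r_def real_sqrt_power)
      then show ?thesis using r
        by (simp add: std_normal_density_def r_def[symmetric] power_divide power2_eq_square power3_eq_cube mult_ac)
    qed
    finally show "((\<lambda>s. 2 * gauss_tail (1 / sqrt s)) has_real_derivative 1 / sqrt (2 * pi * s ^ 3) * exp (- (1 / (2 * s)))) (at s)" .
    show "isCont (\<lambda>s. 1 / sqrt (2 * pi * s ^ 3) * exp (- (1 / (2 * s)))) s"
      using s by (intro continuous_intros) auto
    show "0 \<le> 1 / sqrt (2 * pi * s ^ 3) * exp (- (1 / (2 * s)))" using s by simp
  next
    have "filterlim (\<lambda>s. 1 / sqrt s) at_top (at_right 0)" by real_asymp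
    from tendsto_mult[OF tendsto_const filterlim_compose[OF gauss_tail_at_top this], of 2]
    show "((\<lambda>s. 2 * gauss_tail (1 / sqrt s)) \<longlongrightarrow> 0) (at_right 0)" by simp
    have "((\<lambda>s. 1 / sqrt s) \<longlongrightarrow> 0) at_top" by real_asymp
    from tendsto_mult[OF tendsto_const tendsto_gauss_tail[OF this], of 2]
    show "((\<lambda>s. 2 * gauss_tail (1 / sqrt s)) \<longlongrightarrow> 1) at_top" by (simp add: gauss_tail_0)
  qed
  finally show ?thesis by simp
qed

text \<open>The total masses need not be computed: they are forced by the normalisation of the
  distribution function of the random time.\<close>

locale occ_masses = standard_bridge +
  assumes mass_neg: "y < 0 \<Longrightarrow> ((\<lambda>x. LINT t:{0..x}|lborel. occ_cdf N \<beta> (y / sqrt t) (1 / t) * phi y t) \<longlongrightarrow> 2 * phi_mass y 1) at_top"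
    and mass_pos: "y > 0 \<Longrightarrow> ((\<lambda>x. LINT t:{0..x}|lborel. occ_cdf N \<beta> (y / sqrt t) (1 / t) * phi y t) \<longlongrightarrow> 4) at_top"
begin

text \<open>Up to normalisation, the density of the random time on the positive half-line. It is at
  most \<open>phi y\<close>, with equality up to time 1, where the path cannot spend more than unit
  time below zero.\<close>

definition occ_dens :: "real \<Rightarrow> real \<Rightarrow> real" where
  "occ_dens y t = indicator {0<..} t * (occ_cdf N \<beta> (y / sqrt t) (1 / t) * phi y t)"

definition occ_mass :: "real \<Rightarrow> real \<Rightarrow> real" where
  "occ_mass y x = (LINT t:{0..x}|lborel. occ_cdf N \<beta> (y / sqrt t) (1 / t) * phi y t)"

lemma occ_dens_nonneg: "0 \<le> occ_dens y t"
  by (auto simp: occ_dens_def indicator_def intro!: mult_nonneg_nonneg occ_cdf_nonneg phi_nonneg)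

lemma occ_dens_le: "0 \<le> t \<Longrightarrow> occ_dens y t \<le> phi y t"
  by (auto simp: occ_dens_def indicator_def phi_nonneg intro!: mult_left_le_one_le occ_cdf_nonneg occ_cdf_le_1)

lemma occ_dens_eq_phi: "t \<in> {0..1} \<Longrightarrow> occ_dens y t = phi y t"
  by (cases "t = 0") (auto simp: occ_dens_def occ_cdf_eq_1)

lemma occ_dens_neg [simp]: "t \<le> 0 \<Longrightarrow> occ_dens y t = 0"
  by (simp add: occ_dens_def)

lemma borel_measurable_occ_dens [measurable]: "occ_dens y \<in> borel_measurable borel"
proof -
  have "(\<lambda>t :: real. occ_cdf N \<beta> (y / sqrt t) (1 / t)) \<in> borel_measurable borel"
    by (rule measurable_occ_cdf) auto
  then show ?thesis unfolding occ_dens_def[abs_def] by measurable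
qed

lemma occ_mass_eq: "occ_mass y x = (LINT t|lborel. indicator {0..x} t * occ_dens y t)"
  unfolding occ_mass_def set_lebesgue_integral_def
  by (intro Bochner_Integration.integral_cong) (auto simp: occ_dens_def indicator_def)

lemma occ_dens_integrable:
  assumes "0 \<le> x"
  shows "integrable lborel (\<lambda>t. indicator {0..x} t * occ_dens y t)"
  by (rule Bochner_Integration.integrable_bound[OF phi_integrable[OF assms, of y, unfolded set_integrable_def]])
    (auto simp: indicator_def phi_nonneg occ_dens_nonneg occ_dens_le)

lemma ennreal_occ_mass:
  assumes "0 \<le> x"
  shows "ennreal (occ_mass y x) = (\<integral>\<^sup>+t\<in>{0..x}. ennreal (occ_dens y t) \<partial>lborel)"
proof -
  have "ennreal (occ_mass y x) = (\<integral>\<^sup>+t. ennreal (indicator {0..x} t * occ_dens y t) \<partial>lborel)"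
    unfolding occ_mass_eq by (rule nn_integral_eq_integral[symmetric, OF occ_dens_integrable[OF assms]]) (auto simp: indicator_def occ_dens_nonneg)
  also have "\<dots> = (\<integral>\<^sup>+t\<in>{0..x}. ennreal (occ_dens y t) \<partial>lborel)"
    by (intro nn_integral_cong) (auto simp: indicator_def)
  finally show ?thesis .
qed

lemma occ_mass_eq_phi_mass: "0 \<le> x \<Longrightarrow> x \<le> 1 \<Longrightarrow> occ_mass y x = phi_mass y x"
  unfolding occ_mass_eq phi_mass_def set_lebesgue_integral_def
  by (intro Bochner_Integration.integral_cong) (auto simp: occ_dens_eq_phi indicator_def)

lemma nn_integral_occ_dens:
  assumes "(occ_mass y \<longlongrightarrow> C) at_top"
  shows "(\<integral>\<^sup>+t. ennreal (occ_dens y t) \<partial>lborel) = ennreal C"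
proof -
  have "(\<lambda>n. \<integral>\<^sup>+t. ennreal (occ_dens y t) * indicator {0..real n} t \<partial>lborel) \<longlonglongrightarrow> (\<integral>\<^sup>+t. ennreal (occ_dens y t) \<partial>lborel)"
  proof (rule nn_integral_LIMSEQ)
    show "incseq (\<lambda>n t. ennreal (occ_dens y t) * indicator {0..real n} t)"
      by (auto simp: incseq_def le_fun_def indicator_def)
    fix t
    have "\<forall>\<^sub>F n in sequentially. t \<le> real n" by real_asymp
    then have "\<forall>\<^sub>F n in sequentially. ennreal (occ_dens y t) * indicator {0..real n} t = ennreal (occ_dens y t)"
      by eventually_elim (auto simp: indicator_def)
    then show "(\<lambda>n. ennreal (occ_dens y t) * indicator {0..real n} t) \<longlonglongrightarrow> ennreal (occ_dens y t)"
      by (rule tendsto_eventually)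
  qed auto
  moreover have "(\<lambda>n. ennreal (occ_mass y (real n))) \<longlonglongrightarrow> ennreal C"
    by (intro tendsto_ennrealI filterlim_compose[OF assms filterlim_real_sequentially])
  ultimately show ?thesis
    by (simp add: ennreal_occ_mass LIMSEQ_unique)
qed

lemma occ_dens_mass_neg: "y < 0 \<Longrightarrow> (\<integral>\<^sup>+t. ennreal (occ_dens y t) \<partial>lborel) = ennreal (2 * phi_mass y 1)"
  using mass_neg by (intro nn_integral_occ_dens) (simp add: occ_mass_def[abs_def])

lemma occ_dens_mass_pos: "y > 0 \<Longrightarrow> (\<integral>\<^sup>+t. ennreal (occ_dens y t) \<partial>lborel) = ennreal 4"
  using mass_pos by (intro nn_integral_occ_dens) (simp add: occ_mass_def[abs_def])

text \<open>Scaling time by \<open>v\<close> turns the level \<open>v\<close> into the level 1 and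
  \<open>y\<close> into \<open>y / sqrt v\<close>, where the mass is known. This is the numerator of
  the distribution function of the time below zero.\<close>

lemma occ_dens_mass_scaled:
  assumes y: "y < 0" and v: "v > 0"
  shows "(\<integral>\<^sup>+t\<in>{0<..}. ennreal (occ_cdf N \<beta> (y / sqrt t) (v / t) * phi y t) \<partial>lborel) = ennreal (2 * phi_mass y v)"
proof -
  have [measurable]: "(\<lambda>t :: real. occ_cdf N \<beta> (y / sqrt t) (v / t)) \<in> borel_measurable borel"
    by (rule measurable_occ_cdf) auto
  have "(\<integral>\<^sup>+t\<in>{0<..}. ennreal (occ_cdf N \<beta> (y / sqrt t) (v / t) * phi y t) \<partial>lborel)
    = ennreal \<bar>v\<bar> * (\<integral>\<^sup>+t. ennreal (occ_cdf N \<beta> (y / sqrt (0 + v * t)) (v / (0 + v * t)) * phi y (0 + v * t)) * indicator {0<..} (0 + v * t) \<partial>lborel)"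
    using v by (intro nn_integral_real_affine) auto
  also have "(\<integral>\<^sup>+t. ennreal (occ_cdf N \<beta> (y / sqrt (0 + v * t)) (v / (0 + v * t)) * phi y (0 + v * t)) * indicator {0<..} (0 + v * t) \<partial>lborel)
    = (\<integral>\<^sup>+t. ennreal (1 / sqrt v) * ennreal (occ_dens (y / sqrt v) t) \<partial>lborel)"
    using v by (intro nn_integral_cong)
      (auto simp: occ_dens_def indicator_def zero_less_mult_iff phi_scale real_sqrt_mult ennreal_mult'[symmetric])
  also have "\<dots> = ennreal (1 / sqrt v) * ennreal (2 * phi_mass (y / sqrt v) 1)"
    using y v by (subst nn_integral_cmult) (auto simp: occ_dens_mass_neg divide_neg_pos)
  also have "ennreal \<bar>v\<bar> * \<dots> = ennreal (v * (1 / sqrt v * (2 * phi_mass (y / sqrt v) 1)))"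
    using v by (simp add: ennreal_mult'[symmetric] phi_mass_nonneg)
  also have "v * (1 / sqrt v * (2 * phi_mass (y / sqrt v) 1)) = v / sqrt v * (2 * phi_mass (y / sqrt v) 1)" by simp
  also have "\<dots> = 2 * phi_mass y v"
    using v by (simp add: phi_mass_scale[OF v, of y] real_div_sqrt)
  finally show ?thesis .
qed

text \<open>The bound of \<open>occ_cdf_ge\<close> at \<open>c = y / sqrt t\<close> and
  \<open>r = 1 / t\<close>, simplified.\<close>

definition occ_lower :: "real \<Rightarrow> real \<Rightarrow> real" where
  "occ_lower y t = 1 / t * occ_tail (sqrt (y\<^sup>2 * (1 - 1 / t)))"

lemma occ_lower_eq:
  assumes "y < 0" "t > 1"
  shows "1 / t * occ_tail (- (y / sqrt t) * sqrt ((1 - 1 / t) / (1 / t))) = occ_lower y t"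
proof -
  have "sqrt (y\<^sup>2 * (1 - 1 / t)) = - y * sqrt (1 - 1 / t)" using assms by (simp add: real_sqrt_mult)
  moreover have "sqrt ((1 - 1 / t) / (1 / t)) = sqrt (1 - 1 / t) * sqrt t"
    using assms by (simp add: real_sqrt_mult[symmetric])
  ultimately show ?thesis using assms by (simp add: occ_lower_def)
qed

lemma occ_lower_nonneg: "t > 1 \<Longrightarrow> 0 \<le> occ_lower y t"
  unfolding occ_lower_def by (intro mult_nonneg_nonneg occ_tail_nonneg) auto

lemma occ_lower_le:
  assumes "y < 0" "t > 1"
  shows "occ_lower y t \<le> occ_cdf N \<beta> (y / sqrt t) (1 / t)"
  using occ_cdf_ge[of "y / sqrt t" "1 / t"] occ_lower_eq[OF assms] assms by (simp add: divide_neg_pos)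

text \<open>Half of the prescribed total \<open>2 * phi_mass y 1\<close> is used up by time 1, where
  the density is \<open>phi y\<close>.\<close>

lemma occ_dens_mass_gt_1:
  assumes y: "y < 0"
  shows "(\<integral>\<^sup>+t\<in>{1<..}. ennreal (occ_dens y t) \<partial>lborel) = ennreal (phi_mass y 1)"
proof -
  have "(\<integral>\<^sup>+t. ennreal (occ_dens y t) \<partial>lborel) = (\<integral>\<^sup>+t. ennreal (occ_dens y t) * indicator {0..1} t + ennreal (occ_dens y t) * indicator {1<..} t \<partial>lborel)"
    by (intro nn_integral_cong) (auto simp: indicator_def)
  also have "\<dots> = ennreal (occ_mass y 1) + (\<integral>\<^sup>+t\<in>{1<..}. ennreal (occ_dens y t) \<partial>lborel)"
    by (subst nn_integral_add) (auto simp: ennreal_occ_mass)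
  finally have "ennreal (phi_mass y 1) + (\<integral>\<^sup>+t\<in>{1<..}. ennreal (occ_dens y t) \<partial>lborel) = ennreal (phi_mass y 1) + ennreal (phi_mass y 1)"
    using occ_dens_mass_neg[OF y] occ_mass_eq_phi_mass[of 1 y] by (simp add: ennreal_plus[symmetric] phi_mass_nonneg del: ennreal_plus)
  then show ?thesis by (simp add: ennreal_add_left_cancel)
qed

text \<open>Beyond time 1 the lower bound and the density have the same finite integral, by
  \<open>occ_phi_mass\<close> and \<open>occ_dens_mass_gt_1\<close>. One dominates the other, so
  they agree almost everywhere.\<close>

lemma occ_cdf_eq_occ_lower_AE:
  assumes y: "y < 0"
  shows "AE t in lborel. t > 1 \<longrightarrow> occ_cdf N \<beta> (y / sqrt t) (1 / t) = occ_lower y t"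
proof -
  have [measurable]: "occ_lower y \<in> borel_measurable borel" unfolding occ_lower_def[abs_def] by measurable
  define a where "a = (\<lambda>t. ennreal (occ_lower y t * phi y t) * indicator {1<..} t)"
  define b where "b = (\<lambda>t. ennreal (occ_dens y t) * indicator {1<..} t)"
  have am: "a \<in> borel_measurable lborel" and bm: "b \<in> borel_measurable lborel"
    unfolding a_def b_def
    by (intro borel_measurable_times_ennreal measurable_compose[OF _ measurable_ennreal] borel_measurable_times; simp)+
  have le: "a t \<le> b t" for t
    unfolding a_def b_def occ_dens_def using occ_lower_le[OF y, of t]
    by (auto simp: indicator_def phi_nonneg intro!: ennreal_leI mult_right_mono)
  have ia: "(\<integral>\<^sup>+t. a t \<partial>lborel) = ennreal (phi_mass y 1)"
    unfolding a_def occ_lower_def using occ_phi_mass[of y] y by simp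
  have ib: "(\<integral>\<^sup>+t. b t \<partial>lborel) = ennreal (phi_mass y 1)"
    unfolding b_def by (rule occ_dens_mass_gt_1[OF y])
  have "(\<integral>\<^sup>+t. b t - a t \<partial>lborel) = (\<integral>\<^sup>+t. b t \<partial>lborel) - (\<integral>\<^sup>+t. a t \<partial>lborel)"
    using le ia am bm by (intro nn_integral_diff) auto
  then have "(\<integral>\<^sup>+t. b t - a t \<partial>lborel) = 0" by (simp add: ia ib)
  then have "AE t in lborel. b t - a t = 0" using am bm by (subst (asm) nn_integral_0_iff_AE) auto
  then show ?thesis
  proof eventually_elim
    case (elim t)
    show ?case
    proof
      assume t: "t > 1"
      have "b t \<le> a t" using elim by (simp add: ennreal_minus_eq_0)
      then have "ennreal (occ_cdf N \<beta> (y / sqrt t) (1 / t) * phi y t) \<le> ennreal (occ_lower y t * phi y t)"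
        using t by (simp add: a_def b_def occ_dens_def)
      then have "occ_cdf N \<beta> (y / sqrt t) (1 / t) * phi y t \<le> occ_lower y t * phi y t"
        using t by (subst (asm) ennreal_le_iff) (auto intro!: mult_nonneg_nonneg occ_lower_nonneg phi_nonneg)
      then show "occ_cdf N \<beta> (y / sqrt t) (1 / t) = occ_lower y t"
        using phi_pos[of t y] t occ_lower_le[OF y t] by simp
    qed
  qed
qed

text \<open>If the bound failed at the start \<open>- \<kappa>\<close>, then by continuity of
  \<open>occ_tail\<close> the value there would exceed the bound for some
  \<open>k < \<kappa>\<close> too. Along the curve of starts \<open>y / sqrt t\<close> and levels
  \<open>1 / t\<close> through \<open>- k\<close> and \<open>r\<close>, for \<open>t\<close>
  slightly below \<open>1 / r\<close>, the start is still above \<open>- \<kappa>\<close> and the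
  level at least \<open>r\<close>. Monotonicity then contradicts the almost everywhere identity on
  an interval of positive length.\<close>

lemma occ_cdf_le:
  assumes \<kappa>: "\<kappa> > 0" and r: "0 < r" "r < 1"
  shows "occ_cdf N \<beta> (- \<kappa>) r \<le> r * occ_tail (\<kappa> * sqrt ((1 - r) / r))"
proof (rule ccontr)
  assume "\<not> occ_cdf N \<beta> (- \<kappa>) r \<le> r * occ_tail (\<kappa> * sqrt ((1 - r) / r))"
  then have less: "r * occ_tail (\<kappa> * sqrt ((1 - r) / r)) < occ_cdf N \<beta> (- \<kappa>) r" by simp
  have "((\<lambda>k. r * occ_tail (k * sqrt ((1 - r) / r))) \<longlongrightarrow> r * occ_tail (\<kappa> * sqrt ((1 - r) / r))) (at_left \<kappa>)"
    by (intro tendsto_intros)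
  from order_tendstoD(2)[OF this less]
  have "\<forall>\<^sub>F k in at_left \<kappa>. r * occ_tail (k * sqrt ((1 - r) / r)) < occ_cdf N \<beta> (- \<kappa>) r" .
  then have "\<forall>\<^sub>F k in at_left \<kappa>. r * occ_tail (k * sqrt ((1 - r) / r)) < occ_cdf N \<beta> (- \<kappa>) r \<and> k \<in> {0<..<\<kappa>}"
    using eventually_at_left_real[OF \<kappa>] by (rule eventually_conj)
  from eventually_happens'[OF trivial_limit_at_left_real this]
  obtain k where k: "r * occ_tail (k * sqrt ((1 - r) / r)) < occ_cdf N \<beta> (- \<kappa>) r" "0 < k" "k < \<kappa>"
    by auto
  \<comment> \<open>Chosen so that the curve passes through the right point:
    \<open>y / sqrt t0 = - k\<close> and \<open>1 / t0 = r\<close>.\<close>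
  define y where "y = - k / sqrt r"
  have y: "y < 0" using k r by (simp add: y_def)
  define t0 where "t0 = 1 / r"
  have t0: "t0 > 1" using r by (simp add: t0_def)
  have "occ_lower y t0 = r * occ_tail (k * sqrt ((1 - r) / r))"
    using occ_lower_eq[OF y t0] r by (simp add: t0_def y_def real_sqrt_divide)
  moreover have "(occ_lower y \<longlongrightarrow> occ_lower y t0) (at_left t0)"
    unfolding occ_lower_def using t0 by (intro tendsto_intros) auto
  ultimately have "\<forall>\<^sub>F t in at_left t0. occ_lower y t < occ_cdf N \<beta> (- \<kappa>) r"
    using k(1) order_tendstoD(2) by metis
  moreover have "((\<lambda>t. - y / sqrt t) \<longlongrightarrow> - y / sqrt t0) (at_left t0)"
    using t0 by (intro tendsto_intros) auto
  then have "\<forall>\<^sub>F t in at_left t0. - y / sqrt t < \<kappa>"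
    using k r by (intro order_tendstoD(2)) (auto simp: y_def t0_def real_sqrt_divide)
  ultimately have "\<forall>\<^sub>F t in at_left t0. occ_lower y t < occ_cdf N \<beta> (- \<kappa>) r \<and> - y / sqrt t < \<kappa>"
    by (rule eventually_conj)
  then obtain e where e: "e < t0" "\<And>t. e < t \<Longrightarrow> t < t0 \<Longrightarrow> occ_lower y t < occ_cdf N \<beta> (- \<kappa>) r \<and> - y / sqrt t < \<kappa>"
    unfolding eventually_at_left_field by blast
  have "AE t in lborel. \<not> (max e 1 < t \<and> t < t0)"
    using occ_cdf_eq_occ_lower_AE[OF y]
  proof eventually_elim
    case (elim t)
    show ?case
    proof
      assume t: "max e 1 < t \<and> t < t0"
      then have "occ_cdf N \<beta> (y / sqrt t) (1 / t) = occ_lower y t" using elim by simp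
      moreover have "occ_cdf N \<beta> (- \<kappa>) r \<le> occ_cdf N \<beta> (y / sqrt t) (1 / t)"
      proof (rule occ_cdf_mono)
        show "- \<kappa> \<le> y / sqrt t" using e(2)[of t] t by simp
        show "r \<le> 1 / t" using t r by (simp add: t0_def field_simps)
      qed
      ultimately show False using e(2)[of t] t by simp
    qed
  qed
  moreover have "(AE t in lborel. \<not> (max e 1 < t \<and> t < t0)) \<longleftrightarrow> emeasure lborel {max e 1<..<t0} = 0"
    by (rule AE_iff_measurable) auto
  ultimately have "emeasure lborel {max e 1<..<t0} = 0" by simp
  then show False using e(1) t0 by (simp add: emeasure_lborel_Ioo)
qed

text \<open>At time \<open>t = y\<^sup>2 * s\<close> the rescaled start is
  \<open>1 / sqrt s\<close>, independent of \<open>y\<close>, while the level \<open>1 / t\<close>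
  tends to 0. By \<open>occ_cdf_reflect\<close> and \<open>occ_cdf_le\<close> the probability is at
  least \<open>1 - r * occ_tail a\<close> with \<open>r\<close> close to 1 and \<open>a\<close>
  close to \<open>1 / (y * s)\<close>, so the derivative of \<open>occ_tail\<close> at 0 determines
  the limit of the lower bound. The prescribed mass 4 makes the rescaled densities probability
  densities, and the one-sided Scheffe argument applies.\<close>

lemma inv_chi_limit:
  assumes x: "x > 0"
  shows "((\<lambda>y. occ_mass y (x * y\<^sup>2) / 4) \<longlongrightarrow> (LINT s|lborel. indicator {0..x} s * inv_chi_density s)) at_top"
proof (rule tendsto_at_topI_sequentially)
  fix Y :: "nat \<Rightarrow> real" assume Y: "filterlim Y at_top sequentially"
  \<comment> \<open>The total mass is known for positive \<open>y\<close> only. Finitely many terms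
    of the sequence are changed so that it is available for every index.\<close>
  define Y' where "Y' = (\<lambda>n. if Y n > 0 then Y n else 1)"
  have Y'pos: "Y' n > 0" for n by (simp add: Y'_def)
  have YY': "\<forall>\<^sub>F n in sequentially. Y' n = Y n"
    using filterlim_at_top_dense[THEN iffD1, OF Y, rule_format, of 0] by eventually_elim (simp add: Y'_def)
  then have Y': "filterlim Y' at_top sequentially"
    using Y by (subst filterlim_cong[OF refl refl]) auto
  define k where "k = (\<lambda>n s. (Y' n)\<^sup>2 / 4 * occ_dens (Y' n) ((Y' n)\<^sup>2 * s))"
  have km [measurable]: "k n \<in> borel_measurable borel" for n unfolding k_def by measurable
  have k_eq: "k n s = Y' n * occ_cdf N \<beta> (1 / sqrt s) (1 / ((Y' n)\<^sup>2 * s)) / (4 * sqrt s) * exp (- (1 / (2 * s)))" if s: "s > 0" for n s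
  proof -
    have q: "sqrt ((Y' n)\<^sup>2 * s) = Y' n * sqrt s" using Y'pos[of n] by (simp add: real_sqrt_mult)
    have "phi (Y' n) ((Y' n)\<^sup>2 * s) = 1 / (Y' n * sqrt s) * exp (- (1 / (2 * s)))"
      unfolding phi_def q using Y'pos[of n] s by simp
    then show ?thesis
      unfolding k_def occ_dens_def q using Y'pos[of n] s by (simp add: power2_eq_square)
  qed
  have "(\<lambda>n. LINT s|lborel. indicator {0..x} s * k n s) \<longlonglongrightarrow> (LINT s|lborel. indicator {0..x} s * inv_chi_density s)"
  proof (rule tendsto_set_integral_of_lower_bound[where C=1])
    show "k n \<in> borel_measurable lborel" for n by simp
    show "inv_chi_density \<in> borel_measurable lborel" by simp
    show "0 \<le> k n s" for n s by (simp add: k_def occ_dens_nonneg)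
    show "0 \<le> inv_chi_density s" for s by (rule inv_chi_density_nonneg)
    show "(\<integral>\<^sup>+s. ennreal (inv_chi_density s) \<partial>lborel) = ennreal 1" by (rule inv_chi_density_mass)
    fix n
    have "(\<integral>\<^sup>+s. ennreal (k n s) \<partial>lborel) = ennreal (1/4) * (ennreal \<bar>(Y' n)\<^sup>2\<bar> * (\<integral>\<^sup>+s. ennreal (occ_dens (Y' n) (0 + (Y' n)\<^sup>2 * s)) \<partial>lborel))"
      unfolding k_def
      by (subst nn_integral_cmult[symmetric], simp, subst nn_integral_cmult[symmetric], simp)
        (auto intro!: nn_integral_cong simp: ennreal_mult'[symmetric] occ_dens_nonneg)
    also have "ennreal \<bar>(Y' n)\<^sup>2\<bar> * (\<integral>\<^sup>+s. ennreal (occ_dens (Y' n) (0 + (Y' n)\<^sup>2 * s)) \<partial>lborel) = (\<integral>\<^sup>+t. ennreal (occ_dens (Y' n) t) \<partial>lborel)"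
      using Y'pos[of n] by (intro nn_integral_real_affine[symmetric]) auto
    also have "\<dots> = ennreal 4" by (rule occ_dens_mass_pos[OF Y'pos])
    finally show "(\<integral>\<^sup>+s. ennreal (k n s) \<partial>lborel) = ennreal 1" by (simp add: ennreal_mult'[symmetric] del: ennreal_numeral)
  next
    fix s :: real
    show "\<exists>l. l \<longlonglongrightarrow> inv_chi_density s \<and> (\<forall>\<^sub>F n in sequentially. l n \<le> k n s)"
    proof (cases "s > 0")
      case False
      then show ?thesis
        by (intro exI[of _ "\<lambda>_. 0"]) (auto simp: inv_chi_density_def k_def occ_dens_nonneg)
    next
      case s: True
      define r where "r = (\<lambda>y. 1 - 1 / (y\<^sup>2 * s))"
      define a where "a = (\<lambda>y. 1 / sqrt s * sqrt ((1 - r y) / r y))"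
      define L where "L = (\<lambda>y. y * (1 - r y * occ_tail (a y)) / (4 * sqrt s) * exp (- (1 / (2 * s))))"
      have rlim: "(r \<longlongrightarrow> 1) at_top" unfolding r_def using s by real_asymp
      have ya: "((\<lambda>y. y * a y) \<longlongrightarrow> 1 / s) at_top"
      proof -
        have "((\<lambda>y. y * a y) \<longlongrightarrow> inverse s powr (1 / 2) / root 2 s) at_top"
          unfolding a_def r_def using s by real_asymp
        also have "inverse s powr (1 / 2) / root 2 s = 1 / s"
        proof -
          have "root 2 s = sqrt s" by (simp only: sqrt_def)
          moreover have "inverse s powr (1 / 2) = inverse (sqrt s)"
            using s by (simp add: powr_half_sqrt real_sqrt_inverse)
          moreover have "inverse (sqrt s) / sqrt s = 1 / s"
            using s by (simp add: divide_inverse mult.commute inverse_mult_distrib[symmetric] del: inverse_mult_distrib)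
          ultimately show ?thesis by simp
        qed
        finally show ?thesis .
      qed
      have alim: "filterlim a (at_right 0) at_top"
        unfolding a_def r_def using s by real_asymp
      have "((\<lambda>h. (occ_tail (0 + h) - occ_tail 0) / h) \<longlongrightarrow> 4 * 0 * gauss_tail 0 - 4 * std_normal_density 0) (at 0)"
        using occ_tail_deriv[of 0] unfolding DERIV_def .
      then have "((\<lambda>h. (occ_tail h - 1) / h) \<longlongrightarrow> - 4 / sqrt (2 * pi)) (at_right 0)"
        by (simp add: filterlim_at_split std_normal_density_def)
      from filterlim_compose[OF this alim]
      have oa: "((\<lambda>y. (occ_tail (a y) - 1) / a y) \<longlongrightarrow> - 4 / sqrt (2 * pi)) at_top" .
      have a0: "(a \<longlongrightarrow> 0) at_top" using alim by (simp add: filterlim_at)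
      have yr: "((\<lambda>y. y * (1 - r y)) \<longlongrightarrow> 0) at_top" unfolding r_def using s by real_asymp
      \<comment> \<open>The difference \<open>1 - r * occ_tail a\<close> is split into
        \<open>1 - r\<close>, of order \<open>1 / y\<^sup>2\<close>, and
        \<open>- r * (occ_tail a - 1)\<close>, of order \<open>1 / y\<close>, which carries the
        limit.\<close>
      have "((\<lambda>y. y * (1 - r y) - r y * (y * a y) * ((occ_tail (a y) - 1) / a y)) \<longlongrightarrow> 0 - 1 * (1 / s) * (- 4 / sqrt (2 * pi))) at_top"
        by (intro tendsto_intros yr rlim ya oa)
      then have m0: "((\<lambda>y. y * (1 - r y) - r y * (y * a y) * ((occ_tail (a y) - 1) / a y)) \<longlongrightarrow> 1 / s * (4 / sqrt (2 * pi))) at_top"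
        by simp
      have ev: "\<forall>\<^sub>F y in at_top. y * (1 - r y) - r y * (y * a y) * ((occ_tail (a y) - 1) / a y) = y * (1 - r y * occ_tail (a y))"
      proof -
        have "\<forall>\<^sub>F y in at_top. a y > 0" using alim unfolding filterlim_at by (auto elim: eventually_mono)
        then show ?thesis by eventually_elim (simp add: field_simps)
      qed
      have main: "((\<lambda>y. y * (1 - r y * occ_tail (a y))) \<longlongrightarrow> 1 / s * (4 / sqrt (2 * pi))) at_top"
        by (rule Lim_transform_eventually[OF m0 ev])
      have "(L \<longlongrightarrow> 1 / s * (4 / sqrt (2 * pi)) / (4 * sqrt s) * exp (- (1 / (2 * s)))) at_top"
        unfolding L_def using s by (intro tendsto_intros main) auto
      also have "1 / s * (4 / sqrt (2 * pi)) / (4 * sqrt s) * exp (- (1 / (2 * s))) = inv_chi_density s"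
      proof -
        have "sqrt (s ^ 3) = s * sqrt s" using s by (simp add: power3_eq_cube real_sqrt_mult)
        then show ?thesis using s by (simp add: inv_chi_density_def real_sqrt_mult)
      qed
      finally have "(\<lambda>n. L (Y' n)) \<longlonglongrightarrow> inv_chi_density s"
        using Y' by (rule filterlim_compose)
      moreover have "\<forall>\<^sub>F n in sequentially. L (Y' n) \<le> k n s"
      proof -
        have "\<forall>\<^sub>F y in at_top. 0 < r y \<and> r y < 1"
          unfolding r_def using s by (intro eventually_conj) real_asymp+
        then have "\<forall>\<^sub>F n in sequentially. 0 < r (Y' n) \<and> r (Y' n) < 1"
          using Y' by (rule eventually_compose_filterlim)
        then show ?thesis
        proof eventually_elim
          case (elim n)
          have "1 - r (Y' n) * occ_tail (a (Y' n)) \<le> 1 - occ_cdf N \<beta> (- (1 / sqrt s)) (r (Y' n))"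
            unfolding a_def using occ_cdf_le[of "1 / sqrt s" "r (Y' n)"] elim s by simp
          also have "\<dots> \<le> occ_cdf N \<beta> (1 / sqrt s) (1 / ((Y' n)\<^sup>2 * s))"
            using occ_cdf_reflect[of "1 / sqrt s" "1 / ((Y' n)\<^sup>2 * s)"] by (simp add: r_def)
          finally show ?case
            unfolding L_def k_eq[OF s] using Y'pos[of n] s
            by (intro mult_right_mono divide_right_mono mult_left_mono) auto
        qed
      qed
      ultimately show ?thesis by blast
    qed
  qed auto
  then show "(\<lambda>n. occ_mass (Y n) (x * (Y n)\<^sup>2) / 4) \<longlonglongrightarrow> (LINT s|lborel. indicator {0..x} s * inv_chi_density s)"
  proof (rule Lim_transform_eventually)
    show "\<forall>\<^sub>F n in sequentially. (LINT s|lborel. indicator {0..x} s * k n s) = occ_mass (Y n) (x * (Y n)\<^sup>2) / 4"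
      using YY'
    proof eventually_elim
      case (elim n)
      have y: "Y n > 0" using Y'pos[of n] elim by simp
      have "occ_mass (Y n) (x * (Y n)\<^sup>2) = \<bar>(Y n)\<^sup>2\<bar> * (LINT s|lborel. indicator {0..x * (Y n)\<^sup>2} (0 + (Y n)\<^sup>2 * s) * occ_dens (Y n) (0 + (Y n)\<^sup>2 * s))"
        unfolding occ_mass_eq using y by (subst lborel_integral_real_affine[where c="(Y n)\<^sup>2" and t=0]) auto
      also have "(\<lambda>s. indicator {0..x * (Y n)\<^sup>2} (0 + (Y n)\<^sup>2 * s) * occ_dens (Y n) (0 + (Y n)\<^sup>2 * s)) = (\<lambda>s. (indicator {0..x} s * k n s) * (4 / (Y n)\<^sup>2))"
        using y by (auto simp: k_def elim indicator_def fun_eq_iff zero_le_mult_iff mult.commute)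
      finally show ?case using y by simp
    qed
  qed
qed

text \<open>In the variable \<open>s = y\<^sup>2 * (t - 1)\<close> the density of the random time
  beyond 1 has mass \<open>1 / 2\<close> for every \<open>y < 0\<close>. The lower bound from
  \<open>occ_lower\<close> converges to \<open>exp (s / 2) * occ_tail (sqrt s) / 4\<close>, which
  has the same mass, so tails converge as well; the tail of the limit is \<open>g_tail\<close> by
  \<open>occ_tail_g_tail\<close>.\<close>

lemma g_tail_limit:
  assumes w: "w \<ge> 0"
  shows "((\<lambda>y. 1 - occ_mass y (1 + w / y\<^sup>2) / (2 * phi_mass y 1)) \<longlongrightarrow> g_tail w) at_bot"
  unfolding filterlim_at_bot_mirror
proof (rule tendsto_at_topI_sequentially)
  fix Y :: "nat \<Rightarrow> real" assume Y: "filterlim Y at_top sequentially"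
  define Z where "Z = (\<lambda>n. if Y n > 0 then - Y n else - 1)"
  have Zneg: "Z n < 0" for n by (simp add: Z_def)
  have YZ: "\<forall>\<^sub>F n in sequentially. Z n = - Y n"
    using filterlim_at_top_dense[THEN iffD1, OF Y, rule_format, of 0] by eventually_elim (simp add: Z_def)
  then have Z: "filterlim Z at_bot sequentially"
    using Y by (subst filterlim_cong[OF refl refl]) (auto simp: filterlim_uminus_at_top)
  define J where "J = (\<lambda>y. y\<^sup>2 * exp (y\<^sup>2 / 2) * phi_mass y 1)"
  have J: "(\<lambda>n. J (Z n)) \<longlonglongrightarrow> 2" unfolding J_def by (rule filterlim_compose[OF phi_mass_asymp Z])
  define T where "T = (\<lambda>n s. 1 + s / (Z n)\<^sup>2)"
  define d where "d = (\<lambda>n s. indicator {0<..} s * (occ_dens (Z n) (T n s) / (2 * phi_mass (Z n) 1 * (Z n)\<^sup>2)))"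
  define f where "f = (\<lambda>s. indicator {0<..} s * (exp (s / 2) * occ_tail (sqrt s) / 4))"
  have pm: "phi_mass (Z n) 1 > 0" for n by (rule phi_mass_pos) simp
  have aff: "(\<integral>\<^sup>+s. ennreal (d n s) * indicator {w<..} s \<partial>lborel) = (\<integral>\<^sup>+t\<in>{1 + w / (Z n)\<^sup>2<..}. ennreal (occ_dens (Z n) t / (2 * phi_mass (Z n) 1)) \<partial>lborel)"
    if "w \<ge> 0" for n w
  proof -
    have z2: "(Z n)\<^sup>2 > 0" using Zneg[of n] by simp
    have "(\<integral>\<^sup>+t\<in>{1 + w / (Z n)\<^sup>2<..}. ennreal (occ_dens (Z n) t / (2 * phi_mass (Z n) 1)) \<partial>lborel)
      = ennreal \<bar>1 / (Z n)\<^sup>2\<bar> * (\<integral>\<^sup>+s. ennreal (occ_dens (Z n) (1 + 1 / (Z n)\<^sup>2 * s) / (2 * phi_mass (Z n) 1)) * indicator {1 + w / (Z n)\<^sup>2<..} (1 + 1 / (Z n)\<^sup>2 * s) \<partial>lborel)"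
      using z2 by (intro nn_integral_real_affine) auto
    also have "\<dots> = (\<integral>\<^sup>+s. ennreal \<bar>1 / (Z n)\<^sup>2\<bar> * (ennreal (occ_dens (Z n) (1 + 1 / (Z n)\<^sup>2 * s) / (2 * phi_mass (Z n) 1)) * indicator {1 + w / (Z n)\<^sup>2<..} (1 + 1 / (Z n)\<^sup>2 * s)) \<partial>lborel)"
    proof (rule nn_integral_cmult[symmetric])
      have "(\<lambda>s. occ_dens (Z n) (1 + 1 / (Z n)\<^sup>2 * s)) \<in> borel_measurable lborel"
        by (rule measurable_compose[OF _ borel_measurable_occ_dens]) simp
      from measurable_compose[OF borel_measurable_divide[OF this borel_measurable_const] measurable_ennreal]
      show "(\<lambda>s. ennreal (occ_dens (Z n) (1 + 1 / (Z n)\<^sup>2 * s) / (2 * phi_mass (Z n) 1)) * indicator {1 + w / (Z n)\<^sup>2<..} (1 + 1 / (Z n)\<^sup>2 * s)) \<in> borel_measurable lborel"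
        by (intro borel_measurable_times_ennreal) auto
    qed
    also have "\<dots> = (\<integral>\<^sup>+s. ennreal (d n s) * indicator {w<..} s \<partial>lborel)"
      using z2 that pm[of n] by (intro nn_integral_cong)
        (auto simp: d_def T_def indicator_def ennreal_mult'[symmetric] divide_less_cancel mult.commute)
    finally show ?thesis by simp
  qed
  have "(\<lambda>n. LINT s|lborel. indicator {w<..} s * d n s) \<longlonglongrightarrow> (LINT s|lborel. indicator {w<..} s * f s)"
  proof (rule tendsto_set_integral_of_lower_bound[where C="1/2"])
    show "d n \<in> borel_measurable lborel" for n
    proof -
      have "(\<lambda>s. occ_dens (Z n) (T n s)) \<in> borel_measurable lborel"
        unfolding T_def by (rule measurable_compose[OF _ borel_measurable_occ_dens]) simp
      then show ?thesis unfolding d_def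
        by (intro borel_measurable_times borel_measurable_divide borel_measurable_const) auto
    qed
    show "f \<in> borel_measurable lborel" unfolding f_def
      by (intro borel_measurable_times borel_measurable_divide borel_measurable_const measurable_compose[OF _ borel_measurable_occ_tail]) auto
    show "0 \<le> d n s" for n s using pm[of n] by (simp add: d_def occ_dens_nonneg)
    show "0 \<le> f s" for s by (auto simp: f_def indicator_def occ_tail_nonneg)
    show "(\<integral>\<^sup>+s. ennreal (f s) \<partial>lborel) = ennreal (1/2)"
    proof -
      have "(\<integral>\<^sup>+s. ennreal (f s) \<partial>lborel) = (\<integral>\<^sup>+x\<in>{0<..}. ennreal (exp (x / 2) * occ_tail (sqrt x) / 4) \<partial>lborel)"
        by (intro nn_integral_cong) (auto simp: f_def indicator_def)
      then show ?thesis using occ_tail_g_tail[of 0] by (simp add: g_tail_0)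
    qed
    fix n
    have "(\<integral>\<^sup>+s. ennreal (d n s) \<partial>lborel) = (\<integral>\<^sup>+s. ennreal (d n s) * indicator {0<..} s \<partial>lborel)"
      by (intro nn_integral_cong) (auto simp: d_def indicator_def)
    also have "\<dots> = (\<integral>\<^sup>+t\<in>{1<..}. ennreal (occ_dens (Z n) t / (2 * phi_mass (Z n) 1)) \<partial>lborel)"
      using aff[of 0 n] by simp
    also have "\<dots> = (\<integral>\<^sup>+t. ennreal (1 / (2 * phi_mass (Z n) 1)) * (ennreal (occ_dens (Z n) t) * indicator {1<..} t) \<partial>lborel)"
      using pm[of n] by (intro nn_integral_cong) (auto simp: ennreal_mult'[symmetric] indicator_def)
    also have "\<dots> = ennreal (1 / (2 * phi_mass (Z n) 1)) * ennreal (phi_mass (Z n) 1)"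
      using occ_dens_mass_gt_1[OF Zneg[of n]] by (subst nn_integral_cmult) auto
    also have "\<dots> = ennreal (1/2)"
      using pm[of n] by (subst ennreal_mult'[symmetric]) auto
    finally show "(\<integral>\<^sup>+s. ennreal (d n s) \<partial>lborel) = ennreal (1/2)" .
  next
    fix s :: real
    show "\<exists>l. l \<longlonglongrightarrow> f s \<and> (\<forall>\<^sub>F n in sequentially. l n \<le> d n s)"
    proof (cases "s > 0")
      case False
      then show ?thesis
        by (intro exI[of _ "\<lambda>_. 0"]) (auto simp: f_def d_def)
    next
      case s: True
      \<comment> \<open>This is \<open>occ_lower\<close> times the kernel over the normalisation,
        rewritten: the exponent of the kernel at \<open>t = T n s\<close> is
        \<open>s / (2 * t)\<close> minus half the square of \<open>Z n\<close>, and the second part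
        combines with the normalising mass into \<open>J\<close>, which tends to 2.\<close>
      define l where "l = (\<lambda>n. 1 / (T n s * sqrt (T n s)) * occ_tail (sqrt (s / T n s)) * exp (s / T n s / 2) / (2 * J (Z n)))"
      have "((\<lambda>y. 1 + s / y\<^sup>2) \<longlongrightarrow> 1) at_bot" by real_asymp
      from filterlim_compose[OF this Z] have T: "(\<lambda>n. T n s) \<longlonglongrightarrow> 1" unfolding T_def .
      have "l \<longlonglongrightarrow> 1 / (1 * sqrt 1) * occ_tail (sqrt (s / 1)) * exp (s / 1 / 2) / (2 * 2)"
        unfolding l_def by (intro tendsto_intros T J) auto
      then have "l \<longlonglongrightarrow> f s" using s by (simp add: f_def mult.commute)
      moreover have "l n \<le> d n s" for n
      proof -
        define t where "t = T n s"
        have z2: "(Z n)\<^sup>2 > 0" using Zneg[of n] by simp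
        have t: "t > 1" using s z2 by (simp add: t_def T_def)
        have x: "(Z n)\<^sup>2 * (1 - 1 / t) = s / t"
        proof -
          have "(Z n)\<^sup>2 * (t - 1) = s" using z2 by (simp add: t_def T_def)
          moreover have "(Z n)\<^sup>2 * (1 - 1 / t) = (Z n)\<^sup>2 * (t - 1) / t" using t by (simp add: field_simps)
          ultimately show ?thesis by simp
        qed
        have ph: "phi (Z n) t = 1 / sqrt t * (exp (s / t / 2) * exp (- ((Z n)\<^sup>2 / 2)))"
        proof -
          have "- ((Z n)\<^sup>2 / (2 * t)) = s / t / 2 + - ((Z n)\<^sup>2 / 2)"
            using x t by (simp add: field_simps)
          then show ?thesis unfolding phi_def by (simp only: exp_add)
        qed
        have "l n = occ_lower (Z n) t * phi (Z n) t / (2 * phi_mass (Z n) 1 * (Z n)\<^sup>2)"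
          unfolding l_def t_def[symmetric] occ_lower_def x ph J_def using t z2 pm[of n]
          by (simp add: exp_minus field_simps)
        also have "\<dots> \<le> occ_cdf N \<beta> (Z n / sqrt t) (1 / t) * phi (Z n) t / (2 * phi_mass (Z n) 1 * (Z n)\<^sup>2)"
          using occ_lower_le[OF Zneg t] t pm[of n] by (intro divide_right_mono mult_right_mono) (auto simp: phi_nonneg)
        also have "\<dots> = d n s" using s t by (simp add: d_def occ_dens_def t_def[symmetric])
        finally show ?thesis .
      qed
      ultimately show ?thesis by (intro exI[of _ l] conjI always_eventually allI)
    qed
  qed auto
  moreover have "(LINT s|lborel. indicator {w<..} s * f s) = g_tail w"
  proof (rule integral_eq_nn_integral[THEN trans])
    have "(\<integral>\<^sup>+s. ennreal (indicator {w<..} s * f s) \<partial>lborel) = (\<integral>\<^sup>+x\<in>{w<..}. ennreal (exp (x / 2) * occ_tail (sqrt x) / 4) \<partial>lborel)"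
      using w by (intro nn_integral_cong) (auto simp: f_def indicator_def)
    then show "enn2real (\<integral>\<^sup>+s. ennreal (indicator {w<..} s * f s) \<partial>lborel) = g_tail w"
      using occ_tail_g_tail[OF w] g_tail_nonneg[OF w] by simp
  qed (use w in \<open>auto simp: f_def indicator_def occ_tail_nonneg\<close>)
  moreover have "(LINT s|lborel. indicator {w<..} s * d n s) = 1 - occ_mass (Z n) (1 + w / (Z n)\<^sup>2) / (2 * phi_mass (Z n) 1)" for n
  proof (rule integral_eq_nn_integral[THEN trans])
    define b where "b = 1 + w / (Z n)\<^sup>2"
    have b: "b \<ge> 0" using w by (simp add: b_def)
    have "ennreal (occ_mass (Z n) b) + (\<integral>\<^sup>+t\<in>{b<..}. ennreal (occ_dens (Z n) t) \<partial>lborel) = (\<integral>\<^sup>+t. ennreal (occ_dens (Z n) t) * indicator {0..b} t + ennreal (occ_dens (Z n) t) * indicator {b<..} t \<partial>lborel)"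
      using b by (subst nn_integral_add) (auto simp: ennreal_occ_mass)
    also have "\<dots> = (\<integral>\<^sup>+t. ennreal (occ_dens (Z n) t) \<partial>lborel)"
      using b by (intro nn_integral_cong) (auto simp: indicator_def)
    also have "\<dots> = ennreal (2 * phi_mass (Z n) 1)" by (rule occ_dens_mass_neg[OF Zneg])
    finally have sum: "ennreal (occ_mass (Z n) b) + (\<integral>\<^sup>+t\<in>{b<..}. ennreal (occ_dens (Z n) t) \<partial>lborel) = ennreal (2 * phi_mass (Z n) 1)" .
    have om: "0 \<le> occ_mass (Z n) b" unfolding occ_mass_eq by (intro integral_nonneg_AE) (auto simp: indicator_def occ_dens_nonneg)
    have rest: "(\<integral>\<^sup>+t\<in>{b<..}. ennreal (occ_dens (Z n) t) \<partial>lborel) = ennreal (2 * phi_mass (Z n) 1 - occ_mass (Z n) b)"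
    proof -
      have "(\<integral>\<^sup>+t\<in>{b<..}. ennreal (occ_dens (Z n) t) \<partial>lborel) = (ennreal (occ_mass (Z n) b) + (\<integral>\<^sup>+t\<in>{b<..}. ennreal (occ_dens (Z n) t) \<partial>lborel)) - ennreal (occ_mass (Z n) b)"
        by simp
      also have "\<dots> = ennreal (2 * phi_mass (Z n) 1 - occ_mass (Z n) b)"
        unfolding sum using om by (rule ennreal_minus)
      finally show ?thesis .
    qed
    have le: "occ_mass (Z n) b \<le> 2 * phi_mass (Z n) 1"
      using sum om pm[of n] by (metis ennreal_le_iff le_iff_add less_imp_le mult_nonneg_nonneg zero_le_numeral)
    have "(\<integral>\<^sup>+s. ennreal (indicator {w<..} s * d n s) \<partial>lborel) = (\<integral>\<^sup>+s. ennreal (d n s) * indicator {w<..} s \<partial>lborel)"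
      by (intro nn_integral_cong) (auto simp: indicator_def)
    also have "\<dots> = (\<integral>\<^sup>+t. ennreal (1 / (2 * phi_mass (Z n) 1)) * (ennreal (occ_dens (Z n) t) * indicator {b<..} t) \<partial>lborel)"
      unfolding aff[OF w] b_def using pm[of n] by (intro nn_integral_cong) (auto simp: ennreal_mult'[symmetric] indicator_def)
    also have "\<dots> = ennreal (1 / (2 * phi_mass (Z n) 1)) * ennreal (2 * phi_mass (Z n) 1 - occ_mass (Z n) b)"
      using rest by (subst nn_integral_cmult) auto
    also have "\<dots> = ennreal (1 - occ_mass (Z n) b / (2 * phi_mass (Z n) 1))"
      using pm[of n] by (subst ennreal_mult'[symmetric]) (auto simp: diff_divide_distrib)
    finally show "enn2real (\<integral>\<^sup>+s. ennreal (indicator {w<..} s * d n s) \<partial>lborel) = 1 - occ_mass (Z n) (1 + w / (Z n)\<^sup>2) / (2 * phi_mass (Z n) 1)"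
      using le pm[of n] by (simp add: b_def)
  qed (use pm[of n] in \<open>auto simp: d_def T_def indicator_def occ_dens_nonneg\<close>)
  ultimately have "(\<lambda>n. 1 - occ_mass (Z n) (1 + w / (Z n)\<^sup>2) / (2 * phi_mass (Z n) 1)) \<longlonglongrightarrow> g_tail w" by simp
  then show "(\<lambda>n. 1 - occ_mass (- Y n) (1 + w / (- Y n)\<^sup>2) / (2 * phi_mass (- Y n) 1)) \<longlonglongrightarrow> g_tail w"
    by (rule Lim_transform_eventually) (use YZ in \<open>eventually_elim, simp\<close>)
qed

end

section \<open>The process and its time below zero\<close>

text \<open>By continuity the process is the limit of its values at the last multiple of
  \<open>1 / n\<close>, and these depend on time through countably many cells. The maximum with 0
  extends the process to all real times.\<close>

lemma joint_measurable_process: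
  fixes Z :: "real \<Rightarrow> 'w \<Rightarrow> real"
  assumes Z: "continuous_process M {0..} Z"
  shows "(\<lambda>z. Z (max 0 (fst z)) (snd z)) \<in> borel_measurable ((borel :: real measure) \<Otimes>\<^sub>M M)"
proof (rule borel_measurable_LIMSEQ_real)
  fix n :: nat
  show "(\<lambda>z. Z (real (nat \<lfloor>max 0 (fst z) * real n\<rfloor>) / real n) (snd z)) \<in> borel_measurable ((borel :: real measure) \<Otimes>\<^sub>M M)"
  proof (rule measurable_compose_countable'[where I=UNIV and f="\<lambda>i z. Z (real i / real n) (snd z)"])
    fix i :: nat
    have "Z (real i / real n) \<in> borel_measurable M"
      using Z by (auto simp: continuous_process_def)
    then show "(\<lambda>z. Z (real i / real n) (snd z)) \<in> borel_measurable ((borel :: real measure) \<Otimes>\<^sub>M M)"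
      by (rule measurable_compose[OF measurable_snd])
    show "(\<lambda>z. nat \<lfloor>max 0 (fst z) * real n\<rfloor>) \<in> measurable ((borel :: real measure) \<Otimes>\<^sub>M M) (count_space UNIV)"
      by measurable
  qed simp
next
  fix z assume "z \<in> space ((borel :: real measure) \<Otimes>\<^sub>M M)"
  then have "snd z \<in> space M" by (simp add: space_pair_measure mem_Times_iff)
  then have c: "continuous_on {0..} (\<lambda>t. Z t (snd z))" using Z by (simp add: continuous_process_def)
  define s where "s = max 0 (fst z)"
  have s: "s \<ge> 0" by (simp add: s_def)
  have lim: "(\<lambda>n. real (nat \<lfloor>s * real n\<rfloor>) / real n) \<longlonglongrightarrow> s"
  proof (rule tendsto_sandwich[of "\<lambda>m. s - 1 / real m" _ _ "\<lambda>_. s"])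
    show "\<forall>\<^sub>F m in sequentially. s - 1 / real m \<le> real (nat \<lfloor>s * real m\<rfloor>) / real m"
      using eventually_gt_at_top[of 0]
    proof eventually_elim
      case (elim m)
      have "s * real m - 1 \<le> real (nat \<lfloor>s * real m\<rfloor>)" using s by linarith
      then have "(s * real m - 1) / real m \<le> real (nat \<lfloor>s * real m\<rfloor>) / real m" by (rule divide_right_mono) simp
      then show ?case using elim by (simp add: diff_divide_distrib)
    qed
    show "\<forall>\<^sub>F m in sequentially. real (nat \<lfloor>s * real m\<rfloor>) / real m \<le> s"
      using eventually_gt_at_top[of 0] by eventually_elim (use s in \<open>simp add: pos_divide_le_eq\<close>)
    show "(\<lambda>m. s - 1 / real m) \<longlonglongrightarrow> s" by real_asymp
  qed simp
  have "(\<lambda>n. Z (real (nat \<lfloor>s * real n\<rfloor>) / real n) (snd z)) \<longlonglongrightarrow> Z s (snd z)"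
    using c[unfolded continuous_on_sequentially, rule_format, of s "\<lambda>n. real (nat \<lfloor>s * real n\<rfloor>) / real n"] s lim
    by (auto simp: comp_def)
  then show "(\<lambda>n. Z (real (nat \<lfloor>max 0 (fst z) * real n\<rfloor>) / real n) (snd z)) \<longlonglongrightarrow> Z (max 0 (fst z)) (snd z)"
    by (simp add: s_def)
qed

text \<open>The process shares with the modulus of a Brownian motion its law and not its values, so
  nonnegativity is almost sure only. At a fixed time it is an event on one coordinate; rational
  times are treated together, and continuity gives all times.\<close>

lemma bessel3_nonneg_AE:
  assumes Z: "bessel3 M r Z"
  shows "AE \<omega> in M. \<forall>t\<ge>0. 0 \<le> Z t \<omega>"
proof -
  interpret prob_space M using Z by (simp add: bessel3_def)
  have cp: "continuous_process M {0..} Z" using Z by (simp add: bessel3_def)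
  obtain N :: "(real \<Rightarrow> real ^ 3) measure" and x :: "real ^ 3" and W where W: "brownian_motion_vec N x W"
    and law: "law M {0..} Z = law N {0..} (\<lambda>t \<omega>. norm (W t \<omega>))"
    using Z unfolding bessel3_def by blast
  have Wm: "(\<lambda>\<omega>. norm (W t \<omega>)) \<in> borel_measurable N" if "t \<ge> 0" for t
  proof -
    have "(\<lambda>\<omega>. W t \<omega> $ i) \<in> borel_measurable N" for i
    proof -
      have "brownian_motion N (x $ i) (\<lambda>t \<omega>. W t \<omega> $ i)" using W by (simp add: brownian_motion_vec_def)
      then show ?thesis using that by (simp add: brownian_motion_def continuous_process_def)
    qed
    then show ?thesis unfolding norm_vec_def L2_set_def by measurable
  qed
  have nonneg: "AE \<omega> in M. 0 \<le> Z t \<omega>" if t: "t \<ge> 0" for t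
  proof -
    define A where "A = {f \<in> space (path_space {0..}). f t < 0}"
    have coord: "(\<lambda>f. f t) \<in> borel_measurable (path_space {0..})"
      using t by (intro measurable_component_singleton) auto
    have A: "A \<in> sets (path_space {0..})" unfolding A_def using coord by measurable
    have Zm: "sample_path {0..} Z \<in> measurable M (path_space {0..})" by (rule measurable_sample_path[OF cp])
    have Nm: "sample_path {0..} (\<lambda>t \<omega>. norm (W t \<omega>)) \<in> measurable N (path_space {0..})"
    proof -
      have "(\<lambda>\<omega>. \<lambda>s\<in>{0..}. norm (W s \<omega>)) \<in> measurable N (path_space {0..})"
        by (intro measurable_restrict Wm) auto
      then show ?thesis by (simp add: sample_path_def[abs_def])
    qed
    have e1: "sample_path {0..} Z -` A \<inter> space M = {\<omega> \<in> space M. Z t \<omega> < 0}"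
      using t by (auto simp: A_def sample_path_def space_PiM)
    have e2: "sample_path {0..} (\<lambda>t \<omega>. norm (W t \<omega>)) -` A \<inter> space N = {}"
      using t by (auto simp: A_def sample_path_def)
    have "emeasure M {\<omega> \<in> space M. Z t \<omega> < 0} = emeasure (law M {0..} Z) A"
      unfolding law_def using A Zm by (simp add: emeasure_distr e1)
    also have "\<dots> = emeasure (law N {0..} (\<lambda>t \<omega>. norm (W t \<omega>))) A" by (simp only: law)
    also have "\<dots> = 0" unfolding law_def using A Nm by (simp add: emeasure_distr e2)
    finally have "emeasure M {\<omega> \<in> space M. Z t \<omega> < 0} = 0" .
    moreover have "{\<omega> \<in> space M. Z t \<omega> < 0} \<in> sets M"
      using measurable_sets[OF Zm A] by (simp add: e1)
    ultimately show ?thesis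
      by (intro AE_I'[of "{\<omega> \<in> space M. Z t \<omega> < 0}"]) (auto simp: null_sets_def)
  qed
  have "AE \<omega> in M. \<forall>q\<in>\<rat> \<inter> {0..}. 0 \<le> Z q \<omega>"
    by (subst AE_ball_countable) (auto intro: countable_subset[OF _ countable_rat] nonneg)
  then show ?thesis
    using AE_space
  proof eventually_elim
    case (elim \<omega>)
    have c: "continuous_on {0..} (\<lambda>t. Z t \<omega>)" using cp elim by (simp add: continuous_process_def)
    show ?case
    proof (intro allI impI)
      fix t :: real assume t: "0 \<le> t"
      obtain q where q: "\<And>n. q n \<in> \<rat> \<inter> {0..}" "q \<longlonglongrightarrow> t"
      proof -
        have "\<exists>r\<in>\<rat>. t < r \<and> r < t + 1 / real (Suc n)" for n by (rule Rats_dense_in_real) simp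
        then obtain q where q: "\<And>n. q n \<in> \<rat>" "\<And>n. t < q n" "\<And>n. q n < t + 1 / real (Suc n)" by metis
        have "(\<lambda>n. t + 1 / real (Suc n)) \<longlonglongrightarrow> t" by real_asymp
        then have "q \<longlonglongrightarrow> t"
          by (rule tendsto_sandwich[of "\<lambda>_. t", rotated 3]) (intro always_eventually allI less_imp_le q, intro always_eventually allI less_imp_le q, simp)
        moreover have "q n \<in> \<rat> \<inter> {0..}" for n using q(1,2)[of n] t by auto
        ultimately show thesis using that by blast
      qed
      have "(\<lambda>n. Z (q n) \<omega>) \<longlonglongrightarrow> Z t \<omega>"
        using c[unfolded continuous_on_sequentially, rule_format, of t q] q t by (auto simp: comp_def)
      then show "0 \<le> Z t \<omega>"
        by (rule LIMSEQ_le_const) (use elim q in blast)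
    qed
  qed
qed

text \<open>For \<open>y < 0\<close> the term with \<open>Y\<close> vanishes. In the copy
  \<open>X'\<close> the arguments of \<open>b\<close> and \<open>Z\<close> are clamped to the ranges
  in which the two processes are defined; this changes nothing at nonnegative times and gives joint
  measurability in time and sample point.\<close>

lemma measurable_neg_time_X_process:
  assumes y: "y < 0" and g: "g \<in> borel_measurable M"
    and b: "continuous_process M {0..1} b" and Z: "continuous_process M {0..} Z"
  shows "(\<lambda>\<omega>. neg_time {0..} (\<lambda>s. X_process y g b Z Y s \<omega>)) \<in> borel_measurable M"
proof -
  let ?L = "borel :: real measure"
  have b': "continuous_process M {0..} (\<lambda>t. b (min 1 t))"
    unfolding continuous_process_def
  proof (intro conjI ballI)
    fix t :: real assume "t \<in> {0..}"
    then show "b (min 1 t) \<in> borel_measurable M" using b by (simp add: continuous_process_def)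
  next
    fix \<omega> assume "\<omega> \<in> space M"
    then have "continuous_on {0..1} (\<lambda>t. b t \<omega>)" using b by (simp add: continuous_process_def)
    then show "continuous_on {0..} (\<lambda>t. b (min 1 t) \<omega>)"
      by (rule continuous_on_compose2) (auto intro!: continuous_intros)
  qed
  have gm [measurable]: "(\<lambda>z. g (snd z)) \<in> borel_measurable (M' \<Otimes>\<^sub>M M)" for M' :: "real measure"
    by (rule measurable_compose[OF measurable_snd g])
  have B: "(\<lambda>z. b (min 1 (max 0 (fst z / g (snd z)))) (snd z)) \<in> borel_measurable (?L \<Otimes>\<^sub>M M)"
    by (rule measurable_compose[OF _ joint_measurable_process[OF b'], of "\<lambda>z. (fst z / g (snd z), snd z)", simplified]) measurable
  have Zm: "(\<lambda>z. Z (max 0 (fst z - g (snd z))) (snd z)) \<in> borel_measurable (?L \<Otimes>\<^sub>M M)"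
    by (rule measurable_compose[OF _ joint_measurable_process[OF Z], of "\<lambda>z. (fst z - g (snd z), snd z)", simplified]) measurable
  define X' where "X' = (\<lambda>z. of_bool (g (snd z) > 0 \<and> fst z < g (snd z)) * (sqrt (g (snd z)) * b (min 1 (max 0 (fst z / g (snd z)))) (snd z) + y - fst z / g (snd z) * y)
      + of_bool (g (snd z) > 0 \<and> fst z \<ge> g (snd z)) * Z (max 0 (fst z - g (snd z))) (snd z))"
  have p: "Measurable.pred (?L \<Otimes>\<^sub>M M) (\<lambda>z. g (snd z) > 0 \<and> fst z < g (snd z))"
    "Measurable.pred (?L \<Otimes>\<^sub>M M) (\<lambda>z. g (snd z) > 0 \<and> fst z \<ge> g (snd z))"
    by measurable
  have ob: "(\<lambda>z. of_bool (P z) :: real) \<in> borel_measurable K" if "Measurable.pred K P" for K :: "(real \<times> 'a) measure" and P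
    using that unfolding of_bool_def by measurable
  have X': "X' \<in> borel_measurable (?L \<Otimes>\<^sub>M M)"
    unfolding X'_def
    by (intro borel_measurable_add borel_measurable_times borel_measurable_diff ob p B Zm
        borel_measurable_divide borel_measurable_const gm measurable_compose[OF gm borel_measurable_sqrt]) simp_all
  have XX': "X_process y g b Z Y s \<omega> = X' (s, \<omega>)" if "s \<ge> 0" for s \<omega>
  proof -
    have "min 1 (max 0 (s / g \<omega>)) = s / g \<omega>" if "g \<omega> > 0" "s < g \<omega>"
      using that \<open>s \<ge> 0\<close> by (simp add: max_def min_def field_simps)
    then show ?thesis using y by (auto simp: X_process_def X'_def)
  qed
  have "neg_time {0..} (\<lambda>s. X_process y g b Z Y s \<omega>) = (LINT s|lborel. indicator {0..} s * indicator {..<0} (X' (s, \<omega>)))" for \<omega>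
    unfolding neg_time_def set_lebesgue_integral_def
    by (intro Bochner_Integration.integral_cong) (auto simp: XX' indicator_def)
  moreover have "(\<lambda>\<omega>. LINT s|lborel. indicator {0..} s * indicator {..<0} (X' (s, \<omega>)) :: real) \<in> borel_measurable M"
  proof (rule lborel.borel_measurable_lebesgue_integral)
    have "(\<lambda>w. X' (snd w, fst w)) \<in> borel_measurable (M \<Otimes>\<^sub>M lborel)"
      by (rule measurable_compose[OF _ X']) measurable
    then have "(\<lambda>w. indicator {0..} (snd w) * indicator {..<0} (X' (snd w, fst w)) :: real) \<in> borel_measurable (M \<Otimes>\<^sub>M lborel)"
      by (intro borel_measurable_times measurable_compose[OF measurable_snd] measurable_compose[OF \<open>(\<lambda>w. X' (snd w, fst w)) \<in> _\<close>]) simp_all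
    then show "case_prod (\<lambda>\<omega> s. indicator {0..} s * indicator {..<0} (X' (s, \<omega>)) :: real) \<in> borel_measurable (M \<Otimes>\<^sub>M lborel)"
      by (simp add: case_prod_beta')
  qed
  ultimately show ?thesis by simp
qed

text \<open>From \<open>g\<close> on the process is nonnegative. Before \<open>g\<close>, undoing
  the scaling of the bridge produces the factor \<open>g\<close> and the start
  \<open>y / sqrt g\<close>; the single time \<open>g\<close> is negligible.\<close>

lemma neg_time_X_process:
  assumes y: "y < 0" and g: "g \<omega> > 0" and b: "continuous_on {0..1} (\<lambda>s. b s \<omega>)" and Z: "\<forall>t\<ge>0. 0 \<le> Z t \<omega>"
  shows "neg_time {0..} (\<lambda>s. X_process y g b Z Y s \<omega>) = g \<omega> * tilted_neg_time (y / sqrt (g \<omega>)) (sample_path {0..1} b \<omega>)"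
proof -
  define h where "h = (\<lambda>s. sqrt (g \<omega>) * b (s / g \<omega>) \<omega> + y - s / g \<omega> * y)"
  have cont: "continuous_on {0..g \<omega>} h"
  proof -
    have "continuous_on {0..g \<omega>} (\<lambda>s. b (s / g \<omega>) \<omega>)"
      by (rule continuous_on_compose2[OF b]) (use g in \<open>auto intro!: continuous_intros simp: divide_le_eq_1\<close>)
    then show ?thesis unfolding h_def using g by (intro continuous_intros) auto
  qed
  have m1: "(\<lambda>s. indicator {0..g \<omega>} s * indicator {..<0} (h s) :: real) \<in> borel_measurable lborel"
  proof -
    have "(\<lambda>s. indicator {0..g \<omega>} s *\<^sub>R h s) \<in> borel_measurable borel"
      using cont by (intro borel_measurable_continuous_on_indicator) auto
    then have "(\<lambda>s. indicator {0..g \<omega>} s * h s) \<in> borel_measurable lborel" by simp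
    then have "(\<lambda>s. indicator {..<0} (indicator {0..g \<omega>} s * h s) :: real) \<in> borel_measurable lborel"
      by (rule measurable_compose) simp
    also have "(\<lambda>s. indicator {..<0} (indicator {0..g \<omega>} s * h s) :: real) = (\<lambda>s. indicator {0..g \<omega>} s * indicator {..<0} (h s))"
      by (auto simp: indicator_def fun_eq_iff)
    finally show ?thesis .
  qed
  have "neg_time {0..} (\<lambda>s. X_process y g b Z Y s \<omega>) = (LINT s|lborel. indicator {0..<g \<omega>} s * (indicator {0..g \<omega>} s * indicator {..<0} (h s)))"
    unfolding neg_time_def set_lebesgue_integral_def
    by (intro Bochner_Integration.integral_cong) (use y g Z in \<open>auto simp: X_process_def h_def indicator_def not_le not_less\<close>)
  also have "\<dots> = (LINT s|lborel. indicator {0..g \<omega>} s * indicator {..<0} (h s))"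
  proof (rule integral_cong_AE)
    show "(\<lambda>s. indicator {0..<g \<omega>} s * (indicator {0..g \<omega>} s * indicator {..<0} (h s)) :: real) \<in> borel_measurable lborel"
      by (rule borel_measurable_times[OF _ m1]) simp
    show "AE s in lborel. indicator {0..<g \<omega>} s * (indicator {0..g \<omega>} s * indicator {..<0} (h s)) = (indicator {0..g \<omega>} s * indicator {..<0} (h s) :: real)"
      using AE_lborel_singleton[of "g \<omega>"] by eventually_elim (auto simp: indicator_def)
  qed (rule m1)
  also have "\<dots> = neg_time {0..g \<omega>} h" by (simp add: neg_time_def set_lebesgue_integral_def)
  also have "\<dots> = g \<omega> * neg_time {0..1} (\<lambda>s. b s \<omega> + y / sqrt (g \<omega>) * (1 - s))"
    unfolding h_def by (rule neg_time_rescaled_bridge[OF g])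
  finally show ?thesis using b by (simp add: tilted_neg_time_eq sample_path_def)
qed

text \<open>The conditional law is prescribed on products of a set of times and a set of paths,
  whereas the time below zero involves \<open>g\<close> and the path jointly. Both sides are
  measures in \<open>E\<close> that agree on such rectangles, and these form a generator stable
  under intersections.\<close>

lemma (in standard_bridge) conditioned_bridge_joint:
  fixes M :: "'w measure"
  assumes M: "prob_space M" and g: "g \<in> borel_measurable M"
    and cb: "conditioned_bridge_given N \<beta> y M g b"
    and E: "E \<in> sets (borel \<Otimes>\<^sub>M path_space {0..1})"
  shows "emeasure M {\<omega> \<in> space M. (g \<omega>, sample_path {0..1} b \<omega>) \<in> E}
    = (\<integral>\<^sup>+x. ennreal (\<P>(\<omega> in N. (x, sample_path {0..1} \<beta> \<omega>) \<in> E \<bar>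
        neg_time {0..x} (\<lambda>s. sqrt x * \<beta> (s / x) \<omega> + y - s / x * y) \<le> 1)) \<partial>distr M borel g)"
proof -
  interpret M: prob_space M by (rule M)
  define D where "D = distr M borel g"
  interpret D: prob_space D unfolding D_def by (rule M.prob_space_distr[OF g])
  define P where "P = path_space {0..1}"
  have bm: "sample_path {0..1} b \<in> measurable M P" using cb unfolding P_def conditioned_bridge_given_def
    by (intro measurable_sample_path) blast
  have sm [measurable]: "sample_path {0..1} \<beta> \<in> measurable N P" unfolding P_def by (rule measurable_sample_path[OF process])
  have gb: "(\<lambda>\<omega>. (g \<omega>, sample_path {0..1} b \<omega>)) \<in> measurable M (borel \<Otimes>\<^sub>M P)"
    using g bm by measurable
  define C where "C = (\<lambda>x \<omega>. neg_time {0..x} (\<lambda>s. sqrt x * \<beta> (s / x) \<omega> + y - s / x * y) \<le> 1)"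
  define V where "V = (\<lambda>z. tilted_neg_time (y / sqrt (fst z)) (sample_path {0..1} \<beta> (snd z)))"
  have V [measurable]: "V \<in> borel_measurable (borel \<Otimes>\<^sub>M N)"
  proof -
    have "(\<lambda>z. (y / sqrt (fst z), sample_path {0..1} \<beta> (snd z))) \<in> (borel :: real measure) \<Otimes>\<^sub>M N \<rightarrow>\<^sub>M borel \<Otimes>\<^sub>M P"
      by measurable
    from measurable_compose[OF this measurable_tilted_neg_time[folded P_def]] show ?thesis by (simp add: V_def)
  qed
  \<comment> \<open>For \<open>x \<le> 0\<close> the interval \<open>{0..x}\<close> is a null set,
    so the condition holds for every path.\<close>
  have CV: "C x \<omega> \<longleftrightarrow> x \<le> 0 \<or> x * V (x, \<omega>) \<le> 1" if "\<omega> \<in> space N" for x \<omega>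
  proof (cases "x > 0")
    case True
    have "V (x, \<omega>) = neg_time {0..1} (\<lambda>s. \<beta> s \<omega> + y / sqrt x * (1 - s))"
      using process that by (simp add: V_def sample_path_def tilted_neg_time_eq continuous_process_def)
    then show ?thesis using neg_time_rescaled_bridge[OF True, of "\<lambda>s. \<beta> s \<omega>" y] True by (simp add: C_def)
  next
    case False
    have "neg_time {0..x} f = 0" for f
    proof -
      have "AE s in lborel. indicator {0..x} s *\<^sub>R indicator {..<0} (f s) = (0 :: real)"
        using AE_lborel_singleton[of "0::real"] by eventually_elim (use False in \<open>auto simp: indicator_def\<close>)
      then show ?thesis unfolding neg_time_def set_lebesgue_integral_def by (rule integral_eq_zero_AE)
    qed
    then show ?thesis using False by (simp add: C_def)
  qed
  define Cs where "Cs = {z \<in> space (borel \<Otimes>\<^sub>M N). C (fst z) (snd z)}"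
  have Cs: "Cs \<in> sets (borel \<Otimes>\<^sub>M N)"
  proof -
    have "Cs = {z \<in> space (borel \<Otimes>\<^sub>M N). fst z \<le> 0 \<or> fst z * V z \<le> 1}"
      using CV by (auto simp: Cs_def space_pair_measure)
    also have "\<dots> \<in> sets (borel \<Otimes>\<^sub>M N)" by measurable
    finally show ?thesis .
  qed
  have Cx: "{\<omega> \<in> space N. C x \<omega>} \<in> sets N" for x
    using sets_Pair1[OF Cs, of x] by (auto simp: Cs_def space_pair_measure vimage_def cong: conj_cong)
  define w where "w = (\<lambda>x. measure N (Pair x -` Cs))"
  have w_eq: "w x = measure N {\<omega> \<in> space N. C x \<omega>}" for x
    unfolding w_def by (rule arg_cong[where f="measure N"]) (auto simp: Cs_def space_pair_measure)
  have wm: "w \<in> borel_measurable borel"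
    unfolding w_def measure_def using measurable_emeasure_Pair[OF Cs] by measurable
  \<comment> \<open>The density of the joint law with respect to the product of the law of
    \<open>g\<close> and \<open>N\<close>. Where the condition has probability 0,
    \<open>1 / 0 = 0\<close> gives the same value 0 as the conditional probability.\<close>
  define \<rho> where "\<rho> = (\<lambda>z. ennreal (1 / w (fst z)) * indicator Cs z)"
  have \<rho>m: "\<rho> \<in> borel_measurable (D \<Otimes>\<^sub>M N)"
  proof -
    have "(\<lambda>z. ennreal (1 / w (fst z))) \<in> borel_measurable (borel \<Otimes>\<^sub>M N)"
      by (rule measurable_compose[OF measurable_compose[OF measurable_fst wm]]) measurable
    then have "\<rho> \<in> borel_measurable (borel \<Otimes>\<^sub>M N)"
      unfolding \<rho>_def using Cs by (intro borel_measurable_times_ennreal) auto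
    then show ?thesis by (simp add: D_def cong: measurable_cong_sets sets_pair_measure_cong)
  qed
  define K where "K = distr (density (D \<Otimes>\<^sub>M N) \<rho>) (borel \<Otimes>\<^sub>M P) (\<lambda>z. (fst z, sample_path {0..1} \<beta> (snd z)))"
  have K: "emeasure K F = (\<integral>\<^sup>+x. ennreal (\<P>(\<omega> in N. (x, sample_path {0..1} \<beta> \<omega>) \<in> F \<bar> C x \<omega>)) \<partial>D)"
    if F: "F \<in> sets (borel \<Otimes>\<^sub>M P)" for F
  proof -
    have tm: "(\<lambda>z. (fst z, sample_path {0..1} \<beta> (snd z))) \<in> measurable (D \<Otimes>\<^sub>M N) (borel \<Otimes>\<^sub>M P)"
      unfolding D_def by measurable
    define F' where "F' = (\<lambda>z. (fst z, sample_path {0..1} \<beta> (snd z))) -` F \<inter> space (D \<Otimes>\<^sub>M N)"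
    have F': "F' \<in> sets (D \<Otimes>\<^sub>M N)" unfolding F'_def by (rule measurable_sets[OF tm F])
    have "emeasure K F = (\<integral>\<^sup>+z. \<rho> z * indicator F' z \<partial>(D \<Otimes>\<^sub>M N))"
      unfolding K_def using tm F F' \<rho>m
      by (subst emeasure_distr) (auto simp: emeasure_density F'_def)
    also have "\<dots> = (\<integral>\<^sup>+x. \<integral>\<^sup>+\<omega>. \<rho> (x, \<omega>) * indicator F' (x, \<omega>) \<partial>N \<partial>D)"
      using \<rho>m F' by (intro nn_integral_fst[symmetric]) auto
    also have "\<dots> = (\<integral>\<^sup>+x. ennreal (\<P>(\<omega> in N. (x, sample_path {0..1} \<beta> \<omega>) \<in> F \<bar> C x \<omega>)) \<partial>D)"
    proof (intro nn_integral_cong)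
      fix x assume "x \<in> space D"
      define G where "G = {\<omega> \<in> space N. (x, sample_path {0..1} \<beta> \<omega>) \<in> F \<and> C x \<omega>}"
      have G: "G \<in> sets N"
      proof -
        have "{\<omega> \<in> space N. (x, sample_path {0..1} \<beta> \<omega>) \<in> F} \<in> sets N"
        proof -
          have "Pair x -` F' = {\<omega> \<in> space N. (x, sample_path {0..1} \<beta> \<omega>) \<in> F}"
            by (auto simp: F'_def space_pair_measure D_def)
          then show ?thesis using sets_Pair1[OF F', of x] by simp
        qed
        with Cx[of x] have "{\<omega> \<in> space N. (x, sample_path {0..1} \<beta> \<omega>) \<in> F} \<inter> {\<omega> \<in> space N. C x \<omega>} \<in> sets N" by (rule sets.Int[rotated])
        also have "{\<omega> \<in> space N. (x, sample_path {0..1} \<beta> \<omega>) \<in> F} \<inter> {\<omega> \<in> space N. C x \<omega>} = G" by (auto simp: G_def)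
        finally show ?thesis .
      qed
      have "(\<integral>\<^sup>+\<omega>. \<rho> (x, \<omega>) * indicator F' (x, \<omega>) \<partial>N) = (\<integral>\<^sup>+\<omega>. ennreal (1 / w x) * indicator G \<omega> \<partial>N)"
        by (intro nn_integral_cong) (auto simp: \<rho>_def F'_def G_def Cs_def indicator_def space_pair_measure D_def)
      also have "\<dots> = ennreal (1 / w x) * ennreal (measure N G)"
        using G by (simp add: nn_integral_cmult_indicator emeasure_eq_measure)
      also have "\<dots> = ennreal (measure N G / w x)"
        by (subst ennreal_mult'[symmetric]) (auto simp: w_def)
      finally show "(\<integral>\<^sup>+\<omega>. \<rho> (x, \<omega>) * indicator F' (x, \<omega>) \<partial>N) = ennreal (\<P>(\<omega> in N. (x, sample_path {0..1} \<beta> \<omega>) \<in> F \<bar> C x \<omega>))"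
        by (simp add: cond_prob_def w_eq G_def)
    qed
    finally show ?thesis .
  qed
  have cp_le_1: "\<P>(\<omega> in N. Q \<omega> \<bar> C x \<omega>) \<le> 1" for Q x
  proof -
    have "measure N {\<omega> \<in> space N. Q \<omega> \<and> C x \<omega>} \<le> measure N {\<omega> \<in> space N. C x \<omega>}"
      by (rule finite_measure_mono[OF _ Cx]) auto
    then show ?thesis
      unfolding cond_prob_def by (cases "measure N {\<omega> \<in> space N. C x \<omega>} = 0") (auto simp: divide_le_eq_1 zero_less_measure_iff)
  qed
  have cp_nonneg: "0 \<le> \<P>(\<omega> in N. Q \<omega> \<bar> C x \<omega>)" for Q x unfolding cond_prob_def by simp
  have rect: "emeasure (distr M (borel \<Otimes>\<^sub>M P) (\<lambda>\<omega>. (g \<omega>, sample_path {0..1} b \<omega>))) (B \<times> A) = emeasure K (B \<times> A)"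
    if B: "B \<in> sets borel" and A: "A \<in> sets P" for A B
  proof -
    have BA: "B \<times> A \<in> sets (borel \<Otimes>\<^sub>M P)" using A B by simp
    have "emeasure (distr M (borel \<Otimes>\<^sub>M P) (\<lambda>\<omega>. (g \<omega>, sample_path {0..1} b \<omega>))) (B \<times> A) = emeasure M {\<omega> \<in> space M. g \<omega> \<in> B \<and> sample_path {0..1} b \<omega> \<in> A}"
      using gb BA by (subst emeasure_distr) (auto intro!: arg_cong[where f="emeasure M"])
    also have "\<dots> = ennreal (LINT x:B|D. \<P>(\<omega> in N. sample_path {0..1} \<beta> \<omega> \<in> A \<bar> C x \<omega>))"
      using cb A B unfolding conditioned_bridge_given_def C_def D_def P_def by (simp add: M.emeasure_eq_measure)
    also have "\<dots> = (\<integral>\<^sup>+x. ennreal (indicator B x * \<P>(\<omega> in N. sample_path {0..1} \<beta> \<omega> \<in> A \<bar> C x \<omega>)) \<partial>D)"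
    proof -
      have cm: "(\<lambda>x. \<P>(\<omega> in N. sample_path {0..1} \<beta> \<omega> \<in> A \<bar> C x \<omega>)) \<in> borel_measurable D"
      proof -
        define S where "S = {z \<in> space (borel \<Otimes>\<^sub>M N). sample_path {0..1} \<beta> (snd z) \<in> A} \<inter> Cs"
        have "{z \<in> space ((borel :: real measure) \<Otimes>\<^sub>M N). sample_path {0..1} \<beta> (snd z) \<in> A} \<in> sets (borel \<Otimes>\<^sub>M N)"
          using A by measurable
        then have S: "S \<in> sets (borel \<Otimes>\<^sub>M N)" unfolding S_def using Cs by (rule sets.Int)
        have "\<P>(\<omega> in N. sample_path {0..1} \<beta> \<omega> \<in> A \<bar> C x \<omega>) = measure N (Pair x -` S) / w x" for x
          unfolding cond_prob_def w_eq
          by (rule arg_cong2[where f="(/)"], rule arg_cong[where f="measure N"]) (auto simp: S_def Cs_def space_pair_measure)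
        moreover have "(\<lambda>x. measure N (Pair x -` S)) \<in> borel_measurable borel"
          unfolding measure_def using measurable_emeasure_Pair[OF S] by measurable
        ultimately show ?thesis using wm by (simp add: D_def borel_measurable_divide)
      qed
      have "integrable D (\<lambda>x. indicator B x * \<P>(\<omega> in N. sample_path {0..1} \<beta> \<omega> \<in> A \<bar> C x \<omega>))"
        by (rule D.integrable_const_bound[where B=1])
          (use cm B cp_le_1 cp_nonneg in \<open>auto simp: indicator_def D_def intro!: borel_measurable_times\<close>)
      from nn_integral_eq_integral[OF this] show ?thesis
        using cp_nonneg by (simp add: set_lebesgue_integral_def indicator_def)
    qed
    also have "\<dots> = emeasure K (B \<times> A)"
      unfolding K[OF BA] by (intro nn_integral_cong) (auto simp: indicator_def cond_prob_def)
    finally show ?thesis .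
  qed
  have eq: "distr M (borel \<Otimes>\<^sub>M P) (\<lambda>\<omega>. (g \<omega>, sample_path {0..1} b \<omega>)) = K"
  proof (rule measure_eqI_generator_eq[OF Int_stable_pair_measure_generator[of borel P], where A="\<lambda>_. space borel \<times> space P"])
    show "sets (distr M (borel \<Otimes>\<^sub>M P) (\<lambda>\<omega>. (g \<omega>, sample_path {0..1} b \<omega>))) = sigma_sets (space borel \<times> space P) {a \<times> b |a b. a \<in> sets borel \<and> b \<in> sets P}"
      by (simp add: sets_pair_measure)
    show "sets K = sigma_sets (space borel \<times> space P) {a \<times> b |a b. a \<in> sets borel \<and> b \<in> sets P}"
      by (simp add: sets_pair_measure K_def)
    show "{a \<times> b |a b. a \<in> sets (borel :: real measure) \<and> b \<in> sets P} \<subseteq> Pow (space borel \<times> space P)"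
      by (rule pair_measure_closed)
    show "emeasure (distr M (borel \<Otimes>\<^sub>M P) (\<lambda>\<omega>. (g \<omega>, sample_path {0..1} b \<omega>))) X = emeasure K X"
      if "X \<in> {a \<times> b |a b. a \<in> sets (borel :: real measure) \<and> b \<in> sets P}" for X
      using that rect by blast
    show "range (\<lambda>_ :: nat. space (borel :: real measure) \<times> space P) \<subseteq> {a \<times> b |a b. a \<in> sets borel \<and> b \<in> sets P}"
      by (auto simp only: image_subset_iff intro!: CollectI exI[of _ "space (borel :: real measure)"] exI[of _ "space P"] sets.top)
    show "emeasure (distr M (borel \<Otimes>\<^sub>M P) (\<lambda>\<omega>. (g \<omega>, sample_path {0..1} b \<omega>))) (space borel \<times> space P) \<noteq> \<infinity>"
      using finite_measure.emeasure_finite[OF prob_space.finite_measure[OF M.prob_space_distr[OF gb]]] by simp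
  qed simp
  have "emeasure M {\<omega> \<in> space M. (g \<omega>, sample_path {0..1} b \<omega>) \<in> E} = emeasure (distr M (borel \<Otimes>\<^sub>M P) (\<lambda>\<omega>. (g \<omega>, sample_path {0..1} b \<omega>))) E"
    using gb E[folded P_def] by (subst emeasure_distr) (auto intro!: arg_cong[where f="emeasure M"])
  then show ?thesis unfolding eq K[OF E[folded P_def]] C_def D_def .
qed

section \<open>Limit laws\<close>

lemma density_of_cdf:
  assumes D: "real_distribution D" and f [measurable]: "f \<in> borel_measurable borel" and nonneg: "\<And>t. 0 \<le> f t"
    and mass: "(\<integral>\<^sup>+t. ennreal (f t) \<partial>lborel) = 1"
    and cdf: "\<And>x. (\<integral>\<^sup>+t\<in>{..x}. ennreal (f t) \<partial>lborel) = ennreal (cdf D x)"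
  shows "D = density lborel f"
proof (rule cdf_unique[OF D])
  have "prob_space (density lborel f)"
    by (rule prob_spaceI) (simp add: emeasure_density mass)
  then show "real_distribution (density lborel f)"
    by (simp add: real_distribution_def real_distribution_axioms_def)
  show "cdf D = cdf (density lborel f)"
  proof
    fix x
    interpret D: real_distribution D by (rule D)
    have "cdf (density lborel f) x = enn2real (\<integral>\<^sup>+t\<in>{..x}. ennreal (f t) \<partial>lborel)"
      unfolding Distribution_Functions.cdf_def measure_def by (simp add: emeasure_density)
    then show "cdf D x = cdf (density lborel f) x" by (simp add: cdf D.cdf_nonneg)
  qed
qed

lemma measure_density_singleton:
  assumes [measurable]: "f \<in> borel_measurable borel"
  shows "measure (density lborel f) {a :: real} = 0"
proof -
  have "emeasure (density lborel f) {a} = 0"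
    using AE_lborel_singleton[of a] by (subst emeasure_density) (auto simp: nn_integral_0_iff_AE)
  then show ?thesis by (simp add: measure_def)
qed

text \<open>The rescaling is decreasing, so it turns \<open>\<le>\<close> into \<open>\<ge>\<close>;
  passing to the complement then requires that the boundary point carries no mass.\<close>

lemma cdf_rescaled:
  assumes M: "prob_space M" and V: "V \<in> borel_measurable M" and y: "y \<noteq> 0"
    and atom: "measure (distr M borel V) {1 - u / y\<^sup>2} = 0"
  shows "cdf (distr M borel (\<lambda>\<omega>. y\<^sup>2 * (1 - V \<omega>))) u = 1 - cdf (distr M borel V) (1 - u / y\<^sup>2)"
proof -
  interpret M: prob_space M by (rule M)
  define a where "a = 1 - u / y\<^sup>2"
  interpret D: real_distribution "distr M borel V" using V by simp
  have y2: "y\<^sup>2 > 0" using y by simp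
  have iff: "y\<^sup>2 * (1 - v) \<le> u \<longleftrightarrow> a \<le> v" for v
    using y2 by (simp add: a_def field_simps)
  have V': "(\<lambda>\<omega>. y\<^sup>2 * (1 - V \<omega>)) \<in> borel_measurable M" using V by measurable
  have "cdf (distr M borel (\<lambda>\<omega>. y\<^sup>2 * (1 - V \<omega>))) u = measure M {\<omega> \<in> space M. y\<^sup>2 * (1 - V \<omega>) \<le> u}"
    unfolding Distribution_Functions.cdf_def using V' by (simp add: measure_distr vimage_def Int_def conj_commute)
  also have "\<dots> = measure M {\<omega> \<in> space M. a \<le> V \<omega>}" by (simp only: iff)
  also have "\<dots> = measure (distr M borel V) {a..}"
    using V by (simp add: measure_distr vimage_def Int_def conj_commute)
  also have "{a..} = space (distr M borel V) - {..<a}" by auto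
  also have "measure (distr M borel V) \<dots> = 1 - measure (distr M borel V) {..<a}" by (rule D.prob_compl) simp
  also have "measure (distr M borel V) {..<a} = measure (distr M borel V) {..<a} + measure (distr M borel V) {a}"
    using atom by (simp add: a_def)
  also have "\<dots> = measure (distr M borel V) ({..<a} \<union> {a})" by (rule D.finite_measure_Union[symmetric]) auto
  also have "{..<a} \<union> {a} = {..a}" by auto
  finally show ?thesis by (simp add: Distribution_Functions.cdf_def a_def)
qed

text \<open>Convergence in law keeps \<open>y\<^sup>2 * (1 - V)\<close> tight, while
  \<open>y\<^sup>2 * (1 - x)\<close> diverges for every \<open>x \<noteq> 1\<close>. The point 1
  itself is excluded as a discontinuity of the limit distribution function.\<close>

lemma weak_conv_along_return_1:
  assumes M: "\<And>y. prob_space (M y)" and V: "\<And>y. y < 0 \<Longrightarrow> V y \<in> borel_measurable (M y)" and \<mu>: "real_distribution \<mu>"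
    and lim: "\<And>u. ((\<lambda>y. cdf (distr (M y) borel (\<lambda>\<omega>. y\<^sup>2 * (1 - V y \<omega>))) u) \<longlongrightarrow> cdf \<mu> u) at_bot"
  shows "weak_conv_along at_bot (\<lambda>y. distr (M y) borel (V y)) (return borel 1)"
  unfolding weak_conv_along_def
proof (intro allI impI)
  fix x :: real assume x: "isCont (cdf (return borel 1)) x"
  interpret \<mu>: real_distribution \<mu> by (rule \<mu>)
  interpret R: prob_space "return borel (1::real)" by (rule prob_space_return) simp
  interpret R: real_distribution "return borel (1::real)" by standard auto
  have x1: "x \<noteq> 1" using x by (auto simp: R.isCont_cdf measure_return)
  have cdf_R: "cdf (return borel 1) x = (if x < 1 then 0 else 1)"
    using x1 by (simp add: Distribution_Functions.cdf_def measure_return indicator_def)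
  have cdf_eq: "cdf (distr (M y) borel (\<lambda>\<omega>. y\<^sup>2 * (1 - V y \<omega>))) u = measure (M y) {\<omega> \<in> space (M y). y\<^sup>2 * (1 - V y \<omega>) \<le> u}" if "y < 0" for y u
  proof -
    have "(\<lambda>\<omega>. y\<^sup>2 * (1 - V y \<omega>)) \<in> borel_measurable (M y)" using V[OF that] by measurable
    then show ?thesis unfolding Distribution_Functions.cdf_def by (simp add: measure_distr vimage_def Int_def conj_commute)
  qed
  have cdf_V: "cdf (distr (M y) borel (V y)) x = measure (M y) {\<omega> \<in> space (M y). V y \<omega> \<le> x}" if "y < 0" for y
    unfolding Distribution_Functions.cdf_def using V[OF that] by (simp add: measure_distr vimage_def Int_def conj_commute)
  have Vm: "{\<omega> \<in> space (M y). y\<^sup>2 * (1 - V y \<omega>) \<le> u} \<in> sets (M y)" "{\<omega> \<in> space (M y). V y \<omega> \<le> x} \<in> sets (M y)" if "y < 0" for y u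
    using V[OF that] by measurable
  show "((\<lambda>y. cdf (distr (M y) borel (V y)) x) \<longlongrightarrow> cdf (return borel 1) x) at_bot"
  proof (cases "x < 1")
    case True
    show ?thesis unfolding cdf_R if_P[OF True]
    proof (rule tendstoI)
      fix e :: real assume e: "e > 0"
      have "\<forall>\<^sub>F u in at_top. dist (cdf \<mu> u) 1 < e / 2"
        using \<mu>.cdf_lim_at_top_prob e by (intro tendstoD) auto
      then obtain u where "dist (cdf \<mu> u) 1 < e / 2"
        unfolding eventually_at_top_linorder by blast
      then have u: "1 - cdf \<mu> u < e / 2" unfolding dist_real_def by linarith
      have "\<forall>\<^sub>F y in at_bot. dist (cdf (distr (M y) borel (\<lambda>\<omega>. y\<^sup>2 * (1 - V y \<omega>))) u) (cdf \<mu> u) < e / 2"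
        using lim[of u] e by (intro tendstoD) auto
      moreover have "\<forall>\<^sub>F y in at_bot. u < y\<^sup>2 * (1 - x)" using True by real_asymp
      ultimately show "\<forall>\<^sub>F y in at_bot. dist (cdf (distr (M y) borel (V y)) x) 0 < e"
        using eventually_gt_at_bot[of "0::real"]
      proof eventually_elim
        case (elim y)
        interpret My: prob_space "M y" by (rule M)
        have "measure (M y) {\<omega> \<in> space (M y). V y \<omega> \<le> x} \<le> measure (M y) (space (M y) - {\<omega> \<in> space (M y). y\<^sup>2 * (1 - V y \<omega>) \<le> u})"
        proof (rule My.finite_measure_mono)
          show "{\<omega> \<in> space (M y). V y \<omega> \<le> x} \<subseteq> space (M y) - {\<omega> \<in> space (M y). y\<^sup>2 * (1 - V y \<omega>) \<le> u}"
          proof safe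
            fix \<omega> assume "V y \<omega> \<le> x" "y\<^sup>2 * (1 - V y \<omega>) \<le> u"
            moreover have "y\<^sup>2 * (1 - x) \<le> y\<^sup>2 * (1 - V y \<omega>)" using \<open>V y \<omega> \<le> x\<close> by (intro mult_left_mono) auto
            ultimately show False using elim by linarith
          qed
        qed (use Vm[OF elim(3)] in auto)
        also have "\<dots> = 1 - measure (M y) {\<omega> \<in> space (M y). y\<^sup>2 * (1 - V y \<omega>) \<le> u}"
          by (rule My.prob_compl[OF Vm(1)[OF elim(3)]])
        finally have le: "cdf (distr (M y) borel (V y)) x \<le> 1 - cdf (distr (M y) borel (\<lambda>\<omega>. y\<^sup>2 * (1 - V y \<omega>))) u"
          unfolding cdf_eq[OF elim(3)] cdf_V[OF elim(3)] .
        have "0 \<le> cdf (distr (M y) borel (V y)) x" by (simp add: cdf_V[OF elim(3)])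
        then show ?case using le elim(1) u unfolding dist_real_def by linarith
      qed
    qed
  next
    case False
    with x1 have x: "x > 1" by simp
    show ?thesis unfolding cdf_R if_not_P[OF False]
    proof (rule tendstoI)
      fix e :: real assume e: "e > 0"
      have "\<forall>\<^sub>F u in at_bot. dist (cdf \<mu> u) 0 < e / 2"
        using \<mu>.cdf_lim_at_bot e by (intro tendstoD) auto
      then obtain u where "dist (cdf \<mu> u) 0 < e / 2"
        unfolding eventually_at_bot_linorder by blast
      then have u: "cdf \<mu> u < e / 2" unfolding dist_real_def by linarith
      have "\<forall>\<^sub>F y in at_bot. dist (cdf (distr (M y) borel (\<lambda>\<omega>. y\<^sup>2 * (1 - V y \<omega>))) u) (cdf \<mu> u) < e / 2"
        using lim[of u] e by (intro tendstoD) auto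
      moreover have "\<forall>\<^sub>F y in at_bot. y\<^sup>2 * (1 - x) < u" using x by real_asymp
      ultimately show "\<forall>\<^sub>F y in at_bot. dist (cdf (distr (M y) borel (V y)) x) 1 < e"
        using eventually_gt_at_bot[of "0::real"]
      proof eventually_elim
        case (elim y)
        interpret My: prob_space "M y" by (rule M)
        have "measure (M y) (space (M y) - {\<omega> \<in> space (M y). V y \<omega> \<le> x}) \<le> measure (M y) {\<omega> \<in> space (M y). y\<^sup>2 * (1 - V y \<omega>) \<le> u}"
        proof (rule My.finite_measure_mono)
          show "space (M y) - {\<omega> \<in> space (M y). V y \<omega> \<le> x} \<subseteq> {\<omega> \<in> space (M y). y\<^sup>2 * (1 - V y \<omega>) \<le> u}"
          proof safe
            fix \<omega> assume "\<not> V y \<omega> \<le> x"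
            then have "y\<^sup>2 * (1 - V y \<omega>) \<le> y\<^sup>2 * (1 - x)" by (intro mult_left_mono) auto
            then show "y\<^sup>2 * (1 - V y \<omega>) \<le> u" using elim by linarith
          qed
        qed (use Vm[OF elim(3)] in auto)
        also have "measure (M y) (space (M y) - {\<omega> \<in> space (M y). V y \<omega> \<le> x}) = 1 - measure (M y) {\<omega> \<in> space (M y). V y \<omega> \<le> x}"
          by (rule My.prob_compl[OF Vm(2)[OF elim(3)]])
        finally have le: "1 - cdf (distr (M y) borel (V y)) x \<le> cdf (distr (M y) borel (\<lambda>\<omega>. y\<^sup>2 * (1 - V y \<omega>))) u"
          unfolding cdf_eq[OF elim(3)] cdf_V[OF elim(3)] .
        have "cdf (distr (M y) borel (V y)) x \<le> 1" by (simp add: cdf_V[OF elim(3)])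
        then show ?case using le elim(1) u unfolding dist_real_def by linarith
      qed
    qed
  qed
qed

text \<open>The theorem describes the limit law by its distribution function; a density shows that
  such a law exists. On the negative side it is the limit in \<open>g_tail_limit\<close> reflected
  at 0, on the positive side half the exponential density of rate 1/2. Each side has mass
  1/2.\<close>

definition g_limit_density :: "real \<Rightarrow> real" where
  "g_limit_density x = (if x < 0 then exp (- x / 2) * occ_tail (sqrt (- x)) / 4 else exp (- x / 2) / 4)"

lemma borel_measurable_g_limit_density [measurable]: "g_limit_density \<in> borel_measurable borel"
proof -
  have [measurable]: "(\<lambda>x. occ_tail (sqrt (- x))) \<in> borel_measurable borel"
    by (rule measurable_compose[OF _ borel_measurable_occ_tail]) simp
  show ?thesis unfolding g_limit_density_def[abs_def]
    by (intro measurable_If borel_measurable_divide borel_measurable_times borel_measurable_const) auto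
qed

lemma g_limit_le_0:
  assumes u: "u \<le> 0"
  shows "(\<integral>\<^sup>+x\<in>{..u}. ennreal (g_limit_density x) \<partial>lborel) = ennreal (g_tail (- u))"
proof -
  have "(\<integral>\<^sup>+x\<in>{..u}. ennreal (g_limit_density x) \<partial>lborel) = ennreal \<bar>-1\<bar> * (\<integral>\<^sup>+x. ennreal (g_limit_density (0 + (-1) * x)) * indicator {..u} (0 + (-1) * x) \<partial>lborel)"
    by (rule nn_integral_real_affine) auto
  also have "\<dots> = (\<integral>\<^sup>+x. ennreal (g_limit_density (- x)) * indicator {..u} (- x) \<partial>lborel)" by simp
  also have "\<dots> = (\<integral>\<^sup>+x\<in>{- u<..}. ennreal (exp (x / 2) * occ_tail (sqrt x) / 4) \<partial>lborel)"
    by (rule nn_integral_cong_AE)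
      (use AE_lborel_singleton[of "- u"] in eventually_elim, use u in \<open>auto simp: g_limit_density_def indicator_def\<close>)
  also have "\<dots> = ennreal (g_tail (- u))" using u by (intro occ_tail_g_tail) simp
  finally show ?thesis .
qed

lemma nn_integral_exp_Icc:
  assumes "0 \<le> u"
  shows "(\<integral>\<^sup>+x\<in>{0..u}. ennreal (exp (- x / 2) / 4) \<partial>lborel) = ennreal (1/2 - 1/2 * exp (- u / 2))"
proof -
  have "(\<integral>\<^sup>+x. ennreal (exp (- x / 2) / 4) * indicator {0..u} x \<partial>lborel) = ennreal (- 1/2 * exp (- u / 2) - - 1/2 * exp (- 0 / 2))"
    by (rule nn_integral_FTC_Icc) (use assms in \<open>auto intro!: derivative_eq_intros\<close>)
  then show ?thesis by simp
qed

lemma g_limit_ge_0: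
  assumes u: "u \<ge> 0"
  shows "(\<integral>\<^sup>+x\<in>{..u}. ennreal (g_limit_density x) \<partial>lborel) = ennreal (1 - 1/2 * exp (- (u / 2)))"
proof -
  have "(\<integral>\<^sup>+x\<in>{..u}. ennreal (g_limit_density x) \<partial>lborel) = (\<integral>\<^sup>+x. ennreal (g_limit_density x) * indicator {..0} x + ennreal (exp (- x / 2) / 4) * indicator {0..u} x \<partial>lborel)"
    by (rule nn_integral_cong_AE)
      (use AE_lborel_singleton[of "0::real"] in eventually_elim, use u in \<open>auto simp: g_limit_density_def indicator_def\<close>)
  also have "\<dots> = ennreal (g_tail (- 0)) + ennreal (1/2 - 1/2 * exp (- u / 2))"
    by (subst nn_integral_add) (auto simp: g_limit_le_0 nn_integral_exp_Icc[OF u, simplified])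
  also have "\<dots> = ennreal (1 - 1/2 * exp (- (u / 2)))"
    using u by (subst ennreal_plus[symmetric]) (auto simp: g_tail_0)
  finally show ?thesis .
qed

lemma g_limit_mass: "(\<integral>\<^sup>+x. ennreal (g_limit_density x) \<partial>lborel) = 1"
proof -
  have "(\<lambda>n. \<integral>\<^sup>+x. ennreal (g_limit_density x) * indicator {..real n} x \<partial>lborel) \<longlonglongrightarrow> (\<integral>\<^sup>+x. ennreal (g_limit_density x) \<partial>lborel)"
  proof (rule nn_integral_LIMSEQ)
    show "incseq (\<lambda>n x. ennreal (g_limit_density x) * indicator {..real n} x)"
      by (auto simp: incseq_def le_fun_def indicator_def)
    fix x :: real
    have "\<forall>\<^sub>F n in sequentially. x \<le> real n" by real_asymp
    then have "\<forall>\<^sub>F n in sequentially. ennreal (g_limit_density x) * indicator {..real n} x = ennreal (g_limit_density x)"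
      by eventually_elim (auto simp: indicator_def)
    then show "(\<lambda>n. ennreal (g_limit_density x) * indicator {..real n} x) \<longlonglongrightarrow> ennreal (g_limit_density x)"
      by (rule tendsto_eventually)
  qed auto
  moreover have "(\<lambda>n. ennreal (1 - 1/2 * exp (- (real n / 2)))) \<longlonglongrightarrow> ennreal 1"
    by (rule tendsto_ennrealI) real_asymp
  ultimately show ?thesis by (simp add: g_limit_ge_0 LIMSEQ_unique)
qed

lemma g_limit_distribution:
  "real_distribution (density lborel g_limit_density)"
  "u \<le> 0 \<Longrightarrow> cdf (density lborel g_limit_density) u = g_tail (- u)"
  "u \<ge> 0 \<Longrightarrow> cdf (density lborel g_limit_density) u = 1 - 1/2 * exp (- (u / 2))"
proof -
  have "prob_space (density lborel g_limit_density)"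
    by (rule prob_spaceI) (simp add: emeasure_density g_limit_mass)
  then show "real_distribution (density lborel g_limit_density)"
    by (simp add: real_distribution_def real_distribution_axioms_def)
  have c: "cdf (density lborel g_limit_density) u = enn2real (\<integral>\<^sup>+t\<in>{..u}. ennreal (g_limit_density t) \<partial>lborel)" for u
    unfolding Distribution_Functions.cdf_def measure_def by (simp add: emeasure_density)
  show "u \<le> 0 \<Longrightarrow> cdf (density lborel g_limit_density) u = g_tail (- u)"
    unfolding c by (simp add: g_limit_le_0 g_tail_nonneg)
  show "u \<ge> 0 \<Longrightarrow> cdf (density lborel g_limit_density) u = 1 - 1/2 * exp (- (u / 2))"
  proof -
    assume u: "u \<ge> 0"
    then have "exp (- (u / 2)) \<le> 1" by simp
    then have "0 \<le> 1 - 1/2 * exp (- (u / 2))" by linarith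
    then show ?thesis unfolding c g_limit_ge_0[OF u] by (rule enn2real_ennreal)
  qed
qed

lemma phi_mass_0: "phi_mass y 0 = 0"
  unfolding phi_mass_def set_lebesgue_integral_def
  by (rule integral_eq_zero_AE) (auto simp: indicator_def phi_def)

text \<open>The exponential factor of \<open>phi\<close> is largest at the end point
  \<open>K\<close>. The mass on a bounded interval therefore vanishes as \<open>y\<close> grows,
  which gives the divergence of \<open>g\<close> in part (a).\<close>

lemma phi_mass_le_exp:
  assumes "K > 0"
  shows "phi_mass y K \<le> exp (- (y\<^sup>2 / (2 * K))) * phi_mass 0 K"
proof -
  have "phi_mass y K \<le> (LINT t:{0..K}|lborel. exp (- (y\<^sup>2 / (2 * K))) * phi 0 t)"
    unfolding phi_mass_def
  proof (rule set_integral_mono)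
    show "set_integrable lborel {0..K} (phi y)" "set_integrable lborel {0..K} (\<lambda>t. exp (- (y\<^sup>2 / (2 * K))) * phi 0 t)"
      using phi_integrable[of K] assms by auto
    fix t assume t: "t \<in> {0..K}"
    show "phi y t \<le> exp (- (y\<^sup>2 / (2 * K))) * phi 0 t"
    proof (cases "t = 0")
      case False
      then have "y\<^sup>2 / (2 * K) \<le> y\<^sup>2 / (2 * t)" using t by (intro divide_left_mono) auto
      then have "exp (- (y\<^sup>2 / (2 * t))) * (1 / sqrt t) \<le> exp (- (y\<^sup>2 / (2 * K))) * (1 / sqrt t)"
        using t by (intro mult_right_mono) auto
      then show ?thesis by (simp add: phi_def)
    qed simp
  qed
  then show ?thesis by (simp add: phi_mass_def)
qed

context occ_masses
begin

text \<open>The density form shows that \<open>g\<close> has no atoms for \<open>y < 0\<close>, and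
  it is what the conditional law of the bridge is integrated against.\<close>

lemma law_eq_occ_density:
  assumes y: "y < 0" and D: "real_distribution D"
    and cdf: "\<And>x. x \<ge> 0 \<Longrightarrow> cdf D x = occ_mass y x / (2 * phi_mass y 1)" "\<And>x. x < 0 \<Longrightarrow> cdf D x = 0"
  shows "D = density lborel (\<lambda>t. occ_dens y t / (2 * phi_mass y 1))"
proof (rule density_of_cdf[OF D])
  have pm: "phi_mass y 1 > 0" by (rule phi_mass_pos) simp
  have scale: "(\<integral>\<^sup>+t\<in>A. ennreal (occ_dens y t / (2 * phi_mass y 1)) \<partial>lborel) = ennreal (1 / (2 * phi_mass y 1)) * (\<integral>\<^sup>+t\<in>A. ennreal (occ_dens y t) \<partial>lborel)"
    if "A \<in> sets borel" for A
  proof -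
    have "(\<integral>\<^sup>+t\<in>A. ennreal (occ_dens y t / (2 * phi_mass y 1)) \<partial>lborel) = (\<integral>\<^sup>+t. ennreal (1 / (2 * phi_mass y 1)) * (ennreal (occ_dens y t) * indicator A t) \<partial>lborel)"
      using pm by (intro nn_integral_cong) (auto simp: indicator_def ennreal_mult'[symmetric])
    also have "\<dots> = ennreal (1 / (2 * phi_mass y 1)) * (\<integral>\<^sup>+t\<in>A. ennreal (occ_dens y t) \<partial>lborel)"
      using that by (intro nn_integral_cmult) auto
    finally show ?thesis .
  qed
  show "(\<lambda>t. occ_dens y t / (2 * phi_mass y 1)) \<in> borel_measurable borel"
    by (intro borel_measurable_divide) auto
  show "0 \<le> occ_dens y t / (2 * phi_mass y 1)" for t using pm by (simp add: occ_dens_nonneg)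
  show "(\<integral>\<^sup>+t. ennreal (occ_dens y t / (2 * phi_mass y 1)) \<partial>lborel) = 1"
    using scale[of UNIV] occ_dens_mass_neg[OF y] pm by (simp add: ennreal_mult'[symmetric])
  show "(\<integral>\<^sup>+t\<in>{..x}. ennreal (occ_dens y t / (2 * phi_mass y 1)) \<partial>lborel) = ennreal (cdf D x)" for x
  proof (cases "x < 0")
    case True
    have "(\<integral>\<^sup>+t\<in>{..x}. ennreal (occ_dens y t / (2 * phi_mass y 1)) \<partial>lborel) = (\<integral>\<^sup>+t. 0 \<partial>(lborel :: real measure))"
      using True by (intro nn_integral_cong) (auto simp: indicator_def)
    then show ?thesis using True cdf by simp
  next
    case False
    have "(\<integral>\<^sup>+t\<in>{..x}. ennreal (occ_dens y t) \<partial>lborel) = (\<integral>\<^sup>+t\<in>{0..x}. ennreal (occ_dens y t) \<partial>lborel)"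
      by (intro nn_integral_cong) (auto simp: indicator_def)
    also have "\<dots> = ennreal (occ_mass y x)" using False by (simp add: ennreal_occ_mass)
    finally show ?thesis
      using False pm cdf(1)[of x] scale[of "{..x}"] by (simp add: ennreal_mult'[symmetric])
  qed
qed

text \<open>Since \<open>v \<le> 1\<close>, the event is part of the conditioning event, so given
  \<open>g = x\<close> its probability is the quotient of \<open>occ_cdf\<close> at the levels
  \<open>v / x\<close> and \<open>1 / x\<close>. The density of \<open>g\<close> contains the
  denominator as a factor, which cancels, and the remaining integral is
  \<open>occ_dens_mass_scaled\<close>.\<close>

lemma prob_neg_time_X_process_le:
  fixes M :: "'w measure"
  assumes y: "y < 0" and v: "0 < v" "v \<le> 1" and M: "prob_space M" and g: "g \<in> borel_measurable M"
    and D: "distr M borel g = density lborel (\<lambda>t. occ_dens y t / (2 * phi_mass y 1))"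
    and cb: "conditioned_bridge_given N \<beta> y M g b" and Z: "bessel3 M 0 Z"
  shows "measure M {\<omega> \<in> space M. neg_time {0..} (\<lambda>s. X_process y g b Z Y s \<omega>) \<le> v} = phi_mass y v / phi_mass y 1"
proof -
  interpret M: prob_space M by (rule M)
  have bc: "continuous_process M {0..1} b" using cb by (simp add: conditioned_bridge_given_def)
  have Zc: "continuous_process M {0..} Z" using Z by (simp add: bessel3_def)
  have pm: "phi_mass y 1 > 0" by (rule phi_mass_pos) simp
  have dm: "(\<lambda>t. ennreal (occ_dens y t / (2 * phi_mass y 1))) \<in> borel_measurable lborel"
    by (intro measurable_compose[OF _ measurable_ennreal] borel_measurable_divide) auto
  define P where "P = path_space {0..1}"
  define E where "E = {z \<in> space (borel \<Otimes>\<^sub>M P). fst z > 0 \<and> fst z * tilted_neg_time (y / sqrt (fst z)) (snd z) \<le> v}"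
  have E: "E \<in> sets (borel \<Otimes>\<^sub>M P)"
  proof -
    have "(\<lambda>z. (y / sqrt (fst z), snd z)) \<in> borel \<Otimes>\<^sub>M P \<rightarrow>\<^sub>M borel \<Otimes>\<^sub>M P" by measurable
    from measurable_compose[OF this measurable_tilted_neg_time[folded P_def]]
    have "(\<lambda>z. tilted_neg_time (y / sqrt (fst z)) (snd z)) \<in> borel_measurable (borel \<Otimes>\<^sub>M P)" by simp
    then show ?thesis unfolding E_def by measurable
  qed
  have D_pos: "AE x in distr M borel g. x > 0"
    unfolding D using dm pm by (subst AE_density) (auto simp: occ_dens_def indicator_def)
  then have g_pos: "AE \<omega> in M. g \<omega> > 0"
    by (rule AE_distrD[OF g])
  have sp: "sample_path {0..1} b \<in> measurable M P" unfolding P_def by (rule measurable_sample_path[OF bc])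
  have gsp: "(\<lambda>\<omega>. (g \<omega>, sample_path {0..1} b \<omega>)) \<in> measurable M (borel \<Otimes>\<^sub>M P)" using g sp by measurable
  have Em: "{\<omega> \<in> space M. (g \<omega>, sample_path {0..1} b \<omega>) \<in> E} \<in> sets M"
    using measurable_sets[OF gsp E] by (simp add: vimage_def Int_def conj_commute)
  have "measure M {\<omega> \<in> space M. neg_time {0..} (\<lambda>s. X_process y g b Z Y s \<omega>) \<le> v} = measure M {\<omega> \<in> space M. (g \<omega>, sample_path {0..1} b \<omega>) \<in> E}"
  proof (rule M.prob_eq_AE)
    show "AE \<omega> in M. (neg_time {0..} (\<lambda>s. X_process y g b Z Y s \<omega>) \<le> v) = ((g \<omega>, sample_path {0..1} b \<omega>) \<in> E)"
      using g_pos bessel3_nonneg_AE[OF Z] AE_space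
    proof eventually_elim
      case (elim \<omega>)
      have "continuous_on {0..1} (\<lambda>s. b s \<omega>)" using bc elim by (simp add: continuous_process_def)
      from neg_time_X_process[where g=g and b=b and Z=Z and \<omega>=\<omega> and Y=Y, OF y elim(1) this elim(2)]
      show ?case using elim measurable_space[OF sp elim(3)] by (simp add: E_def space_pair_measure)
    qed
    show "{\<omega> \<in> space M. neg_time {0..} (\<lambda>s. X_process y g b Z Y s \<omega>) \<le> v} \<in> M.events"
      using measurable_neg_time_X_process[OF y g bc Zc, of Y] by measurable
  qed (rule Em)
  also have "\<dots> = phi_mass y v / phi_mass y 1"
  proof -
    have cond: "\<P>(\<omega> in N. (x, sample_path {0..1} \<beta> \<omega>) \<in> E \<bar> neg_time {0..x} (\<lambda>s. sqrt x * \<beta> (s / x) \<omega> + y - s / x * y) \<le> 1)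
        = occ_cdf N \<beta> (y / sqrt x) (v / x) / occ_cdf N \<beta> (y / sqrt x) (1 / x)" if x: "x > 0" for x
    proof -
      define A where "A = (\<lambda>\<omega>. neg_time {0..1} (\<lambda>s. \<beta> s \<omega> + y / sqrt x * (1 - s)))"
      have C: "neg_time {0..x} (\<lambda>s. sqrt x * \<beta> (s / x) \<omega> + y - s / x * y) \<le> 1 \<longleftrightarrow> A \<omega> \<le> 1 / x" for \<omega>
        using neg_time_rescaled_bridge[OF x, of "\<lambda>s. \<beta> s \<omega>" y] x by (simp add: A_def pos_le_divide_eq mult.commute)
      have Ex: "(x, sample_path {0..1} \<beta> \<omega>) \<in> E \<longleftrightarrow> A \<omega> \<le> v / x" if "\<omega> \<in> space N" for \<omega>
      proof -
        have "sample_path {0..1} \<beta> \<omega> \<in> space P"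
          unfolding P_def using measurable_space[OF measurable_sample_path[OF process] that] .
        moreover have "tilted_neg_time (y / sqrt x) (sample_path {0..1} \<beta> \<omega>) = A \<omega>"
          using process that by (simp add: A_def sample_path_def tilted_neg_time_eq continuous_process_def)
        ultimately show ?thesis using x by (simp add: E_def space_pair_measure pos_le_divide_eq mult.commute)
      qed
      have "v / x \<le> 1 / x" using v x by (intro divide_right_mono) auto
      then have "{\<omega> \<in> space N. (x, sample_path {0..1} \<beta> \<omega>) \<in> E \<and> A \<omega> \<le> 1 / x} = {\<omega> \<in> space N. A \<omega> \<le> v / x}"
        using Ex by force
      then show ?thesis unfolding cond_prob_def C by (simp add: occ_cdf_def A_def)
    qed
    have qm: "(\<lambda>x :: real. occ_cdf N \<beta> (y / sqrt x) (u / x)) \<in> borel_measurable borel" for u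
      by (rule measurable_occ_cdf) auto
    have "emeasure M {\<omega> \<in> space M. (g \<omega>, sample_path {0..1} b \<omega>) \<in> E}
      = (\<integral>\<^sup>+x. ennreal (occ_cdf N \<beta> (y / sqrt x) (v / x) / occ_cdf N \<beta> (y / sqrt x) (1 / x)) \<partial>distr M borel g)"
      unfolding conditioned_bridge_joint[OF M g cb E[unfolded P_def]]
      by (rule nn_integral_cong_AE) (use D_pos in eventually_elim, simp only: cond)
    also have "\<dots> = (\<integral>\<^sup>+x. ennreal (occ_dens y x / (2 * phi_mass y 1)) * ennreal (occ_cdf N \<beta> (y / sqrt x) (v / x) / occ_cdf N \<beta> (y / sqrt x) (1 / x)) \<partial>lborel)"
      unfolding D by (rule nn_integral_density[OF dm]) (intro measurable_compose[OF _ measurable_ennreal] borel_measurable_divide qm; simp add: qm)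
    also have "\<dots> = (\<integral>\<^sup>+x. ennreal (1 / (2 * phi_mass y 1)) * (ennreal (occ_cdf N \<beta> (y / sqrt x) (v / x) * phi y x) * indicator {0<..} x) \<partial>lborel)"
    proof (intro nn_integral_cong)
      fix x :: real
      show "ennreal (occ_dens y x / (2 * phi_mass y 1)) * ennreal (occ_cdf N \<beta> (y / sqrt x) (v / x) / occ_cdf N \<beta> (y / sqrt x) (1 / x))
        = ennreal (1 / (2 * phi_mass y 1)) * (ennreal (occ_cdf N \<beta> (y / sqrt x) (v / x) * phi y x) * indicator {0<..} x)"
      proof (cases "x > 0")
        case True
        have le: "occ_cdf N \<beta> (y / sqrt x) (v / x) \<le> occ_cdf N \<beta> (y / sqrt x) (1 / x)"
          using v True by (intro occ_cdf_mono divide_right_mono) auto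
        have "occ_dens y x / (2 * phi_mass y 1) * (occ_cdf N \<beta> (y / sqrt x) (v / x) / occ_cdf N \<beta> (y / sqrt x) (1 / x))
          = 1 / (2 * phi_mass y 1) * (occ_cdf N \<beta> (y / sqrt x) (v / x) * phi y x)"
        \<comment> \<open>If the denominator is 0, so is the numerator by monotonicity, and both
          sides vanish.\<close>
        proof (cases "occ_cdf N \<beta> (y / sqrt x) (1 / x) = 0")
          case True
          then have "occ_cdf N \<beta> (y / sqrt x) (v / x) = 0" using le occ_cdf_nonneg[of "y / sqrt x" "v / x"] by simp
          then show ?thesis by simp
        qed (use True in \<open>simp add: occ_dens_def\<close>)
        then show ?thesis
          using True pm by (simp add: ennreal_mult'[symmetric] occ_dens_nonneg)
      qed simp
    qed
    also have "\<dots> = ennreal (1 / (2 * phi_mass y 1)) * ennreal (2 * phi_mass y v)"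
    proof -
      have "(\<lambda>x. ennreal (occ_cdf N \<beta> (y / sqrt x) (v / x) * phi y x) * indicator {0<..} x) \<in> borel_measurable lborel"
        by (intro borel_measurable_times_ennreal measurable_compose[OF _ measurable_ennreal] borel_measurable_times) (simp_all add: qm)
      from nn_integral_cmult[OF this] show ?thesis by (simp add: occ_dens_mass_scaled[OF y v(1)])
    qed
    also have "\<dots> = ennreal (phi_mass y v / phi_mass y 1)"
      using pm by (subst ennreal_mult'[symmetric]) auto
    finally show ?thesis
      using pm phi_mass_nonneg[of y v] by (simp add: M.emeasure_eq_measure)
  qed
  finally show ?thesis .
qed

end

lemma law_eq_phi_density:
  assumes D: "real_distribution D" and y: "y < 0"
    and cdf: "\<And>v. 0 < v \<Longrightarrow> v \<le> 1 \<Longrightarrow> cdf D v = phi_mass y v / phi_mass y 1" and neg: "\<And>v. v < 0 \<Longrightarrow> cdf D v = 0"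
  shows "D = density lborel (\<lambda>t. indicator {0..1} t * phi y t / phi_mass y 1)"
proof (rule density_of_cdf[OF D])
  interpret D: real_distribution D by (rule D)
  have pm: "phi_mass y 1 > 0" by (rule phi_mass_pos) simp
  show "(\<lambda>t. indicator {0..1} t * phi y t / phi_mass y 1) \<in> borel_measurable borel"
    by (intro borel_measurable_divide borel_measurable_times) auto
  show "0 \<le> indicator {0..1} t * phi y t / phi_mass y 1" for t using pm by (auto simp: indicator_def phi_nonneg)
  have part: "(\<integral>\<^sup>+t\<in>{0..x}. ennreal (phi y t / phi_mass y 1) \<partial>lborel) = ennreal (phi_mass y x / phi_mass y 1)" if "0 \<le> x" for x
  proof -
    have "(\<integral>\<^sup>+t\<in>{0..x}. ennreal (phi y t / phi_mass y 1) \<partial>lborel) = (\<integral>\<^sup>+t. ennreal (1 / phi_mass y 1) * (ennreal (phi y t) * indicator {0..x} t) \<partial>lborel)"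
      using pm by (intro nn_integral_cong) (auto simp: indicator_def ennreal_mult'[symmetric])
    also have "\<dots> = ennreal (1 / phi_mass y 1) * ennreal (phi_mass y x)"
      using that by (subst nn_integral_cmult) (auto simp: ennreal_phi_mass)
    finally show ?thesis using pm by (simp add: ennreal_mult'[symmetric])
  qed
  have "(\<integral>\<^sup>+t. ennreal (indicator {0..1} t * phi y t / phi_mass y 1) \<partial>lborel) = (\<integral>\<^sup>+t\<in>{0..1}. ennreal (phi y t / phi_mass y 1) \<partial>lborel)"
    by (intro nn_integral_cong) (auto simp: indicator_def)
  then show "(\<integral>\<^sup>+t. ennreal (indicator {0..1} t * phi y t / phi_mass y 1) \<partial>lborel) = 1"
    using part[of 1] pm by simp
  have cdf1: "cdf D 1 = 1" using cdf[of 1] pm by simp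
  \<comment> \<open>The point 0 is covered by neither assumption on the distribution function. The
    value there is squeezed to 0 by \<open>phi_mass y v \<le> 2 * sqrt v\<close> for small
    \<open>v\<close>.\<close>
  have cdf0: "cdf D 0 = 0"
  proof (rule antisym)
    have "((\<lambda>v. 2 * sqrt v / phi_mass y 1) \<longlongrightarrow> 2 * sqrt 0 / phi_mass y 1) (at_right 0)"
      using pm by (intro tendsto_intros) auto
    moreover have "\<forall>\<^sub>F v in at_right 0. cdf D 0 \<le> 2 * sqrt v / phi_mass y 1"
      using eventually_at_right_real[of 0 1]
    proof (rule eventually_mono)
      fix v :: real assume v: "v \<in> {0<..<1}"
      have "cdf D 0 \<le> cdf D v" using v by (intro D.cdf_nondecreasing) auto
      also have "\<dots> = phi_mass y v / phi_mass y 1" using v by (intro cdf) auto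
      also have "phi_mass y v \<le> exp (- (y\<^sup>2 / (2 * v))) * phi_mass 0 v" using v by (intro phi_mass_le_exp) auto
      also have "\<dots> \<le> 1 * phi_mass 0 v" using v by (intro mult_right_mono phi_mass_nonneg) auto
      also have "phi_mass 0 v \<le> 2 * sqrt v"
      proof -
        have "ennreal (phi_mass 0 v) = (\<integral>\<^sup>+t\<in>{0<..<v}. ennreal (1 / sqrt t) \<partial>lborel)"
          using v unfolding ennreal_phi_mass[OF less_imp_le[of 0 v], of 0, simplified]
          by (subst ennreal_phi_mass) (auto intro!: nn_integral_cong_AE eventually_mono[OF AE_conjI[OF AE_lborel_singleton[of 0] AE_lborel_singleton[of v]]] simp: phi_def indicator_def)
        then show ?thesis using v by (simp add: nn_integral_inverse_sqrt phi_mass_nonneg)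
      qed
      finally show "cdf D 0 \<le> 2 * sqrt v / phi_mass y 1" using pm by (simp add: divide_right_mono)
    qed simp
    ultimately show "cdf D 0 \<le> 0"
      by (intro tendsto_lowerbound[of "\<lambda>v. 2 * sqrt v / phi_mass y 1" 0 "at_right 0"]) auto
  qed (rule D.cdf_nonneg)
  show "(\<integral>\<^sup>+t\<in>{..x}. ennreal (indicator {0..1} t * phi y t / phi_mass y 1) \<partial>lborel) = ennreal (cdf D x)" for x
  proof -
    consider "x < 0" | "0 \<le> x" "x \<le> 1" | "x > 1" by linarith
    then show ?thesis
    proof cases
      case 1
      have "(\<integral>\<^sup>+t\<in>{..x}. ennreal (indicator {0..1} t * phi y t / phi_mass y 1) \<partial>lborel) = (\<integral>\<^sup>+t. 0 \<partial>(lborel :: real measure))"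
        using 1 by (intro nn_integral_cong) (auto simp: indicator_def)
      then show ?thesis using 1 neg by simp
    next
      case 2
      have "(\<integral>\<^sup>+t\<in>{..x}. ennreal (indicator {0..1} t * phi y t / phi_mass y 1) \<partial>lborel) = (\<integral>\<^sup>+t\<in>{0..x}. ennreal (phi y t / phi_mass y 1) \<partial>lborel)"
        using 2 by (intro nn_integral_cong) (auto simp: indicator_def)
      moreover have "phi_mass y x / phi_mass y 1 = cdf D x"
      proof (cases "x = 0")
        case True
        then show ?thesis using cdf0 by (simp add: phi_mass_0)
      qed (use 2 cdf in auto)
      ultimately show ?thesis using part[OF 2(1)] by simp
    next
      case 3
      have "(\<integral>\<^sup>+t\<in>{..x}. ennreal (indicator {0..1} t * phi y t / phi_mass y 1) \<partial>lborel) = (\<integral>\<^sup>+t\<in>{0..1}. ennreal (phi y t / phi_mass y 1) \<partial>lborel)"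
        using 3 by (intro nn_integral_cong) (auto simp: indicator_def)
      moreover have "cdf D x = 1"
        using D.cdf_nondecreasing[of 1 x] cdf1 D.cdf_bounded_prob[of x] 3 by simp
      ultimately show ?thesis using part[of 1] pm by simp
    qed
  qed
qed

lemma cdf_exponential:
  "cdf (density lborel (exponential_density (1 / 2))) u = (if 0 \<le> u then 1 - exp (- (u / 2)) else 0)"
proof -
  have "exp (- (u / 2)) \<le> 1" if "0 \<le> u" using that by simp
  then have "0 \<le> 1 - exp (- (u / 2))" if "0 \<le> u" using that by simp
  then show ?thesis
    unfolding Distribution_Functions.cdf_def measure_def
    by (simp add: emeasure_erlang_density erlang_CDF_0 mult.commute)
qed

lemma inv_chi_density_cdf:
  "x \<le> 0 \<Longrightarrow> cdf (density lborel inv_chi_density) x = 0"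
  "x > 0 \<Longrightarrow> cdf (density lborel inv_chi_density) x = (LINT s|lborel. indicator {0..x} s * inv_chi_density s)"
proof -
  have c: "cdf (density lborel inv_chi_density) x = enn2real (\<integral>\<^sup>+s\<in>{..x}. ennreal (inv_chi_density s) \<partial>lborel)"
    unfolding Distribution_Functions.cdf_def measure_def by (simp add: emeasure_density)
  show "cdf (density lborel inv_chi_density) x = 0" if "x \<le> 0"
  proof -
    have "(\<integral>\<^sup>+s\<in>{..x}. ennreal (inv_chi_density s) \<partial>lborel) = (\<integral>\<^sup>+s. 0 \<partial>(lborel :: real measure))"
      using that by (intro nn_integral_cong) (auto simp: inv_chi_density_def indicator_def)
    then show ?thesis by (simp add: c)
  qed
  show "cdf (density lborel inv_chi_density) x = (LINT s|lborel. indicator {0..x} s * inv_chi_density s)" if "x > 0"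
  proof -
    have "(\<integral>\<^sup>+s\<in>{..x}. ennreal (inv_chi_density s) \<partial>lborel) = (\<integral>\<^sup>+s. ennreal (indicator {0..x} s * inv_chi_density s) \<partial>lborel)"
      by (intro nn_integral_cong) (auto simp: inv_chi_density_def indicator_def)
    then show ?thesis
      unfolding c by (subst integral_eq_nn_integral) (auto simp: inv_chi_density_nonneg)
  qed
qed

lemma (in prob_space) prob_Ioc:
  fixes g :: "'a \<Rightarrow> real"
  assumes g: "g \<in> borel_measurable M" and x: "0 \<le> x"
  shows "\<P>(\<omega> in M. 0 < g \<omega> \<and> g \<omega> \<le> x) = \<P>(\<omega> in M. g \<omega> \<le> x) - \<P>(\<omega> in M. g \<omega> \<le> 0)"
proof -
  have "{\<omega> \<in> space M. 0 < g \<omega> \<and> g \<omega> \<le> x} = {\<omega> \<in> space M. g \<omega> \<le> x} - {\<omega> \<in> space M. g \<omega> \<le> 0}" by auto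
  moreover have "{\<omega> \<in> space M. g \<omega> \<le> x} \<in> sets M" "{\<omega> \<in> space M. g \<omega> \<le> 0} \<in> sets M" using g by measurable
  moreover have "{\<omega> \<in> space M. g \<omega> \<le> 0} \<subseteq> {\<omega> \<in> space M. g \<omega> \<le> x}" using x by auto
  ultimately show ?thesis using finite_measure_Diff by simp
qed

theorem theorem4:
  fixes N :: "real \<Rightarrow> real \<Rightarrow> 'u measure"
    and b' :: "real \<Rightarrow> real \<Rightarrow> real \<Rightarrow> 'u \<Rightarrow> real"
    and N\<^sub>0 :: "'v measure"
    and \<beta> :: "real \<Rightarrow> 'v \<Rightarrow> real"
    and q :: "real \<Rightarrow> real \<Rightarrow> real \<Rightarrow> real"
    and M :: "real \<Rightarrow> 'w measure"
    and g :: "real \<Rightarrow> 'w \<Rightarrow> real"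
    and b Z Y X :: "real \<Rightarrow> real \<Rightarrow> 'w \<Rightarrow> real"
    and \<Gamma> :: "real \<Rightarrow> 'w \<Rightarrow> real"
  assumes bridge: "\<And>y t. t > 0 \<Longrightarrow> brownian_bridge (N y t) t y 0 (b' y t)"
    and q: "\<And>y t u. t > 0 \<Longrightarrow> u \<ge> 0 \<Longrightarrow> q y t u = neg_time_cdf (N y t) (b' y t) t u"
    and standard_bridge: "brownian_bridge N\<^sub>0 1 0 0 \<beta>"
    and prob: "\<And>y. prob_space (M y)"
    and g_measurable: "\<And>y. g y \<in> borel_measurable (M y)"
    and g_nonneg: "\<And>y \<omega>. \<omega> \<in> space (M y) \<Longrightarrow> g y \<omega> \<ge> 0"
    and g_law: "\<And>y x. x \<ge> 0 \<Longrightarrow> \<P>(\<omega> in M y. g y \<omega> \<le> x) = g_cdf q y x"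
    and b_law: "\<And>y. conditioned_bridge_given N\<^sub>0 \<beta> y (M y) (g y) (b y)"
    and Z_bessel: "\<And>y. bessel3 (M y) 0 (Z y)"
    and Z_indep: "\<And>y. indep_elements (M y)
          (borel \<Otimes>\<^sub>M path_space {0..1}) (\<lambda>\<omega>. (g y \<omega>, sample_path {0..1} (b y) \<omega>))
          (path_space {0..}) (sample_path {0..} (Z y))"
    and Y_bessel: "\<And>y. y > 0 \<Longrightarrow> bessel3 (M y) y (Y y)"
    and Y_indep: "\<And>y. y > 0 \<Longrightarrow> indep_elements (M y)
          (borel \<Otimes>\<^sub>M path_space {0..1} \<Otimes>\<^sub>M path_space {0..})
          (\<lambda>\<omega>. (g y \<omega>, sample_path {0..1} (b y) \<omega>, sample_path {0..} (Z y) \<omega>))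
          (path_space {0..}) (sample_path {0..} (Y y))"
    and X: "\<And>y t \<omega>. X y t \<omega> = X_process y (g y) (b y) (Z y) (Y y) t \<omega>"
    and \<Gamma>: "\<And>y \<omega>. \<Gamma> y \<omega> = neg_time {0..} (\<lambda>s. X y s \<omega>)"
  shows
    "(weak_conv_along at_top
        (\<lambda>y. distr (uniform_measure (M y) {\<omega> \<in> space (M y). g y \<omega> > 0}) borel (\<lambda>\<omega>. g y \<omega> / y\<^sup>2))
        (density lborel (\<lambda>s. indicator {0<..} s * (1 / sqrt (2 * pi * s ^ 3) * exp (- (1 / (2 * s))))))
      \<and> (\<forall>K>0. ((\<lambda>y. \<P>(\<omega> in M y. g y \<omega> > K \<bar> g y \<omega> > 0)) \<longlongrightarrow> 1) at_top))
     \<and>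
     (weak_conv_along at_bot
        (\<lambda>y. distr (M y) borel (\<lambda>\<omega>. y\<^sup>2 * (1 - \<Gamma> y \<omega>)))
        (density lborel (exponential_density (1 / 2)))
      \<and> (\<exists>\<mu>. real_distribution \<mu>
          \<and> (\<forall>u\<le>0. cdf \<mu> u = (LINT z:{0<..}|lborel. 2 * z / sqrt (2 * pi * (2 * z - u)) * exp (- z)))
          \<and> (\<forall>u\<ge>0. cdf \<mu> u = 1 - 1 / 2 * exp (- (u / 2)))
          \<and> weak_conv_along at_bot (\<lambda>y. distr (M y) borel (\<lambda>\<omega>. y\<^sup>2 * (1 - g y \<omega>))) \<mu>)
      \<and> weak_conv_along at_bot (\<lambda>y. distr (M y) borel (\<Gamma> y)) (return borel 1)
      \<and> weak_conv_along at_bot (\<lambda>y. distr (M y) borel (g y)) (return borel 1))"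
proof -
  interpret standard_bridge N\<^sub>0 \<beta> by (rule standard_bridgeI[OF standard_bridge])
  have gm: "{\<omega> \<in> space (M y). g y \<omega> \<le> x} \<in> sets (M y)" "{\<omega> \<in> space (M y). x < g y \<omega>} \<in> sets (M y)" for x y
    using g_measurable[of y] by measurable
  \<comment> \<open>\<open>q\<close> is specified for positive \<open>t\<close> only; at
    \<open>t = 0\<close> both integrands vanish because \<open>1 / sqrt 0 = 0\<close>.\<close>
  have q_eq: "(LINT t:{0..x}|lborel. q y t 1 * (1 / sqrt t) * exp (- (y\<^sup>2 / (2 * t))))
    = (LINT t:{0..x}|lborel. occ_cdf N\<^sub>0 \<beta> (y / sqrt t) (1 / t) * phi y t)" for x y
    unfolding set_lebesgue_integral_def
  proof (intro Bochner_Integration.integral_cong refl)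
    fix t :: real
    show "indicator {0..x} t *\<^sub>R (q y t 1 * (1 / sqrt t) * exp (- (y\<^sup>2 / (2 * t))))
      = indicator {0..x} t *\<^sub>R (occ_cdf N\<^sub>0 \<beta> (y / sqrt t) (1 / t) * phi y t)"
    proof (cases "t > 0")
      case True
      then show ?thesis
        by (simp add: q neg_time_cdf_eq_occ_cdf[OF True bridge[OF True]] phi_def)
    qed (auto simp: phi_def indicator_def)
  qed
  have phi_eq: "(LINT t:{0..1}|lborel. 1 / sqrt t * exp (- (y\<^sup>2 / (2 * t)))) = phi_mass y 1" for y
    by (simp add: phi_mass_def phi_def)
  have g_cdf_neg: "g_cdf q y x = (LINT t:{0..x}|lborel. occ_cdf N\<^sub>0 \<beta> (y / sqrt t) (1 / t) * phi y t) / (2 * phi_mass y 1)"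
    if "y < 0" for x y unfolding g_cdf_def q_eq phi_eq using that by simp
  have g_cdf_pos: "g_cdf q y x = (2 * sqrt (2 * pi) * y + (LINT t:{0..x}|lborel. occ_cdf N\<^sub>0 \<beta> (y / sqrt t) (1 / t) * phi y t)) / (2 * sqrt (2 * pi) * y + 4)"
    if "y > 0" for x y unfolding g_cdf_def q_eq phi_eq using that by simp
  have pm: "phi_mass y 1 > 0" for y by (rule phi_mass_pos) simp
  have cdf_g: "cdf (distr (M y) borel (g y)) x = \<P>(\<omega> in M y. g y \<omega> \<le> x)" for x y
    unfolding Distribution_Functions.cdf_def using g_measurable[of y]
    by (simp add: measure_distr vimage_def Int_def conj_commute)
  have rd_g: "real_distribution (distr (M y) borel (g y))" for y
    using prob_space.real_distribution_distr[OF prob g_measurable] .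
  \<comment> \<open>A distribution function tends to 1. Solved for the integral that it contains,
    the prescribed formula then yields the total masses which \<open>occ_masses\<close> asks
    for.\<close>
  have lim_g: "(g_cdf q y \<longlongrightarrow> 1) at_top" for y
  proof -
    have "(cdf (distr (M y) borel (g y)) \<longlongrightarrow> 1) at_top"
      by (rule real_distribution.cdf_lim_at_top_prob[OF rd_g])
    moreover have "\<forall>\<^sub>F x in at_top. cdf (distr (M y) borel (g y)) x = g_cdf q y x"
      using eventually_ge_at_top[of "0::real"] by eventually_elim (simp add: cdf_g g_law)
    ultimately show ?thesis by (simp add: tendsto_cong)
  qed
  interpret occ_masses N\<^sub>0 \<beta>
  proof
    show "((\<lambda>x. LINT t:{0..x}|lborel. occ_cdf N\<^sub>0 \<beta> (y / sqrt t) (1 / t) * phi y t) \<longlongrightarrow> 2 * phi_mass y 1) at_top"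
      if "y < 0" for y
    proof -
      have "((\<lambda>x. g_cdf q y x * (2 * phi_mass y 1)) \<longlongrightarrow> 1 * (2 * phi_mass y 1)) at_top"
        by (intro tendsto_mult lim_g tendsto_const)
      then show ?thesis using pm[of y] by (simp add: g_cdf_neg[OF that])
    qed
    show "((\<lambda>x. LINT t:{0..x}|lborel. occ_cdf N\<^sub>0 \<beta> (y / sqrt t) (1 / t) * phi y t) \<longlongrightarrow> 4) at_top"
      if y: "y > 0" for y
    proof -
      have p: "2 * sqrt (2 * pi) * y + 4 > 0" using y by (intro add_nonneg_pos) auto
      have "((\<lambda>x. g_cdf q y x * (2 * sqrt (2 * pi) * y + 4) - 2 * sqrt (2 * pi) * y)
          \<longlongrightarrow> 1 * (2 * sqrt (2 * pi) * y + 4) - 2 * sqrt (2 * pi) * y) at_top"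
        by (intro tendsto_mult tendsto_diff lim_g tendsto_const)
      then show ?thesis using p by (simp add: g_cdf_pos[OF y])
    qed
  qed
  have g_law_neg: "\<P>(\<omega> in M y. g y \<omega> \<le> x) = occ_mass y x / (2 * phi_mass y 1)" if "y < 0" "0 \<le> x" for y x
    using that by (simp add: g_law g_cdf_neg occ_mass_def)
  have g_law_pos: "\<P>(\<omega> in M y. g y \<omega> \<le> x) = (2 * sqrt (2 * pi) * y + occ_mass y x) / (2 * sqrt (2 * pi) * y + 4)" if "y > 0" "0 \<le> x" for y x
    using that by (simp add: g_law g_cdf_pos occ_mass_def)

  \<comment> \<open>For \<open>y > 0\<close> the random time has an atom at 0, of mass
    \<open>2 * sqrt (2 * pi) * y\<close> over the denominator. It cancels in both formulas, so that
    conditionally on \<open>g > 0\<close> the distribution function is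
    \<open>occ_mass / 4\<close>.\<close>
  have P_pos: "\<P>(\<omega> in M y. g y \<omega> > 0) = 4 / (2 * sqrt (2 * pi) * y + 4)"
    and P_le: "0 \<le> x \<Longrightarrow> \<P>(\<omega> in M y. 0 < g y \<omega> \<and> g y \<omega> \<le> x) = occ_mass y x / (2 * sqrt (2 * pi) * y + 4)"
    and den: "2 * sqrt (2 * pi) * y + 4 > 0" if y: "y > 0" for x y
  proof -
    interpret My: prob_space "M y" by (rule prob)
    show p: "2 * sqrt (2 * pi) * y + 4 > 0" using y by (intro add_nonneg_pos) auto
    have m0: "occ_mass y 0 = 0"
      using occ_mass_eq_phi_mass[of 0 y] phi_mass_0 by simp
    have "{\<omega> \<in> space (M y). g y \<omega> > 0} = space (M y) - {\<omega> \<in> space (M y). g y \<omega> \<le> 0}" by auto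
    then have "\<P>(\<omega> in M y. g y \<omega> > 0) = 1 - \<P>(\<omega> in M y. g y \<omega> \<le> 0)"
      using My.prob_compl[OF gm(1)] by simp
    then show "\<P>(\<omega> in M y. g y \<omega> > 0) = 4 / (2 * sqrt (2 * pi) * y + 4)"
      using y p by (simp add: g_law_pos m0 field_simps)
    show "\<P>(\<omega> in M y. 0 < g y \<omega> \<and> g y \<omega> \<le> x) = occ_mass y x / (2 * sqrt (2 * pi) * y + 4)" if "0 \<le> x"
      unfolding My.prob_Ioc[OF g_measurable that]
      using y that by (simp add: g_law_pos m0 diff_divide_distrib[symmetric])
  qed

  have a1: "weak_conv_along at_top
      (\<lambda>y. distr (uniform_measure (M y) {\<omega> \<in> space (M y). g y \<omega> > 0}) borel (\<lambda>\<omega>. g y \<omega> / y\<^sup>2))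
      (density lborel inv_chi_density)"
    unfolding weak_conv_along_def
  proof (intro allI impI)
    fix x :: real
    define A where "A = (\<lambda>y. {\<omega> \<in> space (M y). g y \<omega> > 0})"
    have eq: "cdf (distr (uniform_measure (M y) (A y)) borel (\<lambda>\<omega>. g y \<omega> / y\<^sup>2)) x = (if x \<le> 0 then 0 else occ_mass y (x * y\<^sup>2) / 4)"
      if y: "y > 0" for y
    proof -
      interpret My: prob_space "M y" by (rule prob)
      have PA: "measure (M y) (A y) = 4 / (2 * sqrt (2 * pi) * y + 4)" using P_pos[OF y] by (simp add: A_def)
      have "measure (M y) (A y) > 0" unfolding PA using den[OF y] by simp
      then have nz: "emeasure (M y) (A y) \<noteq> 0" by (simp add: My.emeasure_eq_measure)
      have "(\<lambda>\<omega>. g y \<omega> / y\<^sup>2) \<in> borel_measurable (uniform_measure (M y) (A y))" using g_measurable[of y] by simp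
      then have "cdf (distr (uniform_measure (M y) (A y)) borel (\<lambda>\<omega>. g y \<omega> / y\<^sup>2)) x
        = measure (uniform_measure (M y) (A y)) {\<omega> \<in> space (M y). g y \<omega> / y\<^sup>2 \<le> x}"
        unfolding Distribution_Functions.cdf_def by (simp add: measure_distr vimage_def Int_def conj_commute)
      also have "{\<omega> \<in> space (M y). g y \<omega> / y\<^sup>2 \<le> x} = {\<omega> \<in> space (M y). g y \<omega> \<le> x * y\<^sup>2}"
        using y by (auto simp: divide_le_eq)
      also have "measure (uniform_measure (M y) (A y)) \<dots> = measure (M y) (A y \<inter> {\<omega> \<in> space (M y). g y \<omega> \<le> x * y\<^sup>2}) / measure (M y) (A y)"
        by (rule measure_uniform_measure) (use nz gm in auto)
      also have "A y \<inter> {\<omega> \<in> space (M y). g y \<omega> \<le> x * y\<^sup>2} = {\<omega> \<in> space (M y). 0 < g y \<omega> \<and> g y \<omega> \<le> x * y\<^sup>2}"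
        by (auto simp: A_def)
      finally have c: "cdf (distr (uniform_measure (M y) (A y)) borel (\<lambda>\<omega>. g y \<omega> / y\<^sup>2)) x
        = measure (M y) {\<omega> \<in> space (M y). 0 < g y \<omega> \<and> g y \<omega> \<le> x * y\<^sup>2} / measure (M y) (A y)" .
      show ?thesis
      proof (cases "x \<le> 0")
        case True
        then have "x * y\<^sup>2 \<le> 0" by (simp add: mult_nonpos_nonneg)
        then have e: "{\<omega> \<in> space (M y). 0 < g y \<omega> \<and> g y \<omega> \<le> x * y\<^sup>2} = {}" by force
        show ?thesis using True unfolding c e by simp
      next
        case False
        then show ?thesis unfolding c PA using den[OF y] by (simp add: P_le[OF y])
      qed
    qed
    have "((\<lambda>y. if x \<le> 0 then 0 else occ_mass y (x * y\<^sup>2) / 4) \<longlongrightarrow> cdf (density lborel inv_chi_density) x) at_top"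
      using inv_chi_limit[of x] by (cases "x \<le> 0") (auto simp: inv_chi_density_cdf)
    moreover have "\<forall>\<^sub>F y in at_top. (if x \<le> 0 then 0 else occ_mass y (x * y\<^sup>2) / 4) = cdf (distr (uniform_measure (M y) (A y)) borel (\<lambda>\<omega>. g y \<omega> / y\<^sup>2)) x"
      using eventually_gt_at_top[of "0::real"] by eventually_elim (simp only: eq)
    ultimately show "((\<lambda>y. cdf (distr (uniform_measure (M y) {\<omega> \<in> space (M y). g y \<omega> > 0}) borel (\<lambda>\<omega>. g y \<omega> / y\<^sup>2)) x) \<longlongrightarrow> cdf (density lborel inv_chi_density) x) at_top"
      unfolding A_def by (rule Lim_transform_eventually)
  qed

  \<comment> \<open>The divergence is obtained directly: conditionally on \<open>g > 0\<close> the
    mass up to \<open>K\<close> is at most a quarter of \<open>phi_mass y K\<close>, which decays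
    exponentially in \<open>y\<^sup>2\<close>.\<close>
  have a2: "((\<lambda>y. \<P>(\<omega> in M y. g y \<omega> > K \<bar> g y \<omega> > 0)) \<longlongrightarrow> 1) at_top" if K: "K > 0" for K
  proof -
    have eq: "\<P>(\<omega> in M y. g y \<omega> > K \<bar> g y \<omega> > 0) = 1 - occ_mass y K / 4" if y: "y > 0" for y
    proof -
      interpret My: prob_space "M y" by (rule prob)
      have "{\<omega> \<in> space (M y). g y \<omega> > K \<and> g y \<omega> > 0} = {\<omega> \<in> space (M y). g y \<omega> > 0} - {\<omega> \<in> space (M y). 0 < g y \<omega> \<and> g y \<omega> \<le> K}"
        using K by auto
      moreover have "{\<omega> \<in> space (M y). 0 < g y \<omega> \<and> g y \<omega> \<le> K} = {\<omega> \<in> space (M y). 0 < g y \<omega>} \<inter> {\<omega> \<in> space (M y). g y \<omega> \<le> K}" by auto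
      ultimately have "\<P>(\<omega> in M y. g y \<omega> > K \<and> g y \<omega> > 0) = \<P>(\<omega> in M y. g y \<omega> > 0) - \<P>(\<omega> in M y. 0 < g y \<omega> \<and> g y \<omega> \<le> K)"
        using gm[of y] by (auto intro!: My.finite_measure_Diff)
      also have "\<dots> = (4 - occ_mass y K) / (2 * sqrt (2 * pi) * y + 4)"
        using y K by (simp add: P_pos P_le diff_divide_distrib)
      finally show ?thesis
        using den[OF y] unfolding cond_prob_def P_pos[OF y] by (simp add: field_simps)
    qed
    have nn: "0 \<le> occ_mass y K" for y
      unfolding occ_mass_eq by (intro integral_nonneg_AE AE_I2) (auto simp: occ_dens_nonneg)
    have le: "occ_mass y K \<le> exp (- (y\<^sup>2 / (2 * K))) * phi_mass 0 K" for y
    proof (rule order_trans[OF _ phi_mass_le_exp[OF K]])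
      have "ennreal (occ_mass y K) \<le> ennreal (phi_mass y K)"
        unfolding ennreal_occ_mass[OF less_imp_le[OF K]] ennreal_phi_mass[OF less_imp_le[OF K]]
        by (intro nn_integral_mono) (auto simp: indicator_def occ_dens_le intro!: ennreal_leI)
      then show "occ_mass y K \<le> phi_mass y K" by (simp add: phi_mass_nonneg)
    qed
    have "((\<lambda>y. exp (- (y\<^sup>2 / (2 * K))) * phi_mass 0 K) \<longlongrightarrow> 0) at_top" using K by real_asymp
    then have "((\<lambda>y. occ_mass y K) \<longlongrightarrow> 0) at_top"
      by (rule tendsto_sandwich[OF always_eventually always_eventually tendsto_const, rotated 2]) (auto simp: nn le)
    then have "((\<lambda>y. 1 - occ_mass y K / 4) \<longlongrightarrow> 1 - 0 / 4) at_top" by (intro tendsto_diff tendsto_divide tendsto_const) auto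
    moreover have "\<forall>\<^sub>F y in at_top. 1 - occ_mass y K / 4 = \<P>(\<omega> in M y. g y \<omega> > K \<bar> g y \<omega> > 0)"
      using eventually_gt_at_top[of "0::real"] by eventually_elim (simp only: eq)
    ultimately show ?thesis using Lim_transform_eventually by fastforce
  qed

  have D_g: "distr (M y) borel (g y) = density lborel (\<lambda>t. occ_dens y t / (2 * phi_mass y 1))" if y: "y < 0" for y
  proof (rule law_eq_occ_density[OF y rd_g])
    show "cdf (distr (M y) borel (g y)) x = occ_mass y x / (2 * phi_mass y 1)" if "x \<ge> 0" for x
      by (simp only: cdf_g g_law_neg[OF y that])
    show "cdf (distr (M y) borel (g y)) x = 0" if "x < 0" for x
    proof -
      have e: "{\<omega> \<in> space (M y). g y \<omega> \<le> x} = {}" using g_nonneg[of _ y] that by force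
      show ?thesis unfolding cdf_g e by simp
    qed
  qed
  \<comment> \<open>The formulas for the distribution functions of \<open>g\<close> and \<Gamma> are
    available at nonnegative and at positive arguments respectively; far to the left the threshold
    \<open>1 - u / y\<^sup>2\<close> is positive.\<close>
  have inside: "\<forall>\<^sub>F y in at_bot. 0 < 1 - u / y\<^sup>2" for u :: real by real_asymp

  have lim_g': "((\<lambda>y. cdf (distr (M y) borel (\<lambda>\<omega>. y\<^sup>2 * (1 - g y \<omega>))) u) \<longlongrightarrow> cdf (density lborel g_limit_density) u) at_bot" for u
  proof -
    have eq: "cdf (distr (M y) borel (\<lambda>\<omega>. y\<^sup>2 * (1 - g y \<omega>))) u = 1 - occ_mass y (1 - u / y\<^sup>2) / (2 * phi_mass y 1)"
      if "y < 0" "0 < 1 - u / y\<^sup>2" for y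
    proof -
      have "measure (distr (M y) borel (g y)) {1 - u / y\<^sup>2} = 0"
        unfolding D_g[OF that(1)] by (intro measure_density_singleton borel_measurable_divide) auto
      from cdf_rescaled[OF prob g_measurable _ this] show ?thesis using that by (simp add: cdf_g g_law_neg)
    qed
    have "\<forall>\<^sub>F y in at_bot. 1 - occ_mass y (1 - u / y\<^sup>2) / (2 * phi_mass y 1) = cdf (distr (M y) borel (\<lambda>\<omega>. y\<^sup>2 * (1 - g y \<omega>))) u"
      using inside[of u] eventually_gt_at_bot[of "0::real"] by eventually_elim (simp only: eq)
    moreover have "((\<lambda>y. 1 - occ_mass y (1 - u / y\<^sup>2) / (2 * phi_mass y 1)) \<longlongrightarrow> cdf (density lborel g_limit_density) u) at_bot"
    \<comment> \<open>For \<open>u \<le> 0\<close> the threshold is at least 1 and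
      \<open>g_tail_limit\<close> applies. For \<open>u > 0\<close> it lies below 1, where the
      density of \<open>g\<close> is proportional to \<open>phi y\<close>, and
      \<open>phi_mass_ratio\<close> applies.\<close>
    proof (cases "u \<le> 0")
      case True
      then show ?thesis using g_tail_limit[of "- u"] by (simp add: g_limit_distribution)
    next
      case False
      have "((\<lambda>y. 1 - 1/2 * (phi_mass y (1 - u / y\<^sup>2) / phi_mass y 1)) \<longlongrightarrow> 1 - 1/2 * exp (- (u / 2))) at_bot"
        using False by (intro tendsto_diff tendsto_mult tendsto_const phi_mass_ratio) auto
      moreover have "\<forall>\<^sub>F y in at_bot. 1 - 1/2 * (phi_mass y (1 - u / y\<^sup>2) / phi_mass y 1) = 1 - occ_mass y (1 - u / y\<^sup>2) / (2 * phi_mass y 1)"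
        using inside[of u] by eventually_elim (use False in \<open>simp add: occ_mass_eq_phi_mass\<close>)
      ultimately have "((\<lambda>y. 1 - occ_mass y (1 - u / y\<^sup>2) / (2 * phi_mass y 1)) \<longlongrightarrow> 1 - 1/2 * exp (- (u / 2))) at_bot"
        by (rule Lim_transform_eventually)
      then show ?thesis using False by (simp add: g_limit_distribution(3))
    qed
    ultimately show ?thesis by (rule Lim_transform_eventually[rotated])
  qed

  have \<Gamma>_eq: "\<Gamma> y = (\<lambda>\<omega>. neg_time {0..} (\<lambda>s. X_process y (g y) (b y) (Z y) (Y y) s \<omega>))" for y
    by (simp add: fun_eq_iff \<Gamma> X)
  have \<Gamma>_meas: "\<Gamma> y \<in> borel_measurable (M y)" if "y < 0" for y
    unfolding \<Gamma>_eq using b_law[of y] Z_bessel[of y] that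
    by (intro measurable_neg_time_X_process g_measurable) (auto simp: conditioned_bridge_given_def bessel3_def)
  have cdf_\<Gamma>: "cdf (distr (M y) borel (\<Gamma> y)) v = \<P>(\<omega> in M y. \<Gamma> y \<omega> \<le> v)" if "y < 0" for v y
    unfolding Distribution_Functions.cdf_def using \<Gamma>_meas[OF that]
    by (simp add: measure_distr vimage_def Int_def conj_commute)
  have \<Gamma>_law: "cdf (distr (M y) borel (\<Gamma> y)) v = phi_mass y v / phi_mass y 1" if "y < 0" "0 < v" "v \<le> 1" for y v
    unfolding cdf_\<Gamma>[OF that(1)] unfolding \<Gamma>_eq
    by (rule prob_neg_time_X_process_le[OF that prob g_measurable D_g[OF that(1)] b_law Z_bessel])
  have rd_\<Gamma>: "real_distribution (distr (M y) borel (\<Gamma> y))" if "y < 0" for y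
    using prob_space.real_distribution_distr[OF prob \<Gamma>_meas[OF that]] .
  have D_\<Gamma>: "distr (M y) borel (\<Gamma> y) = density lborel (\<lambda>t. indicator {0..1} t * phi y t / phi_mass y 1)" if y: "y < 0" for y
  proof (rule law_eq_phi_density[OF rd_\<Gamma>[OF y] y \<Gamma>_law[OF y]])
    show "cdf (distr (M y) borel (\<Gamma> y)) v = 0" if "v < 0" for v
    proof -
      have "\<not> \<Gamma> y \<omega> \<le> v" for \<omega>
        using neg_time_nonneg[of "{0..}" "\<lambda>s. X_process y (g y) (b y) (Z y) (Y y) s \<omega>"] that unfolding \<Gamma>_eq by linarith
      then show ?thesis by (simp add: cdf_\<Gamma>[OF y])
    qed
  qed
  have lim_\<Gamma>: "((\<lambda>y. cdf (distr (M y) borel (\<lambda>\<omega>. y\<^sup>2 * (1 - \<Gamma> y \<omega>))) u) \<longlongrightarrow> cdf (density lborel (exponential_density (1 / 2))) u) at_bot" for u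
  proof -
    have eq: "cdf (distr (M y) borel (\<lambda>\<omega>. y\<^sup>2 * (1 - \<Gamma> y \<omega>))) u = 1 - cdf (distr (M y) borel (\<Gamma> y)) (1 - u / y\<^sup>2)" if y: "y < 0" for y
    proof (rule cdf_rescaled[OF prob \<Gamma>_meas[OF y]])
      show "measure (distr (M y) borel (\<Gamma> y)) {1 - u / y\<^sup>2} = 0"
        unfolding D_\<Gamma>[OF y] by (intro measure_density_singleton borel_measurable_divide borel_measurable_times) auto
    qed (use y in simp)
    show ?thesis
    proof (cases "u < 0")
      \<comment> \<open>The threshold exceeds 1, where the distribution function of \<Gamma> has
        already reached 1.\<close>
      case True
      have "\<forall>\<^sub>F y in at_bot. 0 = cdf (distr (M y) borel (\<lambda>\<omega>. y\<^sup>2 * (1 - \<Gamma> y \<omega>))) u"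
        using eventually_gt_at_bot[of "0::real"]
      proof eventually_elim
        case (elim y)
        interpret D: real_distribution "distr (M y) borel (\<Gamma> y)" by (rule rd_\<Gamma>[OF elim])
        have "cdf (distr (M y) borel (\<Gamma> y)) 1 = 1" using \<Gamma>_law[OF elim, of 1] pm[of y] by simp
        moreover have "1 \<le> 1 - u / y\<^sup>2" using True by (simp add: divide_nonpos_nonneg)
        ultimately have "cdf (distr (M y) borel (\<Gamma> y)) (1 - u / y\<^sup>2) = 1"
          using D.cdf_nondecreasing[of 1 "1 - u / y\<^sup>2"] D.cdf_bounded_prob[of "1 - u / y\<^sup>2"] by simp
        then show ?case by (simp add: eq[OF elim])
      qed
      from Lim_transform_eventually[OF tendsto_const this] show ?thesis using True by (simp add: cdf_exponential)
    next
      case False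
      have "((\<lambda>y. 1 - phi_mass y (1 - u / y\<^sup>2) / phi_mass y 1) \<longlongrightarrow> 1 - exp (- (u / 2))) at_bot"
        using False by (intro tendsto_diff tendsto_const phi_mass_ratio) auto
      moreover have "\<forall>\<^sub>F y in at_bot. 1 - phi_mass y (1 - u / y\<^sup>2) / phi_mass y 1 = cdf (distr (M y) borel (\<lambda>\<omega>. y\<^sup>2 * (1 - \<Gamma> y \<omega>))) u"
        using inside[of u] eventually_gt_at_bot[of "0::real"]
        by eventually_elim (use False in \<open>simp add: eq \<Gamma>_law\<close>)
      ultimately have "((\<lambda>y. cdf (distr (M y) borel (\<lambda>\<omega>. y\<^sup>2 * (1 - \<Gamma> y \<omega>))) u) \<longlongrightarrow> 1 - exp (- (u / 2))) at_bot"
        by (rule Lim_transform_eventually)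
      then show ?thesis using False by (simp add: cdf_exponential)
    qed
  qed
  have exp_rd: "real_distribution (density lborel (exponential_density (1 / 2)))"
    using prob_space_exponential_density[of "1 / 2"] by (simp add: real_distribution_def real_distribution_axioms_def)

  show ?thesis
  proof (intro conjI exI[of _ "density lborel g_limit_density"] allI impI)
    show "weak_conv_along at_top
        (\<lambda>y. distr (uniform_measure (M y) {\<omega> \<in> space (M y). g y \<omega> > 0}) borel (\<lambda>\<omega>. g y \<omega> / y\<^sup>2))
        (density lborel (\<lambda>s. indicator {0<..} s * (1 / sqrt (2 * pi * s ^ 3) * exp (- (1 / (2 * s))))))"
      using a1 by (simp only: inv_chi_density_def[abs_def])
    show "((\<lambda>y. \<P>(\<omega> in M y. g y \<omega> > K \<bar> g y \<omega> > 0)) \<longlongrightarrow> 1) at_top" if "K > 0" for K by (rule a2[OF that])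
    show "weak_conv_along at_bot (\<lambda>y. distr (M y) borel (\<lambda>\<omega>. y\<^sup>2 * (1 - \<Gamma> y \<omega>))) (density lborel (exponential_density (1 / 2)))"
      unfolding weak_conv_along_def using lim_\<Gamma> by blast
    show "real_distribution (density lborel g_limit_density)" by (rule g_limit_distribution)
    show "cdf (density lborel g_limit_density) u = (LINT z:{0<..}|lborel. 2 * z / sqrt (2 * pi * (2 * z - u)) * exp (- z))" if "u \<le> 0" for u
      using that by (simp add: g_limit_distribution g_tail_def)
    show "cdf (density lborel g_limit_density) u = 1 - 1 / 2 * exp (- (u / 2))" if "0 \<le> u" for u
      by (rule g_limit_distribution(3)[OF that])
    show "weak_conv_along at_bot (\<lambda>y. distr (M y) borel (\<lambda>\<omega>. y\<^sup>2 * (1 - g y \<omega>))) (density lborel g_limit_density)"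
      unfolding weak_conv_along_def using lim_g' by blast
    show "weak_conv_along at_bot (\<lambda>y. distr (M y) borel (\<Gamma> y)) (return borel 1)"
      by (rule weak_conv_along_return_1[OF prob \<Gamma>_meas exp_rd lim_\<Gamma>])
    show "weak_conv_along at_bot (\<lambda>y. distr (M y) borel (g y)) (return borel 1)"
      by (rule weak_conv_along_return_1[OF prob g_measurable g_limit_distribution(1) lim_g'])
  qed
qed

end
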